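(* Let $s\ge 1$ and let $\lambda=\langle 0^{m_0},1^{m_1},\dots,s^{m_s}\rangle$ be a partition with $n=\sum_{r=0}^s m_r$ parts and $m_0\ge 1$. Set $M_i=m_i+\cdots+m_s$ for $1\le i\le s$, and let $x_1,\dots,x_n>0$. The stationary distribution $\pi$ of the multispecies PushTASEP with content $\lambda$ and site parameters $x_1,\dots,x_n$ is given by $$\pi(\eta)=\frac{f_\eta(x_1,\dots,x_n;q=1,t=0)}{Z_\lambda(x_1,\dots,x_n)},\qquad \eta\in\Omega_\lambda,$$ where $f_\eta$ is the ASEP polynomial and $$Z_\lambda(x_1,\dots,x_n)=P_\lambda(x_1,\dots,x_n;1,0)=\prod_{i=1}^{s}e_{M_i}(x_1,\dots,x_n),$$ with $P_\lambda(x_1,\dots,x_n;q,t)$ the symmetric Macdonald polynomial (evaluated at $q=1$, $t=0$).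
   Context: **Content and configurations.** $\langle 0^{m_0},1^{m_1},\dots,s^{m_s}\rangle$ denotes the partition (weakly decreasing tuple) $\lambda$ of length $n$ with exactly $m_r$ parts equal to $r$. $\Omega_\lambda$ is the set of all distinct rearrangements $\eta=(\eta_1,\dots,\eta_n)$ of $\lambda$. **Multispecies PushTASEP.** The sites $1,2,\dots,n$ are arranged clockwise on a ring (site $n$ is followed by site $1$). $\eta_j=r\ge1$ means that site $j$ holds a particle of species $r$; $\eta_j=0$ means that site $j$ is vacant. The process is the continuous-time Markov chain on $\Omega_\lambda$ in which a bell rings at each site $j$ independently at rate $1/x_j$. If site $j$ is vacant when its bell rings, nothing changes. Otherwise let $i_1=\eta_j$; this particle moves to the first site $j_2$ clockwise from $j$ with $i_2:=\eta_{j_2}<i_1$. If $i_2=0$ the jump is complete; otherwise the displaced particle of species $i_2$ moves to the first site $j_3$ clockwise from $j_2$ with $\eta_{j_3}<i_2$, and so on until a vacancy is filled. All these moves occur instantaneously and site $j$ is left vacant. **Symmetric functions.** $e_m(x_1,\dots,x_n)=\sum_{1\le i_1<\cdots<i_m\le n}x_{i_1}\cdots x_{i_m}$, with $e_0=1$. **ASEP polynomials.** For generic $q,t$ let $T_i$ ($1\le i\le n-1$) act on polynomials in $x_1,\dots,x_n$ with coefficients in $\mathbb{Q}(q,t)$ by $$T_i f=t f-\frac{t x_i-x_{i+1}}{x_i-x_{i+1}}\,(f-s_i f),$$ where $s_i$ exchanges $x_i$ and $x_{i+1}$; for a tuple $\mu$ let $s_i\mu$ be $\mu$ with entries $i$ and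 $i+1$ exchanged. The ASEP polynomials $\{f_\mu(x_1,\dots,x_n;q,t):\mu\in\Omega_\lambda\}$ are the unique family of homogeneous polynomials of degree $\sum_i\lambda_i$ in $x_1,\dots,x_n$, with coefficients in $\mathbb{Q}(q,t)$, such that 1. $T_i f_\mu=f_{s_i\mu}$ whenever $\mu_i>\mu_{i+1}$; 2. $T_i f_\mu=t f_\mu$ whenever $\mu_i=\mu_{i+1}$; 3. $q^{\mu_n}f_\mu(x_1,\dots,x_n;q,t)=f_{(\mu_n,\mu_1,\dots,\mu_{n-1})}(qx_n,x_1,\dots,x_{n-1};q,t)$; 4. the coefficient of $x_1^{\lambda_1}\cdots x_n^{\lambda_n}$ in $f_\lambda$ is $1$. The coefficients are rational functions of $q,t$ that are regular at $(q,t)=(1,0)$, and $f_\eta(x;q=1,t=0)$ denotes the evaluation there. $P_\lambda(x;q,t)$ is the usual monic symmetric Macdonald polynomial, evaluated in the same way. *)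

theory Defs
  imports
    Complex_Main
    "HOL-Library.Poly_Mapping"
    "HOL-Combinatorics.Multiset_Permutations"
    "HOL-Computational_Algebra.Polynomial_Factorial"
begin

text \<open>Sites, tuple entries and variables are numbered from \<open>0\<close> to \<open>n - 1\<close> throughout.\<close>

definition content_partition :: "nat \<Rightarrow> (nat \<Rightarrow> nat) \<Rightarrow> nat list" where
  "content_partition s m = concat (map (\<lambda>r. replicate (m r) r) (rev [0..<Suc s]))"

definition configs :: "nat list \<Rightarrow> nat list set" where
  "configs lam = permutations_of_multiset (mset lam)"

definition swap_entries :: "nat \<Rightarrow> nat list \<Rightarrow> nat list" where
  "swap_entries i mu = mu[i := mu ! Suc i, Suc i := mu ! i]"

definition next_site :: "nat list \<Rightarrow> nat \<Rightarrow> nat \<Rightarrow> nat" where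
  "next_site eta j r =
     (j + (LEAST d. 0 < d \<and> eta ! ((j + d) mod length eta) < r)) mod length eta"

text \<open>
  A particle of species \<open>r\<close> leaves \<open>j\<close> and starts the chain of displacements. The whole chain is
  read off the configuration before the bell; this is what the sequential description gives, since
  the sites of a chain are distinct and the chain fills a vacancy before it comes back to its
  starting site. The guard fails exactly when \<open>r = 0\<close> (end of the chain) or when no site has a
  smaller entry, which cannot happen for \<open>r > 0\<close> if there is a vacancy.
\<close>
function displace :: "nat list \<Rightarrow> nat \<Rightarrow> nat \<Rightarrow> nat list" where
  "displace eta j r =
     (let k = next_site eta j r
      in if eta ! k < r then (displace eta k (eta ! k))[k := r] else eta)"
  by pat_completeness auto
termination by (relation "measure (\<lambda>(_, _, r). r)") auto

declare displace.simps [simp del]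

definition ring_bell :: "nat list \<Rightarrow> nat \<Rightarrow> nat list" where
  "ring_bell eta j = (displace eta j (eta ! j))[j := 0]"

definition jump_rate :: "(nat \<Rightarrow> real) \<Rightarrow> nat list \<Rightarrow> nat list \<Rightarrow> real" where
  "jump_rate x eta zeta = (\<Sum>j | j < length eta \<and> ring_bell eta j = zeta. 1 / x j)"

text \<open>Global balance for a continuous-time chain on \<open>S\<close>; the diagonal of \<open>rate\<close> is not used, so
  bells that do not change the configuration do not count.\<close>
definition stationary_distribution ::
    "'a set \<Rightarrow> ('a \<Rightarrow> 'a \<Rightarrow> real) \<Rightarrow> ('a \<Rightarrow> real) \<Rightarrow> bool" where
  "stationary_distribution S rate p \<longleftrightarrow>
     (\<forall>a\<in>S. 0 \<le> p a) \<and> (\<Sum>a\<in>S. p a) = 1 \<and>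
     (\<forall>a\<in>S. (\<Sum>b\<in>S - {a}. p b * rate b a) = p a * (\<Sum>b\<in>S - {a}. rate a b))"

text \<open>In \<open>rat poly poly\<close> the inner variable is \<open>q\<close> and the outer one is \<open>t\<close>.\<close>
type_synonym qt = "rat poly poly fract"

definition qvar :: qt where "qvar = to_fract [:[:0, 1:]:]"
definition tvar :: qt where "tvar = to_fract [:0, 1:]"

definition eval_q1_t0 :: "rat poly poly \<Rightarrow> rat" where
  "eval_q1_t0 a = poly (poly a 0) 1"

text \<open>The value at \<open>(q, t) = (1, 0)\<close>, unspecified for a rational function that is not regular there.\<close>
definition value_q1_t0 :: "qt \<Rightarrow> rat" where
  "value_q1_t0 c = (THE v. \<exists>a b. c = Fract a b \<and> eval_q1_t0 b \<noteq> 0 \<and>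
                                 v = eval_q1_t0 a / eval_q1_t0 b)"

text \<open>A monomial is given by its exponents, as a finitely supported function on the variables.\<close>
type_synonym qtpoly = "(nat \<Rightarrow>\<^sub>0 nat) \<Rightarrow>\<^sub>0 qt"

definition Const :: "qt \<Rightarrow> qtpoly" where "Const c = Poly_Mapping.single 0 c"

definition Var :: "nat \<Rightarrow> qtpoly" where
  "Var i = Poly_Mapping.single (Poly_Mapping.single i 1) 1"

definition insertion ::
    "('a::zero \<Rightarrow> 'b::comm_semiring_1) \<Rightarrow> (nat \<Rightarrow> 'b) \<Rightarrow> ((nat \<Rightarrow>\<^sub>0 nat) \<Rightarrow>\<^sub>0 'a) \<Rightarrow> 'b" where
  "insertion h v p =
     (\<Sum>e\<in>Poly_Mapping.keys p. h (Poly_Mapping.lookup p e) *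
        (\<Prod>i\<in>Poly_Mapping.keys e. v i ^ Poly_Mapping.lookup e i))"

abbreviation subst :: "(nat \<Rightarrow> qtpoly) \<Rightarrow> qtpoly \<Rightarrow> qtpoly" where
  "subst \<equiv> insertion Const"

definition specialize_q1_t0 :: "(nat \<Rightarrow> real) \<Rightarrow> qtpoly \<Rightarrow> real" where
  "specialize_q1_t0 x p = insertion (\<lambda>c. of_rat (value_q1_t0 c)) x p"

definition homogeneous :: "nat \<Rightarrow> nat \<Rightarrow> qtpoly \<Rightarrow> bool" where
  "homogeneous n d p \<longleftrightarrow>
     (\<forall>e\<in>Poly_Mapping.keys p. Poly_Mapping.keys e \<subseteq> {..<n} \<and>
                              (\<Sum>i<n. Poly_Mapping.lookup e i) = d)"

definition esym :: "nat \<Rightarrow> nat \<Rightarrow> (nat \<Rightarrow> real) \<Rightarrow> real" where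
  "esym n k x = (\<Sum>S | S \<subseteq> {..<n} \<and> card S = k. \<Prod>i\<in>S. x i)"

text \<open>The value lies in the field of rational functions in the variables; it is always a polynomial.\<close>
definition hecke :: "nat \<Rightarrow> qtpoly \<Rightarrow> qtpoly fract" where
  "hecke i f =
     to_fract (Const tvar * f)
     - Fract (Const tvar * Var i - Var (Suc i)) (Var i - Var (Suc i))
       * to_fract (f - subst (Var(i := Var (Suc i), Suc i := Var i)) f)"

text \<open>These conditions determine \<open>f\<close> uniquely on \<open>configs lam\<close>; its other values are irrelevant.\<close>
definition asep_polynomials :: "nat list \<Rightarrow> (nat list \<Rightarrow> qtpoly) \<Rightarrow> bool" where
  "asep_polynomials lam f \<longleftrightarrow>
    (let n = length lam in
      (\<forall>mu\<in>configs lam. homogeneous n (sum_list lam) (f mu)) \<and>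
      (\<forall>mu\<in>configs lam. \<forall>i. Suc i < n \<and> mu ! i > mu ! Suc i \<longrightarrow>
          hecke i (f mu) = to_fract (f (swap_entries i mu))) \<and>
      (\<forall>mu\<in>configs lam. \<forall>i. Suc i < n \<and> mu ! i = mu ! Suc i \<longrightarrow>
          hecke i (f mu) = to_fract (Const tvar * f mu)) \<and>
      (\<forall>mu\<in>configs lam.
          Const (qvar ^ last mu) * f mu =
          subst (\<lambda>i. if i = 0 then Const qvar * Var (n - 1) else Var (i - 1))
                (f (last mu # butlast mu))) \<and>
      Poly_Mapping.lookup (f lam) (Poly_Mapping.nth lam) = 1)"

definition monomial_symmetric :: "nat list \<Rightarrow> qtpoly" where
  "monomial_symmetric mu = (\<Sum>eta\<in>configs mu. Poly_Mapping.single (Poly_Mapping.nth eta) 1)"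

definition strictly_dominated :: "nat list \<Rightarrow> nat list set" where
  "strictly_dominated lam =
     {mu. length mu = length lam \<and> sorted_wrt (\<ge>) mu \<and> sum_list mu = sum_list lam \<and> mu \<noteq> lam \<and>
          (\<forall>k\<le>length lam. sum_list (take k mu) \<le> sum_list (take k lam))}"

text \<open>
  The Macdonald q-difference operator \<open>D\<^sub>n\<^sup>1 = \<Sum>\<^sub>i \<Prod>\<^sub>j\<^sub>\<noteq>\<^sub>i (t x\<^sub>i - x\<^sub>j) / (x\<^sub>i - x\<^sub>j) \<cdot> T\<^sub>q\<^sub>,\<^sub>x\<^sub>i\<close>, where
  \<open>T\<^sub>q\<^sub>,\<^sub>x\<^sub>i\<close> replaces \<open>x\<^sub>i\<close> by \<open>q x\<^sub>i\<close>.
\<close>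
definition macdonald_operator :: "nat \<Rightarrow> qtpoly \<Rightarrow> qtpoly fract" where
  "macdonald_operator n f =
     (\<Sum>i<n. (\<Prod>j\<in>{..<n} - {i}. Fract (Const tvar * Var i - Var j) (Var i - Var j))
             * to_fract (subst (Var(i := Const qvar * Var i)) f))"

text \<open>
  For a partition \<open>\<lambda>\<close> with \<open>n\<close> parts (zeros allowed), \<open>P\<^sub>\<lambda>\<close> in \<open>n\<close> variables is the unique
  eigenfunction of \<open>D\<^sub>n\<^sup>1\<close> of the form \<open>m\<^sub>\<lambda> + \<Sum> c\<^sub>\<mu> m\<^sub>\<mu>\<close>, summed over the partitions \<open>\<mu>\<close> strictly
  below \<open>\<lambda>\<close> in dominance order (Macdonald, Symmetric Functions and Hall Polynomials,
  Sections VI.3 and VI.4).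
\<close>
definition macdonald_polynomial :: "nat list \<Rightarrow> qtpoly \<Rightarrow> bool" where
  "macdonald_polynomial lam P \<longleftrightarrow>
    (let n = length lam in
      (\<exists>c. P = monomial_symmetric lam +
               (\<Sum>mu\<in>strictly_dominated lam. Const (c mu) * monomial_symmetric mu)) \<and>
      macdonald_operator n P =
        to_fract (Const (\<Sum>i<n. qvar ^ (lam ! i) * tvar ^ (n - Suc i)) * P))"

end

theory Submission
  imports
    Defs
begin

text \<open>
  At \<open>q = 1\<close>, \<open>t = 0\<close> the exchange relations of the ASEP polynomials say that they are
  reproduced by a transfer matrix. In \<open>T(z)\<close> a carrier with parameter \<open>z\<close> runs once around
  the ring; whenever it meets a larger species it either exchanges its species with it or stays as it is, with weights
  \<open>z / x\<^sub>i\<close> and \<open>1 - z / x\<^sub>i\<close>; all other encounters are exchanges. The relations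
  give \<open>T(x\<^sub>j) f = f\<close> for all \<open>j\<close>, and \<open>T(0) f = f\<close>; since
  \<open>T\<close> has degree at most \<open>n\<close> in \<open>z\<close>, \<open>T(z) f = f\<close> identically, and
  the coefficient of \<open>z\<close> is global balance. The chain can be driven to the sorted configuration, so
  signed stationary vectors are unique up to a scalar.

  For the normalisation, the sum \<open>g\<close> of the \<open>f\<^sub>\<mu>\<close> is an eigenfunction of the
  Macdonald operator, and a triangularity argument identifies it with \<open>P\<^sub>\<lambda>\<close>. To first order
  in \<open>q - 1\<close> the operator is a derivation, so the product of the
  \<open>e\<^bsub>M\<^sub>i\<^esub>\<close> is an eigenfunction modulo \<open>(q - 1)\<^sup>2\<close>, and the same
  triangularity shows that it agrees with \<open>P\<^sub>\<lambda>\<close> modulo \<open>q - 1\<close> once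
  \<open>t\<close> is inverted. The coefficients have no pole at \<open>t = 0\<close>, because a renormalised family
  at \<open>t = 0\<close> would have leading exponents with maximal sum of squares, and only
  \<open>x\<^sup>\<mu>\<close> in \<open>f\<^sub>\<mu>\<close> is possible as such. Finally, regularity of the
  individual \<open>f\<^sub>\<mu>\<close> at \<open>(1, 0)\<close> follows from that of their sum by Nakayama's lemma:
  a functional killing the regular part would produce a nonzero stationary vector with sum zero.
\<close>

section \<open>Configurations\<close>

text \<open>The obstacle is that both specialisations are degenerate. At q = 1 all partitions give
  the same eigenvalue of the Macdonald operator, and at t = 0 an eigenvalue retains only the last
  part, so the sum of the \<open>f mu\<close> cannot be identified at (1, 0) directly. This is why
  one works to first order in q - 1 with t inverted, and treats poles along t = 0 with q generic.
  Poles of single members could still cancel in the sum, which is the reason for the quotient module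
  at the end. \<open>value_q1_t0\<close> is meaningful only for regular coefficients, so regularity
  has to be known before the balance equation says anything about the values. The sum of squares of
  the exponents is chosen because the factor x_i - x_{i+1}, which clears the denominator of T_i, can
  be undone on the terms where this sum is maximal: coefficients of one member are then expressed
  through those of another. The same quantity orders the triangular argument, since trading the
  leading exponent of the Vandermonde product for another one strictly increases it.\<close>

lemma configs_iff: "mu \<in> configs lam \<longleftrightarrow> mset mu = mset lam"
  by (simp add: configs_def permutations_of_multiset_def)

lemma finite_configs [simp]: "finite (configs lam)"
  by (simp add: configs_def)

lemma length_configs: "mu \<in> configs lam \<Longrightarrow> length mu = length lam"
  by (metis configs_iff size_mset)

lemma length_swap_entries [simp]: "length (swap_entries i mu) = length mu"
  by (simp add: swap_entries_def)

lemma nth_swap_entries: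
  assumes "Suc i < length mu" "k < length mu"
  shows "swap_entries i mu ! k = (if k = i then mu ! Suc i else if k = Suc i then mu ! i else mu ! k)"
  using assms by (simp add: swap_entries_def nth_list_update)

lemma nth_swap_entries_1 [simp]: "Suc i < length mu \<Longrightarrow> swap_entries i mu ! i = mu ! Suc i"
  by (simp add: nth_swap_entries)

lemma nth_swap_entries_2 [simp]: "Suc i < length mu \<Longrightarrow> swap_entries i mu ! Suc i = mu ! i"
  by (simp add: nth_swap_entries)

lemma swap_entries_swap_entries [simp]:
  assumes "Suc i < length mu"
  shows "swap_entries i (swap_entries i mu) = mu"
  using assms by (intro nth_equalityI) (auto simp: nth_swap_entries)

lemma swap_entries_append:
  "swap_entries (length u) (u @ a # b # v) = u @ b # a # v"
  by (simp add: swap_entries_def list_update_append nth_append)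

lemma swap_entries_eq_self:
  assumes "Suc i < length mu" "mu ! i = mu ! Suc i"
  shows "swap_entries i mu = mu"
  using assms by (intro nth_equalityI) (auto simp: nth_swap_entries)

lemma split_at_pair:
  assumes "Suc i < length mu"
  shows "mu = take i mu @ mu ! i # mu ! Suc i # drop (Suc (Suc i)) mu"
  by (metis Cons_nth_drop_Suc Suc_lessD append_take_drop_id assms)

lemma mset_swap_entries [simp]:
  assumes "Suc i < length mu"
  shows "mset (swap_entries i mu) = mset mu"
  using assms mset_swap[of "Suc i" mu i] by (simp add: swap_entries_def list_update_swap)

lemma swap_entries_configs [simp]:
  "Suc i < length mu \<Longrightarrow> swap_entries i mu \<in> configs lam \<longleftrightarrow> mu \<in> configs lam"
  by (simp add: configs_iff)

text \<open>Sorting measure: undoing an ascent lowers it. It drives the induction over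
  rearrangements and also separates the monomials of an elementary symmetric function from the
  leading one.\<close>

lemma sum_weighted_swap:
  fixes w :: "nat list"
  assumes i: "Suc i < length w" and asc: "w ! i < w ! Suc i"
  shows "(\<Sum>k<length w. k * swap_entries i w ! k) < (\<Sum>k<length w. k * w ! k)"
proof -
  define A where "A = {..<length w} - {i, Suc i}"
  have fin: "finite A" and spl: "{..<length w} = insert i (insert (Suc i) A)" and ni: "i \<notin> insert (Suc i) A" "Suc i \<notin> A"
    using i by (auto simp: A_def)
  have e: "(\<Sum>k\<in>A. k * swap_entries i w ! k) = (\<Sum>k\<in>A. k * w ! k)"
    using i by (intro sum.cong) (auto simp: A_def nth_swap_entries)
  show ?thesis
    unfolding spl using ni fin i asc e by (simp add: algebra_simps)
qed

lemma not_sorted_desc_ascent: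
  fixes w :: "nat list"
  assumes "\<not> sorted_wrt (\<ge>) w"
  obtains i where "Suc i < length w" "w ! i < w ! Suc i"
proof -
  have "\<not> sorted_wrt (\<ge>) w \<Longrightarrow> \<exists>i. Suc i < length w \<and> w ! i < w ! Suc i"
  proof (induction w)
    case (Cons a w)
    show ?case
    proof (cases "sorted_wrt (\<ge>) w")
      case False
      with Cons.IH obtain i where "Suc i < length w" "w ! i < w ! Suc i" by blast
      then show ?thesis by (intro exI[of _ "Suc i"]) simp
    next
      case True
      with Cons.prems obtain x where x: "x \<in> set w" "a < x" by auto
      then obtain b w' where w: "w = b # w'" by (cases w) auto
      with True x have "a < b" by auto
      with w show ?thesis by (intro exI[of _ 0]) simp
    qed
  qed simp
  with assms that show ?thesis by blast
qed

lemma sorted_desc_mset_unique: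
  fixes v w :: "nat list"
  assumes "sorted_wrt (\<ge>) v" "sorted_wrt (\<ge>) w" "mset v = mset w"
  shows "v = w"
proof -
  have "sorted (rev v)" "sorted (rev w)"
    using assms by (auto simp: sorted_wrt_rev)
  then show ?thesis
    by (metis assms(3) mset_rev properties_for_sort rev_rev_ident)
qed

text \<open>The exchange relation yields \<open>f\<close> at \<open>swap_entries i mu\<close> only
  across a descent of \<open>mu\<close>, so properties spread from the weakly decreasing
  \<open>lam\<close> by creating ascents. Conversely, a rearrangement with an ascent comes from one
  of smaller measure.\<close>

lemma configs_induct [consumes 2, case_names sorted swap]:
  assumes lam: "sorted_wrt (\<ge>) lam" and mu: "mu \<in> configs lam"
    and base: "P lam"
    and step: "\<And>mu i. mu \<in> configs lam \<Longrightarrow> P mu \<Longrightarrow> Suc i < length lam \<Longrightarrow> mu ! i > mu ! Suc i \<Longrightarrow>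
                 P (swap_entries i mu)"
  shows "P mu"
  using mu
proof (induction "\<Sum>k<length mu. k * mu ! k" arbitrary: mu rule: less_induct)
  case less
  show ?case
  proof (cases "sorted_wrt (\<ge>) mu")
    case True
    with less.prems lam base sorted_desc_mset_unique show ?thesis
      by (metis configs_iff)
  next
    case False
    then obtain i where i: "Suc i < length mu" "mu ! i < mu ! Suc i"
      using not_sorted_desc_ascent by blast
    then have "P (swap_entries i mu)"
      using less sum_weighted_swap[OF i] by simp
    with step[of "swap_entries i mu" i] i less.prems length_configs[OF less.prems] show ?thesis
      by simp
  qed
qed

section \<open>Exponents with maximal sum of squares\<close>

text \<open>The exchange, symmetry and cyclic relations for the coefficients \<open>c mu be\<close> of \<open>x\<^bsup>be\<^esup>\<close> in \<open>f\<^sub>m\<^sub>u\<close>, reduced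
  to the terms in which \<open>be\<close> has the maximal sum of squares.\<close>
definition graded_kz ::
    "'r::comm_ring_1 \<Rightarrow> 'r \<Rightarrow> nat list \<Rightarrow> (nat list \<Rightarrow> nat list \<Rightarrow> 'r) \<Rightarrow> bool" where
  "graded_kz q t lam c \<longleftrightarrow>
     (\<forall>mu be i. mu \<in> configs lam \<longrightarrow> length be = length lam \<longrightarrow> Suc i < length lam \<longrightarrow>
        (mu ! i > mu ! Suc i \<longrightarrow>
           c (swap_entries i mu) be =
             (if be ! i < be ! Suc i then c mu (swap_entries i be) + (t - 1) * c mu be
              else t * c mu (swap_entries i be))) \<and>
        (mu ! i = mu ! Suc i \<longrightarrow> c mu (swap_entries i be) = c mu be)) \<and>
     (\<forall>a nu b ga. a # nu \<in> configs lam \<longrightarrow> length ga = length nu \<longrightarrow>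
        q ^ b * c (a # nu) (b # ga) = q ^ a * c (nu @ [a]) (ga @ [b]))"

lemma graded_kz_exchange:
  assumes "graded_kz q t lam c" "mu \<in> configs lam" "length be = length lam" "Suc i < length lam"
    "mu ! i > mu ! Suc i"
  shows "c (swap_entries i mu) be =
           (if be ! i < be ! Suc i then c mu (swap_entries i be) + (t - 1) * c mu be
            else t * c mu (swap_entries i be))"
  using assms unfolding graded_kz_def by blast

lemma graded_kz_sym:
  assumes "graded_kz q t lam c" "mu \<in> configs lam" "length be = length lam" "Suc i < length lam"
    "mu ! i = mu ! Suc i"
  shows "c mu (swap_entries i be) = c mu be"
  using assms unfolding graded_kz_def by blast

lemma graded_kz_rotate:
  assumes "graded_kz q t lam c" "a # nu \<in> configs lam" "length ga = length nu"
  shows "q ^ b * c (a # nu) (b # ga) = q ^ a * c (nu @ [a]) (ga @ [b])"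
  using assms unfolding graded_kz_def by blast

lemma graded_kz_exchange_append:
  assumes "graded_kz q 0 lam c" "u @ a # b # v \<in> configs lam" "a > b"
    "length u' = length u" "length v' = length v"
  shows "c (u @ b # a # v) (u' @ d # e # v') =
           (if d < e then c (u @ a # b # v) (u' @ e # d # v') - c (u @ a # b # v) (u' @ d # e # v')
            else 0)"
proof -
  have len: "length lam = length u + length v + 2"
    using length_configs[OF assms(2)] by simp
  have "c (swap_entries (length u) (u @ a # b # v)) (u' @ d # e # v') =
          (if (u' @ d # e # v') ! length u < (u' @ d # e # v') ! Suc (length u)
           then c (u @ a # b # v) (swap_entries (length u) (u' @ d # e # v'))
                + (0 - 1) * c (u @ a # b # v) (u' @ d # e # v')
           else 0 * c (u @ a # b # v) (swap_entries (length u) (u' @ d # e # v')))"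
    by (rule graded_kz_exchange[OF assms(1,2)]) (use assms len in \<open>auto simp: nth_append\<close>)
  then show ?thesis
    using assms(4) swap_entries_append[of u'] by (simp add: swap_entries_append nth_append)
qed

text \<open>Both lists are compared with their common descending rearrangement.\<close>

lemma adjacent_swaps_invariant:
  fixes v w :: "nat list"
  assumes inv: "\<And>w i. mset w = mset v \<Longrightarrow> Suc i < length w \<Longrightarrow> F (swap_entries i w) = F w"
    and "mset v = mset w"
  shows "F v = F w"
proof -
  define l where "l = rev (sort v)"
  have l: "sorted_wrt (\<ge>) l" unfolding l_def sorted_wrt_rev using sorted_sort[of v] by blast
  have ml: "mset l = mset v" by (simp add: l_def)
  have "F mu = F l" if "mu \<in> configs l" for mu
    using l that
  proof (induction rule: configs_induct)
    case (swap mu i)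
    then show ?case using inv[of mu i] ml length_configs[OF swap(1)] by (simp add: configs_iff)
  qed simp
  from this[of v] this[of w] ml assms(2) show ?thesis by (simp add: configs_iff)
qed

lemma graded_kz_sym_block:
  assumes kz: "graded_kz q t lam c" and mem: "u @ replicate k s @ v \<in> configs lam"
    and len: "length u' = length u" "length be = k" "length v' = length v"
    and ms: "mset be = mset be'"
  shows "c (u @ replicate k s @ v) (u' @ be @ v') = c (u @ replicate k s @ v) (u' @ be' @ v')"
proof (rule adjacent_swaps_invariant[OF _ ms])
  fix w i assume w: "mset w = mset be" "Suc i < length w"
  have lw: "length w = k" using w len by (metis size_mset)
  have L: "length lam = length u + k + length v" using length_configs[OF mem] by simp
  have "swap_entries (length u + i) (u' @ w @ v') = u' @ swap_entries i w @ v'"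
    using w lw len by (auto simp: swap_entries_def list_update_append nth_append)
  moreover have "c (u @ replicate k s @ v) (swap_entries (length u + i) (u' @ w @ v'))
      = c (u @ replicate k s @ v) (u' @ w @ v')"
    by (rule graded_kz_sym[OF kz mem]) (use L lw len w in \<open>auto simp: nth_append\<close>)
  ultimately show "c (u @ replicate k s @ v) (u' @ swap_entries i w @ v') =
      c (u @ replicate k s @ v) (u' @ w @ v')" by simp
qed

text \<open>At t = 0 the exchange relation has only the coefficients 1, -1 and 0, so carrying
  \<open>s\<close> across \<open>r\<close> keeps the values inside any additive group
  \<open>Pr\<close>; later this is divisibility by a power of q, or a bound on the degree in q. The
  coefficient 0 gives the second claim: each exchange needs an ascent of the exponents to produce a
  nonzero value.\<close>

lemma graded_kz_move_right:
  assumes kz: "graded_kz q 0 lam c"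
    and mem: "u @ s # r @ v \<in> configs lam" and small: "\<forall>x\<in>set r. x < s"
    and len: "length u' = length u" "length r' = length r" "length v' = length v"
    and Pr0: "Pr 0" and Prd: "\<And>x y. Pr x \<Longrightarrow> Pr y \<Longrightarrow> Pr (x - y)"
    and Pr: "\<And>w. mset w = mset (r' @ [b]) \<Longrightarrow> Pr (c (u @ s # r @ v) (u' @ w @ v'))"
  shows "Pr (c (u @ r @ s # v) (u' @ r' @ b # v')) \<and>
         (c (u @ r @ s # v) (u' @ r' @ b # v') \<noteq> 0 \<longrightarrow> (\<forall>d\<in>set r'. d < b))"
  using mem small len Pr
proof (induction r arbitrary: v r' b v' rule: rev_induct)
  case Nil
  then show ?case using Nil.prems(6)[of "[b]"] by simp
next
  case (snoc x r)
  from snoc.prems(4) obtain r0 d where r': "r' = r0 @ [d]" and lr0: "length r0 = length r"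
    by (metis length_Suc_conv_rev length_append_singleton)
  have IH: "Pr (c (u @ r @ s # x # v) (u' @ r0 @ e # f # v')) \<and>
     (c (u @ r @ s # x # v) (u' @ r0 @ e # f # v') \<noteq> 0 \<longrightarrow> (\<forall>d\<in>set r0. d < e))"
    if ef: "mset [e, f] = mset [b, d]" for e f
  proof (rule snoc.IH[where v = "x # v" and v' = "f # v'" and b = e and r' = r0])
    show "u @ s # r @ x # v \<in> configs lam" using snoc.prems(1) by simp
    fix w assume w: "mset w = mset (r0 @ [e])"
    have "Pr (c (u @ s # (r @ [x]) @ v) (u' @ (w @ [f]) @ v'))"
      by (rule snoc.prems(6)) (use w ef in \<open>simp add: r'\<close>)
    then show "Pr (c (u @ s # r @ x # v) (u' @ w @ f # v'))" by simp
  qed (use snoc.prems lr0 in auto)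
  have ex: "c ((u @ r) @ x # s # v) ((u' @ r0) @ d # b # v') =
           (if d < b then c ((u @ r) @ s # x # v) ((u' @ r0) @ b # d # v')
              - c ((u @ r) @ s # x # v) ((u' @ r0) @ d # b # v') else 0)"
    by (rule graded_kz_exchange_append[OF kz]) (use snoc.prems lr0 in \<open>auto simp: configs_iff\<close>)
  show ?case
    using ex IH[of b d] IH[of d b] Pr0 Prd by (auto simp: r')
qed

text \<open>Sending one \<open>s\<close> around the ring compares \<open>q ^ b\<close> with
  \<open>q ^ s\<close> for any exponent \<open>b\<close> among the first \<open>k\<close>. If
  exponents below \<open>s\<close> were present there in the whole orbit, divisibility by q would be
  unbounded; a maximal exponent above \<open>s\<close> would make the degree unbounded. Both halves
  use that the coefficients are polynomials in q.\<close>

lemma graded_kz_vanish_top_block: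
  fixes c :: "nat list \<Rightarrow> nat list \<Rightarrow> rat poly"
  assumes kz: "graded_kz [:0, 1:] 0 lam c"
    and lam: "lam = replicate k s @ r" and k: "0 < k" and small: "\<forall>x\<in>set r. x < s"
    and len: "length be = length lam" and nz: "c lam be \<noteq> 0"
  shows "take k be = replicate k s \<and> (\<forall>x\<in>set (drop k be). x < s)"
proof -
  define S where "S = {w. mset w = mset be \<and> c lam w \<noteq> 0}"
  have finS: "finite S"
    by (rule finite_subset[of _ "configs be"]) (auto simp: S_def configs_iff)
  have beS: "be \<in> S" using nz by (simp add: S_def)
  have lenS: "length w = length lam" if "w \<in> S" for w
    using that len by (metis (mono_tags, lifting) S_def mem_Collect_eq size_mset)
  have lam1: "lam = replicate (k - 1) s @ s # r"
    using lam k by (metis Suc_diff_1 append_Cons append_assoc replicate_Suc replicate_append_same append_Nil)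
  have self: "lam \<in> configs lam" by (simp add: configs_iff)
  \<comment> \<open>One \<open>s\<close> is taken once around the ring. Block symmetry brings the
    chosen \<open>b\<close> to the front, the cyclic relation moves \<open>s\<close> and
    \<open>b\<close> to the end at the cost of \<open>q ^ b\<close> against \<open>q ^ s\<close>,
    and \<open>graded_kz_move_right\<close> expresses the result \<open>X\<close> through
    coefficients of \<open>lam\<close> at rearrangements of the same exponents.\<close>
  have travelE: thesis
    if w: "w \<in> S" and b: "b \<in> set (take k w)"
      and th: "\<And>X. \<forall>d\<in>set (drop k w). d < b \<Longrightarrow> [:0, 1:] ^ b * c lam w = [:0, 1:] ^ s * X \<Longrightarrow>
       (\<And>Pr. Pr 0 \<Longrightarrow> (\<And>x y. Pr x \<Longrightarrow> Pr y \<Longrightarrow> Pr (x - y)) \<Longrightarrow>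
          (\<And>z. mset z = mset be \<Longrightarrow> Pr (c lam z)) \<Longrightarrow> Pr X) \<Longrightarrow> thesis"
    for w b thesis
  proof -
    obtain g where g: "mset (take k w) = mset (b # g)"
      by (metis b ex_mset mset.simps(2) multi_member_split set_mset_mset)
    have lw: "length w = length lam" and mw: "mset w = mset be" using w lenS by (auto simp: S_def)
    have lg: "length g = k - 1" "length (take k w) = k"
      using arg_cong[OF g, of size] lw lam by auto
    have "c (([]::nat list) @ replicate k s @ r) ([] @ take k w @ drop k w)
        = c ([] @ replicate k s @ r) ([] @ (b # g) @ drop k w)"
      by (rule graded_kz_sym_block[OF kz]) (use lam lw g in \<open>auto simp: configs_iff\<close>)
    then have c1: "c lam w = c lam (b # g @ drop k w)" by (simp add: lam)
    have lamc: "lam = s # replicate (k - 1) s @ r"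
      using lam k by (cases k) auto
    have c2: "[:0, 1:] ^ b * c (s # replicate (k - 1) s @ r) (b # g @ drop k w) =
        [:0, 1:] ^ s * c ((replicate (k - 1) s @ r) @ [s]) ((g @ drop k w) @ [b])"
    proof (rule graded_kz_rotate[OF kz])
      show "s # replicate (k - 1) s @ r \<in> configs lam" using self lamc by simp
      have "length lam = k + length r" using lam by simp
      then show "length (g @ drop k w) = length (replicate (k - 1) s @ r)" using lg lw by simp
    qed
    define X where "X = c (replicate (k - 1) s @ r @ [s]) (g @ drop k w @ [b])"
    have mv: "Pr X \<and> (X \<noteq> 0 \<longrightarrow> (\<forall>d\<in>set (drop k w). d < b))"
      if "Pr 0" "\<And>x y. Pr x \<Longrightarrow> Pr y \<Longrightarrow> Pr (x - y)" "\<And>z. mset z = mset be \<Longrightarrow> Pr (c lam z)" for Pr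
      unfolding X_def
    proof (rule graded_kz_move_right[where v = "[]" and v' = "[]" and Pr = Pr, OF kz])
      fix z assume z: "mset z = mset (drop k w @ [b])"
      have "mset (take k w @ drop k w) = mset be" using mw by simp
      then have "mset (g @ z) = mset be" using g z by (simp only: mset_append) simp
      then show "Pr (c (replicate (k - 1) s @ s # r @ []) (g @ z @ []))"
        using that(3)[of "g @ z"] lam1 by simp
    next
      show "replicate (k - 1) s @ s # r @ [] \<in> configs lam" using self lam1 by simp
      have "length lam = k + length r" using lam by simp
      then show "length (drop k w) = length r" using lw by simp
    qed (use that small lg in auto)
    have X: "[:0, 1:] ^ b * c lam w = [:0, 1:] ^ s * X"
      using c1 c2 lamc by (simp add: X_def)
    have "X \<noteq> 0" using X w by (auto simp: S_def)
    then have "\<forall>d\<in>set (drop k w). d < b" using mv[of "\<lambda>_. True"] by simp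
    from this X show ?thesis by (rule th) (rule conjunct1[OF mv])
  qed
  have travel: "\<forall>d\<in>set (drop k w). d < b" if "w \<in> S" "b \<in> set (take k w)" for w b
    by (rule travelE[OF that])
  \<comment> \<open>An exponent \<open>b < s\<close> contributes a factor \<open>q ^ (s - b)\<close>
    at each turn. If every member of the orbit has one, all its coefficients are divisible by every
    power of q, although one of them is nonzero.\<close>
  have descent: False
    if h: "\<And>w. w \<in> S \<Longrightarrow> \<exists>b\<in>set (take k w). b < s"
  proof -
    have dv: "\<forall>w. mset w = mset be \<longrightarrow> [:0, 1:] ^ e dvd c lam w" for e
    proof (induction e)
      case (Suc e)
      show ?case
      proof (intro allI impI)
        fix w assume mw: "mset w = mset be"
        show "[:0, 1:] ^ Suc e dvd c lam w"
        proof (cases "w \<in> S")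
          case True
          then obtain b where b: "b \<in> set (take k w)" "b < s" using h by blast
          show ?thesis
          proof (rule travelE[OF True b(1)])
          fix X assume
            X1: "[:0, 1:] ^ b * c lam w = [:0, 1:] ^ s * X"
            and Pr: "\<And>Pr. Pr 0 \<Longrightarrow> (\<And>x y. Pr x \<Longrightarrow> Pr y \<Longrightarrow> Pr (x - y)) \<Longrightarrow>
               (\<And>z. mset z = mset be \<Longrightarrow> Pr (c lam z)) \<Longrightarrow> Pr X"
          have "[:0, 1:] ^ e dvd X"
            by (rule Pr) (use Suc.IH in \<open>auto intro: dvd_diff\<close>)
          with X1 have X: "[:0, 1:] ^ b * c lam w = [:0, 1:] ^ s * X" "[:0, 1:] ^ e dvd X" by auto
          have "[:0, 1::rat:] ^ s = [:0, 1:] ^ b * [:0, 1:] ^ (s - b)"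
            using b by (simp add: power_add[symmetric])
          then have "c lam w = [:0, 1:] ^ (s - b) * X"
            using X(1) by (simp add: mult.assoc)
          moreover have "[:0, 1::rat:] dvd [:0, 1:] ^ (s - b)"
            using b(2) by (meson dvd_power zero_less_diff)
          ultimately show "[:0, 1:] ^ Suc e dvd c lam w"
            using X(2) by (simp only: power_Suc) (rule mult_dvd_mono)
          qed
        qed (use mw in \<open>simp add: S_def\<close>)
      qed
    qed simp
    have "degree ([:0, 1::rat:] ^ Suc (degree (c lam be))) \<le> degree (c lam be)"
      using dv[rule_format, OF refl] nz by (rule dvd_imp_degree_le)
    then show False by (simp add: degree_power_eq)
  qed
  define B where "B = Max (set be)"
  have ne: "set be \<noteq> {}" using len lam k by auto
  have Bin: "B \<in> set w" and Bmax: "\<forall>x\<in>set w. x \<le> B" if "w \<in> S" for w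
  proof -
    have "set w = set be" using that by (metis (mono_tags, lifting) S_def mem_Collect_eq set_mset_mset)
    then show "B \<in> set w" "\<forall>x\<in>set w. x \<le> B" using ne by (auto simp: B_def)
  qed
  have Btake: "B \<in> set (take k w)" and Bdrop: "\<forall>x\<in>set (drop k w). x < B" if w: "w \<in> S" for w
  proof -
    have "take k w \<noteq> []" using lenS[OF w] lam k by auto
    then obtain b where b: "b \<in> set (take k w)" by (meson last_in_set)
    show "B \<in> set (take k w)"
    proof (rule ccontr)
      assume "B \<notin> set (take k w)"
      moreover have "set w = set (take k w) \<union> set (drop k w)" by (metis append_take_drop_id set_append)
      ultimately have "B \<in> set (drop k w)" using Bin[OF w] by blast
      with travel[OF w b] have "B < b" by blast
      moreover have "b \<le> B" using Bmax[OF w] b by (meson in_set_takeD)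
      ultimately show False by simp
    qed
    with travel[OF w] show "\<forall>x\<in>set (drop k w). x < B" by blast
  qed
  have "\<not> B < s" using descent Btake by blast
  moreover have "\<not> s < B"
  proof
    assume sB: "s < B"
    \<comment> \<open>For a maximal exponent above \<open>s\<close> one turn raises the degree in q
      by \<open>B - s\<close>, which contradicts the choice of a coefficient of maximal
      degree.\<close>
    define D where "D = Max ((\<lambda>w. degree (c lam w)) ` S)"
    have Dmax: "degree (c lam z) \<le> D" if "mset z = mset be" for z
    proof (cases "z \<in> S")
      case True then show ?thesis using finS by (simp add: D_def)
    next
      case False then show ?thesis using that by (simp add: S_def)
    qed
    have "D \<in> (\<lambda>w. degree (c lam w)) ` S" unfolding D_def using beS finS by (intro Max_in) auto
    then obtain w where w: "w \<in> S" "degree (c lam w) = D" by blast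
    have False
    proof (rule travelE[OF w(1) Btake[OF w(1)]])
    fix X assume
       X: "[:0, 1:] ^ B * c lam w = [:0, 1:] ^ s * X"
       and Pr: "\<And>Pr. Pr 0 \<Longrightarrow> (\<And>x y. Pr x \<Longrightarrow> Pr y \<Longrightarrow> Pr (x - y)) \<Longrightarrow>
          (\<And>z. mset z = mset be \<Longrightarrow> Pr (c lam z)) \<Longrightarrow> Pr X"
    have dX: "degree X \<le> D"
      by (rule Pr) (use Dmax degree_diff_le in auto)
    have "[:0, 1::rat:] ^ B = [:0, 1:] ^ s * [:0, 1:] ^ (B - s)"
      using sB by (simp add: power_add[symmetric])
    then have "X = [:0, 1:] ^ (B - s) * c lam w" using X by (simp add: mult.assoc)
    moreover have "c lam w \<noteq> 0" using w by (simp add: S_def)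
    ultimately have "degree X = (B - s) + D"
      using w by (simp add: degree_mult_eq degree_power_eq)
    with dX sB show False by simp
    qed
    then show False .
  qed
  ultimately have Bs: "B = s" by simp
  \<comment> \<open>All entries \<open>s\<close> of a member of \<open>S\<close> lie among its first
    \<open>k\<close>, and their number is the same throughout \<open>S\<close>. If \<open>be\<close>
    has another entry in these places, so has every member, and \<open>descent\<close>
    applies.\<close>
  have all_s: "set (take k be) \<subseteq> {s}"
  proof (rule ccontr)
    assume "\<not> set (take k be) \<subseteq> {s}"
    then obtain b where b: "b \<in> set (take k be)" "b \<noteq> s" by blast
    have le: "count_list (take k w) s = count_list w s" if "w \<in> S" for w
    proof -
      have "s \<notin> set (drop k w)" using Bdrop[OF that] Bs by auto
      then have "count_list (drop k w) s = 0" by (simp add: count_list_0_iff)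
      moreover have "count_list w s = count_list (take k w) s + count_list (drop k w) s"
        by (metis append_take_drop_id count_list_append)
      ultimately show ?thesis by simp
    qed
    have ct: "count_list xs s = length xs \<longleftrightarrow> set xs \<subseteq> {s}" for xs :: "nat list"
    proof (induction xs)
      case (Cons x xs)
      then show ?case using count_le_length[of xs s] by auto
    qed simp
    have "\<exists>b\<in>set (take k w). b < s" if w: "w \<in> S" for w
    proof -
      have "mset w = mset be" using w by (simp add: S_def)
      then have "count_list w s = count_list be s" by (metis count_mset)
      then have "count_list (take k w) s = count_list (take k be) s" using le w beS by metis
      moreover have "length (take k w) = length (take k be)" using lenS[OF w] len by simp
      ultimately have "\<not> set (take k w) \<subseteq> {s}" using ct[of "take k w"] ct[of "take k be"] b by auto
      then obtain b' where b': "b' \<in> set (take k w)" "b' \<noteq> s" by blast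
      moreover have "b' \<le> s" using Bmax[OF w] Bs b'(1) in_set_takeD by fastforce
      ultimately show ?thesis by force
    qed
    then show False using descent by blast
  qed
  have "length (take k be) = k" using len lam by simp
  then have "take k be = replicate k s" using all_s
    by (metis replicate_length_same singletonD subsetD)
  with Bdrop[OF beS] Bs show ?thesis by simp
qed

text \<open>A nonzero value after an exchange requires an ascent of \<open>be\<close>. If it stems
  from the swapped exponents, the positions of \<open>s\<close> move along with the exchange. If it
  stems from \<open>be\<close> itself, neither of the two places holds an \<open>s\<close>: the left
  exponent is smaller than the right one, whereas the left part is larger than the right
  one.\<close>

lemma graded_kz_same_positions:
  assumes kz: "graded_kz q 0 lam c" and srt: "sorted_wrt (\<ge>) lam"
    and top: "\<And>be. length be = length lam \<Longrightarrow> c lam be \<noteq> 0 \<Longrightarrow>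
                \<forall>i<length lam. be ! i \<le> s \<and> (be ! i = s \<longleftrightarrow> lam ! i = s)"
    and le: "\<forall>x\<in>set lam. x \<le> s"
    and mu: "mu \<in> configs lam" and len: "length be = length lam" and nz: "c mu be \<noteq> 0"
  shows "\<forall>i<length lam. be ! i \<le> s \<and> (be ! i = s \<longleftrightarrow> mu ! i = s)"
proof -
  have "\<forall>be. length be = length lam \<longrightarrow> c mu be \<noteq> 0 \<longrightarrow>
        (\<forall>i<length lam. be ! i \<le> s \<and> (be ! i = s \<longleftrightarrow> mu ! i = s))"
    using srt mu
  proof (induction rule: configs_induct)
    case (swap mu i)
    have lmu: "length mu = length lam" using swap(1) by (rule length_configs)
    have ms: "mu ! i \<le> s" "mu ! Suc i \<le> s" using swap le lmu
      by (metis Suc_lessD configs_iff nth_mem set_mset_mset)+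
    show ?case
    proof (intro allI impI, goal_cases)
      case (1 be k)
      then have "be ! i < be ! Suc i"
        and nz: "c mu (swap_entries i be) \<noteq> 0 \<or> c mu be \<noteq> 0"
        using graded_kz_exchange[OF kz swap(1) 1(1) swap(2,3)] by (auto split: if_splits)
      from nz show ?case
      proof
        assume "c mu (swap_entries i be) \<noteq> 0"
        then have *: "swap_entries i be ! j \<le> s \<and> (swap_entries i be ! j = s \<longleftrightarrow> mu ! j = s)"
          if "j < length lam" for j using swap 1 that by simp
        show ?thesis using *[of k] *[of i] *[of "Suc i"] 1 swap lmu
          by (auto simp: nth_swap_entries split: if_splits)
      next
        assume "c mu be \<noteq> 0"
        then have *: "be ! j \<le> s \<and> (be ! j = s \<longleftrightarrow> mu ! j = s)" if "j < length lam" for j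
          using swap 1 that by simp
        have "be ! i < be ! Suc i" by fact
        then show ?thesis using *[of k] *[of i] *[of "Suc i"] 1 swap lmu ms
          by (auto simp: nth_swap_entries)
      qed
    qed
  qed (use top in blast)
  then show ?thesis using len nz by blast
qed

text \<open>The term with unchanged exponents drops out: it would have \<open>be = mu\<close>, with
  an ascent required of \<open>be\<close> where \<open>mu\<close> has a descent.\<close>

lemma graded_kz_support_eq:
  assumes kz: "graded_kz q 0 lam c" and srt: "sorted_wrt (\<ge>) lam"
    and top: "\<And>be. length be = length lam \<Longrightarrow> c lam be \<noteq> 0 \<Longrightarrow> be = lam"
    and mu: "mu \<in> configs lam" and len: "length be = length lam" and nz: "c mu be \<noteq> 0"
  shows "be = mu \<and> c lam lam \<noteq> 0"
proof -
  have "\<forall>be. length be = length lam \<longrightarrow> c mu be \<noteq> 0 \<longrightarrow> be = mu \<and> c lam lam \<noteq> 0"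
    using srt mu
  proof (induction rule: configs_induct)
    case (swap mu i)
    have lmu: "length mu = length lam" using swap(1) by (rule length_configs)
    show ?case
    proof (intro allI impI, goal_cases)
      case (1 be)
      then have asc: "be ! i < be ! Suc i"
        and nz: "c mu (swap_entries i be) \<noteq> 0 \<or> c mu be \<noteq> 0"
        using graded_kz_exchange[OF kz swap(1) 1(1) swap(2,3)] by (auto split: if_splits)
      from nz show ?case
      proof
        assume "c mu (swap_entries i be) \<noteq> 0"
        then have "swap_entries i be = mu \<and> c lam lam \<noteq> 0"
          using swap.IH[rule_format, of "swap_entries i be"] 1 by simp
        then show ?thesis using 1 swap swap_entries_swap_entries by metis
      next
        assume "c mu be \<noteq> 0"
        then have "be = mu" using swap 1 by simp
        with asc swap show ?thesis by simp
      qed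
    qed
  qed (use top in blast)
  then show ?thesis using len nz by blast
qed

text \<open>The largest parts are moved around the ring and back; comparing powers of \<open>q\<close> forces the largest
  exponents to sit at their places in every \<open>mu\<close>. Removing them leaves a smaller family.\<close>
theorem graded_kz_support:
  fixes c :: "nat list \<Rightarrow> nat list \<Rightarrow> rat poly"
  assumes "graded_kz [:0, 1:] 0 lam c" "sorted_wrt (\<ge>) lam"
    and "mu \<in> configs lam" "length be = length lam" "c mu be \<noteq> 0"
  shows "be = mu \<and> c lam lam \<noteq> 0"
  using assms
proof (induction "length lam" arbitrary: lam c mu be rule: less_induct)
  case less
  note kz = less.prems(1) and srt = less.prems(2)
  show ?case
  proof (rule graded_kz_support_eq[OF kz srt _ less.prems(3-5)])
    fix be assume len: "length be = length lam" and nz: "c lam be \<noteq> 0"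
    show "be = lam"
    proof (cases lam)
      case Nil
      with len show ?thesis by simp
    next
      case (Cons s lam')
      define k where "k = length (takeWhile (\<lambda>x. x = s) lam)"
      define r where "r = dropWhile (\<lambda>x. x = s) lam"
      have lam: "lam = replicate k s @ r"
      proof -
        have "takeWhile (\<lambda>x. x = s) lam = replicate k s"
          unfolding k_def by (rule replicate_length_same[symmetric]) (auto dest: set_takeWhileD)
        then show ?thesis by (metis r_def takeWhile_dropWhile_id)
      qed
      have k: "0 < k" by (simp add: k_def Cons)
      have les: "\<forall>x\<in>set lam. x \<le> s" using srt Cons by auto
      have small: "\<forall>x\<in>set r. x < s"
      proof (cases r)
        case (Cons y r')
        have "dropWhile (\<lambda>x. x = s) lam \<noteq> []" using Cons unfolding r_def by (metis list.distinct(1))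
        from hd_dropWhile[OF this] have "y \<noteq> s" using Cons unfolding r_def by (metis list.sel(1))
        moreover have "y \<le> s" using les lam Cons by simp
        moreover have "\<forall>x\<in>set r. x \<le> y" using srt lam Cons by (auto simp: sorted_wrt_append)
        ultimately show ?thesis by force
      qed simp
      have block: "take k be = replicate k s \<and> (\<forall>x\<in>set (drop k be). x < s)"
        if "length be = length lam" "c lam be \<noteq> 0" for be
        by (rule graded_kz_vanish_top_block[OF kz lam k small that])
      have pos: "\<forall>i<length lam. be ! i \<le> s \<and> (be ! i = s \<longleftrightarrow> mu ! i = s)"
        if "mu \<in> configs lam" "length be = length lam" "c mu be \<noteq> 0" for mu be
      proof (rule graded_kz_same_positions[OF kz srt _ les that])
        fix be assume l: "length be = length lam" and n: "c lam be \<noteq> 0"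
        have be: "be = replicate k s @ drop k be" using block[OF l n] by (metis append_take_drop_id)
        have dr: "\<forall>x\<in>set (drop k be). x < s" using block[OF l n] by blast
        define z where "z = drop k be"
        have be: "be = replicate k s @ z" and dr: "\<forall>x\<in>set z. x < s" using be dr by (simp_all add: z_def)
        have "length z = length r" using l lam be by simp
        then show "\<forall>i<length lam. be ! i \<le> s \<and> (be ! i = s \<longleftrightarrow> lam ! i = s)"
          using dr small by (auto simp: lam be nth_append) (metis add_diff_inverse_nat less_not_refl nat_add_left_cancel_less nth_mem order_less_imp_le)+
      qed
      have posn: "c (u @ a # v) (u' @ b # v') = 0"
        if "u @ a # v \<in> configs lam" "length u' = length u" "length v' = length v"
           "b > s \<or> (b = s \<longleftrightarrow> a \<noteq> s)" for u a v u' b v'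
      proof (rule ccontr)
        assume nz: "c (u @ a # v) (u' @ b # v') \<noteq> 0"
        have "length lam = length u + length v + 1" using length_configs[OF that(1)] by simp
        with pos[OF that(1) _ nz, rule_format, of "length u"] that
        show False by (auto simp: nth_append)
      qed
      \<comment> \<open>The parts \<open>s\<close> are frozen at the front together with the
        exponents \<open>s\<close>. Exchange and symmetry carry over by a shift of indices; the
        cyclic relation needs the detour through \<open>rot\<close> and \<open>mv\<close>.\<close>
      define c' where "c' nu ga = c (replicate k s @ nu) (replicate k s @ ga)" for nu ga
      have mem: "replicate k s @ nu \<in> configs lam \<longleftrightarrow> nu \<in> configs r" for nu
        by (simp add: configs_iff lam)
      have rot: "c (replicate j s @ w) (replicate j s @ z) = c (w @ replicate j s) (z @ replicate j s)"
        if "replicate j s @ w \<in> configs lam" "length z = length w" for j w z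
        using that
      proof (induction j arbitrary: w z)
        case (Suc j)
        have "[:0, 1:] ^ s * c (s # replicate j s @ w) (s # replicate j s @ z)
            = [:0, 1:] ^ s * c ((replicate j s @ w) @ [s]) ((replicate j s @ z) @ [s])"
          by (rule graded_kz_rotate[OF kz]) (use Suc.prems in auto)
        then have "c (s # replicate j s @ w) (s # replicate j s @ z) =
            c (replicate j s @ (w @ [s])) (replicate j s @ (z @ [s]))" by simp
        also have "\<dots> = c ((w @ [s]) @ replicate j s) ((z @ [s]) @ replicate j s)"
          by (rule Suc.IH) (use Suc.prems in \<open>auto simp: configs_iff add_mset_commute\<close>)
        finally show ?case by simp
      qed simp
      \<comment> \<open>Only one of the two terms of the exchange relation survives: in the other
        one a part \<open>s\<close> would carry the exponent \<open>b < s\<close>.\<close>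
      have mv: "c (w @ a # replicate j s @ v) (z @ b # replicate j s @ v') =
                c (w @ replicate j s @ a # v) (z @ replicate j s @ b # v')"
        if "w @ a # replicate j s @ v \<in> configs lam" "length z = length w" "length v' = length v"
           "a < s" "b < s" for w a v z b j v'
        using that
      proof (induction j arbitrary: v v')
        case (Suc j)
        have "c (w @ a # replicate (Suc j) s @ v) (z @ b # replicate (Suc j) s @ v')
            = c (w @ a # replicate j s @ s # v) (z @ b # replicate j s @ s # v')"
          by (simp add: replicate_app_Cons_same)
        also have "\<dots> = c (w @ replicate j s @ a # s # v) (z @ replicate j s @ b # s # v')"
          by (rule Suc.IH) (use Suc.prems in \<open>auto simp: configs_iff add_mset_commute\<close>)
        also have "\<dots> = c ((w @ replicate j s) @ a # s # v) ((z @ replicate j s) @ b # s # v')" by simp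
        also have "\<dots> = c ((w @ replicate j s) @ s # a # v) ((z @ replicate j s) @ s # b # v')
              - c ((w @ replicate j s) @ s # a # v) ((z @ replicate j s) @ b # s # v')"
          by (subst graded_kz_exchange_append[OF kz]) (use Suc.prems in \<open>auto simp: configs_iff add_mset_commute\<close>)
        also have "c ((w @ replicate j s) @ s # a # v) ((z @ replicate j s) @ b # s # v') = 0"
          by (rule posn) (use Suc.prems in \<open>auto simp: configs_iff add_mset_commute\<close>)
        finally show ?case by (simp add: replicate_app_Cons_same)
      qed simp
      have kz': "graded_kz [:0, 1:] 0 r c'"
        unfolding graded_kz_def
      proof (intro conjI allI impI)
        fix mu be :: "nat list" and i assume a: "mu \<in> configs r" "length be = length r" "Suc i < length r"
        have lmu: "length mu = length r" using a(1) by (rule length_configs)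
        have sw: "swap_entries (k + i) (replicate k s @ w) = replicate k s @ swap_entries i w" for w
          by (simp add: swap_entries_def list_update_append nth_append)
        {
          assume "mu ! i > mu ! Suc i"
          then show "c' (swap_entries i mu) be =
             (if be ! i < be ! Suc i then c' mu (swap_entries i be) + (0 - 1) * c' mu be
              else 0 * c' mu (swap_entries i be))"
            using graded_kz_exchange[OF kz, of "replicate k s @ mu" "replicate k s @ be" "k + i"] a lmu
            by (simp add: c'_def sw mem) (simp add: lam nth_append sw)
        next
          assume "mu ! i = mu ! Suc i"
          then show "c' mu (swap_entries i be) = c' mu be"
            using graded_kz_sym[OF kz, of "replicate k s @ mu" "replicate k s @ be" "k + i"] a lmu
            by (simp add: c'_def sw mem) (simp add: lam nth_append sw)
        }
      next
        fix a b and nu ga :: "nat list" assume a: "a # nu \<in> configs r" "length ga = length nu"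
        have as: "a < s" using a(1) small by (metis configs_iff list.set_intros(1) set_mset_mset)
        have m: "replicate k s @ a # nu \<in> configs lam" using a mem by blast
        show "[:0, 1:] ^ b * c' (a # nu) (b # ga) = [:0, 1:] ^ a * c' (nu @ [a]) (ga @ [b])"
        proof (cases "b < s")
          case False
          then have "c' (a # nu) (b # ga) = 0" unfolding c'_def
            by (intro posn) (use a as m in auto)
          moreover have "c ((replicate k s @ nu) @ a # []) ((replicate k s @ ga) @ b # []) = 0"
            by (intro posn) (use False a(2) as m in \<open>auto simp: configs_iff ac_simps\<close>)
          ultimately show ?thesis by (simp add: c'_def)
        next
          case bs: True
          have "[:0, 1:] ^ b * c' (a # nu) (b # ga) =
              [:0, 1:] ^ b * c (a # nu @ replicate k s) (b # ga @ replicate k s)"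
            unfolding c'_def using rot[OF m, of "b # ga"] a by simp
          also have "\<dots> = [:0, 1:] ^ a * c ((nu @ replicate k s) @ [a]) ((ga @ replicate k s) @ [b])"
            by (rule graded_kz_rotate[OF kz]) (use a(2) m in \<open>auto simp: configs_iff ac_simps\<close>)
          also have "c ((nu @ replicate k s) @ [a]) ((ga @ replicate k s) @ [b]) =
               c (nu @ a # replicate k s @ []) (ga @ b # replicate k s @ [])"
            by (subst mv) (use a(2) m as bs in \<open>auto simp: configs_iff ac_simps\<close>)
          also have "\<dots> = c' (nu @ [a]) (ga @ [b])"
            unfolding c'_def using rot[of k "nu @ [a]" "ga @ [b]"] a(2) m by (simp add: configs_iff ac_simps)
          finally show ?thesis .
        qed
      qed
      have be: "be = replicate k s @ drop k be" using block[OF len nz] by (metis append_take_drop_id)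
      have "drop k be = r \<and> c' r r \<noteq> 0"
      proof (rule less.hyps[OF _ kz'])
        show "length r < length lam" using lam k by simp
        show "sorted_wrt (\<ge>) r" using srt lam by (simp add: sorted_wrt_append)
        show "r \<in> configs r" by (simp add: configs_iff)
        show "length (drop k be) = length r" using len lam by simp
        show "c' r (drop k be) \<noteq> 0" using nz be lam by (simp add: c'_def)
      qed
      with be lam show ?thesis by simp
    qed
  qed
qed

section \<open>Bells and the transfer matrix\<close>

text \<open>A carrier walks over a row of sites and keeps the smaller of the two species at each step. Started
  with the species of the bell, it performs the whole chain of displacements; \<open>pass_out\<close> is what it
  holds at the end.\<close>
primrec pass_sites :: "nat \<Rightarrow> nat list \<Rightarrow> nat list" where
  "pass_sites a [] = []"
| "pass_sites a (b # w) = max a b # pass_sites (min a b) w"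

primrec pass_out :: "nat \<Rightarrow> nat list \<Rightarrow> nat" where
  "pass_out a [] = a"
| "pass_out a (b # w) = pass_out (min a b) w"

lemma length_pass_sites [simp]: "length (pass_sites a w) = length w"
  by (induction w arbitrary: a) auto

lemma pass_sites_append: "pass_sites a (v @ w) = pass_sites a v @ pass_sites (pass_out a v) w"
  by (induction v arbitrary: a) auto

lemma pass_out_append: "pass_out a (v @ w) = pass_out (pass_out a v) w"
  by (induction v arbitrary: a) auto

lemma pass_out_eq: "pass_out a w = Min (insert a (set w))"
proof (induction w arbitrary: a)
  case (Cons b w)
  then show ?case by (cases "w = []") (simp_all add: min.assoc)
qed simp

lemma pass_out_le: "x \<in> insert a (set w) \<Longrightarrow> pass_out a w \<le> x"
  by (simp add: pass_out_eq)

lemma pass_out_in: "pass_out a w \<in> insert a (set w)"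
  unfolding pass_out_eq by (rule Min_in) auto

lemma pass_sites_least: "\<forall>x\<in>set w. a \<le> x \<Longrightarrow> pass_sites a w = w"
  by (induction w) (auto simp: max_def min_def)

lemma pass_out_least: "\<forall>x\<in>set w. a \<le> x \<Longrightarrow> pass_out a w = a"
  by (induction w) (auto simp: min_def)

lemma mset_pass: "add_mset (pass_out a w) (mset (pass_sites a w)) = add_mset a (mset w)"
proof (induction w arbitrary: a)
  case (Cons b w)
  have "add_mset (pass_out (min a b) w) (mset (max a b # pass_sites (min a b) w)) =
     add_mset (max a b) (add_mset (min a b) (mset w))"
    using Cons[of "min a b"] by (simp add: add_mset_commute)
  then show ?case by (auto simp: max_def min_def add_mset_commute)
qed simp

lemma pass_greatest:
  "sorted_wrt (\<ge>) D \<Longrightarrow> \<forall>x\<in>set D. x \<le> e \<Longrightarrow> pass_sites e D @ [pass_out e D] = e # D"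
  by (induction D arbitrary: e) (auto simp: max_def min_def)

section \<open>The bell as one pass of a carrier around the ring\<close>

lemma next_site_Suc:
  assumes k: "k < length eta" and stay: "\<not> eta ! ((k + 1) mod length eta) < r"
    and ex: "0 < d" "eta ! ((k + d) mod length eta) < r"
  shows "next_site eta k r = next_site eta ((k + 1) mod length eta) r"
proof -
  define P where "P d \<longleftrightarrow> 0 < d \<and> eta ! ((k + d) mod length eta) < r" for d
  have P: "P d" "\<not> P 0" using ex by (auto simp: P_def)
  have "\<not> P 1" using stay by (simp add: P_def)
  then have S: "P (Suc m) \<longleftrightarrow> 0 < m \<and> eta ! (((k + 1) mod length eta + m) mod length eta) < r" for m
    using mod_add_left_eq[of "k + 1" "length eta" m] by (cases m) (auto simp: P_def)
  have "(LEAST d. P d) = Suc (LEAST m. P (Suc m))"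
    by (rule Least_Suc[OF P])
  then show ?thesis
    unfolding next_site_def P_def[symmetric] S by (simp add: mod_simps)
qed

lemma next_site_1:
  assumes "eta ! ((k + 1) mod length eta) < r"
  shows "next_site eta k r = (k + 1) mod length eta"
proof -
  have "(LEAST d. 0 < d \<and> eta ! ((k + d) mod length eta) < r) = 1"
    by (rule Least_equality) (use assms in auto)
  then show ?thesis by (simp add: next_site_def)
qed

lemma displace_0: "displace eta k 0 = eta"
  by (subst displace.simps) (simp add: Let_def)

text \<open>\<open>displace\<close> jumps from one displaced particle to the next, whereas the
  carrier visits every site, so the induction runs over the number \<open>m\<close> of sites still
  ahead. A vacancy within this window makes the chain end before it could come back to
  \<open>k\<close>.\<close>

lemma displace_pass:
  assumes "k < length eta" "m < length eta"
    and "r = 0 \<or> (\<exists>i. 1 \<le> i \<and> i \<le> m \<and> eta ! ((k + i) mod length eta) = 0)"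
  shows "length (displace eta k r) = length eta \<and>
    (\<forall>i<m. displace eta k r ! ((k + Suc i) mod length eta) =
       pass_sites r (map (\<lambda>i. eta ! ((k + Suc i) mod length eta)) [0..<m]) ! i) \<and>
    (\<forall>l<length eta. l \<notin> (\<lambda>i. (k + Suc i) mod length eta) ` {..<m} \<longrightarrow> displace eta k r ! l = eta ! l)"
  using assms
proof (induction m arbitrary: k r)
  case 0
  then show ?case by (simp add: displace_0)
next
  case (Suc m)
  define n where "n = length eta"
  define k1 where "k1 = (k + 1) mod n"
  have k1: "k1 < n" unfolding k1_def n_def by (rule mod_less_divisor) (use Suc.prems(1) in linarith)
  have sh: "(k1 + i) mod n = (k + Suc i) mod n" for i by (simp add: k1_def mod_simps)
  have mp: "map (\<lambda>i. eta ! ((k + Suc i) mod n)) [0..<Suc m] =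
     eta ! k1 # map (\<lambda>i. eta ! ((k1 + Suc i) mod n)) [0..<m]"
    by (simp only: map_upt_Suc sh) (simp add: k1_def)
  have im: "(\<lambda>i. (k + Suc i) mod n) ` {..<Suc m} = insert k1 ((\<lambda>i. (k1 + Suc i) mod n) ` {..<m})"
    unfolding lessThan_Suc_eq_insert_0 sh image_insert image_image by (simp add: k1_def)
  have inj: "k1 \<noteq> (k1 + Suc i) mod n" if "i < m" for i
  proof
    assume "k1 = (k1 + Suc i) mod n"
    then have "k1 mod n = (k1 + Suc i) mod n" using k1 by simp
    then have "n dvd Suc i" by (metis mod_eq_dvd_iff_nat le_add1 add_diff_cancel_left')
    then show False using that Suc.prems(2) by (auto simp: n_def dest: dvd_imp_le)
  qed
  have zero: "eta ! k1 = 0 \<or> (\<exists>i. 1 \<le> i \<and> i \<le> m \<and> eta ! ((k1 + i) mod n) = 0)" if "r \<noteq> 0"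
  proof -
    from Suc.prems(3) that have "\<exists>i. 1 \<le> i \<and> i \<le> Suc m \<and> eta ! ((k + i) mod n) = 0"
      by (simp add: n_def)
    then obtain i where i: "1 \<le> i" "i \<le> Suc m" "eta ! ((k + i) mod n) = 0" by blast
    show ?thesis
    proof (cases "i = 1")
      case True then show ?thesis using i by (simp add: k1_def)
    next
      case False
      with i obtain i' where i': "i = Suc i'" by (cases i) auto
      then have "eta ! ((k1 + i') mod n) = 0" using i(3) sh[of i'] by simp
      with False i i' show ?thesis by (intro disjI2 exI[of _ i']) auto
    qed
  qed
  consider "r = 0" | "r \<noteq> 0" "eta ! k1 < r" | "r \<noteq> 0" "\<not> eta ! k1 < r" by blast
  then show ?case
  proof cases
    case 1
    then show ?thesis by (simp add: displace_0 pass_sites_least del: upt_Suc)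
  next
    case 2
    have "next_site eta k r = k1" using next_site_1[of eta k r] 2 by (simp add: k1_def n_def)
    then have d: "displace eta k r = (displace eta k1 (eta ! k1))[k1 := r]"
      by (subst displace.simps) (use 2 in \<open>simp add: Let_def\<close>)
    have IH: "length (displace eta k1 (eta ! k1)) = n \<and>
      (\<forall>i<m. displace eta k1 (eta ! k1) ! ((k1 + Suc i) mod n) =
         pass_sites (eta ! k1) (map (\<lambda>i. eta ! ((k1 + Suc i) mod n)) [0..<m]) ! i) \<and>
      (\<forall>l<n. l \<notin> (\<lambda>i. (k1 + Suc i) mod n) ` {..<m} \<longrightarrow> displace eta k1 (eta ! k1) ! l = eta ! l)"
      unfolding n_def by (rule Suc.IH) (use k1 Suc.prems zero 2 in \<open>auto simp: n_def\<close>)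
    show ?thesis
      unfolding n_def[symmetric] im mp
    proof (intro conjI allI impI, goal_cases)
      case (2 i)
      show ?case
      proof (cases i)
        case 0
        then show ?thesis using IH k1 \<open>eta ! k1 < r\<close> by (simp add: d k1_def)
      next
        case (Suc j)
        have B: "(k + Suc i) mod n = (k1 + Suc j) mod n" using sh[of "Suc j"] Suc by simp
        have j: "j < m" using 2 Suc by simp
        with IH have "displace eta k1 (eta ! k1) ! ((k1 + Suc j) mod n) =
          pass_sites (eta ! k1) (map (\<lambda>i. eta ! ((k1 + Suc i) mod n)) [0..<m]) ! j" by blast
        then show ?thesis unfolding B d using inj[OF j] \<open>eta ! k1 < r\<close> Suc by (simp add: min_def)
      qed
    qed (use IH in \<open>auto simp: d\<close>)
  next
    case 3
    from Suc.prems(3) 3(1) have "\<exists>i. 1 \<le> i \<and> i \<le> Suc m \<and> eta ! ((k + i) mod n) = 0"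
      by (simp add: n_def)
    then obtain i where "1 \<le> i" "eta ! ((k + i) mod n) = 0" by blast
    then have "next_site eta k r = next_site eta k1 r"
      using next_site_Suc[of k eta r i] 3 Suc.prems by (simp add: k1_def n_def)
    \<comment> \<open>The recursion uses its starting site only through \<open>next_site\<close>, so
      a site that keeps its particle can be skipped.\<close>
    then have d: "displace eta k r = displace eta k1 r"
      by (simp only: displace.simps[of eta k r] displace.simps[of eta k1 r])
    have zero': "r = 0 \<or> (\<exists>i. 1 \<le> i \<and> i \<le> m \<and> eta ! ((k1 + i) mod n) = 0)" using zero 3 by auto
    have IH: "length (displace eta k1 r) = n \<and>
      (\<forall>i<m. displace eta k1 r ! ((k1 + Suc i) mod n) =
         pass_sites r (map (\<lambda>i. eta ! ((k1 + Suc i) mod n)) [0..<m]) ! i) \<and>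
      (\<forall>l<n. l \<notin> (\<lambda>i. (k1 + Suc i) mod n) ` {..<m} \<longrightarrow> displace eta k1 r ! l = eta ! l)"
      unfolding n_def by (rule Suc.IH) (use k1 Suc.prems zero' in \<open>auto simp: n_def\<close>)
    have k1n: "displace eta k1 r ! k1 = eta ! k1" using IH k1 inj by auto
    show ?thesis
      unfolding n_def[symmetric] im mp
    proof (intro conjI allI impI, goal_cases)
      case (2 i)
      show ?case
      proof (cases i)
        case 0
        then show ?thesis using k1n 3 by (simp add: d k1_def)
      next
        case (Suc j)
        have B: "(k + Suc i) mod n = (k1 + Suc j) mod n" using sh[of "Suc j"] Suc by simp
        have j: "j < m" using 2 Suc by simp
        with IH have "displace eta k1 r ! ((k1 + Suc j) mod n) =
          pass_sites r (map (\<lambda>i. eta ! ((k1 + Suc i) mod n)) [0..<m]) ! j" by blast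
        then show ?thesis unfolding B d using \<open>\<not> eta ! k1 < r\<close> Suc by (simp add: min_def)
      qed
    qed (use IH in \<open>auto simp: d\<close>)
  qed
qed

text \<open>The carrier leaves with \<open>b\<close>, crosses \<open>q\<close> up to the end of the
  list and wraps around to \<open>p\<close> with what it then holds. Because there is a vacancy, it
  comes back with species 0, which is the vacancy left at the site that rang.\<close>

lemma ring_bell_append:
  assumes "0 \<in> set (p @ b # q)"
  shows "ring_bell (p @ b # q) (length p) =
           pass_sites (pass_out b q) p @ 0 # pass_sites b q"
proof -
  define eta where "eta = p @ b # q"
  define n where "n = length eta"
  define j where "j = length p"
  have j: "j < n" and bj: "eta ! j = b" by (auto simp: n_def eta_def j_def)
  have n: "n = Suc (length p + length q)" by (simp add: n_def eta_def)
  have idx: "eta ! ((j + Suc i) mod n) = (q @ p) ! i" if "i < n - 1" for i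
  proof (cases "j + Suc i < n")
    case True
    then show ?thesis using n by (auto simp: eta_def nth_append j_def)
  next
    case False
    then have "(j + Suc i) mod n = j + Suc i - n" using that j by (simp add: mod_if)
    then show ?thesis using False that n by (auto simp: eta_def nth_append j_def)
  qed
  have mp: "map (\<lambda>i. eta ! ((j + Suc i) mod n)) [0..<n - 1] = q @ p"
    by (rule nth_equalityI) (use idx n in auto)
  have "b = 0 \<or> (\<exists>i. 1 \<le> i \<and> i \<le> n - 1 \<and> eta ! ((j + i) mod n) = 0)"
  proof (cases "b = 0")
    case False
    then have "0 \<in> set (q @ p)" using assms by auto
    then obtain i where "i < n - 1" "(q @ p) ! i = 0" unfolding in_set_conv_nth n by (auto simp: add.commute)
    then show ?thesis using idx[of i] by (intro disjI2 exI[of _ "Suc i"]) auto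
  qed simp
  from displace_pass[of j eta "n - 1" b, folded n_def, OF j _ this] mp n
  have D: "length (displace eta j b) = n"
    "\<And>i. i < n - 1 \<Longrightarrow> displace eta j b ! ((j + Suc i) mod n) = pass_sites b (q @ p) ! i"
    by auto
  show ?thesis
    unfolding ring_bell_def eta_def[symmetric] j_def[symmetric] bj
  proof (rule nth_equalityI)
    fix l assume "l < length ((displace eta j b)[j := 0])"
    then have l: "l < n" using D by simp
    consider "l = j" | "j < l" | "l < j" by linarith
    then show "(displace eta j b)[j := 0] ! l =
        (pass_sites (pass_out b q) p @ 0 # pass_sites b q) ! l"
    proof cases
      case 1
      then show ?thesis using D j by (simp add: nth_append j_def)
    next
      case 2
      then have "displace eta j b ! l = pass_sites b (q @ p) ! (l - Suc j)"
        using D(2)[of "l - Suc j"] l by simp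
      moreover have "l - Suc j < length q" using 2 l n by (simp add: j_def)
      ultimately show ?thesis using 2 l n D(1)
        by (simp add: nth_append pass_sites_append j_def nth_Cons')
    next
      case 3
      have "(j + Suc (n - 1 - j + l)) mod n = l" using 3 j by simp
      then have "displace eta j b ! l = pass_sites b (q @ p) ! (n - 1 - j + l)"
        using D(2)[of "n - 1 - j + l"] 3 j by simp
      then show ?thesis using 3 l n D(1) by (simp add: nth_append pass_sites_append j_def)
    qed
  qed (use D n in simp)
qed

lemma mset_ring_bell:
  assumes "0 \<in> set eta" "j < length eta"
  shows "mset (ring_bell eta j) = mset eta"
proof -
  obtain p b q where eta: "eta = p @ b # q" and j: "length p = j"
    using id_take_nth_drop[OF assms(2)] assms(2) by (metis length_take min.absorb4)
  have z: "pass_out b (q @ p) = 0"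
    using pass_out_le[of 0 b "q @ p"] assms(1) eta by auto
  have "mset (ring_bell eta j) = add_mset 0 (mset (pass_sites b (q @ p)))"
    using ring_bell_append[of p b q] assms(1) j by (simp add: eta pass_sites_append)
  also have "\<dots> = mset eta" using mset_pass[of b "q @ p"] z by (simp add: eta)
  finally show ?thesis .
qed

text \<open>Ringing at site \<open>i\<close> and then at the last site inserts the smallest remaining entry into the
  sorted initial segment: a selection sort.\<close>

lemma ring_bell_closed_sorted:
  assumes closed: "\<And>eta j. eta \<in> Q \<Longrightarrow> j < length eta \<Longrightarrow> ring_bell eta j \<in> Q"
    and "eta \<in> Q" "0 \<in> set eta"
  shows "rev (sort eta) \<in> Q"
proof -
  have sort: "rev (sort (D @ u @ [0])) \<in> Q"
    if "D @ u @ [0] \<in> Q" "sorted_wrt (\<ge>) D" "\<forall>d\<in>set D. \<forall>x\<in>set u. d \<le> x" for D u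
    using that
  proof (induction "length u" arbitrary: D u)
    case 0
    have "sorted_wrt (\<ge>) (rev (sort (D @ u @ [0])))"
      unfolding sorted_wrt_rev using sorted_sort[of "D @ u @ [0]"] by blast
    moreover have "sorted_wrt (\<ge>) (D @ u @ [0])" using 0 by (auto simp: sorted_wrt_append)
    ultimately have "rev (sort (D @ u @ [0])) = D @ u @ [0]"
      by (rule sorted_desc_mset_unique) simp
    then show ?case using 0 by simp
  next
    case (Suc k)
    then obtain x u' where u: "u = x # u'" by (cases u) auto
    define e where "e = pass_out x u'"
    define w where "w = pass_sites x u'"
    have out0: "pass_out x (u' @ [0]) = 0"
      using pass_out_le[of 0 x "u' @ [0]"] by simp
    \<comment> \<open>The carrier sweeps \<open>u\<close>, deposits its minimum \<open>e\<close> in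
      the final vacancy and crosses \<open>D\<close> empty. The second bell brings \<open>e\<close>
      back to the front of \<open>D\<close>, whose descending entries it shifts by one
      place.\<close>
    have "ring_bell (D @ x # u' @ [0]) (length D) = D @ 0 # pass_sites x (u' @ [0])"
      by (subst ring_bell_append) (auto simp: out0 pass_sites_least)
    then have b1: "ring_bell (D @ x # u' @ [0]) (length D) = (D @ 0 # w) @ [e]"
      by (simp add: pass_sites_append w_def e_def)
    have el: "\<forall>d\<in>set D. d \<le> e" using Suc.prems(3) pass_out_in[of x u'] by (auto simp: u e_def)
    have "ring_bell ((D @ 0 # w) @ [e]) (length (D @ 0 # w)) = pass_sites e (D @ 0 # w) @ [0]"
      using ring_bell_append[of "D @ 0 # w" e "[]"] by simp
    also have "pass_sites e (D @ 0 # w) = (pass_sites e D @ [pass_out e D]) @ w"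
      by (simp add: pass_sites_append pass_sites_least)
    also have "pass_sites e D @ [pass_out e D] = e # D"
      using Suc.prems(2) el by (intro pass_greatest) auto
    finally have b2: "ring_bell ((D @ 0 # w) @ [e]) (length (D @ 0 # w)) = (e # D) @ w @ [0]" by simp
    have "(D @ 0 # w) @ [e] \<in> Q"
      using closed[OF Suc.prems(1), of "length D"] b1 by (simp add: u)
    from closed[OF this, of "length (D @ 0 # w)"] b2 have Q: "(e # D) @ w @ [0] \<in> Q" by simp
    have ms: "add_mset e (mset w) = mset u" using mset_pass[of x u'] by (simp add: u e_def w_def)
    have wu: "set w \<subseteq> set u" using ms by (metis set_mset_add_mset_insert set_mset_mset subset_insertI)
    have ew: "\<forall>y\<in>set w. e \<le> y" using wu pass_out_le[of _ x u'] by (auto simp: u e_def)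
    have "rev (sort ((e # D) @ w @ [0])) \<in> Q"
    proof (rule Suc.hyps(1)[OF _ Q])
      show "k = length w" using Suc.hyps(2) by (simp add: w_def u)
      show "sorted_wrt (\<ge>) (e # D)" using Suc.prems(2) el by simp
      show "\<forall>d\<in>set (e # D). \<forall>x\<in>set w. d \<le> x" using ew wu Suc.prems(3) by auto
    qed
    moreover have "sort ((e # D) @ w @ [0]) = sort (D @ u @ [0])"
      by (rule properties_for_sort) (use ms in \<open>auto simp: add_mset_commute\<close>)
    ultimately show ?case by simp
  qed
  obtain p b where eta: "eta = p @ [b]" using assms(3) by (metis empty_iff empty_set rev_exhaust)
  \<comment> \<open>A bell at the last site creates the final vacancy that the invariant of the sort
    requires.\<close>
  have "ring_bell (p @ [b]) (length p) = pass_sites b p @ [0]"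
    using ring_bell_append[of p b "[]"] assms(3) eta by simp
  then have "[] @ pass_sites b p @ [0] \<in> Q" using closed[OF assms(2), of "length p"] eta by simp
  from sort[OF this] have "rev (sort (pass_sites b p @ [0])) \<in> Q" by simp
  moreover have "mset (pass_sites b p @ [0]) = mset eta"
    using mset_ring_bell[of eta "length p"] assms(3) eta \<open>ring_bell (p @ [b]) (length p) = _\<close> by simp
  then have "sort (pass_sites b p @ [0]) = sort eta"
    by (intro properties_for_sort) auto
  ultimately show ?thesis by simp
qed

text \<open>The polynomial variable is the parameter of the carrier.\<close>

fun transfer_weight :: "real list \<Rightarrow> nat \<Rightarrow> nat list \<Rightarrow> nat list \<Rightarrow> nat \<Rightarrow> real poly" where
  "transfer_weight [] a [] [] a' = (if a = a' then 1 else 0)"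
| "transfer_weight (y # ys) a (b # eta) (c # zeta) a' =
     (if b \<le> a then (if c = a then transfer_weight ys b eta zeta a' else 0)
      else (if c = a then [:0, 1 / y:] * transfer_weight ys b eta zeta a' else 0) +
           (if c = b then [:1, - 1 / y:] * transfer_weight ys a eta zeta a' else 0))"
| "transfer_weight _ _ _ _ _ = 0"

section \<open>Coefficients of the transfer matrix\<close>

definition words :: "nat \<Rightarrow> nat \<Rightarrow> nat list set" where
  "words s k = {w. length w = k \<and> set w \<subseteq> {..s}}"

lemma finite_words [simp]: "finite (words s k)"
  unfolding words_def using finite_lists_length_eq[of "{..s}" k] by (simp add: conj_commute)

lemma words_0: "words s 0 = {[]}"
  by (auto simp: words_def)

lemma sum_words_Suc:
  "(\<Sum>w\<in>words s (Suc k). h w) = (\<Sum>b\<le>s. \<Sum>w\<in>words s k. h (b # w))"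
proof -
  have "(\<Sum>w\<in>words s (Suc k). h w) = (\<Sum>(b, w)\<in>{..s} \<times> words s k. h (b # w))"
    by (rule sum.reindex_bij_witness[of _ "\<lambda>(b, w). b # w" "\<lambda>w. (hd w, tl w)"])
       (auto simp: words_def length_Suc_conv)
  then show ?thesis by (simp add: sum.cartesian_product)
qed

lemma sum_words_rotate:
  "(\<Sum>w\<in>words s k. \<Sum>b\<le>s. h (w @ [b])) = (\<Sum>w\<in>words s (Suc k). h w)"
proof -
  have "(\<Sum>w\<in>words s (Suc k). h w) = (\<Sum>(w, b)\<in>words s k \<times> {..s}. h (w @ [b]))"
    by (rule sum.reindex_bij_witness[of _ "\<lambda>(w, b). w @ [b]" "\<lambda>w. (butlast w, last w)"])
       (auto simp: words_def length_Suc_conv_rev in_set_butlastD)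
  then show ?thesis by (simp add: sum.cartesian_product)
qed

lemma degree_transfer_weight: "degree (transfer_weight ys a eta zeta a') \<le> length ys"
proof (induction ys arbitrary: a eta zeta)
  case Nil
  then show ?case by (cases eta; cases zeta) auto
next
  case (Cons y ys)
  have lin: "degree ([:u, v:] * p) \<le> Suc (length ys)" if "degree p \<le> length ys" for u v and p :: "real poly"
    using degree_mult_le[of "[:u, v:]" p] that by (auto split: if_splits)
  show ?case
  proof (cases "eta = [] \<or> zeta = []")
    case True
    then show ?thesis by (cases eta; cases zeta) auto
  next
    case False
    then obtain b eta0 c zeta0 where "eta = b # eta0" "zeta = c # zeta0"
      by (meson list.exhaust)
    then show ?thesis using Cons.IH lin
      by (auto intro!: degree_add_le intro: le_SucI simp del: mult_pCons_left)
  qed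
qed

text \<open>Matrix multiplication in the carrier space; the intermediate state \<open>d\<close>
  stays at most \<open>s\<close> because a carrier only takes species that it has met.\<close>

lemma transfer_weight_append:
  assumes "length eta = length ys" "length zeta = length ys" "set (a # eta) \<subseteq> {..s}"
  shows "transfer_weight (ys @ ys') a (eta @ eta') (zeta @ zeta') a' =
    (\<Sum>d\<le>s. transfer_weight ys a eta zeta d * transfer_weight ys' d eta' zeta' a')"
  using assms
proof (induction ys arbitrary: a eta zeta)
  case Nil
  then show ?case by (simp add: if_distrib[of "\<lambda>x. x * _"] cong: if_cong)
next
  case (Cons y ys)
  then obtain b eta0 c zeta0 where e: "eta = b # eta0" "zeta = c # zeta0"
    by (metis length_Suc_conv)
  show ?case using Cons.prems
    by (simp add: e Cons.IH sum_distrib_left distrib_right sum.distrib mult.assoc)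
qed

text \<open>At z = 0 the carrier never exchanges with a larger species, so it keeps the minimum: a
  single deterministic path of weight 1.\<close>

lemma coeff_0_transfer_weight:
  assumes "length eta = length ys" "length zeta = length ys"
  shows "coeff (transfer_weight ys a eta zeta a') 0 =
    of_bool (zeta = pass_sites a eta \<and> a' = pass_out a eta)"
  using assms
proof (induction ys arbitrary: a eta zeta)
  case (Cons y ys)
  then obtain b eta0 c zeta0 where e: "eta = b # eta0" "zeta = c # zeta0"
    by (metis length_Suc_conv)
  have IH: "coeff (transfer_weight ys u eta0 zeta0 a') 0 =
      of_bool (zeta0 = pass_sites u eta0 \<and> a' = pass_out u eta0)" for u
    using Cons.prems by (intro Cons.IH) (auto simp: e)
  show ?case
  proof (cases "b \<le> a")
    case True
    have "coeff (transfer_weight (y # ys) a eta zeta a') 0 =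
      (if c = a then coeff (transfer_weight ys b eta0 zeta0 a') 0 else 0)"
      using True by (simp add: e)
    then show ?thesis unfolding IH using True by (auto simp: e max_def min_def)
  next
    case False
    have "coeff (transfer_weight (y # ys) a eta zeta a') 0 =
      (if c = b then coeff (transfer_weight ys a eta0 zeta0 a') 0 else 0)"
      using False by (simp add: e coeff_mult_0)
    then show ?thesis unfolding IH using False by (auto simp: e max_def min_def)
  qed
qed auto

lemma coeff_1_linear_mult: "coeff ([:u, v:] * p) 1 = u * coeff p 1 + v * coeff p 0"
  by (simp add: coeff_pCons)

text \<open>The share of site \<open>j\<close> in the coefficient of z, up to the factor 1 / x_j. At
  all other sites the weights are taken at z = 0; at \<open>j\<close>, if a larger species is met,
  the weights z / x_j of exchanging and 1 - z / x_j of staying contribute with opposite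
  signs.\<close>

definition jump_term :: "nat list \<Rightarrow> nat list \<Rightarrow> nat \<Rightarrow> nat \<Rightarrow> nat \<Rightarrow> real" where
  "jump_term eta zeta a a' j =
    (let e = pass_out a (take j eta); b = eta ! j; w = drop (Suc j) eta in
     if e < b then
       of_bool (zeta = pass_sites a (take j eta) @ e # pass_sites b w \<and> a' = pass_out b w)
       - of_bool (zeta = pass_sites a (take j eta) @ b # pass_sites e w \<and> a' = pass_out e w)
     else 0)"

lemma jump_term_0:
  "jump_term (b # eta) (c # zeta) a a' 0 =
     (if a < b then of_bool (c = a \<and> zeta = pass_sites b eta \<and> a' = pass_out b eta)
        - of_bool (c = b \<and> zeta = pass_sites a eta \<and> a' = pass_out a eta) else 0)"
  by (simp add: jump_term_def)

lemma jump_term_Suc: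
  "jump_term (b # eta) (c # zeta) a a' (Suc j) =
     (if c = max a b then jump_term eta zeta (min a b) a' j else 0)"
  by (simp add: jump_term_def Let_def)

lemma coeff_1_transfer_weight:
  assumes "length eta = length ys" "length zeta = length ys"
  shows "coeff (transfer_weight ys a eta zeta a') 1 =
    (\<Sum>j<length ys. jump_term eta zeta a a' j / ys ! j)"
  using assms
proof (induction ys arbitrary: a eta zeta)
  case Nil
  then show ?case by simp
next
  case (Cons y ys)
  then obtain b eta0 c zeta0 where e: "eta = b # eta0" "zeta = c # zeta0"
    by (metis length_Suc_conv)
  have len: "length eta0 = length ys" "length zeta0 = length ys" using Cons.prems e by auto
  have sp: "(\<Sum>j<length (y # ys). jump_term eta zeta a a' j / (y # ys) ! j) =
      jump_term eta zeta a a' 0 / y +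
      (if c = max a b then coeff (transfer_weight ys (min a b) eta0 zeta0 a') 1 else 0)"
    unfolding length_Cons sum.lessThan_Suc_shift e
    by (simp add: jump_term_Suc Cons.IH[OF len] del: One_nat_def)
  show ?case
  proof (cases "b \<le> a")
    case True
    then show ?thesis
      unfolding sp by (simp add: e jump_term_0 max_def min_def)
  next
    case False
    then show ?thesis
      unfolding sp
      by (auto simp: e jump_term_0 coeff_0_transfer_weight[OF len] coeff_1_linear_mult
          max_def min_def simp del: mult_pCons_left One_nat_def)
  qed
qed

lemma split_nth:
  assumes "j < length eta"
  obtains p q where "eta = p @ eta ! j # q" "length p = j"
  using id_take_nth_drop[OF assms] assms by (metis length_take min.absorb4)

text \<open>Closing up the carrier turns both terms into known configurations. In the positive one
  it leaves \<open>j\<close> with \<open>b\<close> and returns with a vacancy, which is the bell; in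
  the negative one it is at most every entry of the ring, hence a vacancy, and changes
  nothing.\<close>

lemma sum_jump_term:
  assumes "0 \<in> set eta" "set eta \<subseteq> {..s}" "j < length eta"
  shows "(\<Sum>a\<le>s. jump_term eta zeta a a j) = of_bool (zeta = ring_bell eta j) - of_bool (zeta = eta)"
proof -
  obtain p q where eta: "eta = p @ eta ! j # q" and j: "length p = j"
    using split_nth[OF assms(3)] by blast
  define b where "b = eta ! j"
  have eta: "eta = p @ b # q" using eta by (simp add: b_def)
  have parts: "take j eta = p" "drop (Suc j) eta = q" using j eta by auto
  have bell: "ring_bell eta j = pass_sites (pass_out b q) p @ 0 # pass_sites b q"
    using ring_bell_append[of p b q] assms(1) j by (simp add: eta)
  define r where "r = pass_out b q"
  show ?thesis
  proof (cases "b = 0")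
    case True
    have "ring_bell eta j = eta"
      unfolding bell using True by (simp add: eta pass_out_least pass_sites_least)
    moreover have "jump_term eta zeta a a j = 0" for a
      using True by (simp add: jump_term_def b_def[symmetric])
    ultimately show ?thesis by simp
  next
    case False
    have r: "r \<le> s" using pass_out_in[of b q] assms(2) eta by (auto simp: r_def)
    have er: "pass_out r p = 0"
    proof -
      have "pass_out b (q @ p) \<le> 0" by (rule pass_out_le) (use assms(1) eta False in auto)
      then show ?thesis by (simp add: pass_out_append r_def)
    qed
    have "jump_term eta zeta a a j = of_bool (a = r) * of_bool (zeta = ring_bell eta j)
            - of_bool (a = 0) * of_bool (zeta = eta)" for a
    proof -
      define e where "e = pass_out a p"
      have J: "jump_term eta zeta a a j = (if e < b then
          of_bool (zeta = pass_sites a p @ e # pass_sites b q \<and> a = r)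
          - of_bool (zeta = pass_sites a p @ b # pass_sites e q \<and> a = pass_out e q) else 0)"
        by (simp add: jump_term_def parts e_def b_def[symmetric] r_def Let_def)
      have 1: "(e < b \<and> zeta = pass_sites a p @ e # pass_sites b q \<and> a = r) \<longleftrightarrow>
            (a = r \<and> zeta = ring_bell eta j)"
        using er False by (auto simp: e_def bell r_def)
      have 2: "(e < b \<and> zeta = pass_sites a p @ b # pass_sites e q \<and> a = pass_out e q) \<longleftrightarrow>
            (a = 0 \<and> zeta = eta)"
      proof
        assume A: "e < b \<and> zeta = pass_sites a p @ b # pass_sites e q \<and> a = pass_out e q"
        then have "a \<le> e" using pass_out_le[of e e q] by simp
        moreover have "e \<le> a" using pass_out_le[of a a p] by (simp add: e_def)
        ultimately have ea: "e = a" by simp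
        have "a \<le> x" if "x \<in> set eta" for x
          using that A ea pass_out_le[of x e q] pass_out_le[of x a p]
          by (auto simp: eta e_def)
        then have a0: "a = 0" using assms(1) by auto
        from A have "zeta = pass_sites a p @ b # pass_sites e q" by blast
        then show "a = 0 \<and> zeta = eta" unfolding ea a0 by (simp add: eta pass_sites_least)
      next
        assume "a = 0 \<and> zeta = eta"
        then show "e < b \<and> zeta = pass_sites a p @ b # pass_sites e q \<and> a = pass_out e q"
          using False by (simp add: eta e_def pass_sites_least pass_out_least)
      qed
      show ?thesis
        unfolding J using 1 2 by (cases "e < b") (auto simp: of_bool_def)
    qed
    then show ?thesis using r by (simp add: sum_subtractf of_bool_def if_distrib[of "\<lambda>x. x * _"] cong: if_cong)
  qed
qed

text \<open>A carrier that returns as it started is minimal among all entries, hence a vacancy, and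
  at z = 0 a vacancy moves nothing.\<close>

lemma sum_coeff_0_transfer_weight:
  assumes "0 \<in> set eta" "length eta = length xs" "length zeta = length xs"
  shows "(\<Sum>a\<le>s. coeff (transfer_weight xs a eta zeta a) 0) = of_bool (zeta = eta)"
proof -
  have "coeff (transfer_weight xs a eta zeta a) 0 = of_bool (a = 0) * of_bool (zeta = eta)" for a
  proof -
    have "a = 0" if "a = pass_out a eta" using pass_out_le[of 0 a eta] assms(1) that by simp
    then have "(zeta = pass_sites a eta \<and> a = pass_out a eta) \<longleftrightarrow> (a = 0 \<and> zeta = eta)"
      by (auto simp: pass_sites_least pass_out_least)
    then show ?thesis using assms by (simp add: coeff_0_transfer_weight)
  qed
  then show ?thesis by (simp add: of_bool_def if_distrib[of "\<lambda>x. x * _"] cong: if_cong)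
qed

text \<open>The relations at q = 1, t = 0 for a list of entries with a parallel list of parameters,
  so that a parameter can be carried past its neighbours. \<open>vacancy\<close> anticipates that
  \<open>G\<close> is extended by zero outside the configurations.\<close>

locale exchange_family =
  fixes s :: nat and G :: "nat list \<Rightarrow> real list \<Rightarrow> real"
  assumes vacancy: "\<And>w x. G w x \<noteq> 0 \<Longrightarrow> 0 \<in> set w"
    and exchange: "\<And>u v us vs c d y z. length us = length u \<Longrightarrow> length vs = length v \<Longrightarrow> d < c \<Longrightarrow>
      (y - z) * G (u @ d # c # v) (us @ y # z # vs) =
        z * (G (u @ c # d # v) (us @ y # z # vs) - G (u @ c # d # v) (us @ z # y # vs))"
    and symmetric: "\<And>u v us vs c y z. length us = length u \<Longrightarrow> length vs = length v \<Longrightarrow>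
      G (u @ c # c # v) (us @ y # z # vs) = G (u @ c # c # v) (us @ z # y # vs)"
    and rotate: "\<And>w a xs y. length xs = length w \<Longrightarrow> G (w @ [a]) (xs @ [y]) = G (a # w) (y # xs)"
begin

text \<open>The exchange relation is solved for the effect of interchanging two neighbouring
  parameters. The coefficients 1, z / y and 1 - z / y are the local weights of
  \<open>transfer_weight\<close>, with z the parameter of the carrier.\<close>

lemma exchange_parameters:
  assumes len: "length us = length u" "length vs = length v" and ne: "y \<noteq> z" "y \<noteq> 0"
  shows "G (u @ c # d # v) (us @ y # z # vs) =
    (if d < c then G (u @ c # d # v) (us @ z # y # vs) + (1 - z / y) * G (u @ d # c # v) (us @ z # y # vs)
     else if c = d then G (u @ c # d # v) (us @ z # y # vs)
     else z / y * G (u @ c # d # v) (us @ z # y # vs))"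
proof -
  consider "d < c" | "c = d" | "c < d" by linarith
  then show ?thesis
  proof cases
    case 1
    have "(z - y) * G (u @ d # c # v) (us @ z # y # vs) =
       y * (G (u @ c # d # v) (us @ z # y # vs) - G (u @ c # d # v) (us @ y # z # vs))"
      by (rule exchange[OF len 1])
    moreover have "X = A + (1 - z / y) * B" if "(z - y) * B = y * (A - X)" for X A B
    proof -
      have "(1 - z / y) * B = - ((z - y) * B) / y" using ne by (simp add: field_simps)
      also have "\<dots> = X - A" unfolding that using ne by simp
      finally show ?thesis by simp
    qed
    ultimately show ?thesis using 1 by simp
  next
    case 2
    with symmetric[OF len] show ?thesis by simp
  next
    case 3
    have e: "(z - y) * G (u @ c # d # v) (us @ z # y # vs) =
       y * (G (u @ d # c # v) (us @ z # y # vs) - G (u @ d # c # v) (us @ y # z # vs))"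
      "(y - z) * G (u @ c # d # v) (us @ y # z # vs) =
       z * (G (u @ d # c # v) (us @ y # z # vs) - G (u @ d # c # v) (us @ z # y # vs))"
      by (rule exchange[OF len 3])+
    have "z * ((y - z) * G (u @ c # d # v) (us @ z # y # vs)) =
        - (z * ((z - y) * G (u @ c # d # v) (us @ z # y # vs)))"
      by (simp add: algebra_simps)
    then have "y * ((y - z) * G (u @ c # d # v) (us @ y # z # vs)) =
        z * ((y - z) * G (u @ c # d # v) (us @ z # y # vs))"
      unfolding e by (simp add: algebra_simps)
    then have "y * G (u @ c # d # v) (us @ y # z # vs) = z * G (u @ c # d # v) (us @ z # y # vs)"
      using ne by (metis mult.left_commute mult_left_cancel right_minus_eq)
    with 3 ne show ?thesis by (simp add: field_simps)
  qed
qed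

text \<open>Iterating the local step: moving z to the left across \<open>ys\<close> multiplies the
  local weights, and the species that sits at z is the carrier.\<close>

lemma carry_parameter:
  assumes "length zeta = length ys" "set (d # zeta) \<subseteq> {..s}" "length us = length u"
    "length vs = length v" "\<forall>y\<in>set ys. y \<noteq> 0 \<and> y \<noteq> z"
  shows "G (u @ zeta @ d # v) (us @ ys @ z # vs) =
    (\<Sum>b\<le>s. \<Sum>eta\<in>words s (length ys).
       poly (transfer_weight ys b eta zeta d) z * G (u @ b # eta @ v) (us @ z # ys @ vs))"
  using assms
proof (induction ys arbitrary: zeta u us)
  case Nil
  then show ?case by (simp add: words_0 if_distrib[of "\<lambda>x. poly x _"] if_distrib[of "\<lambda>x. x * _"] cong: if_cong)
next
  case (Cons y ys)
  then obtain c zeta0 where e: "zeta = c # zeta0" and len: "length zeta0 = length ys"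
    by (metis length_Suc_conv)
  have c: "c \<le> s" using Cons.prems e by simp
  define W where "W b eta = poly (transfer_weight ys b eta zeta0 d) z" for b eta
  define H where "H a b eta = G (u @ a # b # eta @ v) (us @ z # y # ys @ vs)" for a b eta
  have "G (u @ zeta @ d # v) (us @ (y # ys) @ z # vs) =
      G ((u @ [c]) @ zeta0 @ d # v) ((us @ [y]) @ ys @ z # vs)" by (simp add: e)
  also have "\<dots> = (\<Sum>b\<le>s. \<Sum>eta\<in>words s (length ys).
       W b eta * G ((u @ [c]) @ b # eta @ v) ((us @ [y]) @ z # ys @ vs))"
    unfolding W_def by (rule Cons.IH) (use Cons.prems e in auto)
  also have "\<dots> = (\<Sum>b\<le>s. \<Sum>eta\<in>words s (length ys). W b eta *
       (if b \<le> c then H c b eta else z / y * H c b eta)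
       + W b eta * (if b < c then (1 - z / y) * H b c eta else 0))"
  proof (intro sum.cong refl)
    fix b eta assume eta: "eta \<in> words s (length ys)"
    have "G (u @ c # b # eta @ v) (us @ y # z # ys @ vs) =
       (if b < c then H c b eta + (1 - z / y) * H b c eta
        else if c = b then H c b eta else z / y * H c b eta)"
      unfolding H_def by (rule exchange_parameters) (use Cons.prems eta in \<open>auto simp: words_def\<close>)
    then show "W b eta * G ((u @ [c]) @ b # eta @ v) ((us @ [y]) @ z # ys @ vs) =
       W b eta * (if b \<le> c then H c b eta else z / y * H c b eta)
       + W b eta * (if b < c then (1 - z / y) * H b c eta else 0)"
      by (simp add: distrib_left)
  qed
  also have "\<dots> = (\<Sum>b\<le>s. \<Sum>eta\<in>words s (length ys). W b eta *
       (if b \<le> c then H c b eta else z / y * H c b eta))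
       + (\<Sum>b\<le>s. \<Sum>eta\<in>words s (length ys). W b eta * (if b < c then (1 - z / y) * H b c eta else 0))"
    by (simp add: sum.distrib)
  also have "\<dots> = (\<Sum>a\<le>s. \<Sum>b\<le>s. \<Sum>eta\<in>words s (length ys).
        (if a = c then W b eta * (if b \<le> c then H c b eta else z / y * H c b eta) else 0)
      + (if b = c then W a eta * (if a < c then (1 - z / y) * H a c eta else 0) else 0))"
  proof -
    have 1: "(\<Sum>a\<le>s. \<Sum>b\<le>s. \<Sum>eta\<in>words s (length ys). (if a = c then F b eta else 0)) =
        (\<Sum>b\<le>s. \<Sum>eta\<in>words s (length ys). F b eta)" for F :: "nat \<Rightarrow> nat list \<Rightarrow> real"
    proof -
      have "(\<Sum>b\<le>s. \<Sum>eta\<in>words s (length ys). (if a = c then F b eta else 0)) =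
        (if a = c then (\<Sum>b\<le>s. \<Sum>eta\<in>words s (length ys). F b eta) else 0)" for a by simp
      then show ?thesis using c by simp
    qed
    have 2: "(\<Sum>a\<le>s. \<Sum>b\<le>s. \<Sum>eta\<in>words s (length ys). (if b = c then F a eta else 0)) =
        (\<Sum>b\<le>s. \<Sum>eta\<in>words s (length ys). F b eta)" for F :: "nat \<Rightarrow> nat list \<Rightarrow> real"
      by (subst sum.swap) (rule 1)
    show ?thesis by (simp only: sum.distrib 1 2)
  qed
  also have "\<dots> = (\<Sum>a\<le>s. \<Sum>b\<le>s. \<Sum>eta\<in>words s (length ys).
      poly (transfer_weight (y # ys) a (b # eta) zeta d) z * H a b eta)"
    by (intro sum.cong refl) (auto simp: e W_def algebra_simps)
  also have "\<dots> = (\<Sum>a\<le>s. \<Sum>eta\<in>words s (length (y # ys)).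
       poly (transfer_weight (y # ys) a eta zeta d) z * G (u @ a # eta @ v) (us @ z # (y # ys) @ vs))"
    by (simp add: sum_words_Suc H_def)
  finally show ?case .
qed

text \<open>The component at \<open>zeta\<close> of the transfer matrix applied to \<open>G\<close>,
  as a polynomial in z; equal initial and final carriers close the ring.\<close>

definition trace_poly :: "real list \<Rightarrow> nat list \<Rightarrow> real poly" where
  "trace_poly xs zeta =
     (\<Sum>eta\<in>words s (length xs). \<Sum>a\<le>s. smult (G eta xs) (transfer_weight xs a eta zeta a))"

text \<open>Cyclicity of the trace, with the last site split off on one side and the first on the
  other.\<close>

lemma trace_poly_rotate:
  assumes "length zeta = length xs"
  shows "trace_poly (xs @ [y]) (zeta @ [c]) = trace_poly (y # xs) (c # zeta)"
proof -
  have "trace_poly (xs @ [y]) (zeta @ [c]) = (\<Sum>eta\<in>words s (length xs). \<Sum>b\<le>s. \<Sum>a\<le>s.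
      smult (G (b # eta) (y # xs)) (transfer_weight (xs @ [y]) a (eta @ [b]) (zeta @ [c]) a))"
    unfolding trace_poly_def length_append_singleton sum_words_rotate[symmetric]
    by (intro sum.cong refl) (auto simp: rotate words_def)
  also have "\<dots> = (\<Sum>eta\<in>words s (length xs). \<Sum>b\<le>s. \<Sum>a\<le>s.
      smult (G (b # eta) (y # xs)) (transfer_weight (y # xs) a (b # eta) (c # zeta) a))"
  proof (rule sum.cong[OF refl], rule sum.cong[OF refl])
    fix eta b assume eta: "eta \<in> words s (length xs)" and b: "b \<in> {..s}"
    have 1: "transfer_weight (xs @ [y]) a (eta @ [b]) (zeta @ [c]) a =
        (\<Sum>d\<le>s. transfer_weight xs a eta zeta d * transfer_weight [y] d [b] [c] a)" if "a \<le> s" for a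
      by (rule transfer_weight_append) (use eta that assms in \<open>auto simp: words_def\<close>)
    have 2: "transfer_weight (y # xs) d (b # eta) (c # zeta) d =
        (\<Sum>a\<le>s. transfer_weight [y] d [b] [c] a * transfer_weight xs a eta zeta d)" if "d \<le> s" for d
      using transfer_weight_append[of "[b]" "[y]" "[c]" d s xs eta zeta d] b that by simp
    have "(\<Sum>a\<le>s. transfer_weight (xs @ [y]) a (eta @ [b]) (zeta @ [c]) a) =
        (\<Sum>a\<le>s. \<Sum>d\<le>s. transfer_weight [y] d [b] [c] a * transfer_weight xs a eta zeta d)"
      using 1 by (intro sum.cong refl) (simp add: mult.commute)
    also have "\<dots> = (\<Sum>a\<le>s. transfer_weight (y # xs) a (b # eta) (c # zeta) a)"
      using 2 by (subst sum.swap) simp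
    finally show "(\<Sum>a\<le>s. smult (G (b # eta) (y # xs)) (transfer_weight (xs @ [y]) a (eta @ [b]) (zeta @ [c]) a)) =
        (\<Sum>a\<le>s. smult (G (b # eta) (y # xs)) (transfer_weight (y # xs) a (b # eta) (c # zeta) a))"
      by (simp add: poly_eq_iff coeff_sum flip: sum_distrib_left)
  qed
  also have "\<dots> = trace_poly (y # xs) (c # zeta)"
    unfolding trace_poly_def length_Cons sum_words_Suc by (rule sum.swap)
  finally show ?thesis .
qed

text \<open>When z equals the first parameter, the first site degenerates: exchanging has weight 1
  and staying has weight 0. Its entry and the carrier trade places, the trace opens up into the sum
  of \<open>carry_parameter\<close>, and the cyclic relation brings z back to the front.\<close>

lemma poly_trace_poly_hd:
  assumes "length zeta = length ys" "set (c # zeta) \<subseteq> {..s}" "z \<noteq> 0" "\<forall>y\<in>set ys. y \<noteq> 0 \<and> y \<noteq> z"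
  shows "poly (trace_poly (z # ys) (c # zeta)) z = G (c # zeta) (z # ys)"
proof -
  have "poly (trace_poly (z # ys) (c # zeta)) z =
     (\<Sum>b\<le>s. \<Sum>eta\<in>words s (length ys). \<Sum>a\<le>s.
        G (b # eta) (z # ys) * (if a = c then poly (transfer_weight ys b eta zeta a) z else 0))"
    unfolding trace_poly_def poly_sum length_Cons sum_words_Suc
    by (intro sum.cong refl) (use assms in auto)
  also have "\<dots> = (\<Sum>b\<le>s. \<Sum>eta\<in>words s (length ys).
        poly (transfer_weight ys b eta zeta c) z * G ([] @ b # eta @ []) ([] @ z # ys @ []))"
    using assms(2) by (simp add: if_distrib[of "\<lambda>x. _ * x"] mult.commute cong: if_cong)
  also have "\<dots> = G ([] @ zeta @ [c]) ([] @ ys @ [z])"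
    by (rule carry_parameter[symmetric]) (use assms in auto)
  finally show ?thesis using rotate assms by simp
qed

text \<open>The ring is rotated until z stands first; \<open>qs\<close> is emptied from its end, so
  that each step is one use of the cyclic relation.\<close>

lemma poly_trace_poly:
  assumes "length zeta = length ps + length qs + 1" "set zeta \<subseteq> {..s}" "z \<noteq> 0"
    "\<forall>y\<in>set (ps @ qs). y \<noteq> 0 \<and> y \<noteq> z"
  shows "poly (trace_poly (ps @ z # qs) zeta) z = G zeta (ps @ z # qs)"
  using assms
proof (induction qs arbitrary: ps zeta rule: rev_induct)
  case Nil
  then obtain zeta0 c where e: "zeta = zeta0 @ [c]" and len: "length zeta0 = length ps"
    by (metis add.right_neutral length_Suc_conv_rev list.size(3) Suc_eq_plus1)
  show ?case
    using poly_trace_poly_hd[of zeta0 ps c z] trace_poly_rotate[OF len, of z c]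
      rotate[of ps zeta0 c z] Nil len by (simp add: e)
next
  case (snoc y qs)
  then obtain zeta0 c where e: "zeta = zeta0 @ [c]" and len: "length zeta0 = length (ps @ z # qs)"
    by (metis (no_types, lifting) add_Suc_right length_Cons length_Suc_conv_rev length_append length_append_singleton Suc_eq_plus1)
  have "poly (trace_poly ((y # ps) @ z # qs) (c # zeta0)) z = G (c # zeta0) ((y # ps) @ z # qs)"
    by (rule snoc.IH) (use snoc.prems len in \<open>auto simp: e\<close>)
  then show ?case
    using trace_poly_rotate[OF len, of y c] rotate[of "ps @ z # qs" zeta0 c y] len by (simp add: e)
qed

theorem balance_distinct:
  assumes xs: "distinct xs" "0 \<notin> set xs" and zeta: "zeta \<in> words s (length xs)"
  shows "(\<Sum>eta\<in>words s (length xs). G eta xs *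
    (\<Sum>j<length xs. (of_bool (zeta = ring_bell eta j) - of_bool (zeta = eta)) / xs ! j)) = 0"
proof -
  define n where "n = length xs"
  have lz: "length zeta = n" "set zeta \<subseteq> {..s}" using zeta by (auto simp: words_def n_def)
  define Q where "Q = trace_poly xs zeta - [:G zeta xs:]"
  have "degree (trace_poly xs zeta) \<le> n"
    unfolding trace_poly_def n_def
    by (intro degree_sum_le finite_words finite_atMost)
       (rule order.trans[OF degree_smult_le degree_transfer_weight])
  then have deg: "degree Q \<le> n" unfolding Q_def by (intro degree_diff_le) auto
  have rts: "poly Q z = 0" if z: "z \<in> set xs" for z
  proof -
    obtain ps qs where e: "xs = ps @ z # qs" using z by (meson split_list)
    have "poly (trace_poly (ps @ z # qs) zeta) z = G zeta (ps @ z # qs)"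
      by (rule poly_trace_poly) (use xs lz e in \<open>auto simp: n_def\<close>)
    then show ?thesis by (simp add: Q_def e)
  qed
  have c0: "coeff (trace_poly xs zeta) 0 = G zeta xs"
  proof -
    have "coeff (trace_poly xs zeta) 0 =
       (\<Sum>eta\<in>words s n. G eta xs * (\<Sum>a\<le>s. coeff (transfer_weight xs a eta zeta a) 0))"
      by (simp add: trace_poly_def coeff_sum sum_distrib_left n_def)
    also have "\<dots> = (\<Sum>eta\<in>words s n. G eta xs * of_bool (zeta = eta))"
    proof (intro sum.cong refl)
      fix eta assume eta: "eta \<in> words s n"
      show "G eta xs * (\<Sum>a\<le>s. coeff (transfer_weight xs a eta zeta a) 0) = G eta xs * of_bool (zeta = eta)"
      proof (cases "G eta xs = 0")
        case False
        then show ?thesis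
          using sum_coeff_0_transfer_weight[of eta xs zeta s] vacancy eta lz by (simp add: words_def n_def)
      qed simp
    qed
    also have "\<dots> = G zeta xs"
      using zeta by (simp add: of_bool_def n_def if_distrib[of "\<lambda>x. _ * x"] cong: if_cong)
    finally show ?thesis .
  qed
  have "poly Q 0 = 0" using c0 by (simp add: Q_def poly_0_coeff_0)
  then have sub: "insert 0 (set xs) \<subseteq> {z. poly Q z = 0}" using rts by auto
  have "Q = 0"
  proof (rule ccontr)
    assume "Q \<noteq> 0"
    then have "card (insert 0 (set xs)) \<le> degree Q"
      using card_mono[OF poly_roots_finite sub] card_poly_roots_bound[of Q] by simp
    then show False using deg xs by (simp add: distinct_card n_def)
  qed
  then have "coeff (trace_poly xs zeta) 1 = 0"
    by (simp add: Q_def)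
  also have "coeff (trace_poly xs zeta) 1 =
     (\<Sum>eta\<in>words s n. G eta xs * (\<Sum>a\<le>s. coeff (transfer_weight xs a eta zeta a) 1))"
    by (simp add: trace_poly_def coeff_sum sum_distrib_left n_def)
  also have "\<dots> = (\<Sum>eta\<in>words s n. G eta xs *
    (\<Sum>j<n. (of_bool (zeta = ring_bell eta j) - of_bool (zeta = eta)) / xs ! j))"
  proof (intro sum.cong refl)
    fix eta assume eta: "eta \<in> words s n"
    then have le: "length eta = length xs" "set eta \<subseteq> {..s}" by (auto simp: words_def n_def)
    show "G eta xs * (\<Sum>a\<le>s. coeff (transfer_weight xs a eta zeta a) 1) =
      G eta xs * (\<Sum>j<n. (of_bool (zeta = ring_bell eta j) - of_bool (zeta = eta)) / xs ! j)"
    proof (cases "G eta xs = 0")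
      case False
      have "(\<Sum>a\<le>s. coeff (transfer_weight xs a eta zeta a) 1) =
          (\<Sum>a\<le>s. \<Sum>j<n. jump_term eta zeta a a j / xs ! j)"
        using le lz by (intro sum.cong refl coeff_1_transfer_weight[THEN trans]) (simp_all add: n_def)
      also have "\<dots> = (\<Sum>j<n. (\<Sum>a\<le>s. jump_term eta zeta a a j) / xs ! j)"
        by (subst sum.swap) (simp add: sum_divide_distrib)
      also have "\<dots> = (\<Sum>j<n. (of_bool (zeta = ring_bell eta j) - of_bool (zeta = eta)) / xs ! j)"
        using sum_jump_term[of eta s _ zeta] vacancy[OF False] le by (simp add: n_def)
      finally show ?thesis by simp
    qed simp
  qed
  finally show ?thesis by (simp add: n_def)
qed

end

section \<open>Balance\<close>

definition balanced :: "'a set \<Rightarrow> ('a \<Rightarrow> 'a \<Rightarrow> real) \<Rightarrow> ('a \<Rightarrow> real) \<Rightarrow> bool" where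
  "balanced S rate p \<longleftrightarrow>
     (\<forall>a\<in>S. (\<Sum>b\<in>S - {a}. p b * rate b a) = p a * (\<Sum>b\<in>S - {a}. rate a b))"

lemma balanced_diff:
  assumes "balanced S rate p" "balanced S rate p'"
  shows "balanced S rate (\<lambda>a. p a - k * p' a)"
  using assms unfolding balanced_def
  by (simp add: left_diff_distrib sum_subtractf mult.assoc flip: sum_distrib_left)

text \<open>When the balance equation is summed over the set where \<open>p\<close> is positive, the
  internal flow cancels. What remains equates a flow into the set, which is at most zero, with the
  flow out of it, so no positive rate leads out.\<close>

lemma balanced_positive_closed:
  assumes fin: "finite S" and nonneg: "\<And>a b. a \<in> S \<Longrightarrow> b \<in> S \<Longrightarrow> 0 \<le> rate a b"
    and bal: "balanced S rate p" and a: "a \<in> S" "0 < p a" and b: "b \<in> S" "0 < rate a b"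
  shows "0 < p b"
proof (rule ccontr)
  assume nb: "\<not> 0 < p b"
  define P where "P = {a\<in>S. 0 < p a}"
  have finP: "finite P" "finite (S - P)" and PS: "P \<subseteq> S" using fin by (auto simp: P_def)
  have split: "(\<Sum>y\<in>S - {x}. g y) = (\<Sum>y\<in>P - {x}. g y) + (\<Sum>y\<in>S - P. g y)" if "x \<in> P" for x and g :: "'a \<Rightarrow> real"
  proof -
    have "S - {x} = (P - {x}) \<union> (S - P)" "(P - {x}) \<inter> (S - P) = {}" using that PS by auto
    then show ?thesis using finP by (simp add: sum.union_disjoint)
  qed
  have swap: "(\<Sum>x\<in>P. \<Sum>y\<in>P - {x}. p y * rate y x) = (\<Sum>x\<in>P. \<Sum>y\<in>P - {x}. p x * rate x y)"
  proof -
    have off: "(\<Sum>y\<in>P - {x}. g y) = (\<Sum>y\<in>P. if y = x then 0 else g y)" for x and g :: "'a \<Rightarrow> real"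
      using finP by (intro sum.mono_neutral_cong_left) auto
    show ?thesis unfolding off by (subst sum.swap) (intro sum.cong refl, auto)
  qed
  have "(\<Sum>x\<in>P. (\<Sum>y\<in>S - {x}. p y * rate y x)) = (\<Sum>x\<in>P. p x * (\<Sum>y\<in>S - {x}. rate x y))"
    using bal PS by (intro sum.cong refl) (auto simp: balanced_def)
  then have "(\<Sum>x\<in>P. \<Sum>y\<in>S - P. p y * rate y x) = (\<Sum>x\<in>P. \<Sum>y\<in>S - P. p x * rate x y)"
    using swap by (simp add: split sum.distrib sum_distrib_left distrib_left)
  moreover have "(\<Sum>x\<in>P. \<Sum>y\<in>S - P. p y * rate y x) \<le> 0"
    using PS nonneg by (intro sum_nonpos mult_nonpos_nonneg) (auto simp: P_def)
  moreover have "0 < (\<Sum>x\<in>P. \<Sum>y\<in>S - P. p x * rate x y)"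
  proof (rule sum_pos2[OF finP(1)])
    show "a \<in> P" using a by (simp add: P_def)
    have "0 < p a * rate a b" using a b by simp
    also have "\<dots> \<le> (\<Sum>y\<in>S - P. p a * rate a y)"
      by (rule member_le_sum) (use finP nb a b nonneg in \<open>auto simp: P_def\<close>)
    finally show "0 < (\<Sum>y\<in>S - P. p a * rate a y)" .
    show "0 \<le> (\<Sum>y\<in>S - P. p x * rate x y)" if "x \<in> P" for x
      using that PS nonneg by (intro sum_nonneg mult_nonneg_nonneg) (auto simp: P_def)
  qed
  ultimately show False by simp
qed

section \<open>Uniqueness of signed stationary vectors\<close>

lemma jump_rate_nonneg:
  assumes "\<And>j. j < length eta \<Longrightarrow> 0 < x j"
  shows "0 \<le> jump_rate x eta zeta"
  unfolding jump_rate_def by (intro sum_nonneg) (auto intro: less_imp_le assms)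

text \<open>Positivity anywhere propagates along bells to the sorted configuration. Applied to
  \<open>p\<close> and to its negative, this excludes the presence of both signs.\<close>

lemma balanced_sign_definite:
  fixes x :: "nat \<Rightarrow> real"
  assumes zero: "0 \<in> set lam" and x: "\<And>j. j < length lam \<Longrightarrow> 0 < x j"
    and bal: "balanced (configs lam) (jump_rate x) p"
  shows "(\<forall>a\<in>configs lam. 0 \<le> p a) \<or> (\<forall>a\<in>configs lam. p a \<le> 0)"
proof -
  have reach: "0 < p (rev (sort lam))"
    if bal: "balanced (configs lam) (jump_rate x) p" and a: "a \<in> configs lam" "0 < p a" for p a
  proof -
    define Q where "Q = {b \<in> configs lam. 0 < p b}"
    have "rev (sort a) \<in> Q"
    proof (rule ring_bell_closed_sorted)
      show "a \<in> Q" using a by (simp add: Q_def)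
      show "0 \<in> set a" using a(1) zero by (metis configs_iff set_mset_mset)
      fix eta j assume e: "eta \<in> Q" "j < length eta"
      then have eta: "eta \<in> configs lam" "0 < p eta" and len: "length eta = length lam"
        by (auto simp: Q_def length_configs)
      have bell: "ring_bell eta j \<in> configs lam"
        using mset_ring_bell[OF _ e(2)] eta(1) zero by (metis configs_iff set_mset_mset)
      have "0 < jump_rate x eta (ring_bell eta j)"
        unfolding jump_rate_def
        by (rule sum_pos2[of _ j]) (use e x len in \<open>auto intro: less_imp_le\<close>)
      then have "0 < p (ring_bell eta j)"
        by (intro balanced_positive_closed[OF _ _ bal eta bell] jump_rate_nonneg)
           (auto intro: x simp: length_configs)
      then show "ring_bell eta j \<in> Q" using bell by (simp add: Q_def)
    qed
    moreover have "sort a = sort lam" using a(1) by (intro properties_for_sort) (auto simp: configs_iff)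
    ultimately show ?thesis by (simp add: Q_def)
  qed
  have "balanced (configs lam) (jump_rate x) (\<lambda>a. 0 - 1 * p a)"
    by (rule balanced_diff[OF _ bal]) (simp add: balanced_def)
  from reach[OF bal] reach[OF this] show ?thesis by fastforce
qed

lemma balanced_sum_0:
  fixes x :: "nat \<Rightarrow> real"
  assumes "0 \<in> set lam" "\<And>j. j < length lam \<Longrightarrow> 0 < x j"
    and "balanced (configs lam) (jump_rate x) p" and sum: "(\<Sum>a\<in>configs lam. p a) = 0"
    and a: "a \<in> configs lam"
  shows "p a = 0"
  using balanced_sign_definite[OF assms(1-3)]
proof
  assume "\<forall>a\<in>configs lam. 0 \<le> p a"
  with sum a show ?thesis by (simp add: sum_nonneg_eq_0_iff)
next
  assume "\<forall>a\<in>configs lam. p a \<le> 0"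
  with sum_nonneg_eq_0_iff[of "configs lam" "\<lambda>a. - p a"] sum a show ?thesis by (simp add: sum_negf)
qed

text \<open>A stationary \<open>p\<close> differs from w / Z by a balanced function of sum zero.
  Conversely the sign of \<open>w\<close> follows from its sum: a balanced function has one sign,
  and \<open>Z\<close> is positive.\<close>

theorem stationary_distribution_iff:
  fixes x :: "nat \<Rightarrow> real"
  assumes zero: "0 \<in> set lam" and x: "\<And>j. j < length lam \<Longrightarrow> 0 < x j"
    and bal: "balanced (configs lam) (jump_rate x) w" and Z: "(\<Sum>a\<in>configs lam. w a) = Z" "0 < Z"
  shows "stationary_distribution (configs lam) (jump_rate x) p \<longleftrightarrow> (\<forall>a\<in>configs lam. p a = w a / Z)"
proof
  assume st: "stationary_distribution (configs lam) (jump_rate x) p"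
  have "balanced (configs lam) (jump_rate x) (\<lambda>a. p a - (1 / Z) * w a)"
    by (rule balanced_diff[OF _ bal]) (use st in \<open>simp add: stationary_distribution_def balanced_def\<close>)
  moreover have "(\<Sum>a\<in>configs lam. p a - (1 / Z) * w a) = 0"
    using st Z by (simp add: stationary_distribution_def sum_subtractf flip: sum_divide_distrib)
  ultimately show "\<forall>a\<in>configs lam. p a = w a / Z"
    using balanced_sum_0[OF zero x] by fastforce
next
  assume p: "\<forall>a\<in>configs lam. p a = w a / Z"
  have "\<not> (\<forall>a\<in>configs lam. w a \<le> 0)" using Z sum_nonpos[of "configs lam" w] by force
  then have nonneg: "\<forall>a\<in>configs lam. 0 \<le> w a" using balanced_sign_definite[OF zero x bal] by blast
  have "balanced (configs lam) (jump_rate x) (\<lambda>a. 0 - (- 1 / Z) * w a)"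
    by (rule balanced_diff[OF _ bal]) (simp add: balanced_def)
  then have "balanced (configs lam) (jump_rate x) p" using p by (simp add: balanced_def)
  moreover have "(\<Sum>a\<in>configs lam. p a) = 1"
    using p Z by (simp flip: sum_divide_distrib)
  ultimately show "stationary_distribution (configs lam) (jump_rate x) p"
    using nonneg p Z by (simp add: stationary_distribution_def balanced_def)
qed

text \<open>The interface for the specialised polynomials. Continuity is asked along the lines x_i +
  e i because these separate coinciding parameters for small e > 0, whereas the interpolation in z
  needs distinct ones; coinciding parameters are reached as e tends to 0.\<close>

locale exchange_functions =
  fixes lam :: "nat list" and F :: "nat list \<Rightarrow> (nat \<Rightarrow> real) \<Rightarrow> real"
  assumes zero: "0 \<in> set lam"
    and exchange: "\<And>mu i x. mu \<in> configs lam \<Longrightarrow> Suc i < length lam \<Longrightarrow> mu ! i > mu ! Suc i \<Longrightarrow>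
       (x i - x (Suc i)) * F (swap_entries i mu) x =
         x (Suc i) * (F mu x - F mu (x(i := x (Suc i), Suc i := x i)))"
    and symmetric: "\<And>mu i x. mu \<in> configs lam \<Longrightarrow> Suc i < length lam \<Longrightarrow> mu ! i = mu ! Suc i \<Longrightarrow>
       F mu (x(i := x (Suc i), Suc i := x i)) = F mu x"
    and rotate: "\<And>a nu x. a # nu \<in> configs lam \<Longrightarrow>
       F (nu @ [a]) x = F (a # nu) (\<lambda>i. if i = 0 then x (length lam - 1) else x (i - 1))"
    and local: "\<And>mu x y. mu \<in> configs lam \<Longrightarrow> \<forall>i<length lam. x i = y i \<Longrightarrow> F mu x = F mu y"
    and continuous: "\<And>mu x. mu \<in> configs lam \<Longrightarrow> continuous_on UNIV (\<lambda>e. F mu (\<lambda>i. x i + e * real i))"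
begin

definition list_weight :: "nat list \<Rightarrow> real list \<Rightarrow> real" where
  "list_weight w xs = (if w \<in> configs lam \<and> length xs = length lam then F w (nth_default 0 xs) else 0)"

sublocale exchange_family "Max (set lam)" list_weight
proof
  fix w x assume "list_weight w x \<noteq> 0"
  then show "0 \<in> set w" using zero by (metis configs_iff list_weight_def set_mset_mset)
next
  fix u v :: "nat list" and us vs :: "real list" and c d :: nat and y z :: real
  assume len: "length us = length u" "length vs = length v" and dc: "d < c"
  show "(y - z) * list_weight (u @ d # c # v) (us @ y # z # vs) =
        z * (list_weight (u @ c # d # v) (us @ y # z # vs) - list_weight (u @ c # d # v) (us @ z # y # vs))"
  proof (cases "u @ c # d # v \<in> configs lam")
    case True
    define xs where "xs = nth_default 0 (us @ y # z # vs)"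
    define i where "i = length u"
    have L: "length lam = length u + length v + 2" using length_configs[OF True] by simp
    have xi: "xs i = y" "xs (Suc i) = z" using len by (auto simp: xs_def i_def nth_default_append)
    have m2: "u @ d # c # v \<in> configs lam" using True by (simp add: configs_iff add_mset_commute)
    have "(xs i - xs (Suc i)) * F (swap_entries i (u @ c # d # v)) xs =
         xs (Suc i) * (F (u @ c # d # v) xs - F (u @ c # d # v) (xs(i := xs (Suc i), Suc i := xs i)))"
      by (rule exchange[OF True]) (use L dc in \<open>auto simp: i_def nth_append\<close>)
    moreover have "F (u @ c # d # v) (xs(i := xs (Suc i), Suc i := xs i)) =
        F (u @ c # d # v) (nth_default 0 (us @ z # y # vs))"
      by (rule local[OF True])
         (use len in \<open>auto simp: xs_def i_def nth_default_def nth_append nth_Cons split: nat.splits\<close>)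
    ultimately show ?thesis
      using True m2 L len xi unfolding i_def swap_entries_append by (simp add: list_weight_def xs_def)
  next
    case False
    then have "u @ d # c # v \<notin> configs lam" by (simp add: configs_iff add_mset_commute)
    with False show ?thesis by (simp add: list_weight_def)
  qed
next
  fix u v :: "nat list" and us vs :: "real list" and c :: nat and y z :: real
  assume len: "length us = length u" "length vs = length v"
  show "list_weight (u @ c # c # v) (us @ y # z # vs) = list_weight (u @ c # c # v) (us @ z # y # vs)"
  proof (cases "u @ c # c # v \<in> configs lam")
    case True
    define xs where "xs = nth_default 0 (us @ y # z # vs)"
    define i where "i = length u"
    have L: "length lam = length u + length v + 2" using length_configs[OF True] by simp
    have "F (u @ c # c # v) (xs(i := xs (Suc i), Suc i := xs i)) = F (u @ c # c # v) xs"
      by (rule symmetric[OF True]) (use L in \<open>auto simp: i_def nth_append\<close>)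
    moreover have "F (u @ c # c # v) (xs(i := xs (Suc i), Suc i := xs i)) =
        F (u @ c # c # v) (nth_default 0 (us @ z # y # vs))"
      by (rule local[OF True])
         (use len in \<open>auto simp: xs_def i_def nth_default_def nth_append nth_Cons split: nat.splits\<close>)
    ultimately show ?thesis using True L len by (simp add: list_weight_def xs_def)
  qed (simp add: list_weight_def)
next
  fix w :: "nat list" and a :: nat and xs :: "real list" and y :: real
  assume len: "length xs = length w"
  show "list_weight (w @ [a]) (xs @ [y]) = list_weight (a # w) (y # xs)"
  proof (cases "a # w \<in> configs lam")
    case True
    have L: "length lam = Suc (length w)" using length_configs[OF True] by simp
    have m2: "w @ [a] \<in> configs lam" using True by (simp add: configs_iff)
    have "F (a # w) (\<lambda>i. if i = 0 then nth_default 0 (xs @ [y]) (length lam - 1)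
              else nth_default 0 (xs @ [y]) (i - 1)) = F (a # w) (nth_default 0 (y # xs))"
      by (rule local[OF True])
         (use len L in \<open>auto simp: nth_default_def nth_append nth_Cons split: nat.splits\<close>)
    then show ?thesis using rotate[OF True] True m2 L len by (simp add: list_weight_def)
  next
    case False
    then have "w @ [a] \<notin> configs lam" by (simp add: configs_iff)
    with False show ?thesis by (simp add: list_weight_def)
  qed
qed

lemma configs_words: "configs lam \<subseteq> words (Max (set lam)) (length lam)"
proof
  fix w assume w: "w \<in> configs lam"
  then have "set w = set lam" by (metis configs_iff set_mset_mset)
  then show "w \<in> words (Max (set lam)) (length lam)"
    using w by (auto simp: words_def length_configs)
qed

lemma sum_bells_distinct:
  assumes x: "inj_on x {..<length lam}" "\<forall>j<length lam. x j \<noteq> 0" and zeta: "zeta \<in> configs lam"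
  shows "(\<Sum>eta\<in>configs lam. F eta x *
    (\<Sum>j<length lam. (of_bool (zeta = ring_bell eta j) - of_bool (zeta = eta)) / x j)) = 0"
proof -
  define xs where "xs = map x [0..<length lam]"
  have lxs: "length xs = length lam" by (simp add: xs_def)
  have xs: "distinct xs" "0 \<notin> set xs"
    using x by (auto simp: xs_def distinct_map lessThan_atLeast0)
  have "list_weight eta xs = (if eta \<in> configs lam then F eta x else 0)" for eta
    unfolding list_weight_def lxs
    by (auto intro!: local simp: xs_def nth_default_nth)
  then have "(\<Sum>eta\<in>configs lam. F eta x *
      (\<Sum>j<length lam. (of_bool (zeta = ring_bell eta j) - of_bool (zeta = eta)) / x j)) =
    (\<Sum>eta\<in>words (Max (set lam)) (length xs). list_weight eta xs *
      (\<Sum>j<length xs. (of_bool (zeta = ring_bell eta j) - of_bool (zeta = eta)) / xs ! j))"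
    using configs_words by (intro sum.mono_neutral_cong_left) (auto simp: xs_def)
  also have "\<dots> = 0"
    by (rule balance_distinct) (use xs zeta configs_words lxs in auto)
  finally show ?thesis .
qed

lemma sum_bells:
  fixes x :: "nat \<Rightarrow> real"
  assumes x: "\<forall>j<length lam. 0 < x j" and zeta: "zeta \<in> configs lam"
  shows "(\<Sum>eta\<in>configs lam. F eta x *
    (\<Sum>j<length lam. (of_bool (zeta = ring_bell eta j) - of_bool (zeta = eta)) / x j)) = 0"
proof -
  define y where "y e i = x i + e * real i" for e i
  define E where "E e = (\<Sum>eta\<in>configs lam. F eta (y e) *
    (\<Sum>j<length lam. (of_bool (zeta = ring_bell eta j) - of_bool (zeta = eta)) / y e j))" for e
  have lim: "(E \<longlongrightarrow> E 0) (at_right 0)"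
  proof -
    have "((\<lambda>e. F eta (y e)) \<longlongrightarrow> F eta (y 0)) (at_right 0)" if "eta \<in> configs lam" for eta
      using continuous[OF that, of x] unfolding y_def[symmetric] continuous_on_def
      by (meson UNIV_I filterlim_at_within_not_equal tendsto_within_subset top_greatest)
    moreover have "((\<lambda>e. y e j) \<longlongrightarrow> y 0 j) (at_right 0)" for j
      unfolding y_def by (intro tendsto_intros)
    moreover have "y 0 j \<noteq> 0" if "j < length lam" for j using x that by (auto simp: y_def)
    ultimately show ?thesis unfolding E_def by (intro tendsto_intros) auto
  qed
  have "\<forall>\<^sub>F e in at_right 0. \<forall>i\<in>{..<length lam}. \<forall>j\<in>{..<length lam} - {i}. y e i \<noteq> y e j"
  proof (intro eventually_ball_finite ballI finite_lessThan finite_Diff)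
    fix i j assume ij: "i \<in> {..<length lam}" "j \<in> {..<length lam} - {i}"
    show "\<forall>\<^sub>F e in at_right 0. y e i \<noteq> y e j"
    proof (cases "x i = x j")
      case True
      then show ?thesis using ij by (auto simp: y_def eventually_at_filter)
    next
      case False
      have "((\<lambda>e. y e i - y e j) \<longlongrightarrow> y 0 i - y 0 j) (at_right 0)"
        unfolding y_def by (intro tendsto_intros)
      then have "\<forall>\<^sub>F e in at_right 0. y e i - y e j \<noteq> 0"
        by (rule tendsto_imp_eventually_ne) (use False in \<open>simp add: y_def\<close>)
      then show ?thesis by eventually_elim simp
    qed
  qed
  moreover have "\<forall>\<^sub>F e in at_right (0::real). 0 < e" by (simp add: eventually_at_right_less)
  ultimately have "\<forall>\<^sub>F e in at_right 0. E e = 0"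
  proof eventually_elim
    case (elim e)
    show ?case unfolding E_def
    proof (rule sum_bells_distinct[OF _ _ zeta])
      show "inj_on (y e) {..<length lam}" using elim by (auto simp: inj_on_def)
      show "\<forall>j<length lam. y e j \<noteq> 0"
        using x elim by (auto simp: y_def add_pos_nonneg less_imp_neq[symmetric] intro!: less_imp_neq[symmetric])
    qed
  qed
  then have "(E \<longlongrightarrow> 0) (at_right 0)" by (rule tendsto_eventually)
  with lim have "E 0 = 0" using tendsto_unique trivial_limit_at_right_real by blast
  moreover have "y 0 = x" by (auto simp: y_def)
  ultimately show ?thesis by (simp add: E_def)
qed

text \<open>In \<open>sum_bells\<close> every bell counts, also one that leaves the configuration
  fixed. Such bells contribute equally to both sides and are removed at the end.\<close>

theorem balanced_jump_rate:
  assumes x: "\<forall>j<length lam. 0 < x j"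
  shows "balanced (configs lam) (jump_rate x) (\<lambda>eta. F eta x)"
  unfolding balanced_def
proof
  fix zeta assume zeta: "zeta \<in> configs lam"
  define r where "r = (\<Sum>j<length lam. 1 / x j)"
  have rate: "jump_rate x eta w = (\<Sum>j<length lam. of_bool (w = ring_bell eta j) / x j)"
    if "eta \<in> configs lam" for eta w
  proof -
    have "jump_rate x eta w = (\<Sum>j | j < length lam \<and> ring_bell eta j = w. 1 / x j)"
      by (simp add: jump_rate_def length_configs[OF that])
    also have "\<dots> = (\<Sum>j<length lam. of_bool (w = ring_bell eta j) / x j)"
      by (intro sum.mono_neutral_cong_left) auto
    finally show ?thesis .
  qed
  have total: "(\<Sum>w\<in>configs lam. jump_rate x zeta w) = r"
  proof -
    have "ring_bell zeta j \<in> configs lam" if "j < length lam" for j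
      using mset_ring_bell[of zeta j] zeta zero that
      by (metis configs_iff length_configs set_mset_mset)
    then have "(\<Sum>w\<in>configs lam. of_bool (w = ring_bell zeta j) / x j) = 1 / x j" if "j < length lam" for j
      using that by (simp add: of_bool_def if_distrib[of "\<lambda>u. u / x j"] cong: if_cong)
    then show ?thesis
      unfolding r_def using zeta by (simp add: rate sum.swap[of _ "{..<length lam}"])
  qed
  have "0 = (\<Sum>eta\<in>configs lam. F eta x * (jump_rate x eta zeta - of_bool (zeta = eta) * r))"
    unfolding sum_bells[OF x zeta, symmetric]
    by (intro sum.cong refl)
       (simp add: rate r_def diff_divide_distrib sum_subtractf sum_distrib_left)
  also have "\<dots> = (\<Sum>eta\<in>configs lam. F eta x * jump_rate x eta zeta) - F zeta x * r"
    using zeta by (simp add: right_diff_distrib sum_subtractf of_bool_def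
        if_distrib[of "\<lambda>u. u * r"] if_distrib[of "\<lambda>u. _ * u"] cong: if_cong)
  finally have "(\<Sum>eta\<in>configs lam. F eta x * jump_rate x eta zeta) = F zeta x * r" by simp
  then have "(\<Sum>eta\<in>configs lam. F eta x * jump_rate x eta zeta) =
      F zeta x * (\<Sum>w\<in>configs lam. jump_rate x zeta w)" by (simp only: total)
  then show "(\<Sum>b\<in>configs lam - {zeta}. F b x * jump_rate x b zeta) =
        F zeta x * (\<Sum>b\<in>configs lam - {zeta}. jump_rate x zeta b)"
    using zeta by (simp add: sum.remove[OF finite_configs zeta] distrib_left)
qed

end

section \<open>Polynomials with coefficients in \<open>\<rat>(q, t)\<close>\<close>

definition monom_value :: "(nat \<Rightarrow> 'b::comm_semiring_1) \<Rightarrow> (nat \<Rightarrow>\<^sub>0 nat) \<Rightarrow> 'b" where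
  "monom_value v e = (\<Prod>i\<in>Poly_Mapping.keys e. v i ^ Poly_Mapping.lookup e i)"

lemma monom_value_superset:
  assumes "finite I" "Poly_Mapping.keys e \<subseteq> I"
  shows "monom_value v e = (\<Prod>i\<in>I. v i ^ Poly_Mapping.lookup e i)"
  unfolding monom_value_def using assms
  by (intro prod.mono_neutral_left) (auto simp: in_keys_iff)

lemma monom_value_0 [simp]: "monom_value v 0 = 1"
  by (simp add: monom_value_def)

lemma monom_value_single [simp]: "monom_value v (Poly_Mapping.single i k) = v i ^ k"
  by (cases "k = 0") (simp_all add: monom_value_def)

lemma monom_value_add: "monom_value v (d + e) = monom_value v d * monom_value v e"
proof -
  define I where "I = Poly_Mapping.keys d \<union> Poly_Mapping.keys e"
  have "finite I" "Poly_Mapping.keys d \<subseteq> I" "Poly_Mapping.keys e \<subseteq> I" "Poly_Mapping.keys (d + e) \<subseteq> I"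
    using keys_add[of d e] by (auto simp: I_def)
  then show ?thesis
    by (simp add: monom_value_superset[of I] lookup_add power_add prod.distrib)
qed

lemma insertion_alt:
  "insertion h v p = (\<Sum>e\<in>Poly_Mapping.keys p. h (Poly_Mapping.lookup p e) * monom_value v e)"
  by (simp add: insertion_def monom_value_def)

lemma insertion_superset:
  assumes "finite X" "Poly_Mapping.keys p \<subseteq> X" "h 0 = 0"
  shows "insertion h v p = (\<Sum>e\<in>X. h (Poly_Mapping.lookup p e) * monom_value v e)"
  unfolding insertion_alt using assms
  by (intro sum.mono_neutral_left) (auto simp: in_keys_iff)

lemma insertion_single:
  assumes "h 0 = 0"
  shows "insertion h v (Poly_Mapping.single e c) = h c * monom_value v e"
  using insertion_superset[of "{e}" "Poly_Mapping.single e c" h v] assms by simp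

lemma insertion_cong_vars:
  assumes "\<And>i e. e \<in> Poly_Mapping.keys p \<Longrightarrow> i \<in> Poly_Mapping.keys e \<Longrightarrow> v i = w i"
  shows "insertion h v p = insertion h w p"
  unfolding insertion_alt monom_value_def
  by (intro sum.cong prod.cong refl arg_cong2[of _ _ _ _ "(*)"]) (use assms in auto)

lemma insertion_additive:
  fixes h :: "'a::comm_monoid_add \<Rightarrow> 'b::comm_semiring_1"
  assumes "h 0 = 0"
    and "\<And>e. h (Poly_Mapping.lookup p e + Poly_Mapping.lookup r e) =
              h (Poly_Mapping.lookup p e) + h (Poly_Mapping.lookup r e)"
  shows "insertion h v (p + r) = insertion h v p + insertion h v r"
proof -
  define X where "X = Poly_Mapping.keys p \<union> Poly_Mapping.keys r"
  have "finite X" "Poly_Mapping.keys p \<subseteq> X" "Poly_Mapping.keys r \<subseteq> X" "Poly_Mapping.keys (p + r) \<subseteq> X"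
    using keys_add[of p r] by (auto simp: X_def)
  then show ?thesis
    using assms by (simp add: insertion_superset[of X] lookup_add distrib_right sum.distrib)
qed

lemma insertion_0 [simp]: "insertion h v 0 = 0"
  by (simp add: insertion_def)

lemma poly_mapping_sum_single:
  "p = (\<Sum>e\<in>Poly_Mapping.keys p. Poly_Mapping.single e (Poly_Mapping.lookup p e))"
  by (rule poly_mapping_eqI)
     (auto simp: lookup_sum lookup_single when_def in_keys_iff sum.delta if_distrib cong: if_cong)

lemma single_times:
  "Poly_Mapping.single d c * p =
     (\<Sum>e\<in>Poly_Mapping.keys p. Poly_Mapping.single (d + e) (c * Poly_Mapping.lookup p e))"
  by (subst (1) poly_mapping_sum_single[of p]) (simp add: sum_distrib_left mult_single)

lemma lookup_single_times:
  fixes d :: "nat \<Rightarrow>\<^sub>0 nat" and p :: "(nat \<Rightarrow>\<^sub>0 nat) \<Rightarrow>\<^sub>0 'a::comm_semiring_0"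
  shows "Poly_Mapping.lookup (Poly_Mapping.single d c * p) (d + e) = c * Poly_Mapping.lookup p e"
  by (simp add: single_times lookup_sum lookup_single when_def in_keys_iff if_distrib sum.delta cong: if_cong)

lemma lookup_single_times_0:
  assumes "\<And>e'. e \<noteq> d + e'"
  shows "Poly_Mapping.lookup (Poly_Mapping.single d c * p) e = 0"
  using assms[symmetric] by (simp add: single_times lookup_sum lookup_single when_def)

lemma lookup_Const_times [simp]: "Poly_Mapping.lookup (Const c * p) e = c * Poly_Mapping.lookup p e"
  using lookup_single_times[of 0 c p e] by (simp add: Const_def)

lemma Const_0 [simp]: "Const 0 = 0"
  by (simp add: Const_def)

lemma Const_1 [simp]: "Const 1 = 1"
  by (simp add: Const_def)

lemma Const_mult: "Const (a * b) = Const a * Const b"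
  by (simp add: Const_def mult_single)

lemma Const_add: "Const (a + b) = Const a + Const b"
  by (simp add: Const_def single_add)

lemma Const_diff: "Const (a - b) = Const a - Const b"
  by (simp add: Const_def single_diff)

lemma Const_power: "Const (a ^ k) = Const a ^ k"
  by (induction k) (auto simp: Const_mult)

definition ring_hom_on :: "('a::comm_semiring_1 \<Rightarrow> 'b::comm_semiring_1) \<Rightarrow> bool" where
  "ring_hom_on h \<longleftrightarrow> h 0 = 0 \<and> h 1 = 1 \<and> (\<forall>a b. h (a + b) = h a + h b) \<and> (\<forall>a b. h (a * b) = h a * h b)"

lemma ring_hom_onD:
  assumes "ring_hom_on h"
  shows "h 0 = 0" "h 1 = 1" "h (a + b) = h a + h b" "h (a * b) = h a * h b"
  using assms by (auto simp: ring_hom_on_def)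

lemma ring_hom_on_sum: "ring_hom_on h \<Longrightarrow> h (sum g A) = (\<Sum>a\<in>A. h (g a))"
  by (induction A rule: infinite_finite_induct) (auto simp: ring_hom_on_def)

lemma ring_hom_on_prod: "ring_hom_on h \<Longrightarrow> h (prod g A) = (\<Prod>a\<in>A. h (g a))"
  by (induction A rule: infinite_finite_induct) (auto simp: ring_hom_on_def)

lemma ring_hom_on_power: "ring_hom_on h \<Longrightarrow> h (a ^ k) = h a ^ k"
  by (induction k) (auto simp: ring_hom_on_def)

lemma ring_hom_on_diff:
  fixes h :: "'a::comm_ring_1 \<Rightarrow> 'b::comm_ring_1"
  assumes "ring_hom_on h"
  shows "h (a - b) = h a - h b"
proof -
  have "h (a - b) + h b = h a" using ring_hom_onD(3)[OF assms, of "a - b" b] by simp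
  then show ?thesis by (simp add: algebra_simps)
qed

lemma insertion_sum:
  assumes "ring_hom_on h"
  shows "insertion h v (sum g A) = (\<Sum>a\<in>A. insertion h v (g a))"
  using assms
  by (induction A rule: infinite_finite_induct) (auto simp: insertion_additive ring_hom_onD)

lemma ring_hom_on_insertion:
  assumes h: "ring_hom_on h"
  shows "ring_hom_on (insertion h v)"
  unfolding ring_hom_on_def
proof (intro conjI allI)
  show "insertion h v 1 = 1"
    using insertion_single[of h v 0 1] ring_hom_onD[OF h] by simp
  show "insertion h v (a + b) = insertion h v a + insertion h v b" for a b
    by (rule insertion_additive) (auto simp: ring_hom_onD[OF h])
  fix p r :: "(nat \<Rightarrow>\<^sub>0 nat) \<Rightarrow>\<^sub>0 'a"
  have "p * r = (\<Sum>d\<in>Poly_Mapping.keys p. \<Sum>e\<in>Poly_Mapping.keys r.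
      Poly_Mapping.single (d + e) (Poly_Mapping.lookup p d * Poly_Mapping.lookup r e))"
    by (subst (1) poly_mapping_sum_single[of p]) (simp add: sum_distrib_right single_times)
  then have "insertion h v (p * r) = (\<Sum>d\<in>Poly_Mapping.keys p. \<Sum>e\<in>Poly_Mapping.keys r.
      (h (Poly_Mapping.lookup p d) * monom_value v d) * (h (Poly_Mapping.lookup r e) * monom_value v e))"
    by (simp add: insertion_sum[OF h] insertion_single ring_hom_onD[OF h] monom_value_add ac_simps)
  then show "insertion h v (p * r) = insertion h v p * insertion h v r"
    by (simp add: insertion_alt sum_product)
qed simp

lemma insertion_Const [simp]: "h 0 = 0 \<Longrightarrow> insertion h v (Const c) = h c"
  by (simp add: Const_def insertion_single)

lemma insertion_Var [simp]: "h 0 = 0 \<Longrightarrow> h 1 = 1 \<Longrightarrow> insertion h v (Var i) = v i"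
  by (simp add: Var_def insertion_single)

lemma ring_hom_on_Const: "ring_hom_on Const"
  by (simp add: ring_hom_on_def Const_add Const_mult)

lemma insertion_subst:
  assumes h: "ring_hom_on h"
  shows "insertion h v (subst \<sigma> p) = insertion h (\<lambda>i. insertion h v (\<sigma> i)) p"
proof -
  note hv = ring_hom_on_insertion[OF h, of v]
  show ?thesis
    unfolding insertion_alt[of Const] insertion_alt[of h "\<lambda>i. insertion h v (\<sigma> i)"] monom_value_def
    by (simp add: insertion_sum[OF h] ring_hom_onD(4)[OF hv] ring_hom_on_prod[OF hv]
        ring_hom_on_power[OF hv] ring_hom_onD(1)[OF h])
qed

section \<open>Coefficients indexed by lists of exponents\<close>

definition in_vars :: "nat \<Rightarrow> ((nat \<Rightarrow>\<^sub>0 nat) \<Rightarrow>\<^sub>0 'a::zero) \<Rightarrow> bool" where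
  "in_vars n p \<longleftrightarrow> (\<forall>e\<in>Poly_Mapping.keys p. Poly_Mapping.keys e \<subseteq> {..<n})"

abbreviation lcoeff :: "((nat \<Rightarrow>\<^sub>0 nat) \<Rightarrow>\<^sub>0 'a::zero) \<Rightarrow> nat list \<Rightarrow> 'a" where
  "lcoeff p be \<equiv> Poly_Mapping.lookup p (Poly_Mapping.nth be)"

definition expo :: "nat \<Rightarrow> (nat \<Rightarrow>\<^sub>0 nat) \<Rightarrow> nat list" where
  "expo n e = map (Poly_Mapping.lookup e) [0..<n]"

lemma length_expo [simp]: "length (expo n e) = n"
  by (simp add: expo_def)

lemma nth_expo [simp]: "i < n \<Longrightarrow> expo n e ! i = Poly_Mapping.lookup e i"
  by (simp add: expo_def)

lemma nth_of_expo:
  assumes "Poly_Mapping.keys e \<subseteq> {..<n}"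
  shows "Poly_Mapping.nth (expo n e) = e"
proof (rule poly_mapping_eqI)
  fix i
  show "Poly_Mapping.lookup (Poly_Mapping.nth (expo n e)) i = Poly_Mapping.lookup e i"
    using assms by (cases "i < n") (auto simp: nth_default_def in_keys_iff)
qed

lemma keys_nth_subset: "Poly_Mapping.keys (Poly_Mapping.nth be) \<subseteq> {..<length be}"
  by (auto simp: in_keys_iff nth_default_def simp del: keys_nth split: if_splits)

lemma lookup_nth_eq: "Poly_Mapping.lookup (Poly_Mapping.nth be) i = (if i < length be then be ! i else 0)"
  by (simp add: nth_default_def)

lemma nth_inject:
  assumes "length be = length ga" "Poly_Mapping.nth be = Poly_Mapping.nth ga"
  shows "be = ga"
proof (rule nth_equalityI[OF assms(1)])
  fix i assume "i < length be"
  then show "be ! i = ga ! i"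
    using arg_cong[OF assms(2), of "\<lambda>p. Poly_Mapping.lookup p i"] assms(1) by (simp add: nth_default_def)
qed

lemma in_vars_eqI:
  assumes "in_vars n p" "in_vars n r" "\<And>be. length be = n \<Longrightarrow> lcoeff p be = lcoeff r be"
  shows "p = r"
proof (rule poly_mapping_eqI)
  fix e
  show "Poly_Mapping.lookup p e = Poly_Mapping.lookup r e"
  proof (cases "Poly_Mapping.keys e \<subseteq> {..<n}")
    case True
    with assms(3)[of "expo n e"] show ?thesis by (simp only: nth_of_expo length_expo)
  next
    case False
    with assms(1,2) have "e \<notin> Poly_Mapping.keys p" "e \<notin> Poly_Mapping.keys r" by (auto simp: in_vars_def)
    then show ?thesis by (simp add: in_keys_iff)
  qed
qed

lemma lcoeff_Var_times:
  assumes i: "i < length be"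
  shows "lcoeff (Var i * p) be = (if be ! i = 0 then 0 else lcoeff p (be[i := be ! i - 1]))"
proof (cases "be ! i = 0")
  case True
  have "Poly_Mapping.nth be \<noteq> Poly_Mapping.single i 1 + e'" for e'
  proof
    assume "Poly_Mapping.nth be = Poly_Mapping.single i 1 + e'"
    from arg_cong[OF this, of "\<lambda>p. Poly_Mapping.lookup p i"] True i show False
      by (simp add: lookup_nth_eq lookup_add del: lookup_nth)
  qed
  with True show ?thesis unfolding Var_def by (simp add: lookup_single_times_0)
next
  case False
  have "Poly_Mapping.nth be = Poly_Mapping.single i 1 + Poly_Mapping.nth (be[i := be ! i - 1])"
    by (rule poly_mapping_eqI)
       (use i False in \<open>auto simp: lookup_nth_eq lookup_add lookup_single when_def simp del: lookup_nth\<close>)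
  then show ?thesis
    using False lookup_single_times[of "Poly_Mapping.single i 1" 1 p "Poly_Mapping.nth (be[i := be ! i - 1])"]
    by (simp add: Var_def)
qed

text \<open>A scaled permutation of the variables sends distinct monomials to distinct monomials, so
  exactly one coefficient of \<open>p\<close> contributes.\<close>

lemma lcoeff_subst:
  assumes p: "in_vars n p" and be: "length be = n"
    and \<sigma>: "\<And>i. i < n \<Longrightarrow> \<sigma> i = Const (k i) * Var (\<pi> i)"
    and \<pi>: "bij_betw \<pi> {..<n} {..<n}"
  shows "lcoeff (subst \<sigma> p) be =
    (\<Prod>i<n. k i ^ (be ! \<pi> i)) * lcoeff p (map (\<lambda>i. be ! \<pi> i) [0..<n])"
proof -
  define g where "g = map (\<lambda>i. be ! \<pi> i) [0..<n]"
  define img where "img e = (\<Sum>i<n. Poly_Mapping.single (\<pi> i) (Poly_Mapping.lookup e i))"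
    for e :: "nat \<Rightarrow>\<^sub>0 nat"
  have power_Var: "Var j ^ a = Poly_Mapping.single (Poly_Mapping.single j a) 1" for j a
    by (induction a) (simp_all add: Var_def mult_single flip: single_add)
  have prod_single: "(\<Prod>i\<in>I. Poly_Mapping.single (u i) (1::qt)) = Poly_Mapping.single (\<Sum>i\<in>I. u i) 1"
    if "finite I" for I :: "nat set" and u :: "nat \<Rightarrow> nat \<Rightarrow>\<^sub>0 nat"
    using that by (induction I rule: finite_induct) (auto simp: mult_single)
  have mono: "monom_value \<sigma> e = Const (\<Prod>i<n. k i ^ Poly_Mapping.lookup e i) * Poly_Mapping.single (img e) 1"
    if "e \<in> Poly_Mapping.keys p" for e
  proof -
    have "monom_value \<sigma> e = (\<Prod>i<n. \<sigma> i ^ Poly_Mapping.lookup e i)"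
      by (rule monom_value_superset) (use p that in \<open>auto simp: in_vars_def\<close>)
    also have "\<dots> = (\<Prod>i<n. Const (k i ^ Poly_Mapping.lookup e i) *
        Poly_Mapping.single (Poly_Mapping.single (\<pi> i) (Poly_Mapping.lookup e i)) 1)"
      by (intro prod.cong refl) (simp add: \<sigma> power_mult_distrib Const_power power_Var)
    finally show ?thesis
      by (simp add: prod.distrib prod_single img_def ring_hom_on_prod[OF ring_hom_on_Const])
  qed
  have img_lookup: "Poly_Mapping.lookup (img e) (\<pi> i) = Poly_Mapping.lookup e i" if "i < n" for e i
  proof -
    have "(\<pi> j = \<pi> i) = (j = i)" if "j < n" for j
      using \<pi> that \<open>i < n\<close> by (auto simp: bij_betw_def inj_on_def)
    then have "Poly_Mapping.lookup (img e) (\<pi> i) = (\<Sum>j<n. if j = i then Poly_Mapping.lookup e j else 0)"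
      unfolding img_def lookup_sum by (intro sum.cong) (auto simp: lookup_single when_def)
    then show ?thesis using that by simp
  qed
  have img_eq: "img e = Poly_Mapping.nth be \<longleftrightarrow> e = Poly_Mapping.nth g" if e: "e \<in> Poly_Mapping.keys p" for e
  proof
    assume A: "img e = Poly_Mapping.nth be"
    show "e = Poly_Mapping.nth g"
    proof (rule poly_mapping_eqI)
      fix i
      show "Poly_Mapping.lookup e i = Poly_Mapping.lookup (Poly_Mapping.nth g) i"
      proof (cases "i < n")
        case True
        then have "\<pi> i < n" using \<pi> by (auto simp: bij_betw_def)
        then show ?thesis using img_lookup[OF True, of e] True be
          by (simp add: A lookup_nth_eq g_def del: lookup_nth)
      next
        case False
        then have "i \<notin> Poly_Mapping.keys e" using p e by (auto simp: in_vars_def)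
        then show ?thesis using False by (simp add: lookup_nth_eq g_def in_keys_iff del: lookup_nth)
      qed
    qed
  next
    assume A: "e = Poly_Mapping.nth g"
    show "img e = Poly_Mapping.nth be"
    proof (rule poly_mapping_eqI)
      fix j
      show "Poly_Mapping.lookup (img e) j = Poly_Mapping.lookup (Poly_Mapping.nth be) j"
      proof (cases "j < n")
        case True
        then obtain i where i: "i < n" "j = \<pi> i" using \<pi> by (auto simp: bij_betw_def)
        then show ?thesis using img_lookup[OF i(1), of e] True be
          by (simp add: A lookup_nth_eq g_def del: lookup_nth)
      next
        case False
        then have "\<pi> i \<noteq> j" if "i < n" for i using \<pi> that by (auto simp: bij_betw_def)
        then show ?thesis using False be
          by (simp add: img_def lookup_sum lookup_single when_def lookup_nth_eq del: lookup_nth)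
      qed
    qed
  qed
  have "lcoeff (subst \<sigma> p) be = (\<Sum>e\<in>Poly_Mapping.keys p. Poly_Mapping.lookup p e *
      ((\<Prod>i<n. k i ^ Poly_Mapping.lookup e i) * (if img e = Poly_Mapping.nth be then 1 else 0)))"
    unfolding insertion_alt lookup_sum
    by (intro sum.cong refl) (simp add: mono lookup_single when_def)
  also have "\<dots> = (\<Sum>e\<in>Poly_Mapping.keys p. if e = Poly_Mapping.nth g then Poly_Mapping.lookup p e *
      (\<Prod>i<n. k i ^ Poly_Mapping.lookup e i) else 0)"
    by (intro sum.cong refl) (simp add: img_eq)
  also have "\<dots> = lcoeff p g * (\<Prod>i<n. k i ^ (be ! \<pi> i))"
    by (auto simp: sum.delta in_keys_iff g_def lookup_nth_eq simp del: lookup_nth intro!: prod.cong)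
  finally show ?thesis by (simp add: g_def)
qed

section \<open>Coefficients of the ASEP polynomials\<close>

definition sqsum :: "nat list \<Rightarrow> nat" where
  "sqsum be = sum_list (map (\<lambda>x. x ^ 2) be)"

lemma sqsum_nth: "sqsum be = (\<Sum>i<length be. (be ! i) ^ 2)"
  by (simp add: sqsum_def sum_list_sum_nth lessThan_atLeast0)

lemma sqsum_mset: "mset v = mset w \<Longrightarrow> sqsum v = sqsum w"
  unfolding sqsum_def by (metis mset_map sum_mset_sum_list)

lemma sqsum_swap_entries [simp]: "Suc i < length be \<Longrightarrow> sqsum (swap_entries i be) = sqsum be"
  by (rule sqsum_mset) simp

lemma sqsum_le: "sqsum be \<le> (sum_list be) ^ 2"
proof (induction be)
  case (Cons x be)
  have "x ^ 2 + sum_list be ^ 2 \<le> (x + sum_list be) ^ 2" by (simp add: power2_sum)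
  with Cons show ?case by (simp add: sqsum_def)
qed (simp add: sqsum_def)

text \<open>The coefficients at \<open>be\<close> of the exchange relation multiplied by \<open>x\<^sub>i - x\<^sub>i\<^sub>+\<^sub>1\<close>, of the symmetry
  relation and of the cyclic relation.\<close>

definition coeff_kz ::
    "'r::comm_ring_1 \<Rightarrow> 'r \<Rightarrow> nat list \<Rightarrow> (nat list \<Rightarrow> nat list \<Rightarrow> 'r) \<Rightarrow> bool" where
  "coeff_kz q t lam F \<longleftrightarrow>
     (\<forall>mu be i. mu \<in> configs lam \<longrightarrow> length be = length lam \<longrightarrow> Suc i < length lam \<longrightarrow>
        (mu ! i > mu ! Suc i \<longrightarrow>
          (let dec = (\<lambda>j h. if be ! j = 0 then 0 else h (be[j := be ! j - 1])) in
           dec i (F (swap_entries i mu)) - dec (Suc i) (F (swap_entries i mu)) =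
             (1 - t) * dec (Suc i) (F mu) + t * dec i (\<lambda>b. F mu (swap_entries i b))
             - dec (Suc i) (\<lambda>b. F mu (swap_entries i b)))) \<and>
        (mu ! i = mu ! Suc i \<longrightarrow> F mu (swap_entries i be) = F mu be)) \<and>
     (\<forall>a nu b ga. a # nu \<in> configs lam \<longrightarrow> length ga = length nu \<longrightarrow>
        q ^ b * F (a # nu) (b # ga) = q ^ a * F (nu @ [a]) (ga @ [b]))"

text \<open>To isolate the coefficient at \<open>be\<close> from the factor x_i - x_{i+1}, the
  relation is read off at \<open>be\<close> with the larger of its two exponents raised by one (the
  left one in a tie). The competing terms then have the smaller exponent lowered, so the pair is
  spread further and the sum of squares exceeds the maximum \<open>N\<close>.\<close>

lemma coeff_kz_top:
  assumes kz: "coeff_kz q t lam F"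
    and top: "\<And>mu be. mu \<in> configs lam \<Longrightarrow> length be = length lam \<Longrightarrow> N < sqsum be \<Longrightarrow> F mu be = 0"
  shows "graded_kz q t lam (\<lambda>mu be. if sqsum be = N then F mu be else 0)"
  unfolding graded_kz_def
proof (intro conjI allI impI)
  fix mu be :: "nat list" and i
  assume mu: "mu \<in> configs lam" and len: "length be = length lam" and i: "Suc i < length lam"
  have lmu: "length mu = length lam" using mu by (rule length_configs)
  note 0 = kz[unfolded coeff_kz_def Let_def, THEN conjunct1, rule_format, OF mu _ i]
  {
    assume desc: "mu ! i > mu ! Suc i"
    note R = 0[THEN conjunct1, rule_format, OF _ desc]
    have smu: "swap_entries i mu \<in> configs lam" using mu i lmu by simp
    define a b where "a = be ! i" and "b = be ! Suc i"
    show "(if sqsum be = N then F (swap_entries i mu) be else 0) =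
      (if be ! i < be ! Suc i
       then (if sqsum (swap_entries i be) = N then F mu (swap_entries i be) else 0) +
            (t - 1) * (if sqsum be = N then F mu be else 0)
       else t * (if sqsum (swap_entries i be) = N then F mu (swap_entries i be) else 0))"
    proof (cases "sqsum be = N")
      case N: True
      have sq: "sqsum (be[i := x, Suc i := y]) + a ^ 2 + b ^ 2 = sqsum be + x ^ 2 + y ^ 2" for x y
      proof -
        define I where "I = {..<length be} - {i, Suc i}"
        have I: "{..<length be} = insert i (insert (Suc i) I)" "finite I" "i \<notin> insert (Suc i) I" "Suc i \<notin> I"
          using i len by (auto simp: I_def)
        have e: "(\<Sum>k\<in>I. (be[i := x, Suc i := y] ! k) ^ 2) = (\<Sum>k\<in>I. (be ! k) ^ 2)"
          by (intro sum.cong) (auto simp: I_def nth_list_update)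
        show ?thesis unfolding sqsum_nth length_list_update I(1)
          using I(2-4) i len e by (simp add: a_def b_def nth_list_update)
      qed
      show ?thesis
      proof (cases "a < b")
        case True
        define be' where "be' = be[Suc i := b + 1]"
        have at: "be' ! i = a" "be' ! Suc i = b + 1" "length be' = length lam"
          "be'[Suc i := b] = be"
          using i len by (auto simp: be'_def a_def b_def)
        have zero: "F nu (be'[i := a - 1]) = 0 \<and> F nu (swap_entries i (be'[i := a - 1])) = 0"
          if "a \<noteq> 0" "nu \<in> configs lam" for nu
        proof -
          have eq: "be'[i := a - 1] = be[i := a - 1, Suc i := b + 1]"
            by (simp add: be'_def list_update_swap)
          have "(a - 1) ^ 2 + (b + 1) ^ 2 > a ^ 2 + b ^ 2"
          proof -
            obtain a' where a': "a = Suc a'" using \<open>a \<noteq> 0\<close> by (cases a) auto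
            then show ?thesis using True by (simp add: power2_eq_square)
          qed
          then have "N < sqsum (be'[i := a - 1])" using sq[of "a - 1" "b + 1"] N eq by simp
          then show ?thesis using top[OF \<open>nu \<in> configs lam\<close>] at i by simp
        qed
        have "- F (swap_entries i mu) be = (1 - t) * F mu be - F mu (swap_entries i be)"
          using R[of be'] zero[OF _ mu] zero[OF _ smu] at by (cases "a = 0") simp_all
        then have "F (swap_entries i mu) be = F mu (swap_entries i be) + (t - 1) * F mu be"
          by (simp add: algebra_simps)
        then show ?thesis using True N i len by (simp add: a_def b_def)
      next
        case False
        define be' where "be' = be[i := a + 1]"
        have at: "be' ! i = a + 1" "be' ! Suc i = b" "length be' = length lam"
          "be'[i := a] = be"
          using i len by (auto simp: be'_def a_def b_def)
        have zero: "F nu (be'[Suc i := b - 1]) = 0 \<and> F nu (swap_entries i (be'[Suc i := b - 1])) = 0"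
          if "b \<noteq> 0" "nu \<in> configs lam" for nu
        proof -
          have "(a + 1) ^ 2 + (b - 1) ^ 2 > a ^ 2 + b ^ 2"
          proof -
            obtain b' where b': "b = Suc b'" using \<open>b \<noteq> 0\<close> by (cases b) auto
            then show ?thesis using False by (simp add: power2_eq_square)
          qed
          then have "N < sqsum (be'[Suc i := b - 1])" using sq[of "a + 1" "b - 1"] N by (simp add: be'_def)
          then show ?thesis using top[OF \<open>nu \<in> configs lam\<close>] at i by simp
        qed
        have "F (swap_entries i mu) be = t * F mu (swap_entries i be)"
          using R[of be'] zero[OF _ mu] zero[OF _ smu] at by (cases "b = 0") simp_all
        then show ?thesis using False N i len by (simp add: a_def b_def)
      qed
    qed (use i len in simp)
  next
    assume "mu ! i = mu ! Suc i"
    then show "(if sqsum (swap_entries i be) = N then F mu (swap_entries i be) else 0) =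
        (if sqsum be = N then F mu be else 0)"
      using 0[OF len] i len by simp
  }
next
  fix a b and nu ga :: "nat list"
  assume mem: "a # nu \<in> configs lam" and len: "length ga = length nu"
  have "q ^ b * F (a # nu) (b # ga) = q ^ a * F (nu @ [a]) (ga @ [b])"
    using kz mem len unfolding coeff_kz_def by blast
  moreover have "sqsum (b # ga) = sqsum (ga @ [b])" by (rule sqsum_mset) simp
  ultimately show "q ^ b * (if sqsum (b # ga) = N then F (a # nu) (b # ga) else 0) =
        q ^ a * (if sqsum (ga @ [b]) = N then F (nu @ [a]) (ga @ [b]) else 0)"
    by simp
qed

lemma coeff_kz_hom:
  assumes h: "ring_hom_on h" and kz: "coeff_kz q t lam F"
  shows "coeff_kz (h q) (h t) lam (\<lambda>mu be. h (F mu be))"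
proof -
  note hs = ring_hom_onD[OF h] ring_hom_on_diff[OF h] ring_hom_on_power[OF h]
  have dec: "(if P then 0 else h x) = h (if P then 0 else x)" for P x
    by (simp add: hs)
  show ?thesis
    unfolding coeff_kz_def Let_def
  proof (intro conjI allI impI, goal_cases)
    case (1 mu be i)
    note R = kz[unfolded coeff_kz_def Let_def, THEN conjunct1, rule_format, OF 1(1-3), THEN conjunct1, rule_format, OF 1(4)]
    from arg_cong[OF R, of h] show ?case unfolding dec by (simp only: hs)
  next
    case (2 mu be i)
    then show ?case using kz unfolding coeff_kz_def by metis
  next
    case (3 a nu b ga)
    then have "q ^ b * F (a # nu) (b # ga) = q ^ a * F (nu @ [a]) (ga @ [b])"
      using kz unfolding coeff_kz_def by blast
    from arg_cong[OF this, of h] show ?case by (simp only: hs)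
  qed
qed

lemma coeff_kz_cancel:
  fixes k :: "'r::idom"
  assumes k: "k \<noteq> 0" and kz: "coeff_kz q t lam (\<lambda>mu be. k * F mu be)"
  shows "coeff_kz q t lam F"
proof -
  have dec: "(if P then 0 else k * x) = k * (if P then 0 else x)" for P x
    by simp
  show ?thesis
    unfolding coeff_kz_def Let_def
  proof (intro conjI allI impI, goal_cases)
    case (1 mu be i)
    note R = kz[unfolded coeff_kz_def Let_def, THEN conjunct1, rule_format, OF 1(1-3), THEN conjunct1, rule_format, OF 1(4)]
    from R[unfolded dec] have "k * ((if be ! i = 0 then 0 else F (swap_entries i mu) (be[i := be ! i - 1])) -
        (if be ! Suc i = 0 then 0 else F (swap_entries i mu) (be[Suc i := be ! Suc i - 1]))) =
      k * ((1 - t) * (if be ! Suc i = 0 then 0 else F mu (be[Suc i := be ! Suc i - 1])) +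
        t * (if be ! i = 0 then 0 else F mu (swap_entries i (be[i := be ! i - 1]))) -
        (if be ! Suc i = 0 then 0 else F mu (swap_entries i (be[Suc i := be ! Suc i - 1]))))"
      by (simp only: right_diff_distrib distrib_left ac_simps)
    then show ?case using k by (simp only: mult_cancel_left) simp
  next
    case (2 mu be i)
    then have "k * F mu (swap_entries i be) = k * F mu be" using kz unfolding coeff_kz_def by metis
    then show ?case using k by simp
  next
    case (3 a nu b ga)
    then have "q ^ b * (k * F (a # nu) (b # ga)) = q ^ a * (k * F (nu @ [a]) (ga @ [b]))"
      using kz unfolding coeff_kz_def by blast
    then have "k * (q ^ b * F (a # nu) (b # ga)) = k * (q ^ a * F (nu @ [a]) (ga @ [b]))"
      by (simp only: ac_simps)
    then show ?case using k by simp
  qed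
qed

lemma graded_kz_hom:
  assumes h: "ring_hom_on h" and kz: "graded_kz q t lam c"
  shows "graded_kz (h q) (h t) lam (\<lambda>mu be. h (c mu be))"
proof -
  note hs = ring_hom_onD[OF h] ring_hom_on_diff[OF h] ring_hom_on_power[OF h]
  show ?thesis
    unfolding graded_kz_def
  proof (intro conjI allI impI, goal_cases)
    case (1 mu be i)
    then show ?case using graded_kz_exchange[OF kz, of mu be i] by (simp add: hs)
  next
    case (2 mu be i)
    then show ?case using graded_kz_sym[OF kz, of mu be i] by simp
  next
    case (3 a nu b ga)
    then have "q ^ b * c (a # nu) (b # ga) = q ^ a * c (nu @ [a]) (ga @ [b])"
      by (intro graded_kz_rotate[OF kz]) auto
    from arg_cong[OF this, of h] show ?case by (simp only: hs)
  qed
qed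

lemma graded_kz_cancel:
  fixes k :: "'r::idom"
  assumes k: "k \<noteq> 0" and kz: "graded_kz q t lam (\<lambda>mu be. k * c mu be)"
  shows "graded_kz q t lam c"
  unfolding graded_kz_def
proof (intro conjI allI impI, goal_cases)
  case (1 mu be i)
  have "k * c (swap_entries i mu) be =
      k * (if be ! i < be ! Suc i then c mu (swap_entries i be) + (t - 1) * c mu be
       else t * c mu (swap_entries i be))"
    using graded_kz_exchange[OF kz, of mu be i] 1 by (simp add: algebra_simps split: if_splits)
  then show ?case using k by (simp only: mult_cancel_left) simp
next
  case (2 mu be i)
  then show ?case using graded_kz_sym[OF kz, of mu be i] k by simp
next
  case (3 a nu b ga)
  then have "q ^ b * (k * c (a # nu) (b # ga)) = q ^ a * (k * c (nu @ [a]) (ga @ [b]))"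
    by (intro graded_kz_rotate[OF kz]) auto
  then have "k * (q ^ b * c (a # nu) (b # ga)) = k * (q ^ a * c (nu @ [a]) (ga @ [b]))"
    by (simp only: ac_simps)
  then show ?case using k by simp
qed

lemma graded_kz_diff:
  assumes "graded_kz q t lam c" "graded_kz q t lam d"
  shows "graded_kz q t lam (\<lambda>mu be. c mu be - k * d mu be)"
  unfolding graded_kz_def
proof (intro conjI allI impI, goal_cases)
  case (1 mu be i)
  then show ?case
    using graded_kz_exchange[OF assms(1), of mu be i] graded_kz_exchange[OF assms(2), of mu be i]
    by (simp add: algebra_simps split: if_splits)
next
  case (2 mu be i)
  then show ?case using graded_kz_sym[OF assms(1), of mu be i] graded_kz_sym[OF assms(2), of mu be i] by simp
next
  case (3 a nu b ga)
  then have "q ^ b * c (a # nu) (b # ga) = q ^ a * c (nu @ [a]) (ga @ [b])"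
    "q ^ b * d (a # nu) (b # ga) = q ^ a * d (nu @ [a]) (ga @ [b])"
    by (auto intro: graded_kz_rotate[OF assms(1)] graded_kz_rotate[OF assms(2)])
  then show ?case by (simp add: right_diff_distrib mult.left_commute[of _ k])
qed

text \<open>The model solution: \<open>graded_kz_top_part\<close> will be applied to the difference
  between the top part of a family and a multiple of this one.\<close>

lemma graded_kz_diagonal: "graded_kz q t lam (\<lambda>mu be. of_bool (be = mu))"
  unfolding graded_kz_def
proof (intro conjI allI impI, goal_cases)
  case (1 mu be i)
  have l: "length mu = length lam" using 1(1) by (rule length_configs)
  have 2: "be = swap_entries i mu \<longleftrightarrow> swap_entries i be = mu" using 1 l by auto
  have "be ! i < be ! Suc i" if "swap_entries i be = mu"
    using that 1 l nth_swap_entries_1[of i be] nth_swap_entries_2[of i be] by simp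
  moreover have "\<not> be ! i < be ! Suc i" if "be = mu" using that 1 by simp
  ultimately show ?case using 2 by auto
next
  case (2 mu be i)
  have l: "length mu = length lam" using 2(1) by (rule length_configs)
  have "swap_entries i mu = mu" using 2 l by (intro swap_entries_eq_self) auto
  then have "swap_entries i be = mu \<longleftrightarrow> be = mu"
    using 2 l swap_entries_swap_entries[of i be] swap_entries_swap_entries[of i mu] by metis
  then show ?case by simp
qed auto

abbreviation (input) t_poly :: "rat poly poly" where "t_poly \<equiv> [:0, 1:]"
abbreviation (input) q_poly :: "rat poly poly" where "q_poly \<equiv> [:[:0, 1:]:]"

lemma ring_hom_at_0: "ring_hom_on (\<lambda>a :: 'a::comm_ring_1 poly. poly a 0)"
  by (simp add: ring_hom_on_def)

text \<open>Taking out the highest common power of t leaves a family that does not vanish at t = 0.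
  The degree of one nonzero member bounds this power, whatever the size of \<open>I\<close>.\<close>

lemma divide_t_power:
  fixes c :: "'i \<Rightarrow> 'a::idom poly"
  assumes "i0 \<in> I" "c i0 \<noteq> 0"
  obtains k c' where "\<And>i. i \<in> I \<Longrightarrow> c i = [:0, 1:] ^ k * c' i" "\<exists>i\<in>I. poly (c' i) 0 \<noteq> 0"
proof -
  define P where "P k \<longleftrightarrow> (\<forall>i\<in>I. [:0, 1:] ^ k dvd c i)" for k
  have bound: "k \<le> degree (c i0)" if "P k" for k
    using dvd_imp_degree_le[of "[:0, 1:] ^ k" "c i0"] that assms by (simp add: P_def degree_power_eq)
  have "P 0" by (simp add: P_def)
  with bound obtain k where k: "P k" and max: "\<And>l. P l \<Longrightarrow> l \<le> k"
    by (metis ex_has_greatest_nat le_less_Suc_eq less_Suc_eq_le nat_less_le order.refl)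
  define c' where "c' i = (SOME a. c i = [:0, 1:] ^ k * a)" for i
  have c': "c i = [:0, 1:] ^ k * c' i" if "i \<in> I" for i
    unfolding c'_def by (rule someI_ex) (use k that in \<open>auto simp: P_def elim: dvdE\<close>)
  have "\<not> P (Suc k)" using max by fastforce
  then obtain i where i: "i \<in> I" "\<not> [:0, 1:] ^ Suc k dvd c i" by (auto simp: P_def)
  have "poly (c' i) 0 \<noteq> 0"
  proof
    assume "poly (c' i) 0 = 0"
    then have "[:0, 1:] dvd c' i" by (simp add: poly_eq_0_iff_dvd)
    then have "[:0, 1:] ^ Suc k dvd c i"
      unfolding c'[OF i(1)] power_Suc2 by (rule mult_dvd_mono[OF dvd_refl])
    with i show False by blast
  qed
  with c' i that show ?thesis by blast
qed

text \<open>The support theorem speaks about t = 0, so it is applied to the reduction at t = 0 of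
  the family divided by its highest common power of t. What survives the passage back to generic t
  is that the entry at (\<open>lam\<close>, \<open>lam\<close>) is nonzero.\<close>

lemma graded_kz_top_part:
  fixes c :: "nat list \<Rightarrow> nat list \<Rightarrow> rat poly poly"
  assumes kz: "graded_kz q_poly t_poly lam c" and srt: "sorted_wrt (\<ge>) lam"
    and nz: "mu0 \<in> configs lam" "length be0 = length lam" "c mu0 be0 \<noteq> 0"
  shows "c lam lam \<noteq> 0"
proof -
  define I where "I = configs lam \<times> {be :: nat list. length be = length lam}"
  obtain k c' where c': "\<And>i. i \<in> I \<Longrightarrow> case_prod c i = [:0, 1:] ^ k * c' i" "\<exists>i\<in>I. poly (c' i) 0 \<noteq> 0"
    by (rule divide_t_power[of "(mu0, be0)" I "case_prod c"]) (use nz in \<open>auto simp: I_def\<close>)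
  obtain mu be where mb: "mu \<in> configs lam" "length be = length lam" "poly (c' (mu, be)) 0 \<noteq> 0"
    using c'(2) by (auto simp: I_def)
  define e where "e mu be = (if mu \<in> configs lam \<and> length be = length lam then c' (mu, be) else 0)" for mu be
  have "graded_kz q_poly t_poly lam (\<lambda>mu be. [:0, 1:] ^ k * e mu be)"
    unfolding graded_kz_def
  proof (intro conjI allI impI, goal_cases)
    case (1 mu be i)
    have l: "length mu = length lam" using 1(1) by (rule length_configs)
    show ?case using graded_kz_exchange[OF kz, of mu be i] c' 1 l by (auto simp: e_def I_def)
  next
    case (2 mu be i)
    then show ?case using graded_kz_sym[OF kz, of mu be i] c' by (auto simp: e_def I_def)
  next
    case (3 a nu b ga)
    have l: "length (a # nu) = length lam" using 3(1) by (rule length_configs)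
    have m: "nu @ [a] \<in> configs lam" using 3(1) by (simp add: configs_iff)
    have "[:0, 1:] ^ k * e (a # nu) (b # ga) = c (a # nu) (b # ga)"
      "[:0, 1:] ^ k * e (nu @ [a]) (ga @ [b]) = c (nu @ [a]) (ga @ [b])"
      using c'(1)[of "(a # nu, b # ga)"] c'(1)[of "(nu @ [a], ga @ [b])"] 3 l m
      by (simp_all add: e_def I_def)
    with graded_kz_rotate[OF kz, of a nu ga b] 3 show ?case by (simp only:)
  qed
  then have "graded_kz q_poly t_poly lam e" by (rule graded_kz_cancel[rotated]) simp
  from graded_kz_hom[OF ring_hom_at_0 this]
  have "graded_kz [:0, 1:] 0 lam (\<lambda>mu be. poly (e mu be) 0)" by simp
  from graded_kz_support[OF this srt mb(1,2)] mb have "poly (e lam lam) 0 \<noteq> 0" by (simp add: e_def)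
  then have "e lam lam \<noteq> 0" by auto
  then show ?thesis using c'(1)[of "(lam, lam)"] by (auto simp: e_def I_def configs_iff)
qed

section \<open>From Hecke operators to relations between coefficients\<close>

abbreviation swap_vars :: "nat \<Rightarrow> qtpoly \<Rightarrow> qtpoly" where
  "swap_vars i \<equiv> subst (Var(i := Var (Suc i), Suc i := Var i))"

abbreviation rotate_vars :: "nat \<Rightarrow> qtpoly \<Rightarrow> qtpoly" where
  "rotate_vars n \<equiv> subst (\<lambda>i. if i = 0 then Const qvar * Var (n - 1) else Var (i - 1))"

lemma lcoeff_swap_vars:
  assumes "in_vars n p" "length be = n" "Suc i < n"
  shows "lcoeff (swap_vars i p) be = lcoeff p (swap_entries i be)"
proof -
  define \<pi> where "\<pi> j = (if j = i then Suc i else if j = Suc i then i else j)" for j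
  have bij: "bij_betw \<pi> {..<n} {..<n}"
    by (rule bij_betwI[where g = \<pi>]) (use assms in \<open>auto simp: \<pi>_def\<close>)
  have "lcoeff (swap_vars i p) be =
    (\<Prod>i<n. 1 ^ (be ! \<pi> i)) * lcoeff p (map (\<lambda>i. be ! \<pi> i) [0..<n])"
    by (rule lcoeff_subst[OF assms(1,2) _ bij]) (auto simp: \<pi>_def)
  moreover have "map (\<lambda>i. be ! \<pi> i) [0..<n] = swap_entries i be"
    by (rule nth_equalityI) (use assms in \<open>auto simp: \<pi>_def nth_swap_entries\<close>)
  ultimately show ?thesis by simp
qed

lemma lcoeff_rotate_vars:
  assumes "in_vars n p" "length ga + 1 = n"
  shows "lcoeff (rotate_vars n p) (ga @ [b]) = qvar ^ b * lcoeff p (b # ga)"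
proof -
  define \<pi> where "\<pi> j = (if j = 0 then n - 1 else j - 1)" for j
  define k where "k j = (if j = 0 then qvar else 1)" for j :: nat
  have bij: "bij_betw \<pi> {..<n} {..<n}"
    by (rule bij_betwI[where g = "\<lambda>j. if j = n - 1 then 0 else j + 1"])
       (use assms in \<open>auto simp: \<pi>_def\<close>)
  have "lcoeff (rotate_vars n p) (ga @ [b]) =
    (\<Prod>i<n. k i ^ ((ga @ [b]) ! \<pi> i)) * lcoeff p (map (\<lambda>i. (ga @ [b]) ! \<pi> i) [0..<n])"
    by (rule lcoeff_subst[OF assms(1) _ _ bij]) (use assms(2) in \<open>auto simp: \<pi>_def k_def\<close>)
  moreover have "map (\<lambda>i. (ga @ [b]) ! \<pi> i) [0..<n] = b # ga"
    by (rule nth_equalityI) (use assms in \<open>auto simp: \<pi>_def nth_append nth_Cons' split: if_splits\<close>)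
  moreover have "(\<Prod>i<n. k i ^ ((ga @ [b]) ! \<pi> i)) = qvar ^ b"
  proof -
    have "(\<Prod>i<n. k i ^ ((ga @ [b]) ! \<pi> i)) = (\<Prod>i\<in>{0}. k i ^ ((ga @ [b]) ! \<pi> i))"
      by (rule prod.mono_neutral_right) (use assms in \<open>auto simp: k_def\<close>)
    then show ?thesis using assms by (auto simp: k_def \<pi>_def nth_append)
  qed
  ultimately show ?thesis by simp
qed

lemma Var_inject: "Var i = Var j \<longleftrightarrow> i = j"
proof
  assume "Var i = Var j"
  then have "Poly_Mapping.lookup (Var i) (Poly_Mapping.single i 1) =
    Poly_Mapping.lookup (Var j) (Poly_Mapping.single i 1)" by simp
  then have "Poly_Mapping.single i (1::nat) = Poly_Mapping.single j 1"
    by (auto simp: Var_def lookup_single when_def split: if_splits)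
  from arg_cong[OF this, of "\<lambda>p. Poly_Mapping.lookup p i"] show "i = j"
    by (auto simp: lookup_single when_def split: if_splits)
qed simp

lemma hecke_to_fract:
  assumes "hecke i p = to_fract r"
  shows "(Var i - Var (Suc i)) * r = Const (1 - tvar) * (Var (Suc i) * p) +
           Const tvar * (Var i * swap_vars i p) - Var (Suc i) * swap_vars i p"
proof -
  define X Y where "X = Var i" and "Y = Var (Suc i)"
  have XY: "X - Y \<noteq> 0" using Var_inject[of i "Suc i"] by (simp add: X_def Y_def)
  then have nz: "to_fract (X - Y) \<noteq> 0" by (simp only: to_fract_eq_0_iff not_False_eq_True)
  have clear: "a * (u - v / a * w) = a * u - v * w" if "a \<noteq> 0" for a u v w :: "qtpoly fract"
    using that by (simp add: field_simps)
  have "to_fract (X - Y) * to_fract r = to_fract (X - Y) * hecke i p" using assms by simp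
  also have "\<dots> = to_fract (X - Y) * to_fract (Const tvar * p)
      - to_fract (Const tvar * X - Y) * to_fract (p - swap_vars i p)"
    unfolding hecke_def Fract_conv_to_fract X_def[symmetric] Y_def[symmetric]
    by (rule clear[OF nz])
  finally have "to_fract ((X - Y) * r) =
      to_fract ((X - Y) * (Const tvar * p) - (Const tvar * X - Y) * (p - swap_vars i p))"
    by (simp only: to_fract_mult to_fract_diff)
  then have "(X - Y) * r = (X - Y) * (Const tvar * p) - (Const tvar * X - Y) * (p - swap_vars i p)"
    by (simp only: to_fract_eq_iff)
  then show ?thesis unfolding X_def[symmetric] Y_def[symmetric] Const_diff Const_1
    by (simp add: algebra_simps)
qed

text \<open>T_i p = t p amounts to (t x_i - x_{i+1}) (p - s_i p) = 0.\<close>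

lemma hecke_eigen_swap_vars:
  assumes "hecke i p = to_fract (Const tvar * p)"
  shows "swap_vars i p = p"
proof -
  define X Y S where "X = Var i" and "Y = Var (Suc i)" and "S = swap_vars i p"
  have "(X - Y) * (Const tvar * p) = Const (1 - tvar) * (Y * p) + Const tvar * (X * S) - Y * S"
    unfolding X_def Y_def S_def by (rule hecke_to_fract[OF assms])
  then have "(Const tvar * X - Y) * (p - S) = 0"
    by (simp add: Const_diff algebra_simps)
  moreover have "Const tvar * X - Y \<noteq> 0"
  proof
    assume "Const tvar * X - Y = 0"
    then have "Poly_Mapping.lookup (Const tvar * X) (Poly_Mapping.single (Suc i) 1) =
      Poly_Mapping.lookup Y (Poly_Mapping.single (Suc i) 1)" by simp
    moreover have "Poly_Mapping.single i (1::nat) \<noteq> Poly_Mapping.single (Suc i) 1"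
    proof
      assume "Poly_Mapping.single i (1::nat) = Poly_Mapping.single (Suc i) 1"
      from arg_cong[OF this, of "\<lambda>p. Poly_Mapping.lookup p i"] show False
        by (simp add: lookup_single when_def)
    qed
    ultimately show False by (simp add: X_def Y_def Var_def lookup_single when_def)
  qed
  ultimately show ?thesis by (simp add: S_def)
qed

lemma common_denominator:
  assumes "finite X"
  shows "\<exists>h. h \<noteq> 0 \<and> (\<forall>x\<in>X. \<exists>a. to_fract h * x = to_fract a)"
  using assms
proof (induction X rule: finite_induct)
  case empty
  show ?case by (rule exI[of _ 1]) simp
next
  case (insert x X)
  then obtain h where h: "h \<noteq> 0" "\<And>y. y \<in> X \<Longrightarrow> \<exists>a. to_fract h * y = to_fract a" by blast
  obtain a b where x: "x = Fract a b" "b \<noteq> 0" by (cases x) auto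
  have "\<exists>c. to_fract (h * b) * y = to_fract c" if "y \<in> X" for y
  proof -
    from h(2)[OF that] obtain c where c: "to_fract h * y = to_fract c" by blast
    have "to_fract (h * b) * y = to_fract (b * c)" using c by (simp add: ac_simps)
    then show ?thesis by blast
  qed
  moreover have "to_fract (h * b) * x = to_fract (h * a)"
    using x by (simp add: Fract_conv_to_fract)
  ultimately have "\<forall>y\<in>insert x X. \<exists>c. to_fract (h * b) * y = to_fract c" by blast
  moreover have "h * b \<noteq> 0" using h(1) x(2) by simp
  ultimately show ?case by blast
qed

locale asep_family =
  fixes lam :: "nat list" and f :: "nat list \<Rightarrow> qtpoly"
  assumes asep: "asep_polynomials lam f" and srt: "sorted_wrt (\<ge>) lam"
begin

lemma homog: "mu \<in> configs lam \<Longrightarrow> homogeneous (length lam) (sum_list lam) (f mu)"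
  using asep by (simp add: asep_polynomials_def Let_def)

lemma in_vars_f: "mu \<in> configs lam \<Longrightarrow> in_vars (length lam) (f mu)"
  using homog unfolding homogeneous_def in_vars_def by blast

lemma sum_list_lcoeff:
  assumes "mu \<in> configs lam" "length be = length lam" "lcoeff (f mu) be \<noteq> 0"
  shows "sum_list be = sum_list lam"
proof -
  have "Poly_Mapping.nth be \<in> Poly_Mapping.keys (f mu)" using assms(3) by (simp add: in_keys_iff)
  then have "(\<Sum>i<length lam. Poly_Mapping.lookup (Poly_Mapping.nth be) i) = sum_list lam"
    using homog[OF assms(1)] unfolding homogeneous_def by blast
  then show ?thesis using assms(2) by (simp add: sum_list_sum_nth lessThan_atLeast0 nth_default_def)
qed

lemma f_exchange:
  assumes "mu \<in> configs lam" "Suc i < length lam" "mu ! i > mu ! Suc i"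
  shows "(Var i - Var (Suc i)) * f (swap_entries i mu) = Const (1 - tvar) * (Var (Suc i) * f mu) +
           Const tvar * (Var i * swap_vars i (f mu)) - Var (Suc i) * swap_vars i (f mu)"
  by (rule hecke_to_fract) (use asep assms in \<open>simp add: asep_polynomials_def Let_def\<close>)

lemma f_symmetric:
  assumes "mu \<in> configs lam" "Suc i < length lam" "mu ! i = mu ! Suc i"
  shows "swap_vars i (f mu) = f mu"
  by (rule hecke_eigen_swap_vars) (use asep assms in \<open>simp add: asep_polynomials_def Let_def\<close>)

lemma f_rotate:
  assumes "a # nu \<in> configs lam"
  shows "Const (qvar ^ a) * f (nu @ [a]) = rotate_vars (length lam) (f (a # nu))"
proof -
  have "nu @ [a] \<in> configs lam" using assms by (simp add: configs_iff)
  then have "Const (qvar ^ last (nu @ [a])) * f (nu @ [a]) =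
      rotate_vars (length lam) (f (last (nu @ [a]) # butlast (nu @ [a])))"
    using asep unfolding asep_polynomials_def Let_def by blast
  then show ?thesis by simp
qed

lemma lcoeff_lam: "lcoeff (f lam) lam = 1"
  using asep by (simp add: asep_polynomials_def Let_def)

lemma coeff_kz_f: "coeff_kz qvar tvar lam (\<lambda>mu be. lcoeff (f mu) be)"
  unfolding coeff_kz_def Let_def
proof (intro conjI allI impI, goal_cases)
  case (1 mu be i)
  have sw: "lcoeff (swap_vars i (f mu)) b = lcoeff (f mu) (swap_entries i b)" if "length b = length lam" for b
    by (rule lcoeff_swap_vars[OF in_vars_f]) (use 1 that in auto)
  from arg_cong[OF f_exchange[OF 1(1,3,4)], of "\<lambda>p. lcoeff p be"]
  have "lcoeff (Var i * f (swap_entries i mu)) be - lcoeff (Var (Suc i) * f (swap_entries i mu)) be =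
     (1 - tvar) * lcoeff (Var (Suc i) * f mu) be + tvar * lcoeff (Var i * swap_vars i (f mu)) be
     - lcoeff (Var (Suc i) * swap_vars i (f mu)) be"
    by (simp only: left_diff_distrib lookup_minus lookup_add lookup_Const_times)
  then show ?case
    using 1(2,3) by (simp add: lcoeff_Var_times sw del: lookup_nth cong: if_cong)
next
  case (2 mu be i)
  then show ?case
    using lcoeff_swap_vars[OF in_vars_f, of mu be i] f_symmetric[of mu i] by simp
next
  case (3 a nu b ga)
  have l: "length (a # nu) = length lam" using 3(1) by (rule length_configs)
  have "lcoeff (Const (qvar ^ a) * f (nu @ [a])) (ga @ [b]) = qvar ^ b * lcoeff (f (a # nu)) (b # ga)"
    unfolding f_rotate[OF 3(1)] by (rule lcoeff_rotate_vars[OF in_vars_f]) (use 3 l in auto)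
  then show ?case by simp
qed

lemma finite_support: "finite {be. length be = length lam \<and> lcoeff (f mu) be \<noteq> 0}"
proof (rule finite_subset)
  show "{be. length be = length lam \<and> lcoeff (f mu) be \<noteq> 0} \<subseteq> expo (length lam) ` Poly_Mapping.keys (f mu)"
  proof clarify
    fix be assume "length be = length lam" "lcoeff (f mu) be \<noteq> 0"
    moreover have "expo (length lam) (Poly_Mapping.nth be) = be"
      using \<open>length be = length lam\<close> by (intro nth_equalityI) (auto simp: nth_default_def)
    ultimately show "be \<in> expo (length lam) ` Poly_Mapping.keys (f mu)"
      by (metis image_eqI in_keys_iff)
  qed
qed simp

text \<open>Clearing all denominators by one \<open>h\<close> moves the relations into polynomials
  in q and t, where divisibility by t makes sense.\<close>

lemma numerators:
  obtains h F where "h \<noteq> 0" "coeff_kz q_poly t_poly lam F"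
    "\<And>mu be. mu \<in> configs lam \<Longrightarrow> length be = length lam \<Longrightarrow>
       to_fract (F mu be) = to_fract h * lcoeff (f mu) be"
proof -
  define X where "X = insert 0 (\<Union>mu\<in>configs lam. lcoeff (f mu) ` {be. length be = length lam \<and> lcoeff (f mu) be \<noteq> 0})"
  have "finite X" unfolding X_def using finite_support by auto
  from common_denominator[OF this]
  obtain h where h: "h \<noteq> 0" "\<And>x. x \<in> X \<Longrightarrow> \<exists>a. to_fract h * x = to_fract a"
    by metis
  define F where "F mu be = (SOME a. to_fract h * lcoeff (f mu) be = to_fract a)" for mu be
  have F: "to_fract (F mu be) = to_fract h * lcoeff (f mu) be"
    if "mu \<in> configs lam" "length be = length lam" for mu be
  proof -
    have "lcoeff (f mu) be \<in> X" using that by (cases "lcoeff (f mu) be = 0") (auto simp: X_def)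
    from someI_ex[OF h(2)[OF this]] show ?thesis by (simp add: F_def)
  qed
  have hom: "to_fract q_poly = qvar" "to_fract t_poly = tvar" by (simp_all add: qvar_def tvar_def)
  have "coeff_kz q_poly t_poly lam F"
    unfolding coeff_kz_def Let_def
  proof (intro conjI allI impI, goal_cases)
    case (1 mu be i)
    have smu: "swap_entries i mu \<in> configs lam" using 1 by (simp add: length_configs[OF 1(1)])
    note R = coeff_kz_f[unfolded coeff_kz_def Let_def, THEN conjunct1, rule_format, OF 1(1-3),
        THEN conjunct1, rule_format, OF 1(4)]
    have dec: "to_fract (if P then 0 else x) = (if P then 0 else to_fract x)" for P and x :: "rat poly poly"
      by simp
    have dist: "to_fract h * (if P then 0 else x) = (if P then 0 else to_fract h * x)" for P and x :: qt
      by simp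
    have "to_fract ((if be ! i = 0 then 0 else F (swap_entries i mu) (be[i := be ! i - 1])) -
        (if be ! Suc i = 0 then 0 else F (swap_entries i mu) (be[Suc i := be ! Suc i - 1]))) =
      to_fract ((1 - t_poly) * (if be ! Suc i = 0 then 0 else F mu (be[Suc i := be ! Suc i - 1])) +
        t_poly * (if be ! i = 0 then 0 else F mu (swap_entries i (be[i := be ! i - 1]))) -
        (if be ! Suc i = 0 then 0 else F mu (swap_entries i (be[Suc i := be ! Suc i - 1]))))"
      unfolding to_fract_diff to_fract_add to_fract_mult dec hom to_fract_1
      using arg_cong[OF R, of "\<lambda>x. to_fract h * x"] 1 smu
      by (simp add: F dist right_diff_distrib distrib_left mult.left_commute[of "to_fract h"] left_diff_distrib cong: if_cong)
    then show ?case by (simp only: to_fract_eq_iff)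
  next
    case (2 mu be i)
    then have "lcoeff (f mu) (swap_entries i be) = lcoeff (f mu) be"
      using coeff_kz_f unfolding coeff_kz_def by blast
    then have "to_fract (F mu (swap_entries i be)) = to_fract (F mu be)" using 2 by (simp add: F)
    then show ?case by (simp only: to_fract_eq_iff)
  next
    case (3 a nu b ga)
    have l: "length (a # nu) = length lam" using 3(1) by (rule length_configs)
    have m: "nu @ [a] \<in> configs lam" using 3(1) by (simp add: configs_iff)
    have "qvar ^ b * lcoeff (f (a # nu)) (b # ga) = qvar ^ a * lcoeff (f (nu @ [a])) (ga @ [b])"
      using coeff_kz_f 3 unfolding coeff_kz_def by blast
    then have "to_fract h * (qvar ^ b * lcoeff (f (a # nu)) (b # ga)) =
      to_fract h * (qvar ^ a * lcoeff (f (nu @ [a])) (ga @ [b]))" by simp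
    moreover have "to_fract (q_poly ^ k) = qvar ^ k" for k
      by (induction k) (simp_all only: power_0 power_Suc to_fract_1 to_fract_mult hom)
    ultimately have "to_fract (q_poly ^ b * F (a # nu) (b # ga)) = to_fract (q_poly ^ a * F (nu @ [a]) (ga @ [b]))"
      using 3 l m F[of "a # nu" "b # ga"] F[of "nu @ [a]" "ga @ [b]"]
      by (simp only: to_fract_mult) (simp add: ac_simps)
    then show ?case by (simp only: to_fract_eq_iff)
  qed
  with h(1) F that show ?thesis by blast
qed

lemma degree_bound:
  assumes "mu \<in> configs lam" "length be = length lam" "lcoeff (f mu) be \<noteq> 0"
  shows "sqsum be \<le> (sum_list lam) ^ 2"
  using sum_list_lcoeff[OF assms] sqsum_le[of be] by simp

text \<open>The part with the maximal sum of squares over all members satisfies the graded relations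
  and is therefore nonzero at (\<open>lam\<close>, \<open>lam\<close>), which identifies the
  maximum. Subtracting the diagonal solution with the same value there leaves a family that vanishes
  at this place, hence everywhere.\<close>

theorem leading_part:
  assumes mu: "mu \<in> configs lam" and be: "length be = length lam"
  shows "sqsum lam < sqsum be \<Longrightarrow> lcoeff (f mu) be = 0"
    and "sqsum be = sqsum lam \<Longrightarrow> lcoeff (f mu) be = of_bool (be = mu)"
proof -
  obtain h F where h: "h \<noteq> 0" and kz: "coeff_kz q_poly t_poly lam F"
    and F: "\<And>mu be. mu \<in> configs lam \<Longrightarrow> length be = length lam \<Longrightarrow>
       to_fract (F mu be) = to_fract h * lcoeff (f mu) be"
    using numerators by metis
  have F0: "F mu be = 0 \<longleftrightarrow> lcoeff (f mu) be = 0" if "mu \<in> configs lam" "length be = length lam" for mu be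
    using F[OF that] h by (metis mult_eq_0_iff to_fract_eq_0_iff)
  define P where "P N \<longleftrightarrow> (\<exists>mu\<in>configs lam. \<exists>be. length be = length lam \<and> F mu be \<noteq> 0 \<and> sqsum be = N)" for N
  have self: "lam \<in> configs lam" by (simp add: configs_iff)
  have Plam: "P (sqsum lam)"
    unfolding P_def using self F0[OF self refl] lcoeff_lam by auto
  have bnd: "N \<le> (sum_list lam) ^ 2" if "P N" for N
    using that degree_bound F0 unfolding P_def by blast
  define N where "N = (GREATEST N. P N)"
  have N: "P N" and Nmax: "\<And>M. P M \<Longrightarrow> M \<le> N"
    using GreatestI_nat[of P, OF Plam] Greatest_le_nat[of P] bnd unfolding N_def by blast+
  define c where "c mu be = (if sqsum be = N then F mu be else 0)" for mu be
  have kzc: "graded_kz q_poly t_poly lam c"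
    unfolding c_def
    by (rule coeff_kz_top[OF kz]) (use Nmax in \<open>force simp: P_def\<close>)
  obtain mu0 be0 where "mu0 \<in> configs lam" "length be0 = length lam" "c mu0 be0 \<noteq> 0"
    using N unfolding P_def c_def by auto
  then have "c lam lam \<noteq> 0" by (rule graded_kz_top_part[OF kzc srt])
  then have Nlam: "N = sqsum lam" and cl: "c lam lam = F lam lam" by (auto simp: c_def split: if_splits)
  have "c mu be = F lam lam * of_bool (be = mu)" if "mu \<in> configs lam" "length be = length lam" for mu be
  proof (rule ccontr)
    assume "c mu be \<noteq> F lam lam * of_bool (be = mu)"
    then have "c mu be - F lam lam * of_bool (be = mu) \<noteq> 0" by simp
    from graded_kz_top_part[OF graded_kz_diff[OF kzc graded_kz_diagonal] srt that this] cl
    show False by simp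
  qed
  note c = this
  have "to_fract (F lam lam) = to_fract h" using F[OF self refl] lcoeff_lam by simp
  then have Fl: "F lam lam = h" by (simp only: to_fract_eq_iff)
  show "lcoeff (f mu) be = 0" if "sqsum lam < sqsum be"
  proof (rule ccontr)
    assume "lcoeff (f mu) be \<noteq> 0"
    then have "P (sqsum be)" using F0[OF mu be] mu be unfolding P_def by blast
    with Nmax Nlam that show False by fastforce
  qed
  show "lcoeff (f mu) be = of_bool (be = mu)" if "sqsum be = sqsum lam"
  proof -
    have "F mu be = h * of_bool (be = mu)" using c[OF mu be] Fl Nlam that by (simp add: c_def)
    then have "to_fract h * lcoeff (f mu) be = to_fract h * of_bool (be = mu)"
      using F[OF mu be] by (auto simp: of_bool_def)
    then show ?thesis using h by simp
  qed
qed

text \<open>\<open>poly h 0\<close> is a nonzero polynomial in q, so poles along t = 0 are excluded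
  while poles along other curves remain possible. The entry at (\<open>lam\<close>,
  \<open>lam\<close>) serves as denominator because the normalised coefficient there is 1.\<close>

theorem regular_at_t0:
  obtains h where "poly h 0 \<noteq> 0"
    "\<And>mu be. mu \<in> configs lam \<Longrightarrow> length be = length lam \<Longrightarrow>
       \<exists>a. to_fract h * lcoeff (f mu) be = to_fract a"
proof -
  obtain h F where h: "h \<noteq> 0" and kz: "coeff_kz q_poly t_poly lam F"
    and F: "\<And>mu be. mu \<in> configs lam \<Longrightarrow> length be = length lam \<Longrightarrow>
       to_fract (F mu be) = to_fract h * lcoeff (f mu) be"
    using numerators by metis
  have self: "lam \<in> configs lam" by (simp add: configs_iff)
  have "to_fract (F lam lam) = to_fract h" using F[OF self refl] lcoeff_lam by simp
  then have Fl: "F lam lam = h" by (simp only: to_fract_eq_iff)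
  define I where "I = configs lam \<times> {be :: nat list. length be = length lam}"
  obtain k F' where F': "\<And>i. i \<in> I \<Longrightarrow> case_prod F i = [:0, 1:] ^ k * F' i" "\<exists>i\<in>I. poly (F' i) 0 \<noteq> 0"
    by (rule divide_t_power[of "(lam, lam)" I "case_prod F"]) (use h Fl self in \<open>auto simp: I_def\<close>)
  define E where "E mu be = (if mu \<in> configs lam \<and> length be = length lam then F' (mu, be) else 0)" for mu be
  have EF: "[:0, 1:] ^ k * E mu be = F mu be" if "mu \<in> configs lam" "length be = length lam" for mu be
    using F'(1)[of "(mu, be)"] that by (simp add: E_def I_def)
  have "coeff_kz q_poly t_poly lam (\<lambda>mu be. [:0, 1:] ^ k * E mu be)"
    unfolding coeff_kz_def Let_def
  proof (intro conjI allI impI, goal_cases)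
    case (1 mu be i)
    have smu: "swap_entries i mu \<in> configs lam" using 1 by (simp add: length_configs[OF 1(1)])
    note R = kz[unfolded coeff_kz_def Let_def, THEN conjunct1, rule_format, OF 1(1-3),
        THEN conjunct1, rule_format, OF 1(4)]
    show ?case using R 1 smu by (simp add: EF cong: if_cong)
  next
    case (2 mu be i)
    then show ?case using kz EF unfolding coeff_kz_def by simp
  next
    case (3 a nu b ga)
    have l: "length (a # nu) = length lam" using 3(1) by (rule length_configs)
    have m: "nu @ [a] \<in> configs lam" using 3(1) by (simp add: configs_iff)
    have "q_poly ^ b * F (a # nu) (b # ga) = q_poly ^ a * F (nu @ [a]) (ga @ [b])"
      using kz 3 unfolding coeff_kz_def by blast
    then show ?case using EF[OF 3(1), of "b # ga"] EF[OF m, of "ga @ [b]"] 3 l by simp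
  qed
  then have "coeff_kz q_poly t_poly lam E" by (rule coeff_kz_cancel[rotated]) simp
  from coeff_kz_hom[OF ring_hom_at_0 this]
  have kzE: "coeff_kz [:0, 1:] 0 lam (\<lambda>mu be. poly (E mu be) 0)" by simp
  define P where "P N \<longleftrightarrow> (\<exists>mu\<in>configs lam. \<exists>be. length be = length lam \<and> poly (E mu be) 0 \<noteq> 0 \<and> sqsum be = N)" for N
  have Pex: "\<exists>N. P N" using F'(2) unfolding P_def by (force simp: E_def I_def)
  have bnd: "N \<le> (sum_list lam) ^ 2" if "P N" for N
  proof -
    from that obtain mu be where mb: "mu \<in> configs lam" "length be = length lam" "poly (E mu be) 0 \<noteq> 0" "sqsum be = N"
      unfolding P_def by blast
    then have "E mu be \<noteq> 0" by auto
    then have "F mu be \<noteq> 0" using EF[OF mb(1,2)] by (metis mult_eq_0_iff pCons_eq_0_iff power_not_zero zero_neq_one)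
    then have "lcoeff (f mu) be \<noteq> 0" using F[OF mb(1,2)] by auto
    with degree_bound mb show ?thesis by blast
  qed
  define N where "N = (GREATEST N. P N)"
  have N: "P N" and Nmax: "\<And>M. P M \<Longrightarrow> M \<le> N"
    using GreatestI_ex_nat[of P, OF Pex] Greatest_le_nat[of P] bnd unfolding N_def by blast+
  have "graded_kz [:0, 1:] 0 lam (\<lambda>mu be. if sqsum be = N then poly (E mu be) 0 else 0)"
    by (rule coeff_kz_top[OF kzE]) (use Nmax in \<open>force simp: P_def\<close>)
  moreover obtain mu0 be0 where "mu0 \<in> configs lam" "length be0 = length lam"
     "(if sqsum be0 = N then poly (E mu0 be0) 0 else 0) \<noteq> 0"
    using N unfolding P_def by auto
  ultimately have "(if sqsum lam = N then poly (E lam lam) 0 else 0) \<noteq> 0"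
    using graded_kz_support[OF _ srt] by blast
  then have "poly (E lam lam) 0 \<noteq> 0" by (auto split: if_splits)
  moreover have "\<exists>a. to_fract (E lam lam) * lcoeff (f mu) be = to_fract a"
    if mb: "mu \<in> configs lam" "length be = length lam" for mu be
  proof -
    have "to_fract ([:0, 1:] ^ k) * to_fract (E mu be) =
        to_fract ([:0, 1:] ^ k) * (to_fract (E lam lam) * lcoeff (f mu) be)"
      unfolding mult.assoc[symmetric] to_fract_mult[symmetric] EF[OF mb] EF[OF self refl] Fl
      by (rule F[OF mb])
    moreover have "to_fract ([:0, 1:] ^ k :: rat poly poly) \<noteq> 0" by (simp only: to_fract_eq_0_iff) simp
    ultimately show ?thesis by (metis mult_left_cancel)
  qed
  ultimately show ?thesis using that by blast
qed

end

section \<open>The Macdonald operator on a Hecke family\<close>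

definition swap_args :: "nat \<Rightarrow> (nat \<Rightarrow> 'a) \<Rightarrow> nat \<Rightarrow> 'a" where
  "swap_args i v = v(i := v (Suc i), Suc i := v i)"

lemma swap_args_simps [simp]:
  "swap_args i v i = v (Suc i)" "swap_args i v (Suc i) = v i"
  "j \<noteq> i \<Longrightarrow> j \<noteq> Suc i \<Longrightarrow> swap_args i v j = v j"
  by (auto simp: swap_args_def)

lemma swap_args_swap_args [simp]: "swap_args i (swap_args i v) = v"
  by (auto simp: swap_args_def)

lemma swap_args_inj:
  assumes "inj_on v {..<n}" "Suc i < n"
  shows "inj_on (swap_args i v) {..<n}"
proof -
  define \<pi> where "\<pi> j = (if j = i then Suc i else if j = Suc i then i else j)" for j
  have "swap_args i v = v \<circ> \<pi>" by (auto simp: swap_args_def \<pi>_def)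
  moreover have "inj_on \<pi> {..<n}" by (auto simp: \<pi>_def inj_on_def)
  moreover have "\<pi> ` {..<n} \<subseteq> {..<n}" using assms(2) by (auto simp: \<pi>_def)
  ultimately show ?thesis using assms(1) by (simp add: comp_inj_on inj_on_subset)
qed

text \<open>Stated for functions on points over a field, so that one computation covers the ASEP
  polynomials and the monomials of an elementary symmetric function. The condition on t makes every
  eigenvector of T_i with eigenvalue t symmetric.\<close>

locale hecke_family =
  fixes q t :: "'a::field" and lam :: "nat list" and Psi :: "nat list \<Rightarrow> (nat \<Rightarrow> 'a) \<Rightarrow> 'a"
  assumes t: "t ^ 2 \<noteq> 1"
    and desc: "\<And>mu i v. mu \<in> configs lam \<Longrightarrow> Suc i < length lam \<Longrightarrow> mu ! i > mu ! Suc i \<Longrightarrow>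
      v i \<noteq> v (Suc i) \<Longrightarrow>
      Psi (swap_entries i mu) v =
        t * Psi mu v - (t * v i - v (Suc i)) / (v i - v (Suc i)) * (Psi mu v - Psi mu (swap_args i v))"
    and eq: "\<And>mu i v. mu \<in> configs lam \<Longrightarrow> Suc i < length lam \<Longrightarrow> mu ! i = mu ! Suc i \<Longrightarrow>
      Psi mu (swap_args i v) = Psi mu v"
    and rotate: "\<And>a nu v. a # nu \<in> configs lam \<Longrightarrow>
      q ^ a * Psi (nu @ [a]) v = Psi (a # nu) (\<lambda>i. if i = 0 then q * v (length lam - 1) else v (i - 1))"
    and local: "\<And>mu v w. mu \<in> configs lam \<Longrightarrow> \<forall>i<length lam. v i = w i \<Longrightarrow> Psi mu v = Psi mu w"
begin

abbreviation "n \<equiv> length lam"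

definition fac :: "'a \<Rightarrow> 'a \<Rightarrow> 'a" where
  "fac x y = (t * x - y) / (x - y)"

definition hop :: "nat \<Rightarrow> ((nat \<Rightarrow> 'a) \<Rightarrow> 'a) \<Rightarrow> (nat \<Rightarrow> 'a) \<Rightarrow> 'a" where
  "hop i h v = t * h v - fac (v i) (v (Suc i)) * (h v - h (swap_args i v))"

lemma fac_swap: "x \<noteq> y \<Longrightarrow> 1 + t - fac x y = fac y x"
  by (simp add: fac_def field_simps)

text \<open>The three-term identity by which \<open>layers_from\<close> merges the factors belonging
  to two neighbouring indices.\<close>

lemma fac_triple:
  assumes "x \<noteq> y" "x \<noteq> z" "y \<noteq> z"
  shows "fac y x * fac z y + fac x y * fac z x - t = fac z x * fac z y"
proof -
  have ne: "x - y \<noteq> 0" "z - x \<noteq> 0" "z - y \<noteq> 0" using assms by auto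
  have yx: "fac y x = - (t * y - x) / (x - y)" using ne by (simp add: fac_def divide_simps) (simp add: algebra_simps)
  show ?thesis
    unfolding yx unfolding fac_def using ne
    by (simp add: divide_simps) (simp add: algebra_simps)
qed

text \<open>Symmetrised form of the Hecke generator: both values enter with a factor
  \<open>fac\<close>, and the two orders of its arguments sum to 1 + t.\<close>

lemma one_plus_hop:
  assumes "v k \<noteq> v (Suc k)"
  shows "h v + hop k h v = fac (v (Suc k)) (v k) * h v + fac (v k) (v (Suc k)) * h (swap_args k v)"
  unfolding fac_swap[OF assms, symmetric] hop_def by (simp add: algebra_simps)

lemma hop_Psi:
  assumes mu: "mu \<in> configs lam" and i: "Suc i < n" and v: "v i \<noteq> v (Suc i)"
  shows "hop i (Psi mu) v =
    (if mu ! i > mu ! Suc i then Psi (swap_entries i mu) v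
     else if mu ! i = mu ! Suc i then t * Psi mu v
     else (t - 1) * Psi mu v + t * Psi (swap_entries i mu) v)"
proof -
  consider "mu ! i > mu ! Suc i" | "mu ! i = mu ! Suc i" | "mu ! i < mu ! Suc i" by linarith
  then show ?thesis
  proof cases
    case 1
    then show ?thesis using desc[OF mu i 1 v] by (simp add: hop_def fac_def)
  next
    case 2
    then show ?thesis using eq[OF mu i 2] by (simp add: hop_def)
  next
    case 3
    define nu where "nu = swap_entries i mu"
    have len: "length mu = n" using mu by (rule length_configs)
    have nu: "nu \<in> configs lam" "swap_entries i nu = mu" "nu ! i > nu ! Suc i"
      using mu i len 3 by (simp_all add: nu_def)
    define A B where "A = fac (v i) (v (Suc i))" and "B = fac (v (Suc i)) (v i)"
    define X Y where "X = Psi nu v" and "Y = Psi nu (swap_args i v)"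
    have M: "Psi mu v = t * X - A * (X - Y)" "Psi mu (swap_args i v) = t * Y - B * (Y - X)"
      using desc[OF nu(1) i nu(3), of v] desc[OF nu(1) i nu(3), of "swap_args i v"] v
      by (simp_all add: nu A_def B_def X_def Y_def fac_def)
    have AB: "B = 1 + t - A" using fac_swap[OF v] by (simp add: A_def B_def)
    have "hop i (Psi mu) v = t * (t * X - A * (X - Y)) - A * ((t * X - A * (X - Y)) - (t * Y - B * (Y - X)))"
      by (simp add: hop_def M A_def[symmetric])
    also have "\<dots> = (t - 1) * (t * X - A * (X - Y)) + t * X"
      unfolding AB by (simp add: algebra_simps)
    finally show ?thesis using 3 by (simp add: M X_def nu_def)
  qed
qed

lemma sum_configs_swap:
  assumes "Suc i < n"
  shows "(\<Sum>mu\<in>configs lam. h (swap_entries i mu)) = (\<Sum>mu\<in>configs lam. h mu)"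
proof (rule sum.reindex_bij_witness[where i = "swap_entries i" and j = "swap_entries i"])
  fix mu assume "mu \<in> configs lam"
  moreover from this have "length mu = n" by (rule length_configs)
  ultimately show "swap_entries i (swap_entries i mu) = mu" "swap_entries i mu \<in> configs lam"
    "swap_entries i (swap_entries i mu) = mu" "swap_entries i mu \<in> configs lam"
    "h (swap_entries i mu) = h (swap_entries i mu)"
    using assms by auto
qed

lemma hop_sum:
  assumes i: "Suc i < n" and v: "v i \<noteq> v (Suc i)"
  shows "hop i (\<lambda>v. \<Sum>mu\<in>configs lam. r mu * Psi mu v) v =
    (\<Sum>mu\<in>configs lam.
       (if mu ! i > mu ! Suc i then t * r (swap_entries i mu)
        else if mu ! i = mu ! Suc i then t * r mu
        else r (swap_entries i mu) + (t - 1) * r mu) * Psi mu v)"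
proof -
  define S where "S = swap_entries i"
  have S: "S mu \<in> configs lam" "S (S mu) = mu" "S mu ! i = mu ! Suc i" "S mu ! Suc i = mu ! i"
    if "mu \<in> configs lam" for mu
    using that i length_configs[OF that] by (simp_all add: S_def)
  have eqS: "S mu = mu" if "mu \<in> configs lam" "mu ! i = mu ! Suc i" for mu
    using that i length_configs[OF that(1)] by (simp add: S_def swap_entries_eq_self)
  have "hop i (\<lambda>v. \<Sum>mu\<in>configs lam. r mu * Psi mu v) v = (\<Sum>mu\<in>configs lam. r mu * hop i (Psi mu) v)"
    by (simp add: hop_def sum_distrib_left sum_subtractf[symmetric] algebra_simps)
  also have "\<dots> = (\<Sum>mu\<in>configs lam.
      (if mu ! i < mu ! Suc i then (t - 1) * r mu else if mu ! i = mu ! Suc i then t * r mu else 0) * Psi mu v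
      + (if mu ! i > mu ! Suc i then r mu else if mu ! i = mu ! Suc i then 0 else t * r mu) * Psi (S mu) v)"
    by (intro sum.cong refl) (use i v in \<open>auto simp: hop_Psi S_def algebra_simps\<close>)
  also have "\<dots> = (\<Sum>mu\<in>configs lam.
      (if mu ! i < mu ! Suc i then (t - 1) * r mu else if mu ! i = mu ! Suc i then t * r mu else 0) * Psi mu v)
      + (\<Sum>mu\<in>configs lam. (if mu ! i > mu ! Suc i then r mu else if mu ! i = mu ! Suc i then 0 else t * r mu) * Psi (S mu) v)"
    by (rule sum.distrib)
  also have "(\<Sum>mu\<in>configs lam. (if mu ! i > mu ! Suc i then r mu else if mu ! i = mu ! Suc i then 0 else t * r mu) * Psi (S mu) v)
     = (\<Sum>mu\<in>configs lam. (if S mu ! i > S mu ! Suc i then r (S mu) else if S mu ! i = S mu ! Suc i then 0 else t * r (S mu)) * Psi (S (S mu)) v)"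
    using sum_configs_swap[OF i, symmetric,
      of "\<lambda>mu. (if mu ! i > mu ! Suc i then r mu else if mu ! i = mu ! Suc i then 0 else t * r mu) * Psi (S mu) v"]
    unfolding S_def .
  also have "\<dots> = (\<Sum>mu\<in>configs lam. (if mu ! i < mu ! Suc i then r (S mu) else if mu ! i = mu ! Suc i then 0 else t * r (S mu)) * Psi mu v)"
    by (intro sum.cong refl) (auto simp: S)
  finally show ?thesis
    unfolding sum.distrib[symmetric] S_def[symmetric]
    by (auto intro!: sum.cong simp: algebra_simps)
qed

text \<open>\<open>trail\<close> is the coefficient with which \<open>Psi mu\<close> occurs in \<open>T\<^sub>k \<dots> T\<^sub>n\<^sub>-\<^sub>1\<close> applied to the sum of the
  \<open>q\<^bsup>last mu\<^esup> Psi mu\<close>; the sum over \<open>k\<close> depends on the content of \<open>mu\<close> only and is the eigenvalue.\<close>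
primrec trail :: "nat \<Rightarrow> nat list \<Rightarrow> 'a" where
  "trail c [] = q ^ c"
| "trail c (y # w) = (if y \<le> c then t * trail c w else trail c w + (t - 1) * trail y w)"

primrec total :: "nat list \<Rightarrow> 'a" where
  "total [] = 0"
| "total (c # w) = trail c w + total w"

lemma trail_swap: "trail c (u @ a # b # v) = trail c (u @ b # a # v)"
proof -
  have base: "trail c (a # b # v) = trail c (b # a # v)" if "a < b" for a b c v
    using that by (auto simp: algebra_simps)
  have "trail c (a # b # v) = trail c (b # a # v)" for c
    by (cases a b rule: linorder_cases) (simp_all only: base base[symmetric])
  then show ?thesis by (induction u arbitrary: c) auto
qed

text \<open>The two leading trails are not preserved separately, only their sum.\<close>

lemma total_swap: "total (u @ a # b # v) = total (u @ b # a # v)"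
proof -
  have base: "total (a # b # v) = total (b # a # v)" if "a < b" for a b v
    using that by (simp add: algebra_simps)
  have "total (a # b # v) = total (b # a # v)"
    by (cases a b rule: linorder_cases) (simp_all only: base base[symmetric])
  then show ?thesis by (induction u) (auto simp: trail_swap)
qed

lemma total_mset:
  assumes "mset v = mset w"
  shows "total v = total w"
proof (rule adjacent_swaps_invariant[OF _ assms])
  fix w :: "nat list" and i assume "Suc i < length w"
  then show "total (swap_entries i w) = total w"
    using total_swap[of "take i w" "w ! Suc i" "w ! i"] split_at_pair[of i w]
      swap_entries_append[of "take i w" "w ! i" "w ! Suc i" "drop (Suc (Suc i)) w"]
    by (metis Suc_lessD length_take min.absorb4)
qed

lemma trail_greatest: "\<forall>y\<in>set w. y \<le> c \<Longrightarrow> trail c w = t ^ length w * q ^ c"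
  by (induction w) auto

lemma total_sorted:
  "sorted_wrt (\<ge>) w \<Longrightarrow> total w = (\<Sum>i<length w. q ^ (w ! i) * t ^ (length w - Suc i))"
proof (induction w)
  case (Cons c w)
  then show ?case by (simp add: trail_greatest sum.lessThan_Suc_shift mult.commute del: sum.lessThan_Suc)
qed simp

lemma total_nth: "total w = (\<Sum>k<length w. trail (w ! k) (drop (Suc k) w))"
  by (induction w) (simp_all add: sum.lessThan_Suc_shift del: sum.lessThan_Suc)

definition layer :: "nat \<Rightarrow> (nat \<Rightarrow> 'a) \<Rightarrow> 'a" where
  "layer k v = (\<Sum>mu\<in>configs lam. trail (mu ! k) (drop (Suc k) mu) * Psi mu v)"

lemma drop_swap_entries: "Suc i < k \<Longrightarrow> drop k (swap_entries i mu) = drop k mu"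
  by (simp add: swap_entries_def)

lemma hop_layer:
  assumes k: "Suc k < n" and v: "v k \<noteq> v (Suc k)"
  shows "hop k (layer (Suc k)) v = layer k v"
proof -
  have "hop k (layer (Suc k)) v = (\<Sum>mu\<in>configs lam.
       (if mu ! k > mu ! Suc k then t * trail (swap_entries k mu ! Suc k) (drop (Suc (Suc k)) (swap_entries k mu))
        else if mu ! k = mu ! Suc k then t * trail (mu ! Suc k) (drop (Suc (Suc k)) mu)
        else trail (swap_entries k mu ! Suc k) (drop (Suc (Suc k)) (swap_entries k mu))
          + (t - 1) * trail (mu ! Suc k) (drop (Suc (Suc k)) mu)) * Psi mu v)"
    using hop_sum[OF k v, of "\<lambda>mu. trail (mu ! Suc k) (drop (Suc (Suc k)) mu)"]
    by (simp add: layer_def[abs_def])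
  also have "\<dots> = layer k v"
    unfolding layer_def
  proof (intro sum.cong refl)
    fix mu assume "mu \<in> configs lam"
    then have len: "length mu = n" by (rule length_configs)
    have "drop (Suc k) mu = mu ! Suc k # drop (Suc (Suc k)) mu"
      using k len by (simp add: Cons_nth_drop_Suc)
    then show "(if mu ! k > mu ! Suc k then t * trail (swap_entries k mu ! Suc k) (drop (Suc (Suc k)) (swap_entries k mu))
        else if mu ! k = mu ! Suc k then t * trail (mu ! Suc k) (drop (Suc (Suc k)) mu)
        else trail (swap_entries k mu ! Suc k) (drop (Suc (Suc k)) (swap_entries k mu))
          + (t - 1) * trail (mu ! Suc k) (drop (Suc (Suc k)) mu)) * Psi mu v
       = trail (mu ! k) (drop (Suc k) mu) * Psi mu v"
      using k len by (simp add: drop_swap_entries)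
  qed
  finally show ?thesis .
qed

text \<open>The eigenvalue equation at a point and at its swap multiplies the difference of the two
  values by t x - y and by t y - x. Both factors vanish only if t squared is 1 or x = y.\<close>

lemma hop_eigen_symmetric:
  assumes "hop k h v = t * h v" "hop k h (swap_args k v) = t * h (swap_args k v)" and v: "v k \<noteq> v (Suc k)"
  shows "h (swap_args k v) = h v"
proof -
  define X Y where "X = h v" and "Y = h (swap_args k v)"
  have "fac (v k) (v (Suc k)) * (X - Y) = 0" "fac (v (Suc k)) (v k) * (Y - X) = 0"
    using assms by (simp_all add: hop_def X_def Y_def)
  moreover have "fac (v k) (v (Suc k)) \<noteq> 0 \<or> fac (v (Suc k)) (v k) \<noteq> 0"
  proof (rule ccontr)
    assume "\<not> ?thesis"
    then have a: "t * v k = v (Suc k)" "t * v (Suc k) = v k"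
      using v by (auto simp: fac_def)
    then have "t ^ 2 * v k = v k" by (simp add: power2_eq_square mult.assoc)
    then have "v k = 0" using t by (metis mult_cancel_right1)
    with a v show False by simp
  qed
  ultimately show ?thesis by (auto simp: X_def Y_def)
qed

lemma sum_symmetric:
  assumes i: "Suc i < n"
  shows "(\<Sum>mu\<in>configs lam. Psi mu (swap_args i v)) = (\<Sum>mu\<in>configs lam. Psi mu v)"
proof (cases "v i = v (Suc i)")
  case True
  then have "swap_args i v = v" by (auto simp: swap_args_def)
  then show ?thesis by simp
next
  case False
  have "hop i (\<lambda>v. \<Sum>mu\<in>configs lam. 1 * Psi mu v) v = t * (\<Sum>mu\<in>configs lam. 1 * Psi mu v)"
    if "v i \<noteq> v (Suc i)" for v
    unfolding hop_sum[OF i that] sum_distrib_left by (intro sum.cong refl) simp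
  then show ?thesis
    using hop_eigen_symmetric[of i "\<lambda>v. \<Sum>mu\<in>configs lam. Psi mu v" v] False by simp
qed

text \<open>In the last layer the coefficient of \<open>Psi mu\<close> is q raised to the last
  entry, which does not see an exchange of two earlier entries.\<close>

lemma last_layer_symmetric:
  assumes k: "Suc k < n - 1" and v: "v k \<noteq> v (Suc k)"
  shows "layer (n - 1) (swap_args k v) = layer (n - 1) v"
proof -
  have hop: "hop k (layer (n - 1)) v = t * layer (n - 1) v" if v: "v k \<noteq> v (Suc k)" for v
  proof -
    define r where "r mu = trail (mu ! (n - 1)) (drop (Suc (n - 1)) mu)" for mu
    have "hop k (layer (n - 1)) v = (\<Sum>mu\<in>configs lam.
       (if mu ! k > mu ! Suc k then t * r (swap_entries k mu)
        else if mu ! k = mu ! Suc k then t * r mu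
        else r (swap_entries k mu) + (t - 1) * r mu) * Psi mu v)"
      unfolding layer_def[abs_def] r_def[symmetric] by (rule hop_sum) (use k v in auto)
    also have "\<dots> = (\<Sum>mu\<in>configs lam. t * (r mu * Psi mu v))"
    proof (intro sum.cong refl)
      fix mu assume "mu \<in> configs lam"
      then have len: "length mu = n" by (rule length_configs)
      have "r (swap_entries k mu) = r mu"
        using k len by (simp add: r_def nth_swap_entries drop_swap_entries)
      then show "(if mu ! k > mu ! Suc k then t * r (swap_entries k mu)
        else if mu ! k = mu ! Suc k then t * r mu
        else r (swap_entries k mu) + (t - 1) * r mu) * Psi mu v = t * (r mu * Psi mu v)"
        by (simp add: algebra_simps)
    qed
    finally show ?thesis by (simp add: layer_def r_def sum_distrib_left)
  qed
  show ?thesis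
    by (rule hop_eigen_symmetric) (use hop v in auto)
qed

definition to_end :: "nat \<Rightarrow> (nat \<Rightarrow> 'a) \<Rightarrow> nat \<Rightarrow> 'a" where
  "to_end i v j = (if j < i then v j else if j < n - 1 then v (Suc j) else if j = n - 1 then v i else v j)"

text \<open>Let S_k be the sum of the layers from k on and T_k the operator \<open>hop k\<close>.
  Layer k is T_k applied to S_{k+1} - S_{k+2}, and S_{k+2} is symmetric in the variables k and k +
  1, whence S_k = (1 + T_k) S_{k+1} - t S_{k+2}. By \<open>one_plus_hop\<close> the coefficients of
  1 + T_k are factors \<open>fac\<close>, and \<open>fac_triple\<close> recombines the three
  sums.\<close>

lemma layers_from:
  assumes "k < n" "inj_on v {..<n}"
  shows "(\<Sum>l=k..<n. layer l v) =
    (\<Sum>i=k..<n. (\<Prod>l\<in>{k..<n} - {i}. fac (v i) (v l)) * layer (n - 1) (to_end i v))"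
  using assms
proof (induction "n - k" arbitrary: k v rule: less_induct)
  case less
  note inj = less.prems(2)
  have vne: "v a \<noteq> v b" if "a < n" "b < n" "a \<noteq> b" for a b
    using inj that by (auto simp: inj_on_def)
  show ?case
  proof (cases "Suc k = n")
    case True
    have "layer (n - 1) v = layer (n - 1) (to_end (n - 1) v)"
      unfolding layer_def using True
      by (intro sum.cong refl arg_cong2[of _ _ _ _ "(*)"] local) (auto simp: to_end_def)
    moreover have "{k..<n} = {k}" "k = n - 1" using True by auto
    ultimately show ?thesis by simp
  next
    case False
    with less.prems have k: "Suc k < n" by simp
    define S where "S m w = (\<Sum>l=m..<n. layer l w)" for m w
    define P where "P m w i = (\<Prod>l\<in>{m..<n} - {i}. fac (w i) (w l))" for m w i
    define H where "H i w = layer (n - 1) (to_end i w)" for i w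
    have IH: "S m w = (\<Sum>i=m..<n. P m w i * H i w)" if "k < m" "m \<le> n" "inj_on w {..<n}" for m w
    proof (cases "m = n")
      case False
      then show ?thesis unfolding S_def P_def H_def using that by (intro less.hyps) auto
    qed (simp add: S_def)
    define w where "w = swap_args k v"
    have winj: "inj_on w {..<n}" unfolding w_def by (rule swap_args_inj[OF inj k])
    have wv: "w k = v (Suc k)" "w (Suc k) = v k" "\<And>l. Suc k < l \<Longrightarrow> w l = v l"
      by (auto simp: w_def)
    have kk: "v k \<noteq> v (Suc k)" using vne k by simp
    have Hsym: "H i w = H i v" if i: "Suc k < i" "i < n" for i
    proof -
      have "to_end i w = swap_args k (to_end i v)"
        using i by (auto simp: to_end_def w_def swap_args_def fun_eq_iff)
      moreover have "to_end i v k \<noteq> to_end i v (Suc k)" using i kk by (simp add: to_end_def)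
      ultimately show ?thesis
        unfolding H_def using last_layer_symmetric[of k "to_end i v"] i by simp
    qed
    have S2: "S (Suc (Suc k)) w = S (Suc (Suc k)) v"
    proof -
      have "P (Suc (Suc k)) w i = P (Suc (Suc k)) v i" if "i \<in> {Suc (Suc k)..<n}" for i
        unfolding P_def by (intro prod.cong refl) (use that in \<open>auto simp: wv\<close>)
      then show ?thesis using k winj inj Hsym by (simp add: IH)
    qed
    have split: "S k v = layer k v + S (Suc k) v" "S (Suc k) v = layer (Suc k) v + S (Suc (Suc k)) v" for v
      using k by (simp_all add: S_def sum.atLeast_Suc_lessThan)
    have "layer k v = hop k (\<lambda>v. S (Suc k) v - S (Suc (Suc k)) v) v"
      using hop_layer[OF k kk] by (simp add: split(2))
    also have "\<dots> = hop k (S (Suc k)) v - t * S (Suc (Suc k)) v"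
      using S2 by (simp add: hop_def w_def[symmetric] algebra_simps)
    finally have "S k v = (S (Suc k) v + hop k (S (Suc k)) v) - t * S (Suc (Suc k)) v"
      using split(1) by simp
    then have Sk: "S k v = fac (v (Suc k)) (v k) * S (Suc k) v + fac (v k) (v (Suc k)) * S (Suc k) w
        - t * S (Suc (Suc k)) v"
      using one_plus_hop[OF kk, of "S (Suc k)"] by (simp add: w_def)
    define J where "J = {Suc (Suc k)..<n}"
    have sets: "{k..<n} = insert k (insert (Suc k) J)" "{Suc k..<n} = insert (Suc k) J"
      "finite J" "k \<notin> J" "Suc k \<notin> J" using k by (auto simp: J_def)
    define Q where "Q i = (\<Prod>l\<in>J - {i}. fac (v i) (v l))" for i
    have Jw: "w l = v l" if "l \<in> J" for l using that wv(3) by (auto simp: J_def)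
    have P1: "P (Suc k) v (Suc k) = Q (Suc k)" "P (Suc k) w (Suc k) = Q k" "P k v k = fac (v k) (v (Suc k)) * Q k"
      "P k v (Suc k) = fac (v (Suc k)) (v k) * Q (Suc k)"
      using sets by (auto simp: P_def Q_def insert_Diff_if wv Jw intro!: prod.cong)
    have P2: "P (Suc k) v i = fac (v i) (v (Suc k)) * Q i" "P (Suc k) w i = fac (v i) (v k) * Q i"
      "P k v i = fac (v i) (v k) * (fac (v i) (v (Suc k)) * Q i)" "P (Suc (Suc k)) v i = Q i"
      if i: "i \<in> J" for i
    proof -
      have ne: "i \<noteq> k" "i \<noteq> Suc k" using i sets by auto
      have "(\<Prod>l\<in>J - {i}. fac (w i) (w l)) = Q i"
        unfolding Q_def by (intro prod.cong refl) (use i in \<open>auto simp: Jw\<close>)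
      then show "P (Suc k) v i = fac (v i) (v (Suc k)) * Q i" "P (Suc k) w i = fac (v i) (v k) * Q i"
        "P k v i = fac (v i) (v k) * (fac (v i) (v (Suc k)) * Q i)" "P (Suc (Suc k)) v i = Q i"
        using sets ne i by (simp_all add: P_def Q_def insert_Diff_if wv Jw J_def[symmetric])
    qed
    have Hk: "H (Suc k) w = H k v"
    proof -
      have "to_end (Suc k) w = to_end k v"
        using k by (auto simp: to_end_def w_def swap_args_def fun_eq_iff less_Suc_eq)
      then show ?thesis by (simp add: H_def)
    qed
    have e1: "S (Suc k) v = Q (Suc k) * H (Suc k) v + (\<Sum>i\<in>J. fac (v i) (v (Suc k)) * Q i * H i v)"
      using IH[of "Suc k" v] k inj sets by (simp add: P1 P2)
    have e2: "S (Suc k) w = Q k * H k v + (\<Sum>i\<in>J. fac (v i) (v k) * Q i * H i v)"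
    proof -
      have "(\<Sum>i\<in>J. P (Suc k) w i * H i w) = (\<Sum>i\<in>J. fac (v i) (v k) * Q i * H i v)"
        by (intro sum.cong refl) (auto simp: P2 Hsym J_def)
      then show ?thesis using IH[of "Suc k" w] k winj sets by (simp add: P1 Hk)
    qed
    have e3: "S (Suc (Suc k)) v = (\<Sum>i\<in>J. Q i * H i v)"
      using IH[of "Suc (Suc k)" v] k inj by (simp add: P2 J_def[symmetric])
    have e4: "(\<Sum>i=k..<n. P k v i * H i v) = fac (v k) (v (Suc k)) * Q k * H k v +
        fac (v (Suc k)) (v k) * Q (Suc k) * H (Suc k) v +
        (\<Sum>i\<in>J. fac (v i) (v k) * fac (v i) (v (Suc k)) * (Q i * H i v))"
      using sets by (simp add: P1 P2 ac_simps)
    have trip: "(\<Sum>i\<in>J. fac (v i) (v k) * fac (v i) (v (Suc k)) * (Q i * H i v)) =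
       fac (v (Suc k)) (v k) * (\<Sum>i\<in>J. fac (v i) (v (Suc k)) * Q i * H i v) +
       fac (v k) (v (Suc k)) * (\<Sum>i\<in>J. fac (v i) (v k) * Q i * H i v) - t * (\<Sum>i\<in>J. Q i * H i v)"
      unfolding sum_distrib_left sum.distrib[symmetric] sum_subtractf[symmetric]
    proof (intro sum.cong refl)
      fix i assume i: "i \<in> J"
      then have tr: "fac (v (Suc k)) (v k) * fac (v i) (v (Suc k)) + fac (v k) (v (Suc k)) * fac (v i) (v k) - t
         = fac (v i) (v k) * fac (v i) (v (Suc k))"
        using k by (intro fac_triple vne) (auto simp: J_def)
      show "fac (v i) (v k) * fac (v i) (v (Suc k)) * (Q i * H i v) =
        fac (v (Suc k)) (v k) * (fac (v i) (v (Suc k)) * Q i * H i v) +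
        fac (v k) (v (Suc k)) * (fac (v i) (v k) * Q i * H i v) - t * (Q i * H i v)"
        unfolding tr[symmetric] by (simp add: algebra_simps)
    qed
    have "S k v = (\<Sum>i=k..<n. P k v i * H i v)"
      unfolding Sk e1 e2 e3 e4 trip by (simp add: algebra_simps)
    then show ?thesis by (simp add: S_def P_def H_def)
  qed
qed

lemma sum_front:
  assumes "i < n"
  shows "(\<Sum>mu\<in>configs lam. Psi mu (\<lambda>j. if j = 0 then w i else if j \<le> i then w (j - 1) else w j)) =
    (\<Sum>mu\<in>configs lam. Psi mu w)"
  using assms
proof (induction i arbitrary: w)
  case 0
  have "(\<lambda>j. if j = 0 then w 0 else if j \<le> 0 then w (j - 1) else w j) = w" by auto
  then show ?case by simp
next
  case (Suc i)
  have "(\<lambda>j. if j = 0 then w (Suc i) else if j \<le> Suc i then w (j - 1) else w j) =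
    (\<lambda>j. if j = 0 then swap_args i w i else if j \<le> i then swap_args i w (j - 1) else swap_args i w j)"
    by (rule ext) (auto simp: swap_args_def)
  with Suc.IH[of "swap_args i w"] Suc.prems sum_symmetric[of i w] show ?case by simp
qed

text \<open>The power of q in the last layer is what the cyclic relation absorbs: the last argument
  goes to the front multiplied by q, and the symmetry of the sum returns it to place
  \<open>i\<close>. This is where the q-shift of the operator comes from.\<close>

lemma last_layer_to_end:
  assumes i: "i < n"
  shows "layer (n - 1) (to_end i v) = (\<Sum>mu\<in>configs lam. Psi mu (v(i := q * v i)))"
proof -
  define w where "w = v(i := q * v i)"
  define z where "z j = (if j = 0 then w i else if j \<le> i then w (j - 1) else w j)" for j
  have "layer (n - 1) (to_end i v) = (\<Sum>mu\<in>configs lam. Psi (last mu # butlast mu) z)"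
    unfolding layer_def
  proof (intro sum.cong refl)
    fix mu assume mu: "mu \<in> configs lam"
    then have len: "length mu = n" by (rule length_configs)
    then have ne: "mu \<noteq> []" using i by auto
    define a nu where "a = last mu" and "nu = butlast mu"
    have e: "mu = nu @ [a]" using ne by (simp add: a_def nu_def)
    have m: "a # nu \<in> configs lam" using mu by (simp add: configs_iff e)
    have "n - 1 = length nu" using len e by simp
    then have "trail (mu ! (n - 1)) (drop (Suc (n - 1)) mu) = q ^ a"
      using e by simp
    moreover have "Psi (a # nu) (\<lambda>j. if j = 0 then q * to_end i v (n - 1) else to_end i v (j - 1)) = Psi (a # nu) z"
      by (rule local[OF m]) (use i in \<open>auto simp: to_end_def z_def w_def\<close>)
    ultimately show "trail (mu ! (n - 1)) (drop (Suc (n - 1)) mu) * Psi mu (to_end i v) =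
        Psi (last mu # butlast mu) z"
      using rotate[OF m, of "to_end i v"] by (simp add: e)
  qed
  also have "\<dots> = (\<Sum>mu\<in>configs lam. Psi mu z)"
  proof (rule sum.reindex_bij_witness[where i = "\<lambda>mu. tl mu @ [hd mu]" and j = "\<lambda>mu. last mu # butlast mu"])
    fix mu assume mu: "mu \<in> configs lam"
    then have "mu \<noteq> []" using i length_configs[OF mu] by auto
    then have "butlast mu @ [last mu] = mu" "hd mu # tl mu = mu" by auto
    then have "mset (last mu # butlast mu) = mset mu" "mset (tl mu @ [hd mu]) = mset mu"
      by (auto dest: arg_cong[of _ _ mset])
    then show "last mu # butlast mu \<in> configs lam" "tl mu @ [hd mu] \<in> configs lam"
      using mu by (simp_all add: configs_iff)
    show "tl (last mu # butlast mu) @ [hd (last mu # butlast mu)] = mu"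
      "last (tl mu @ [hd mu]) # butlast (tl mu @ [hd mu]) = mu"
      using \<open>mu \<noteq> []\<close> by auto
  qed simp
  also have "\<dots> = (\<Sum>mu\<in>configs lam. Psi mu w)"
    unfolding z_def by (rule sum_front[OF i])
  finally show ?thesis by (simp add: w_def)
qed

text \<open>The layers are summed in two ways: by \<open>layers_from\<close> they give the
  difference operator, and configuration by configuration they give \<open>total\<close>, which
  depends on the content alone.\<close>

theorem difference_operator_eigen:
  assumes srt: "sorted_wrt (\<ge>) lam" and v: "inj_on v {..<n}"
  shows "(\<Sum>i<n. (\<Prod>j\<in>{..<n} - {i}. (t * v i - v j) / (v i - v j)) *
            (\<Sum>mu\<in>configs lam. Psi mu (v(i := q * v i)))) =
    (\<Sum>i<n. q ^ (lam ! i) * t ^ (n - Suc i)) * (\<Sum>mu\<in>configs lam. Psi mu v)"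
proof (cases "n = 0")
  case False
  have eigen: "(\<Sum>i<n. (\<Prod>j\<in>{..<n} - {i}. (t * v i - v j) / (v i - v j)) *
            (\<Sum>mu\<in>configs lam. Psi mu (v(i := q * v i)))) =
      (\<Sum>i<n. (\<Prod>j\<in>{..<n} - {i}. fac (v i) (v j)) * layer (n - 1) (to_end i v))"
    by (intro sum.cong refl) (simp only: last_layer_to_end fac_def lessThan_iff)
  have "(\<Sum>l<n. layer l v) = (\<Sum>mu\<in>configs lam. total mu * Psi mu v)"
  proof -
    have "(\<Sum>l<n. layer l v) =
      (\<Sum>mu\<in>configs lam. (\<Sum>l<n. trail (mu ! l) (drop (Suc l) mu)) * Psi mu v)"
      unfolding layer_def by (subst sum.swap) (simp add: sum_distrib_right)
    also have "\<dots> = (\<Sum>mu\<in>configs lam. total mu * Psi mu v)"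
      by (intro sum.cong refl) (simp add: total_nth length_configs[of _ lam])
    finally show ?thesis .
  qed
  also have "\<dots> = (\<Sum>mu\<in>configs lam. total lam * Psi mu v)"
    by (intro sum.cong refl) (auto simp: configs_iff intro: arg_cong2[of _ _ _ _ "(*)"] total_mset)
  also have "\<dots> = (\<Sum>i<n. q ^ (lam ! i) * t ^ (n - Suc i)) * (\<Sum>mu\<in>configs lam. Psi mu v)"
    by (simp add: total_sorted[OF srt] sum_distrib_left)
  finally show ?thesis
    using layers_from[of 0 v] False v by (simp add: eigen atLeast0LessThan)
qed simp

end

section \<open>Evaluation at the generic point and the two Hecke families\<close>

lemma subst_Var: "subst Var p = p"
proof -
  have power_Var: "Var j ^ a = Poly_Mapping.single (Poly_Mapping.single j a) 1" for j a
    by (induction a) (simp_all add: Var_def mult_single flip: single_add)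
  have prod_single: "(\<Prod>i\<in>I. Poly_Mapping.single (u i) (1::qt)) = Poly_Mapping.single (\<Sum>i\<in>I. u i) 1"
    if "finite I" for I :: "nat set" and u :: "nat \<Rightarrow> nat \<Rightarrow>\<^sub>0 nat"
    using that by (induction I rule: finite_induct) (auto simp: mult_single)
  have "monom_value Var e = Poly_Mapping.single e 1" for e
    unfolding monom_value_def power_Var prod_single[OF finite_keys] poly_mapping_sum_single[symmetric] ..
  then show ?thesis
    unfolding insertion_alt
    by (subst (3) poly_mapping_sum_single) (simp add: Const_def mult_single)
qed

definition lift_const :: "qt \<Rightarrow> qtpoly fract" where
  "lift_const c = to_fract (Const c)"

text \<open>The generic point. Evaluation there is the embedding into the fraction field, and its
  coordinates are distinct, so identities at points become identities of polynomials.\<close>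

definition generic :: "nat \<Rightarrow> qtpoly fract" where
  "generic i = to_fract (Var i)"

lemma ring_hom_lift_const: "ring_hom_on lift_const"
  by (simp add: ring_hom_on_def lift_const_def Const_add Const_mult)

lemmas lift_const_simps = ring_hom_onD[OF ring_hom_lift_const] ring_hom_on_diff[OF ring_hom_lift_const]
  ring_hom_on_power[OF ring_hom_lift_const] ring_hom_on_sum[OF ring_hom_lift_const]

lemma ring_hom_to_fract: "ring_hom_on (to_fract :: 'a::idom \<Rightarrow> 'a fract)"
  by (simp add: ring_hom_on_def)

abbreviation ev :: "(nat \<Rightarrow> qtpoly fract) \<Rightarrow> qtpoly \<Rightarrow> qtpoly fract" where
  "ev \<equiv> insertion lift_const"

lemma ring_hom_ev: "ring_hom_on (ev v)"
  by (rule ring_hom_on_insertion[OF ring_hom_lift_const])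

lemmas ev_simps = ring_hom_onD[OF ring_hom_ev] ring_hom_on_diff[OF ring_hom_ev]
  ring_hom_on_sum[OF ring_hom_ev] ring_hom_on_prod[OF ring_hom_ev] ring_hom_on_power[OF ring_hom_ev]

lemma ev_Const [simp]: "ev v (Const c) = lift_const c"
  by (simp add: lift_const_simps)

lemma ev_Var [simp]: "ev v (Var i) = v i"
  by (simp add: lift_const_simps)

lemma ev_subst: "ev v (subst \<sigma> p) = ev (\<lambda>i. ev v (\<sigma> i)) p"
  by (rule insertion_subst[OF ring_hom_lift_const])

lemma ev_generic: "ev generic p = to_fract p"
proof -
  have "to_fract p = to_fract (subst Var p)" by (simp add: subst_Var)
  also have "\<dots> = ev generic p"
    by (simp add: insertion_def lift_const_def generic_def ring_hom_on_prod[OF ring_hom_to_fract]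
        ring_hom_on_power[OF ring_hom_to_fract])
  finally show ?thesis ..
qed

lemma ev_swap_vars: "ev v (swap_vars i p) = ev (swap_args i v) p"
  unfolding ev_subst by (rule arg_cong[of _ _ "\<lambda>w. ev w p"]) (auto simp: swap_args_def)

lemma generic_inject: "generic i = generic j \<longleftrightarrow> i = j"
  by (simp add: generic_def Var_inject)

lemma tvar_power_inject: "tvar ^ j = tvar ^ k \<longleftrightarrow> j = k"
proof
  assume "tvar ^ j = tvar ^ k"
  then have "to_fract ([:0, 1:] ^ j) = to_fract ([:0, 1:] ^ k :: rat poly poly)"
    by (simp only: tvar_def ring_hom_on_power[OF ring_hom_to_fract])
  then have "([:0, 1:] :: rat poly poly) ^ j = [:0, 1:] ^ k" by (simp only: to_fract_eq_iff)
  from arg_cong[OF this, of degree] show "j = k" by (simp add: degree_power_eq)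
qed simp

lemma lift_const_inject: "lift_const c = lift_const d \<longleftrightarrow> c = d"
proof
  assume "lift_const c = lift_const d"
  then have "Poly_Mapping.lookup (Const c) 0 = Poly_Mapping.lookup (Const d) 0" by (simp add: lift_const_def)
  then show "c = d" by (simp add: Const_def)
qed simp

lemma lift_tvar_square: "(lift_const tvar) ^ 2 \<noteq> 1"
proof
  assume "(lift_const tvar) ^ 2 = 1"
  then have "lift_const (tvar ^ 2) = lift_const 1" by (simp only: lift_const_simps)
  then show False using tvar_power_inject[of 2 0] by (simp only: lift_const_inject) simp
qed

definition eigenvalue :: "nat list \<Rightarrow> qt" where
  "eigenvalue mu = (\<Sum>i<length mu. qvar ^ (mu ! i) * tvar ^ (length mu - Suc i))"

lemma macdonald_operator_of_family:
  assumes fam: "hecke_family (lift_const qvar) (lift_const tvar) lam (\<lambda>mu v. ev v (g mu))"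
    and srt: "sorted_wrt (\<ge>) lam"
  shows "macdonald_operator (length lam) (\<Sum>mu\<in>configs lam. g mu) =
    to_fract (Const (eigenvalue lam) * (\<Sum>mu\<in>configs lam. g mu))"
proof -
  define n where "n = length lam"
  define G where "G = (\<Sum>mu\<in>configs lam. g mu)"
  have inj: "inj_on generic {..<length lam}" by (simp add: inj_on_def generic_inject)
  have shift: "to_fract (subst (Var(i := Const qvar * Var i)) p) =
      ev (generic(i := lift_const qvar * generic i)) p" for i p
  proof -
    have "ev generic (subst (Var(i := Const qvar * Var i)) p) =
      ev (generic(i := lift_const qvar * generic i)) p"
      unfolding ev_subst by (rule arg_cong[of _ _ "\<lambda>w. ev w p"]) (auto simp: ev_simps)
    then show ?thesis by (simp add: ev_generic)
  qed
  have frac: "Fract (Const tvar * Var i - Var j) (Var i - Var j) =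
      (lift_const tvar * generic i - generic j) / (generic i - generic j)" for i j
    by (simp add: Fract_conv_to_fract lift_const_def generic_def)
  have "macdonald_operator n G =
     (\<Sum>i<n. (\<Prod>j\<in>{..<n} - {i}. (lift_const tvar * generic i - generic j) / (generic i - generic j)) *
        (\<Sum>mu\<in>configs lam. ev (generic(i := lift_const qvar * generic i)) (g mu)))"
    unfolding macdonald_operator_def frac shift G_def by (simp add: ev_simps)
  also have "\<dots> = (\<Sum>i<n. lift_const qvar ^ (lam ! i) * lift_const tvar ^ (n - Suc i)) *
      (\<Sum>mu\<in>configs lam. ev generic (g mu))"
    unfolding n_def by (rule hecke_family.difference_operator_eigen[OF fam srt inj])
  also have "(\<Sum>i<n. lift_const qvar ^ (lam ! i) * lift_const tvar ^ (n - Suc i)) = lift_const (eigenvalue lam)"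
    by (simp add: eigenvalue_def lift_const_simps n_def)
  finally show ?thesis
    by (simp only: ev_generic) (simp only: lift_const_def to_fract_mult to_fract_sum n_def G_def)
qed

lemma (in asep_family) hecke_family_f:
  "hecke_family (lift_const qvar) (lift_const tvar) lam (\<lambda>mu v. ev v (f mu))"
proof
  show "(lift_const tvar) ^ 2 \<noteq> 1" by (rule lift_tvar_square)
next
  fix mu i and v :: "nat \<Rightarrow> qtpoly fract"
  assume a: "mu \<in> configs lam" "Suc i < length lam" "mu ! i > mu ! Suc i" "v i \<noteq> v (Suc i)"
  define t where "t = lift_const tvar"
  from arg_cong[OF f_exchange[OF a(1-3)], of "ev v"]
  have "(v i - v (Suc i)) * ev v (f (swap_entries i mu)) = (1 - t) * (v (Suc i) * ev v (f mu)) +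
       t * (v i * ev (swap_args i v) (f mu)) - v (Suc i) * ev (swap_args i v) (f mu)"
    by (simp add: ev_simps ev_swap_vars lift_const_simps t_def)
  moreover have "S = t * X - (t * a - b) / (a - b) * (X - Y)"
    if "(a - b) * S = (1 - t) * (b * X) + t * (a * Y) - b * Y" "a \<noteq> b" for a b S X Y :: "qtpoly fract"
  proof -
    have "(a - b) * S = (a - b) * (t * X) - (t * a - b) * (X - Y)"
      unfolding that(1) by (simp add: algebra_simps)
    also have "\<dots> = (a - b) * (t * X - (t * a - b) / (a - b) * (X - Y))"
      using that(2) by (simp add: right_diff_distrib)
    finally show ?thesis using that(2) by simp
  qed
  ultimately show "ev v (f (swap_entries i mu)) = t * ev v (f mu) - (t * v i - v (Suc i)) / (v i - v (Suc i)) *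
        (ev v (f mu) - ev (swap_args i v) (f mu))" using a(4) by blast
next
  fix mu i and v :: "nat \<Rightarrow> qtpoly fract"
  assume "mu \<in> configs lam" "Suc i < length lam" "mu ! i = mu ! Suc i"
  from arg_cong[OF f_symmetric[OF this], of "ev v"]
  show "ev (swap_args i v) (f mu) = ev v (f mu)" by (simp add: ev_swap_vars)
next
  fix a nu and v :: "nat \<Rightarrow> qtpoly fract"
  assume m: "a # nu \<in> configs lam"
  have "ev v (rotate_vars (length lam) (f (a # nu))) =
     ev (\<lambda>i. if i = 0 then lift_const qvar * v (length lam - 1) else v (i - 1)) (f (a # nu))"
    unfolding ev_subst by (rule arg_cong[of _ _ "\<lambda>w. ev w _"]) (auto simp: ev_simps)
  with arg_cong[OF f_rotate[OF m], of "ev v"]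
  show "lift_const qvar ^ a * ev v (f (nu @ [a])) =
     ev (\<lambda>i. if i = 0 then lift_const qvar * v (length lam - 1) else v (i - 1)) (f (a # nu))"
    by (simp add: ev_simps lift_const_simps)
next
  fix mu and v w :: "nat \<Rightarrow> qtpoly fract"
  assume "mu \<in> configs lam" "\<forall>i<length lam. v i = w i"
  then show "ev v (f mu) = ev w (f mu)"
    using in_vars_f[of mu] by (intro insertion_cong_vars) (auto simp: in_vars_def)
qed

definition list_monom :: "nat list \<Rightarrow> qtpoly" where
  "list_monom mu = Poly_Mapping.single (Poly_Mapping.nth mu) 1"

lemma ev_list_monom: "ev v (list_monom mu) = (\<Prod>i<length mu. v i ^ (mu ! i))"
proof -
  have "ev v (list_monom mu) = monom_value v (Poly_Mapping.nth mu)"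
    by (simp add: list_monom_def insertion_single lift_const_simps)
  also have "\<dots> = (\<Prod>i<length mu. v i ^ Poly_Mapping.lookup (Poly_Mapping.nth mu) i)"
    by (rule monom_value_superset) (use keys_nth_subset in auto)
  finally show ?thesis by (simp add: nth_default_def)
qed

definition column :: "nat \<Rightarrow> nat \<Rightarrow> nat list" where
  "column n r = replicate r 1 @ replicate (n - r) 0"

lemma length_column: "r \<le> n \<Longrightarrow> length (column n r) = n"
  by (simp add: column_def)

lemma sorted_column: "sorted_wrt (\<ge>) (column n r)"
  by (auto simp: column_def sorted_wrt_iff_nth_less nth_append)

text \<open>With entries 0 and 1 the family is explicit, one monomial for each rearrangement,
  because T_i x_i = x_{i+1}. Its sum is an elementary symmetric function, which thereby becomes an
  eigenfunction of the Macdonald operator.\<close>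

lemma hecke_family_column:
  assumes "r \<le> n"
  shows "hecke_family (lift_const qvar) (lift_const tvar) (column n r) (\<lambda>mu v. ev v (list_monom mu))"
proof
  note len = length_column[OF assms]
  show "(lift_const tvar) ^ 2 \<noteq> 1" by (rule lift_tvar_square)
  have split: "(\<Prod>k<n. v k ^ (mu ! k)) = v i ^ (mu ! i) * (v (Suc i) ^ (mu ! Suc i) *
      (\<Prod>k\<in>{..<n} - {i, Suc i}. v k ^ (mu ! k)))"
    if "Suc i < n" for i and v :: "nat \<Rightarrow> qtpoly fract" and mu
  proof -
    have "{..<n} = insert i (insert (Suc i) ({..<n} - {i, Suc i}))" using that by auto
    then have "(\<Prod>k<n. v k ^ (mu ! k)) = (\<Prod>k\<in>insert i (insert (Suc i) ({..<n} - {i, Suc i})). v k ^ (mu ! k))"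
      by (rule arg_cong)
    then show ?thesis by simp
  qed
  {
    fix mu i and v :: "nat \<Rightarrow> qtpoly fract"
    assume a: "mu \<in> configs (column n r)" "Suc i < length (column n r)"
    have lm: "length mu = n" using length_configs[OF a(1)] len by simp
    have i: "Suc i < n" using a len by simp
    have "mset mu = mset (column n r)" using a(1) by (simp add: configs_iff)
    from arg_cong[OF this, of set_mset] have "set mu \<subseteq> {0, 1}" by (auto simp: column_def)
    moreover have "mu ! i \<in> set mu" "mu ! Suc i \<in> set mu" using i lm by auto
    ultimately have le: "mu ! i \<le> 1" "mu ! Suc i \<le> 1" by auto
    define C where "C = (\<Prod>k\<in>{..<n} - {i, Suc i}. v k ^ (mu ! k))"
    have C: "(\<Prod>k\<in>{..<n} - {i, Suc i}. swap_args i v k ^ (mu ! k)) = C"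
      "(\<Prod>k\<in>{..<n} - {i, Suc i}. v k ^ (swap_entries i mu ! k)) = C"
      unfolding C_def using lm i by (auto intro!: prod.cong simp: nth_swap_entries)
    {
      assume d: "mu ! i > mu ! Suc i" "v i \<noteq> v (Suc i)"
      then have e: "mu ! i = 1" "mu ! Suc i = 0" using le by auto
      have "v (Suc i) * C = lift_const tvar * (v i * C) -
        (lift_const tvar * v i - v (Suc i)) / (v i - v (Suc i)) * ((v i - v (Suc i)) * C)"
      proof -
        have cancel: "x / y * (y * C) = x * C" if "y \<noteq> 0" for x y
          using that by simp
        have ne: "v i - v (Suc i) \<noteq> 0" using d(2) by simp
        show ?thesis unfolding cancel[OF ne] by (simp add: algebra_simps)
      qed
      then show "ev v (list_monom (swap_entries i mu)) = lift_const tvar * ev v (list_monom mu) -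
        (lift_const tvar * v i - v (Suc i)) / (v i - v (Suc i)) * (ev v (list_monom mu) - ev (swap_args i v) (list_monom mu))"
        using lm i e by (simp add: ev_list_monom split[OF i] C C_def[symmetric] left_diff_distrib)
    next
      assume "mu ! i = mu ! Suc i"
      then show "ev (swap_args i v) (list_monom mu) = ev v (list_monom mu)"
        using lm i by (simp add: ev_list_monom split[OF i] C C_def[symmetric])
    }
  next
    fix a nu and v :: "nat \<Rightarrow> qtpoly fract"
    assume m: "a # nu \<in> configs (column n r)"
    show "lift_const qvar ^ a * ev v (list_monom (nu @ [a])) =
       ev (\<lambda>i. if i = 0 then lift_const qvar * v (length (column n r) - 1) else v (i - 1)) (list_monom (a # nu))"
    proof -
      have L: "length (column n r) = Suc (length nu)" using length_configs[OF m] by simp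
      have "ev v (list_monom (nu @ [a])) = (\<Prod>i<length nu. v i ^ (nu ! i)) * v (length nu) ^ a"
        by (simp add: ev_list_monom nth_append)
      then show ?thesis
        unfolding ev_list_monom[of _ "a # nu"] length_Cons prod.lessThan_Suc_shift L
        by (simp add: power_mult_distrib)
    qed
  next
    fix mu and v w :: "nat \<Rightarrow> qtpoly fract"
    assume "mu \<in> configs (column n r)" "\<forall>i<length (column n r). v i = w i"
    then show "ev v (list_monom mu) = ev w (list_monom mu)"
      using length_configs[of mu "column n r"] by (auto simp: ev_list_monom intro!: prod.cong)
  }
qed

section \<open>Triangularity\<close>

definition shift :: "qt \<Rightarrow> nat \<Rightarrow> qtpoly \<Rightarrow> qtpoly" where
  "shift c i = subst (Var(i := Const c * Var i))"

lemma ring_hom_shift: "ring_hom_on (shift c i)"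
  unfolding shift_def by (rule ring_hom_on_insertion[OF ring_hom_on_Const])

lemmas shift_simps = ring_hom_onD[OF ring_hom_shift] ring_hom_on_diff[OF ring_hom_shift]
  ring_hom_on_sum[OF ring_hom_shift] ring_hom_on_prod[OF ring_hom_shift]

lemma lookup_shift: "Poly_Mapping.lookup (shift c i p) e = c ^ Poly_Mapping.lookup e i * Poly_Mapping.lookup p e"
proof -
  have mono: "monom_value (Var(i := Const c * Var i)) d =
      Const (c ^ Poly_Mapping.lookup d i) * monom_value Var d" for d
  proof -
    have "monom_value (Var(i := Const c * Var i)) d =
       (\<Prod>j\<in>Poly_Mapping.keys d. (if j = i then Const c ^ Poly_Mapping.lookup d i else 1) * Var j ^ Poly_Mapping.lookup d j)"
      unfolding monom_value_def by (intro prod.cong refl) (auto simp: power_mult_distrib)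
    also have "\<dots> = (\<Prod>j\<in>Poly_Mapping.keys d. if j = i then Const c ^ Poly_Mapping.lookup d i else 1) * monom_value Var d"
      by (simp add: prod.distrib monom_value_def)
    also have "(\<Prod>j\<in>Poly_Mapping.keys d. if j = i then Const c ^ Poly_Mapping.lookup d i else 1) =
        Const c ^ Poly_Mapping.lookup d i"
      by (auto simp: prod.delta in_keys_iff)
    finally show ?thesis by (simp only: Const_power)
  qed
  have lk: "Poly_Mapping.lookup (Const a * monom_value Var d) e = (if d = e then a else 0)" for a d
  proof -
    have "Const a * monom_value Var d = subst Var (Poly_Mapping.single d a)"
      by (simp add: insertion_single)
    then show ?thesis by (simp add: subst_Var lookup_single when_def)
  qed
  have "shift c i p = (\<Sum>d\<in>Poly_Mapping.keys p.
      Const (Poly_Mapping.lookup p d * c ^ Poly_Mapping.lookup d i) * monom_value Var d)"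
    unfolding shift_def insertion_alt mono by (simp add: Const_mult ac_simps)
  then show ?thesis
    by (simp only: lookup_sum lk) (auto simp: in_keys_iff mult.commute)
qed

definition adds :: "(nat \<Rightarrow>\<^sub>0 nat) \<Rightarrow> (nat \<Rightarrow>\<^sub>0 nat) \<Rightarrow> bool" where
  "adds e g \<longleftrightarrow> (\<exists>h. g = e + h)"

lemma lookup_times:
  fixes a b :: qtpoly
  shows "Poly_Mapping.lookup (a * b) g =
    (\<Sum>e\<in>Poly_Mapping.keys a. if adds e g then Poly_Mapping.lookup a e * Poly_Mapping.lookup b (g - e) else 0)"
proof -
  have "a * b = (\<Sum>e\<in>Poly_Mapping.keys a. Poly_Mapping.single e (Poly_Mapping.lookup a e) * b)"
    by (subst (1) poly_mapping_sum_single[of a]) (simp add: sum_distrib_right)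
  moreover have "Poly_Mapping.lookup (Poly_Mapping.single e c * b) g =
      (if adds e g then c * Poly_Mapping.lookup b (g - e) else 0)" for e c
    by (auto simp: adds_def lookup_single_times lookup_single_times_0)
  ultimately show ?thesis by (simp add: lookup_sum)
qed

definition coeffs_in :: "qt set \<Rightarrow> qtpoly \<Rightarrow> bool" where
  "coeffs_in J p \<longleftrightarrow> (\<forall>e. Poly_Mapping.lookup p e \<in> J)"

definition submodule_of :: "qt set \<Rightarrow> qt set \<Rightarrow> bool" where
  "submodule_of A J \<longleftrightarrow> 0 \<in> J \<and> (\<forall>x\<in>J. \<forall>y\<in>J. x + y \<in> J) \<and> (\<forall>a\<in>A. \<forall>x\<in>J. a * x \<in> J)"

lemma submodule_ofD:
  assumes "submodule_of A J"
  shows "0 \<in> J" "x \<in> J \<Longrightarrow> y \<in> J \<Longrightarrow> x + y \<in> J" "a \<in> A \<Longrightarrow> x \<in> J \<Longrightarrow> a * x \<in> J"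
  using assms by (auto simp: submodule_of_def)

lemma submodule_of_sum:
  "submodule_of A J \<Longrightarrow> (\<And>i. i \<in> I \<Longrightarrow> g i \<in> J) \<Longrightarrow> sum g I \<in> J"
  by (induction I rule: infinite_finite_induct) (auto simp: submodule_of_def)

lemma submodule_of_diff:
  assumes "submodule_of A J" "- 1 \<in> A" "x \<in> J" "y \<in> J"
  shows "x - y \<in> J"
proof -
  have "- 1 * y \<in> J" using assms by (intro submodule_ofD(3)[OF assms(1)])
  then show ?thesis using submodule_ofD(2)[OF assms(1) assms(3)] by fastforce
qed

lemma coeffs_in_add: "submodule_of A J \<Longrightarrow> coeffs_in J p \<Longrightarrow> coeffs_in J r \<Longrightarrow> coeffs_in J (p + r)"
  by (simp add: coeffs_in_def lookup_add submodule_ofD)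

lemma coeffs_in_diff:
  "submodule_of A J \<Longrightarrow> - 1 \<in> A \<Longrightarrow> coeffs_in J p \<Longrightarrow> coeffs_in J r \<Longrightarrow> coeffs_in J (p - r)"
  by (simp add: coeffs_in_def lookup_minus submodule_of_diff)

lemma coeffs_in_sum:
  "submodule_of A J \<Longrightarrow> (\<And>i. i \<in> I \<Longrightarrow> coeffs_in J (g i)) \<Longrightarrow> coeffs_in J (sum g I)"
  by (auto simp: coeffs_in_def lookup_sum intro: submodule_of_sum)

lemma coeffs_in_times:
  assumes "submodule_of A J" "coeffs_in A p" "coeffs_in J r"
  shows "coeffs_in J (p * r)"
  unfolding coeffs_in_def lookup_times
  using assms by (auto simp: coeffs_in_def intro!: submodule_of_sum[OF assms(1)] submodule_ofD[OF assms(1)])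

definition polys :: "qt set" where
  "polys = range to_fract"

lemma polys_simps [simp]:
  "0 \<in> polys" "1 \<in> polys" "- 1 \<in> polys" "to_fract a \<in> polys" "qvar \<in> polys" "tvar \<in> polys"
proof -
  have "to_fract 0 \<in> polys" "to_fract 1 \<in> polys" "to_fract (- 1) \<in> polys"
    by (simp_all only: polys_def rangeI)
  then show "0 \<in> polys" "1 \<in> polys" "- 1 \<in> polys" by simp_all
qed (simp_all add: polys_def qvar_def tvar_def)

lemma polys_add: "a \<in> polys \<Longrightarrow> b \<in> polys \<Longrightarrow> a + b \<in> polys"
  by (auto simp: polys_def) (metis rangeI to_fract_add)

lemma polys_mult: "a \<in> polys \<Longrightarrow> b \<in> polys \<Longrightarrow> a * b \<in> polys"
  by (auto simp: polys_def) (metis rangeI to_fract_mult)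

lemma submodule_polys: "submodule_of polys polys"
  by (simp add: submodule_of_def polys_add polys_mult)

lemma polys_diff: "a \<in> polys \<Longrightarrow> b \<in> polys \<Longrightarrow> a - b \<in> polys"
  by (rule submodule_of_diff[OF submodule_polys]) simp_all

lemma polys_sum: "(\<And>i. i \<in> I \<Longrightarrow> g i \<in> polys) \<Longrightarrow> sum g I \<in> polys"
  by (rule submodule_of_sum[OF submodule_polys])

lemma polys_power: "a \<in> polys \<Longrightarrow> a ^ k \<in> polys"
  by (induction k) (simp_all add: polys_mult)

lemma polys_of_nat: "of_nat k \<in> polys"
  by (induction k) (simp_all add: polys_add)

lemma coeffs_in_Const: "c \<in> J \<Longrightarrow> 0 \<in> J \<Longrightarrow> coeffs_in J (Const c)"
  by (simp add: coeffs_in_def Const_def lookup_single when_def)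

lemma coeffs_in_polys_Var: "coeffs_in polys (Var i)"
  by (simp add: coeffs_in_def Var_def lookup_single when_def)

lemma coeffs_in_polys_1: "coeffs_in polys 1"
  by (simp add: coeffs_in_def lookup_one when_def)

section \<open>Leading exponents of the Vandermonde product\<close>

definition weight :: "nat \<Rightarrow> (nat \<Rightarrow> int) \<Rightarrow> (nat \<Rightarrow>\<^sub>0 nat) \<Rightarrow> int" where
  "weight n w e = (\<Sum>i<n. w i * int (Poly_Mapping.lookup e i))"

lemma weight_add: "weight n w (d + e) = weight n w d + weight n w e"
  by (simp add: weight_def lookup_add distrib_left sum.distrib)

lemma weight_single: "j < n \<Longrightarrow> weight n w (Poly_Mapping.single j k) = w j * int k"
  by (simp add: weight_def lookup_single when_def if_distrib[of int] if_distrib[of "\<lambda>x. _ * x"] cong: if_cong)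

text \<open>A leading monomial with coefficient 1 for a linear weight; additivity of the weight
  makes the notion multiplicative.\<close>

definition unique_top :: "nat \<Rightarrow> (nat \<Rightarrow> int) \<Rightarrow> qtpoly \<Rightarrow> (nat \<Rightarrow>\<^sub>0 nat) \<Rightarrow> bool" where
  "unique_top n w p e \<longleftrightarrow> Poly_Mapping.lookup p e = 1 \<and>
     (\<forall>d\<in>Poly_Mapping.keys p. d \<noteq> e \<longrightarrow> weight n w d < weight n w e)"

lemma unique_top_times:
  assumes p: "unique_top n w p a" and r: "unique_top n w r b"
  shows "unique_top n w (p * r) (a + b)"
  unfolding unique_top_def
proof
  have "Poly_Mapping.lookup (p * r) (a + b) = (\<Sum>e\<in>Poly_Mapping.keys p. if e = a then 1 else 0)"
    unfolding lookup_times
  proof (intro sum.cong refl)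
    fix e assume e: "e \<in> Poly_Mapping.keys p"
    show "(if adds e (a + b) then Poly_Mapping.lookup p e * Poly_Mapping.lookup r (a + b - e) else 0) =
        (if e = a then 1 else 0)"
    proof (cases "e = a")
      case True
      then show ?thesis using p r by (auto simp: adds_def unique_top_def)
    next
      case False
      have "Poly_Mapping.lookup r h = 0" if h: "a + b = e + h" for h
      proof (rule ccontr)
        assume "Poly_Mapping.lookup r h \<noteq> 0"
        then have "h = b \<or> weight n w h < weight n w b" using r by (auto simp: unique_top_def in_keys_iff)
        then have "weight n w h \<le> weight n w b" by auto
        moreover have "weight n w e < weight n w a" using p e False by (auto simp: unique_top_def)
        ultimately show False using arg_cong[OF h, of "weight n w"] by (simp add: weight_add)
      qed
      then show ?thesis using False by (auto simp: adds_def)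
    qed
  qed
  also have "\<dots> = 1" using p by (auto simp: unique_top_def in_keys_iff)
  finally show "Poly_Mapping.lookup (p * r) (a + b) = 1" .
  show "\<forall>d\<in>Poly_Mapping.keys (p * r). d \<noteq> a + b \<longrightarrow> weight n w d < weight n w (a + b)"
  proof (intro ballI impI)
    fix d assume "d \<in> Poly_Mapping.keys (p * r)" and ne: "d \<noteq> a + b"
    then obtain e h where d: "d = e + h" and eh: "e \<in> Poly_Mapping.keys p" "h \<in> Poly_Mapping.keys r"
      using keys_mult[of p r] by blast
    have "weight n w e \<le> weight n w a" "e \<noteq> a \<Longrightarrow> weight n w e < weight n w a"
      "weight n w h \<le> weight n w b" "h \<noteq> b \<Longrightarrow> weight n w h < weight n w b"
      using p r eh unfolding unique_top_def by force+
    moreover have "e \<noteq> a \<or> h \<noteq> b" using d ne by auto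
    ultimately show "weight n w d < weight n w (a + b)" by (auto simp: d weight_add)
  qed
qed

lemma unique_top_1: "unique_top n w 1 0"
  by (simp add: unique_top_def)

definition pairs :: "nat \<Rightarrow> (nat \<times> nat) set" where
  "pairs n = {(j, k). j < k \<and> k < n}"

lemma finite_pairs [simp]: "finite (pairs n)"
  by (rule finite_subset[of _ "{..<n} \<times> {..<n}"]) (auto simp: pairs_def)

definition vdm :: "nat \<Rightarrow> qtpoly" where
  "vdm n = (\<Prod>(j, k)\<in>pairs n. Var j - Var k)"

text \<open>One unit vector per factor of the Vandermonde product, so that an induction over the
  factors follows the leading exponent.\<close>

definition staircase :: "nat \<Rightarrow> nat \<Rightarrow>\<^sub>0 nat" where
  "staircase n = (\<Sum>(j, k)\<in>pairs n. Poly_Mapping.single j 1)"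

lemma lookup_staircase: "i < n \<Longrightarrow> Poly_Mapping.lookup (staircase n) i = n - Suc i"
proof -
  assume i: "i < n"
  have "Poly_Mapping.lookup (staircase n) i = (\<Sum>x\<in>pairs n. if fst x = i then 1 else 0)"
    by (simp add: staircase_def lookup_sum lookup_single when_def case_prod_beta cong: if_cong)
  also have "\<dots> = card {x \<in> pairs n. fst x = i}" by (simp add: sum.If_cases Int_def)
  also have "{x \<in> pairs n. fst x = i} = Pair i ` {i<..<n}" by (auto simp: pairs_def)
  also have "card \<dots> = n - Suc i" by (simp add: card_image inj_on_def)
  finally show ?thesis .
qed

lemma keys_staircase: "Poly_Mapping.keys (staircase n) \<subseteq> {..<n}"
proof -
  have "Poly_Mapping.keys (staircase n) \<subseteq> (\<Union>x\<in>pairs n. Poly_Mapping.keys (case x of (j, k) \<Rightarrow> Poly_Mapping.single j (1::nat)))"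
    unfolding staircase_def by (rule keys_sum)
  then show ?thesis by (force simp: pairs_def split: if_splits)
qed

lemma single_1_inject: "Poly_Mapping.single j (1::nat) = Poly_Mapping.single k 1 \<longleftrightarrow> j = k"
proof
  assume "Poly_Mapping.single j (1::nat) = Poly_Mapping.single k 1"
  then have "Poly_Mapping.keys (Poly_Mapping.single j (1::nat)) = Poly_Mapping.keys (Poly_Mapping.single k (1::nat))"
    by (rule arg_cong)
  then show "j = k" by simp
qed simp

lemma keys_Var_diff: "Poly_Mapping.keys (Var j - Var k) \<subseteq> {Poly_Mapping.single j 1, Poly_Mapping.single k 1}"
  by (auto simp: in_keys_iff lookup_minus Var_def lookup_single when_def split: if_splits)

lemma in_vars_vdm: "in_vars n (vdm n)"
proof -
  have "\<forall>e\<in>Poly_Mapping.keys (\<Prod>(j, k)\<in>Q. Var j - Var k). Poly_Mapping.keys e \<subseteq> {..<n}"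
    if "finite Q" "Q \<subseteq> pairs n" for Q
    using that
  proof (induction Q rule: finite_induct)
    case (insert x Q)
    obtain j k where x: "x = (j, k)" "j < n" "k < n" using insert.prems by (auto simp: pairs_def)
    show ?case
    proof
      fix e assume "e \<in> Poly_Mapping.keys (\<Prod>(j, k)\<in>insert x Q. Var j - Var k)"
      then have "e \<in> Poly_Mapping.keys ((Var j - Var k) * (\<Prod>(j, k)\<in>Q. Var j - Var k))"
        using insert.hyps x by simp
      then obtain a b where e: "e = a + b" and ab: "a \<in> Poly_Mapping.keys (Var j - Var k)"
        "b \<in> Poly_Mapping.keys (\<Prod>(j, k)\<in>Q. Var j - Var k)" using keys_mult by blast
      have "Poly_Mapping.keys b \<subseteq> {..<n}" using insert ab by auto
      moreover have "Poly_Mapping.keys a \<subseteq> {..<n}" using keys_Var_diff[of j k] ab x by auto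
      ultimately show "Poly_Mapping.keys e \<subseteq> {..<n}" using keys_add[of a b] e by blast
    qed
  qed simp
  from this[OF finite_pairs subset_refl] show ?thesis unfolding vdm_def in_vars_def .
qed

lemma coeffs_in_polys_vdm: "coeffs_in polys (vdm n)"
proof -
  have "coeffs_in polys (\<Prod>(j, k)\<in>Q. Var j - Var k)" if "finite Q" for Q
    using that
    by (induction Q rule: finite_induct)
       (auto intro!: coeffs_in_times[OF submodule_polys] coeffs_in_diff[OF submodule_polys]
          coeffs_in_polys_Var coeffs_in_polys_1)
  from this[OF finite_pairs] show ?thesis unfolding vdm_def .
qed

lemma unique_top_vdm:
  assumes w: "\<And>i j. i < j \<Longrightarrow> j < n \<Longrightarrow> w j < w i"
  shows "unique_top n w (vdm n) (staircase n)"
proof -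
  have "unique_top n w (\<Prod>(j, k)\<in>Q. Var j - Var k) (\<Sum>(j, k)\<in>Q. Poly_Mapping.single j 1)"
    if "finite Q" "Q \<subseteq> pairs n" for Q
    using that
  proof (induction Q rule: finite_induct)
    case (insert x Q)
    obtain j k where x: "x = (j, k)" "j < k" "k < n" using insert.prems by (auto simp: pairs_def)
    have ne: "Poly_Mapping.single j (1::nat) \<noteq> Poly_Mapping.single k 1"
      using x single_1_inject[of j k] by simp
    have "unique_top n w (Var j - Var k) (Poly_Mapping.single j 1)"
      unfolding unique_top_def
    proof
      show "Poly_Mapping.lookup (Var j - Var k) (Poly_Mapping.single j 1) = 1"
        using ne by (simp add: lookup_minus Var_def lookup_single when_def)
      show "\<forall>d\<in>Poly_Mapping.keys (Var j - Var k). d \<noteq> Poly_Mapping.single j 1 \<longrightarrow>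
          weight n w d < weight n w (Poly_Mapping.single j 1)"
        using keys_Var_diff[of j k] w[of j k] x by (auto simp: weight_single)
    qed
    with insert show ?case using x by (simp add: unique_top_times)
  qed (simp add: unique_top_1)
  from this[OF finite_pairs subset_refl] show ?thesis unfolding vdm_def staircase_def .
qed

text \<open>The version for weights that decrease only weakly, as the parts of a partition
  do.\<close>

lemma weight_vdm_le:
  assumes w: "\<And>i j. i < j \<Longrightarrow> j < n \<Longrightarrow> w j \<le> w i" and e: "e \<in> Poly_Mapping.keys (vdm n)"
  shows "weight n w e \<le> weight n w (staircase n)"
proof -
  have "\<forall>e\<in>Poly_Mapping.keys (\<Prod>(j, k)\<in>Q. Var j - Var k).
      weight n w e \<le> weight n w (\<Sum>(j, k)\<in>Q. Poly_Mapping.single j 1)"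
    if "finite Q" "Q \<subseteq> pairs n" for Q
    using that
  proof (induction Q rule: finite_induct)
    case (insert x Q)
    obtain j k where x: "x = (j, k)" "j < k" "k < n" using insert.prems by (auto simp: pairs_def)
    show ?case
    proof
      fix e assume "e \<in> Poly_Mapping.keys (\<Prod>(j, k)\<in>insert x Q. Var j - Var k)"
      then have "e \<in> Poly_Mapping.keys ((Var j - Var k) * (\<Prod>(j, k)\<in>Q. Var j - Var k))"
        using insert.hyps x by simp
      then obtain a b where e: "e = a + b" and ab: "a \<in> Poly_Mapping.keys (Var j - Var k)"
        "b \<in> Poly_Mapping.keys (\<Prod>(j, k)\<in>Q. Var j - Var k)" using keys_mult by blast
      have "weight n w a \<le> w j" using keys_Var_diff[of j k] ab(1) w[of j k] x by (auto simp: weight_single)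
      moreover have "weight n w b \<le> weight n w (\<Sum>(j, k)\<in>Q. Poly_Mapping.single j 1)" using insert ab by auto
      ultimately show "weight n w e \<le> weight n w (\<Sum>(j, k)\<in>insert x Q. Poly_Mapping.single j 1)"
        using insert.hyps x e by (simp add: weight_add weight_single)
    qed
  qed simp
  from this[OF finite_pairs subset_refl] e show ?thesis unfolding vdm_def staircase_def by (rule bspec)
qed

text \<open>With d the staircase minus \<open>e\<close>, one has h = mu + d, and the sum of squares
  grows by twice the inner product of \<open>mu\<close> and d plus the sum of squares of d. The
  inner product is nonnegative because the staircase maximises the weight given by
  \<open>mu\<close>, and d is nonzero.\<close>

lemma sq_increases:
  assumes mu: "\<And>i j. i < j \<Longrightarrow> j < n \<Longrightarrow> Poly_Mapping.lookup mu j \<le> Poly_Mapping.lookup mu i"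
    and e: "e \<in> Poly_Mapping.keys (vdm n)" "e \<noteq> staircase n"
    and h: "mu + staircase n = e + h"
  shows "sqsum (expo n mu) < sqsum (expo n h)"
proof -
  define m d where "m i = int (Poly_Mapping.lookup mu i)"
    and "d i = int (Poly_Mapping.lookup (staircase n) i) - int (Poly_Mapping.lookup e i)" for i
  have hl: "int (Poly_Mapping.lookup h i) = m i + d i" for i
    using arg_cong[OF h, of "\<lambda>p. int (Poly_Mapping.lookup p i)"] by (simp add: lookup_add m_def d_def)
  have sq: "int (sqsum (expo n g)) = (\<Sum>i<n. (int (Poly_Mapping.lookup g i)) ^ 2)" for g
    by (simp add: sqsum_nth)
  have "weight n m e \<le> weight n m (staircase n)"
    by (rule weight_vdm_le[OF _ e(1)]) (use mu in \<open>auto simp: m_def\<close>)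
  then have 1: "0 \<le> (\<Sum>i<n. m i * d i)"
    by (simp add: weight_def d_def right_diff_distrib sum_subtractf)
  have ke: "Poly_Mapping.keys e \<subseteq> {..<n}" using in_vars_vdm e(1) by (auto simp: in_vars_def)
  have "\<exists>i<n. d i \<noteq> 0"
  proof (rule ccontr)
    assume "\<not> (\<exists>i<n. d i \<noteq> 0)"
    then have "Poly_Mapping.lookup e i = Poly_Mapping.lookup (staircase n) i" if "i < n" for i
      using that by (auto simp: d_def)
    moreover have "Poly_Mapping.lookup e i = Poly_Mapping.lookup (staircase n) i" if "\<not> i < n" for i
      using that ke keys_staircase[of n] by (metis in_keys_iff lessThan_iff subsetD)
    ultimately have "e = staircase n" by (intro poly_mapping_eqI) blast
    with e show False by blast
  qed
  then obtain i where i: "i < n" "d i \<noteq> 0" by blast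
  have 2: "0 < (\<Sum>i<n. (d i) ^ 2)" by (rule sum_pos2[of _ i]) (use i in auto)
  have "int (sqsum (expo n h)) = (\<Sum>i<n. (m i) ^ 2) + 2 * (\<Sum>i<n. m i * d i) + (\<Sum>i<n. (d i) ^ 2)"
    unfolding sq hl by (simp add: power2_sum sum.distrib sum_distrib_left ac_simps)
  moreover have "int (sqsum (expo n mu)) = (\<Sum>i<n. (m i) ^ 2)" unfolding sq m_def ..
  ultimately have "int (sqsum (expo n mu)) < int (sqsum (expo n h))" using 1 2 by simp
  then show ?thesis by simp
qed

text \<open>The coefficients of the Macdonald operator are quotients of Vandermonde products:
  scaling x_i by t alters exactly the factors that contain x_i.\<close>

lemma shift_vdm:
  assumes i: "i < n"
  shows "to_fract (shift tvar i (vdm n)) =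
    to_fract (vdm n) * (\<Prod>j\<in>{..<n} - {i}. Fract (Const tvar * Var i - Var j) (Var i - Var j))"
proof -
  define T where "T = lift_const tvar"
  define g where "g = generic"
  define w where "w = g(i := T * g i)"
  define c where "c j = (T * g i - g j) / (g i - g j)" for j
  have gne: "g j \<noteq> g k" if "j \<noteq> k" for j k using that by (simp add: g_def generic_inject)
  have frac: "Fract (Const tvar * Var i - Var j) (Var i - Var j) = c j" for j
    by (simp add: Fract_conv_to_fract lift_const_def generic_def c_def T_def g_def)
  have "to_fract (shift tvar i (vdm n)) = ev generic (shift tvar i (vdm n))" by (simp add: ev_generic)
  also have "\<dots> = ev w (vdm n)"
    unfolding shift_def ev_subst by (rule arg_cong[of _ _ "\<lambda>w. ev w _"]) (auto simp: w_def ev_simps g_def T_def)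
  also have "\<dots> = (\<Prod>x\<in>pairs n. w (fst x) - w (snd x))"
    by (simp add: vdm_def ev_simps case_prod_beta)
  also have "\<dots> = (\<Prod>x\<in>pairs n. (g (fst x) - g (snd x)) *
      (if fst x = i then c (snd x) else if snd x = i then c (fst x) else 1))"
  proof (intro prod.cong refl)
    fix x assume "x \<in> pairs n"
    then obtain j k where x: "x = (j, k)" "j < k" by (auto simp: pairs_def)
    have cancel: "a * (b / a) = b" if "a \<noteq> 0" for a b :: "qtpoly fract" using that by simp
    have "(g j - g i) * c j = g j - T * g i" if "j \<noteq> i"
    proof -
      have "(g j - g i) * c j = - ((g i - g j) * c j)" by (simp add: algebra_simps)
      also have "\<dots> = - (T * g i - g j)" unfolding c_def using gne[of i j] that by (subst cancel) auto
      finally show ?thesis by simp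
    qed
    moreover have "(g i - g k) * c k = T * g i - g k" if "k \<noteq> i"
      unfolding c_def using gne[of i k] that by (subst cancel) auto
    ultimately show "w (fst x) - w (snd x) = (g (fst x) - g (snd x)) *
      (if fst x = i then c (snd x) else if snd x = i then c (fst x) else 1)"
      using x by (auto simp: w_def)
  qed
  also have "\<dots> = to_fract (vdm n) * (\<Prod>x\<in>pairs n. if fst x = i then c (snd x) else if snd x = i then c (fst x) else 1)"
    by (simp add: prod.distrib vdm_def case_prod_beta g_def generic_def ring_hom_on_prod[OF ring_hom_to_fract])
  also have "(\<Prod>x\<in>pairs n. if fst x = i then c (snd x) else if snd x = i then c (fst x) else 1) =
      (\<Prod>x\<in>{x\<in>pairs n. fst x = i \<or> snd x = i}. if fst x = i then c (snd x) else c (fst x))"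
    by (rule prod.mono_neutral_cong_right) auto
  also have "\<dots> = (\<Prod>j\<in>{..<n} - {i}. c j)"
    by (rule prod.reindex_bij_witness[where i = "\<lambda>j. if j < i then (j, i) else (i, j)"
          and j = "\<lambda>x. if fst x = i then snd x else fst x"])
       (use i in \<open>auto simp: pairs_def split: if_splits\<close>)
  finally show ?thesis by (simp only: frac)
qed

lemma macdonald_operator_polynomial:
  assumes "macdonald_operator n p = to_fract (Const E * p)"
  shows "(\<Sum>i<n. shift tvar i (vdm n) * shift qvar i p) = Const E * (vdm n * p)"
proof -
  have "to_fract (\<Sum>i<n. shift tvar i (vdm n) * shift qvar i p) = to_fract (vdm n) * macdonald_operator n p"
    unfolding macdonald_operator_def to_fract_sum sum_distrib_left
    by (intro sum.cong refl) (simp add: shift_vdm mult.assoc shift_def[of qvar, symmetric])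
  also have "\<dots> = to_fract (Const E * (vdm n * p))"
    unfolding assms by (simp add: ac_simps)
  finally show ?thesis by (simp only: to_fract_eq_iff)
qed

text \<open>Clearing the denominators of the Macdonald operator by the Vandermonde product.\<close>
definition residue :: "nat \<Rightarrow> qt \<Rightarrow> qtpoly \<Rightarrow> qtpoly" where
  "residue n E p = (\<Sum>i<n. shift tvar i (vdm n) * shift qvar i p) - Const E * (vdm n * p)"

lemma residue_diff: "residue n E (p - r) = residue n E p - residue n E r"
  by (simp add: residue_def shift_simps right_diff_distrib sum_subtractf)

text \<open>Multiplication by a monomial of the Vandermonde product followed by the shifts acts on
  each monomial of \<open>p\<close> by a scalar; the last factor is this scalar minus
  \<open>E\<close>.\<close>

lemma lookup_residue:
  "Poly_Mapping.lookup (residue n E p) g = (\<Sum>e\<in>Poly_Mapping.keys (vdm n). if adds e g then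
     Poly_Mapping.lookup (vdm n) e * Poly_Mapping.lookup p (g - e) *
       ((\<Sum>i<n. tvar ^ Poly_Mapping.lookup e i * qvar ^ Poly_Mapping.lookup (g - e) i) - E) else 0)"
proof -
  have keys: "Poly_Mapping.keys (shift tvar i (vdm n)) = Poly_Mapping.keys (vdm n)" for i
  proof -
    have "tvar ^ k \<noteq> 0" for k by (simp add: tvar_def)
    then show ?thesis by (auto simp: in_keys_iff lookup_shift)
  qed
  have "Poly_Mapping.lookup (residue n E p) g =
    (\<Sum>i<n. \<Sum>e\<in>Poly_Mapping.keys (vdm n). if adds e g then
       (tvar ^ Poly_Mapping.lookup e i * Poly_Mapping.lookup (vdm n) e) *
       (qvar ^ Poly_Mapping.lookup (g - e) i * Poly_Mapping.lookup p (g - e)) else 0) -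
    (\<Sum>e\<in>Poly_Mapping.keys (vdm n). if adds e g then
       E * (Poly_Mapping.lookup (vdm n) e * Poly_Mapping.lookup p (g - e)) else 0)"
  proof -
    have "Poly_Mapping.lookup (residue n E p) g =
       (\<Sum>i<n. Poly_Mapping.lookup (shift tvar i (vdm n) * shift qvar i p) g) -
       E * Poly_Mapping.lookup (vdm n * p) g"
      by (simp add: residue_def lookup_minus lookup_sum)
    then show ?thesis
      unfolding lookup_times keys
      by (simp add: lookup_shift sum_distrib_left if_distrib[of "\<lambda>x. E * x"] cong: if_cong)
  qed
  also have "\<dots> = (\<Sum>e\<in>Poly_Mapping.keys (vdm n). if adds e g then
     Poly_Mapping.lookup (vdm n) e * Poly_Mapping.lookup p (g - e) *
       ((\<Sum>i<n. tvar ^ Poly_Mapping.lookup e i * qvar ^ Poly_Mapping.lookup (g - e) i) - E) else 0)"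
    unfolding sum_subtractf[symmetric] sum.swap[of _ _ "{..<n}"]
    by (intro sum.cong refl) (simp add: right_diff_distrib sum_distrib_left ac_simps)
  finally show ?thesis .
qed

definition esymp :: "nat \<Rightarrow> nat \<Rightarrow> qtpoly" where
  "esymp n r = (\<Sum>mu\<in>configs (column n r). list_monom mu)"

lemma esymp_eigen:
  assumes "r \<le> n"
  shows "(\<Sum>i<n. shift tvar i (vdm n) * shift qvar i (esymp n r)) =
    Const (eigenvalue (column n r)) * (vdm n * esymp n r)"
  using macdonald_operator_of_family[OF hecke_family_column[OF assms] sorted_column]
  by (intro macdonald_operator_polynomial) (simp add: length_column[OF assms] esymp_def)

lemma esymp_0: "esymp n 0 = 1"
proof -
  have "configs (column n 0) = {replicate n 0}"
  proof -
    have "mu = replicate n 0" if "mset mu = mset (replicate n 0)" for mu :: "nat list"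
    proof -
      have "set mu = set (replicate n 0)" using that by (metis set_mset_mset)
      moreover have "length mu = n" using that by (metis length_replicate size_mset)
      ultimately show ?thesis by (metis in_set_replicate replicate_length_same)
    qed
    then show ?thesis by (auto simp: configs_iff column_def)
  qed
  moreover have "Poly_Mapping.nth (replicate n (0::nat)) = 0"
    by (rule poly_mapping_eqI) (simp add: nth_default_def)
  ultimately show ?thesis by (simp add: esymp_def list_monom_def)
qed

lemma sum_shift_vdm:
  "(\<Sum>i<n. shift tvar i (vdm n)) = Const (\<Sum>i<n. tvar ^ (n - Suc i)) * vdm n"
  using esymp_eigen[of 0 n] by (simp add: esymp_0 shift_simps eigenvalue_def length_column column_def)

text \<open>Coefficients are compared in the eigenvalue equation of the constant 1.\<close>

lemma sum_tvar_vdm: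
  assumes e: "e \<in> Poly_Mapping.keys (vdm n)"
  shows "(\<Sum>i<n. tvar ^ Poly_Mapping.lookup e i) = (\<Sum>i<n. tvar ^ (n - Suc i))"
proof -
  from arg_cong[OF sum_shift_vdm, of "\<lambda>p. Poly_Mapping.lookup p e"]
  have "(\<Sum>i<n. tvar ^ Poly_Mapping.lookup e i) * Poly_Mapping.lookup (vdm n) e =
      (\<Sum>i<n. tvar ^ (n - Suc i)) * Poly_Mapping.lookup (vdm n) e"
    by (simp add: lookup_sum lookup_shift sum_distrib_right)
  then show ?thesis using e by (simp add: in_keys_iff)
qed

section \<open>Eigenvalues to first order in q - 1\<close>

lemma ring_hom_eval_q1_t0: "ring_hom_on eval_q1_t0"
  by (simp add: ring_hom_on_def eval_q1_t0_def)

lemmas eval_simps = ring_hom_onD[OF ring_hom_eval_q1_t0] ring_hom_on_diff[OF ring_hom_eval_q1_t0]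
  ring_hom_on_power[OF ring_hom_eval_q1_t0]

lemma eval_q1_t0_t: "eval_q1_t0 [:0, 1:] = 0"
  by (simp add: eval_q1_t0_def)

lemma eval_q1_t0_q: "eval_q1_t0 [:[:0, 1:]:] = 1"
  by (simp add: eval_q1_t0_def)

lemma q_neq_1: "qvar - 1 \<noteq> 0"
proof
  assume "qvar - 1 = 0"
  then have "to_fract [:[:0, 1:]:] = to_fract (1 :: rat poly poly)" by (simp add: qvar_def)
  then show False by (simp only: to_fract_eq_iff) (simp add: one_pCons)
qed

definition q_number :: "nat \<Rightarrow> rat poly" where
  "q_number a = (\<Sum>i<a. [:0, 1:] ^ i)"

lemma poly_q_number: "poly (q_number a) 1 = of_nat a"
  by (simp add: q_number_def poly_sum)

lemma to_fract_const_q: "to_fract [:[:0, 1:] ^ k:] = qvar ^ k"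
proof (induction k)
  case (Suc k)
  have "[:[:0, 1::rat:] ^ Suc k:] = [:[:0, 1:]:] * [:[:0, 1:] ^ k:]" by simp
  then have "to_fract [:[:0, 1::rat:] ^ Suc k:] = to_fract [:[:0, 1:]:] * to_fract [:[:0, 1:] ^ k:]"
    by (simp only: to_fract_mult)
  then show ?case using Suc by (simp add: qvar_def)
qed (simp add: one_pCons[symmetric])

lemma qvar_power_minus_1: "qvar ^ a - 1 = (qvar - 1) * to_fract [:q_number a:]"
proof -
  have "[:q_number a:] = (\<Sum>i<a. [:[:0, 1:] ^ i:])"
  proof -
    have add: "[:x + y:] = [:x:] + [:y:]" for x y :: "rat poly" by simp
    show ?thesis unfolding q_number_def
    proof (induction a)
      case (Suc a)
      then show ?case by (simp only: sum.lessThan_Suc add)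
    qed simp
  qed
  then have "to_fract [:q_number a:] = (\<Sum>i<a. qvar ^ i)"
    by (simp add: to_fract_const_q)
  then show ?thesis by (simp add: power_diff_1_eq)
qed

text \<open>The last index \<open>m\<close> at which the two lists differ carries the lowest power
  of t. After division by it and by q - 1, setting t = 0 leaves the difference of two q-numbers,
  whose value at q = 1 is the nonzero difference of the parts at \<open>m\<close>.\<close>

lemma eigenvalue_diff:
  assumes len: "length mu = length lam" and ne: "mu \<noteq> lam"
  obtains u k where "eval_q1_t0 u \<noteq> 0"
    "eigenvalue mu - eigenvalue lam = (qvar - 1) * (tvar ^ k * to_fract u)"
proof -
  define n where "n = length lam"
  define c where "c i = q_number (mu ! i) - q_number (lam ! i)" for i
  define P where "P i \<longleftrightarrow> i < n \<and> mu ! i \<noteq> lam ! i" for i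
  have "\<exists>i. P i" using len ne unfolding P_def n_def by (metis nth_equalityI)
  moreover have bnd: "i \<le> n" if "P i" for i using that by (simp add: P_def)
  ultimately have m: "P (GREATEST i. P i)" and max: "\<And>i. P i \<Longrightarrow> i \<le> (GREATEST i. P i)"
    using GreatestI_ex_nat[of P n] Greatest_le_nat[of P _ n] by auto
  define m where "m = (GREATEST i. P i)"
  have Pm: "P m" and max: "\<And>i. P i \<Longrightarrow> i \<le> m" using m max unfolding m_def by auto
  define u where "u = (\<Sum>i\<le>m. [:c i:] * [:0, 1:] ^ (m - i))"
  have "poly u 0 = (\<Sum>i\<le>m. c i * 0 ^ (m - i))" by (simp add: u_def poly_sum)
  also have "\<dots> = (\<Sum>i\<in>{m}. c i * 0 ^ (m - i))" by (rule sum.mono_neutral_right) auto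
  finally have "poly u 0 = c m" by simp
  then have "eval_q1_t0 u = of_nat (mu ! m) - of_nat (lam ! m)"
    by (simp add: eval_q1_t0_def c_def poly_q_number)
  then have 1: "eval_q1_t0 u \<noteq> 0" using Pm by (simp add: P_def)
  have t: "to_fract ([:0, 1:] ^ k) = tvar ^ k" for k
    by (simp only: tvar_def ring_hom_on_power[OF ring_hom_to_fract])
  have c: "qvar ^ (mu ! i) - qvar ^ (lam ! i) = (qvar - 1) * to_fract [:c i:]" for i
  proof -
    have "[:c i:] = [:q_number (mu ! i):] - [:q_number (lam ! i):]" by (simp add: c_def)
    then have "to_fract [:c i:] = to_fract [:q_number (mu ! i):] - to_fract [:q_number (lam ! i):]"
      by (simp only: to_fract_diff)
    then show ?thesis
      using qvar_power_minus_1[of "mu ! i"] qvar_power_minus_1[of "lam ! i"]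
      by (simp add: right_diff_distrib)
  qed
  have mn: "m < n" using Pm by (simp add: P_def)
  have "eigenvalue mu - eigenvalue lam = (\<Sum>i<n. (qvar ^ (mu ! i) - qvar ^ (lam ! i)) * tvar ^ (n - Suc i))"
    by (simp add: eigenvalue_def len n_def left_diff_distrib sum_subtractf)
  also have "\<dots> = (\<Sum>i\<le>m. (qvar ^ (mu ! i) - qvar ^ (lam ! i)) * tvar ^ (n - Suc i))"
  proof (rule sum.mono_neutral_right)
    show "\<forall>i\<in>{..<n} - {..m}. (qvar ^ (mu ! i) - qvar ^ (lam ! i)) * tvar ^ (n - Suc i) = 0"
    proof
      fix i assume "i \<in> {..<n} - {..m}"
      then have "\<not> P i" "i < n" using max[of i] by auto
      then show "(qvar ^ (mu ! i) - qvar ^ (lam ! i)) * tvar ^ (n - Suc i) = 0" by (simp add: P_def)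
    qed
  qed (use mn in auto)
  also have "\<dots> = (\<Sum>i\<le>m. (qvar - 1) * (tvar ^ (n - Suc m) * (to_fract [:c i:] * tvar ^ (m - i))))"
  proof (intro sum.cong refl)
    fix i assume "i \<in> {..m}"
    then have "n - Suc i = (n - Suc m) + (m - i)" using mn by auto
    then show "(qvar ^ (mu ! i) - qvar ^ (lam ! i)) * tvar ^ (n - Suc i) =
      (qvar - 1) * (tvar ^ (n - Suc m) * (to_fract [:c i:] * tvar ^ (m - i)))"
      unfolding c by (simp only: power_add ac_simps)
  qed
  also have "\<dots> = (qvar - 1) * (tvar ^ (n - Suc m) * to_fract u)"
  proof -
    have "to_fract u = (\<Sum>i\<le>m. to_fract [:c i:] * tvar ^ (m - i))"
      unfolding u_def to_fract_sum to_fract_mult t ..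
    then show ?thesis by (simp only: sum_distrib_left)
  qed
  finally show ?thesis using 1 that by blast
qed

definition q1_multiples :: "qt set \<Rightarrow> qt set" where
  "q1_multiples J = (\<lambda>x. (qvar - 1) * x) ` J"

lemma q1_multiplesI: "x \<in> J \<Longrightarrow> (qvar - 1) * x \<in> q1_multiples J"
  unfolding q1_multiples_def by (rule imageI)

lemma submodule_q1_multiples:
  assumes "submodule_of A J"
  shows "submodule_of A (q1_multiples J)"
  unfolding submodule_of_def
proof (intro conjI ballI)
  show "0 \<in> q1_multiples J" using q1_multiplesI[OF submodule_ofD(1)[OF assms]] by simp
  show "x + y \<in> q1_multiples J" if "x \<in> q1_multiples J" "y \<in> q1_multiples J" for x y
    using that submodule_ofD(2)[OF assms] by (auto simp: q1_multiples_def simp flip: distrib_left)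
  show "a * x \<in> q1_multiples J" if "a \<in> A" "x \<in> q1_multiples J" for a x
    using that submodule_ofD(3)[OF assms] by (auto simp: q1_multiples_def mult.left_commute[of a])
qed

lemma qvar_power_minus_1_in: "qvar ^ a - 1 \<in> q1_multiples polys"
  unfolding qvar_power_minus_1 by (rule q1_multiplesI) simp

text \<open>At q = 1 the exponents of q disappear, and \<open>sum_tvar_vdm\<close> makes the
  remaining sums of powers of t equal; hence the difference is divisible by q - 1.\<close>

lemma eigen_factor_in:
  assumes e: "e \<in> Poly_Mapping.keys (vdm (length lam))"
  shows "(\<Sum>i<length lam. tvar ^ Poly_Mapping.lookup e i * qvar ^ Poly_Mapping.lookup h i) - eigenvalue lam
    \<in> q1_multiples polys"
proof -
  define n where "n = length lam"
  note sm = submodule_q1_multiples[OF submodule_polys]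
  have sub: "(\<Sum>i<n. tvar ^ a i * qvar ^ b i) - (\<Sum>i<n. tvar ^ a i) \<in> q1_multiples polys" for a b :: "nat \<Rightarrow> nat"
  proof -
    have "(\<Sum>i<n. tvar ^ a i * qvar ^ b i) - (\<Sum>i<n. tvar ^ a i) = (\<Sum>i<n. tvar ^ a i * (qvar ^ b i - 1))"
      by (simp add: right_diff_distrib sum_subtractf)
    also have "\<dots> \<in> q1_multiples polys"
      by (intro submodule_of_sum[OF sm] submodule_ofD(3)[OF sm] polys_power qvar_power_minus_1_in) simp
    finally show ?thesis .
  qed
  have "((\<Sum>i<n. tvar ^ Poly_Mapping.lookup e i * qvar ^ Poly_Mapping.lookup h i) - (\<Sum>i<n. tvar ^ Poly_Mapping.lookup e i))
      - ((\<Sum>i<n. tvar ^ (n - Suc i) * qvar ^ (lam ! i)) - (\<Sum>i<n. tvar ^ (n - Suc i))) \<in> q1_multiples polys"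
    by (rule submodule_of_diff[OF sm _ sub sub]) simp
  then show ?thesis
    using sum_tvar_vdm[OF e] by (simp add: eigenvalue_def n_def mult.commute)
qed

definition symmetric_coeffs :: "nat \<Rightarrow> qtpoly \<Rightarrow> bool" where
  "symmetric_coeffs n p \<longleftrightarrow>
     (\<forall>be ga. length be = n \<longrightarrow> mset be = mset ga \<longrightarrow> lcoeff p be = lcoeff p ga)"

text \<open>Up to terms with a larger sum of squared exponents, the coefficient of the residue at
  \<open>mu + staircase\<close> is \<open>lcoeff p mu\<close> times a difference of eigenvalues, which is \<open>q - 1\<close> times a unit once \<open>t\<close>
  is inverted.\<close>
theorem triangular_induction:
  assumes srt: "sorted_wrt (\<ge>) lam" and J: "submodule_of polys J"
    and p: "in_vars (length lam) p" "symmetric_coeffs (length lam) p"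
    and res: "coeffs_in (q1_multiples J) (residue (length lam) (eigenvalue lam) p)"
    and top: "lcoeff p lam \<in> J"
    and div: "\<And>x u k. eval_q1_t0 u \<noteq> 0 \<Longrightarrow> tvar ^ k * to_fract u * x \<in> J \<Longrightarrow> x \<in> J"
    and be: "length be = length lam"
  shows "lcoeff p be \<in> J"
proof -
  define n where "n = length lam"
  define B where "B = Max (insert 0 (sqsum ` expo n ` Poly_Mapping.keys p))"
  have B: "sqsum be \<le> B" if "length be = n" "lcoeff p be \<noteq> 0" for be
  proof -
    have "expo n (Poly_Mapping.nth be) = be"
      using that(1) by (intro nth_equalityI) (auto simp: nth_default_def)
    moreover have "Poly_Mapping.nth be \<in> Poly_Mapping.keys p" using that(2) by (simp add: in_keys_iff)
    ultimately have "be \<in> expo n ` Poly_Mapping.keys p" by (metis imageI)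
    then have "sqsum be \<in> insert 0 (sqsum ` expo n ` Poly_Mapping.keys p)" by blast
    then show ?thesis unfolding B_def by (rule Max_ge[rotated]) simp
  qed
  note smJ = submodule_q1_multiples[OF J]
  \<comment> \<open>Downward induction on the sum of squares, which \<open>B\<close> bounds on the
    support of \<open>p\<close>: all terms but the leading one refer to strictly larger
    sums.\<close>
  have "lcoeff p be \<in> J" if "length be = n" for be
    using that
  proof (induction "Suc B - sqsum be" arbitrary: be rule: less_induct)
    case less
    define mu where "mu = rev (sort be)"
    have lmu: "length mu = n" and mmu: "mset mu = mset be" and smu: "sorted_wrt (\<ge>) mu"
      using less.prems sorted_sort[of be] unfolding mu_def sorted_wrt_rev by auto
    have pmu: "lcoeff p be = lcoeff p mu"
      using p(2) less.prems mmu unfolding symmetric_coeffs_def n_def by metis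
    have sq: "sqsum mu = sqsum be" by (rule sqsum_mset[OF mmu])
    consider "lcoeff p be = 0" | "mu = lam" | "lcoeff p be \<noteq> 0" "mu \<noteq> lam" by blast
    then show ?case
    proof cases
      case 1
      then show ?thesis using submodule_ofD(1)[OF J] by simp
    next
      case 2
      then show ?thesis using top pmu by simp
    next
      case 3
      then have bnd: "sqsum be \<le> B" using B less.prems by blast
      define g where "g = Poly_Mapping.nth mu + staircase n"
      define F where "F e = (if adds e g then
         Poly_Mapping.lookup (vdm n) e * Poly_Mapping.lookup p (g - e) *
         ((\<Sum>i<n. tvar ^ Poly_Mapping.lookup e i * qvar ^ Poly_Mapping.lookup (g - e) i) - eigenvalue lam) else 0)" for e
      \<comment> \<open>Some strictly decreasing weight is chosen in order to read off the
        coefficient 1 at the staircase.\<close>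
      have ut: "unique_top n (\<lambda>i. - int i) (vdm n) (staircase n)" by (rule unique_top_vdm) simp
      then have v1: "Poly_Mapping.lookup (vdm n) (staircase n) = 1" by (simp add: unique_top_def)
      have F0: "F (staircase n) = lcoeff p mu * (eigenvalue mu - eigenvalue lam)"
      proof -
        have a: "adds (staircase n) g" "g - staircase n = Poly_Mapping.nth mu"
          unfolding adds_def g_def
          by (rule exI[of _ "Poly_Mapping.nth mu"], rule add.commute, rule add_diff_cancel_right')
        have "(\<Sum>i<n. tvar ^ Poly_Mapping.lookup (staircase n) i * qvar ^ Poly_Mapping.lookup (Poly_Mapping.nth mu) i)
            = eigenvalue mu"
          unfolding eigenvalue_def lmu
          by (intro sum.cong refl) (use lmu in \<open>simp add: lookup_staircase nth_default_def\<close>)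
        then show ?thesis using a v1 by (simp add: F_def)
      qed
      have Fe: "F e \<in> q1_multiples J" if e: "e \<in> Poly_Mapping.keys (vdm n) - {staircase n}" for e
      proof (cases "adds e g")
        case True
        then obtain h where h: "g = e + h" by (auto simp: adds_def)
        have ge: "g - e = h" by (simp add: h)
        have lt: "sqsum mu < sqsum (expo n h)"
        proof -
          have "sqsum (expo n (Poly_Mapping.nth mu)) < sqsum (expo n h)"
          proof (rule sq_increases)
            show "Poly_Mapping.lookup (Poly_Mapping.nth mu) j \<le> Poly_Mapping.lookup (Poly_Mapping.nth mu) i"
              if "i < j" "j < n" for i j
              using that smu lmu by (simp add: nth_default_def sorted_wrt_iff_nth_less)
          qed (use e h g_def in auto)
          moreover have "expo n (Poly_Mapping.nth mu) = mu"
            using lmu by (intro nth_equalityI) (auto simp: nth_default_def)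
          ultimately show ?thesis by simp
        qed
        have kh: "Poly_Mapping.keys h \<subseteq> {..<n}"
        proof
          fix i assume "i \<in> Poly_Mapping.keys h"
          then have "Poly_Mapping.lookup g i \<noteq> 0" by (simp add: h lookup_add in_keys_iff)
          then have "i \<in> Poly_Mapping.keys (Poly_Mapping.nth mu) \<union> Poly_Mapping.keys (staircase n)"
            by (auto simp: g_def lookup_add in_keys_iff simp del: keys_nth lookup_nth)
          then show "i \<in> {..<n}" using keys_nth_subset[of mu] keys_staircase[of n] lmu by auto
        qed
        have "lcoeff p (expo n h) \<in> J"
          by (rule less.hyps) (use lt sq bnd in auto)
        then have ph: "Poly_Mapping.lookup p h \<in> J" using nth_of_expo[OF kh] by simp
        obtain y where y: "y \<in> polys"
          "(\<Sum>i<n. tvar ^ Poly_Mapping.lookup e i * qvar ^ Poly_Mapping.lookup h i) - eigenvalue lam = (qvar - 1) * y"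
          using eigen_factor_in[of e lam h] e unfolding n_def[symmetric] q1_multiples_def by blast
        have "F e = (qvar - 1) * (y * (Poly_Mapping.lookup (vdm n) e * Poly_Mapping.lookup p h))"
          unfolding F_def ge y(2) using True by (simp add: ac_simps)
        also have "\<dots> \<in> q1_multiples J"
          by (intro q1_multiplesI submodule_ofD(3)[OF J] y ph)
             (use coeffs_in_polys_vdm[of n] in \<open>simp add: coeffs_in_def\<close>)
        finally show ?thesis .
      qed (use submodule_ofD(1)[OF smJ] in \<open>simp add: F_def\<close>)
      have k0: "staircase n \<in> Poly_Mapping.keys (vdm n)" using v1 by (simp add: in_keys_iff)
      have "Poly_Mapping.lookup (residue n (eigenvalue lam) p) g = (\<Sum>e\<in>Poly_Mapping.keys (vdm n). F e)"
        by (simp only: lookup_residue F_def)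
      also have "\<dots> = F (staircase n) + (\<Sum>e\<in>Poly_Mapping.keys (vdm n) - {staircase n}. F e)"
        by (rule sum.remove[OF finite_keys k0])
      finally have "F (staircase n) = Poly_Mapping.lookup (residue n (eigenvalue lam) p) g -
          (\<Sum>e\<in>Poly_Mapping.keys (vdm n) - {staircase n}. F e)" by simp
      also have "\<dots> \<in> q1_multiples J"
        by (rule submodule_of_diff[OF smJ])
           (use res Fe in \<open>auto simp: coeffs_in_def n_def[symmetric] intro: submodule_of_sum[OF smJ]\<close>)
      finally obtain y where y: "y \<in> J" "lcoeff p mu * (eigenvalue mu - eigenvalue lam) = (qvar - 1) * y"
        unfolding F0 q1_multiples_def by blast
      obtain u k where u: "eval_q1_t0 u \<noteq> 0"
        "eigenvalue mu - eigenvalue lam = (qvar - 1) * (tvar ^ k * to_fract u)"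
        by (rule eigenvalue_diff[of mu lam]) (use lmu 3 in \<open>auto simp: n_def\<close>)
      \<comment> \<open>Both sides carry the factor q - 1. Cancelling it leaves
        \<open>lcoeff p mu\<close> times a power of t and a polynomial that is nonzero at (1, 0),
        which \<open>div\<close> removes.\<close>
      have "(qvar - 1) * (tvar ^ k * to_fract u * lcoeff p mu) = (qvar - 1) * y"
        using y(2) unfolding u(2) by (simp only: ac_simps)
      then have "tvar ^ k * to_fract u * lcoeff p mu \<in> J" using q_neq_1 y(1) by (simp only: mult_cancel_left) simp
      then show ?thesis using div[OF u(1)] pmu by simp
    qed
  qed
  then show ?thesis using be by (simp add: n_def)
qed

lemma symmetric_coeffs_of_swap:
  assumes "in_vars n p" "\<And>i. Suc i < n \<Longrightarrow> swap_vars i p = p"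
  shows "symmetric_coeffs n p"
  unfolding symmetric_coeffs_def
proof (intro allI impI)
  fix be ga :: "nat list" assume len: "length be = n" and m: "mset be = mset ga"
  show "lcoeff p be = lcoeff p ga"
  proof (rule adjacent_swaps_invariant[OF _ m])
    fix w i assume w: "mset w = mset be" "Suc i < length w"
    have lw: "length w = n" using w(1) len by (metis size_mset)
    show "lcoeff p (swap_entries i w) = lcoeff p w"
      using lcoeff_swap_vars[OF assms(1) lw, of i] assms(2)[of i] w(2) lw by simp
  qed
qed

lemma symmetric_coeffs_diff:
  "symmetric_coeffs n p \<Longrightarrow> symmetric_coeffs n r \<Longrightarrow> symmetric_coeffs n (p - r)"
  unfolding symmetric_coeffs_def lookup_minus by metis

lemma in_vars_diff: "in_vars n p \<Longrightarrow> in_vars n r \<Longrightarrow> in_vars n (p - r)" for p r :: qtpoly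
  using keys_diff[of p r] unfolding in_vars_def by blast

lemma in_vars_sum: "(\<And>i. i \<in> I \<Longrightarrow> in_vars n (g i)) \<Longrightarrow> in_vars n (sum g I)" for g :: "_ \<Rightarrow> qtpoly"
  using keys_sum[of g I] unfolding in_vars_def by blast

lemma in_vars_add: "in_vars n p \<Longrightarrow> in_vars n r \<Longrightarrow> in_vars n (p + r)" for p r :: qtpoly
  using keys_add[of p r] unfolding in_vars_def by blast

lemma in_vars_times:
  fixes p r :: qtpoly
  assumes "in_vars n p" "in_vars n r"
  shows "in_vars n (p * r)"
  unfolding in_vars_def
proof
  fix e assume "e \<in> Poly_Mapping.keys (p * r)"
  then obtain a b where "e = a + b" "a \<in> Poly_Mapping.keys p" "b \<in> Poly_Mapping.keys r"
    using keys_mult[of p r] by blast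
  then show "Poly_Mapping.keys e \<subseteq> {..<n}"
    using assms keys_add[of a b] unfolding in_vars_def by blast
qed

lemma in_vars_list_monom: "length mu = n \<Longrightarrow> in_vars n (list_monom mu)"
  using keys_nth_subset[of mu] unfolding in_vars_def list_monom_def by simp

lemma in_vars_Const_times: "in_vars n p \<Longrightarrow> in_vars n (Const c * p)"
  by (rule in_vars_times) (simp add: in_vars_def Const_def)

lemma lcoeff_list_monom: "length mu = length be \<Longrightarrow> lcoeff (list_monom mu) be = of_bool (mu = be)"
  using nth_inject[of mu be] by (auto simp: list_monom_def lookup_single when_def)

lemma lcoeff_sum_list_monom:
  assumes "length mu = length be"
  shows "lcoeff (\<Sum>nu\<in>configs mu. list_monom nu) be = of_bool (mset be = mset mu)"
proof -
  have "lcoeff (\<Sum>nu\<in>configs mu. list_monom nu) be = (\<Sum>nu\<in>configs mu. of_bool (nu = be))"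
    unfolding lookup_sum
    by (intro sum.cong refl lcoeff_list_monom) (metis assms length_configs)
  also have "\<dots> = of_bool (be \<in> configs mu)" by (simp add: of_bool_def)
  finally show ?thesis by (simp add: configs_iff)
qed

section \<open>The sum of the family as a Macdonald polynomial\<close>

context asep_family
begin

definition total_poly :: qtpoly where
  "total_poly = (\<Sum>mu\<in>configs lam. f mu)"

lemma in_vars_total: "in_vars (length lam) total_poly"
  unfolding total_poly_def by (rule in_vars_sum) (rule in_vars_f)

lemma symmetric_total: "symmetric_coeffs (length lam) total_poly"
proof (rule symmetric_coeffs_of_swap[OF in_vars_total])
  fix i assume i: "Suc i < length lam"
  have "to_fract (swap_vars i total_poly) = ev (swap_args i generic) total_poly"
    by (simp only: ev_generic[symmetric] ev_swap_vars)
  also have "\<dots> = to_fract total_poly"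
    using hecke_family.sum_symmetric[OF hecke_family_f i, of generic]
    by (simp add: total_poly_def ev_simps ev_generic)
  finally show "swap_vars i total_poly = total_poly" by (simp only: to_fract_eq_iff)
qed

lemma lcoeff_total_lam: "lcoeff total_poly lam = 1"
proof -
  have "lcoeff total_poly lam = (\<Sum>mu\<in>configs lam. of_bool (lam = mu))"
    unfolding total_poly_def lookup_sum
    by (intro sum.cong refl) (simp add: leading_part(2))
  then show ?thesis by (simp add: of_bool_def configs_iff)
qed

lemma residue_total: "residue (length lam) (eigenvalue lam) total_poly = 0"
  using macdonald_operator_polynomial[OF macdonald_operator_of_family[OF hecke_family_f srt]]
  by (simp add: residue_def total_poly_def)

lemma residue_macdonald:
  assumes "macdonald_polynomial lam P"
  shows "residue (length lam) (eigenvalue lam) P = 0"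
proof -
  have "macdonald_operator (length lam) P = to_fract (Const (eigenvalue lam) * P)"
    using assms by (simp add: macdonald_polynomial_def Let_def eigenvalue_def)
  from macdonald_operator_polynomial[OF this] show ?thesis by (simp add: residue_def)
qed

lemma macdonald_expansion:
  assumes "macdonald_polynomial lam P"
  shows "in_vars (length lam) P" "symmetric_coeffs (length lam) P" "lcoeff P lam = 1"
proof -
  define n where "n = length lam"
  define m where "m mu = (\<Sum>nu\<in>configs mu. list_monom nu)" for mu
  obtain c where P: "P = m lam + (\<Sum>mu\<in>strictly_dominated lam. Const (c mu) * m mu)"
    using assms unfolding macdonald_polynomial_def Let_def monomial_symmetric_def m_def list_monom_def by blast
  have len: "length mu = n" and sr: "sorted_wrt (\<ge>) mu" "mu \<noteq> lam" if "mu \<in> strictly_dominated lam" for mu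
    using that by (auto simp: strictly_dominated_def n_def)
  have inm: "in_vars n (m mu)" if "length mu = n" for mu
    unfolding m_def by (intro in_vars_sum in_vars_list_monom) (metis length_configs that)
  show "in_vars (length lam) P"
    unfolding P n_def[symmetric]
    by (rule in_vars_add[OF inm in_vars_sum[OF in_vars_Const_times[OF inm[OF len]]]]) (simp add: n_def)
  have co: "lcoeff P be = of_bool (mset be = mset lam) +
      (\<Sum>mu\<in>strictly_dominated lam. c mu * of_bool (mset be = mset mu))" if "length be = n" for be
  proof -
    have m: "lcoeff (m mu) be = of_bool (mset be = mset mu)" if "length mu = n" for mu
      unfolding m_def by (rule lcoeff_sum_list_monom) (simp add: that \<open>length be = n\<close>)
    show ?thesis
      unfolding P lookup_add lookup_sum lookup_Const_times
      by (intro arg_cong2[of _ _ _ _ "(+)"] sum.cong refl) (simp_all add: m len, simp add: m n_def)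
  qed
  show "symmetric_coeffs (length lam) P"
    unfolding symmetric_coeffs_def n_def[symmetric]
  proof (intro allI impI)
    fix be ga :: "nat list" assume l: "length be = n" and m: "mset be = mset ga"
    from l m have "length ga = n" by (metis size_mset)
    with l m show "lcoeff P be = lcoeff P ga" by (simp add: co)
  qed
  have "mset lam \<noteq> mset mu" if "mu \<in> strictly_dominated lam" for mu
    using sorted_desc_mset_unique[OF srt sr(1)[OF that]] sr(2)[OF that] by auto
  then show "lcoeff P lam = 1" using co[of lam] by (simp add: n_def)
qed

text \<open>For \<open>J\<close> the zero module the triangular induction is a uniqueness statement:
  both polynomials are symmetric eigenfunctions with the same eigenvalue and with coefficient 1 at
  \<open>lam\<close>.\<close>

theorem macdonald_eq_total:
  assumes P: "macdonald_polynomial lam P"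
  shows "P = total_poly"
proof (rule in_vars_eqI[OF macdonald_expansion(1)[OF P] in_vars_total])
  fix be :: "nat list" assume be: "length be = length lam"
  have "lcoeff (P - total_poly) be \<in> {0}"
  proof (rule triangular_induction[OF srt])
    show "submodule_of polys {0}" by (simp add: submodule_of_def)
    show "in_vars (length lam) (P - total_poly)"
      by (rule in_vars_diff[OF macdonald_expansion(1)[OF P] in_vars_total])
    show "symmetric_coeffs (length lam) (P - total_poly)"
      by (rule symmetric_coeffs_diff[OF macdonald_expansion(2)[OF P] symmetric_total])
    show "coeffs_in (q1_multiples {0}) (residue (length lam) (eigenvalue lam) (P - total_poly))"
      by (simp add: residue_diff residue_macdonald[OF P] residue_total coeffs_in_def q1_multiples_def)
    show "lcoeff (P - total_poly) lam \<in> {0}"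
      by (simp add: lookup_minus macdonald_expansion(3)[OF P] lcoeff_total_lam)
    show "x \<in> {0}" if u: "eval_q1_t0 u \<noteq> 0" and 0: "tvar ^ k * to_fract u * x \<in> {0}" for x u k
    proof -
      have "u \<noteq> 0" using u by (auto simp: eval_simps)
      then show ?thesis using 0 by (simp add: tvar_def)
    qed
  qed (rule be)
  then show "lcoeff P be = lcoeff total_poly be" by (simp add: lookup_minus)
qed

end

section \<open>Values at \<open>(q, t) = (1, 0)\<close>\<close>

text \<open>The local ring of rational functions without pole at (1, 0); \<open>vanishing\<close> is
  its maximal ideal. Denominators are multiplied out, so that closure properties reduce to
  identities of polynomials.\<close>

definition regular :: "qt set" where
  "regular = {x. \<exists>a u. eval_q1_t0 u \<noteq> 0 \<and> to_fract u * x = to_fract a}"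

definition vanishing :: "qt set" where
  "vanishing = {x. \<exists>a u. eval_q1_t0 u \<noteq> 0 \<and> eval_q1_t0 a = 0 \<and> to_fract u * x = to_fract a}"

lemma value_q1_t0_eq:
  assumes u: "eval_q1_t0 u \<noteq> 0" and x: "to_fract u * x = to_fract a"
  shows "value_q1_t0 x = eval_q1_t0 a / eval_q1_t0 u"
proof -
  have u0: "u \<noteq> 0" using u by (auto simp: eval_simps)
  then have xe: "x = Fract a u" using x by (simp add: Fract_conv_to_fract field_simps)
  show ?thesis
    unfolding value_q1_t0_def
  proof (rule the_equality)
    show "\<exists>a' b. x = Fract a' b \<and> eval_q1_t0 b \<noteq> 0 \<and> eval_q1_t0 a / eval_q1_t0 u = eval_q1_t0 a' / eval_q1_t0 b"
      using xe u by blast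
    fix v assume "\<exists>a' b. x = Fract a' b \<and> eval_q1_t0 b \<noteq> 0 \<and> v = eval_q1_t0 a' / eval_q1_t0 b"
    then obtain a' b where b: "x = Fract a' b" "eval_q1_t0 b \<noteq> 0" "v = eval_q1_t0 a' / eval_q1_t0 b" by blast
    have "b \<noteq> 0" using b(2) by (auto simp: eval_simps)
    then have "a * b = a' * u" using b(1) xe u0 by (simp add: eq_fract)
    then have "eval_q1_t0 a * eval_q1_t0 b = eval_q1_t0 a' * eval_q1_t0 u" by (metis eval_simps(4))
    then show "v = eval_q1_t0 a / eval_q1_t0 u" unfolding b(3) using u b(2) by (simp add: field_simps)
  qed
qed

lemma regularE:
  assumes "x \<in> regular"
  obtains a u where "eval_q1_t0 u \<noteq> 0" "to_fract u * x = to_fract a"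
  using assms by (auto simp: regular_def)

lemma regularI: "eval_q1_t0 u \<noteq> 0 \<Longrightarrow> to_fract u * x = to_fract a \<Longrightarrow> x \<in> regular"
  by (auto simp: regular_def)

lemma polys_regular: "x \<in> polys \<Longrightarrow> x \<in> regular"
  by (auto simp: polys_def intro: regularI[of 1] simp: eval_simps)

lemma regular_add:
  assumes "x \<in> regular" "y \<in> regular"
  shows "x + y \<in> regular" "value_q1_t0 (x + y) = value_q1_t0 x + value_q1_t0 y"
proof -
  obtain a u where x: "eval_q1_t0 u \<noteq> 0" "to_fract u * x = to_fract a" by (rule regularE[OF assms(1)])
  obtain b w where y: "eval_q1_t0 w \<noteq> 0" "to_fract w * y = to_fract b" by (rule regularE[OF assms(2)])
  have uw: "eval_q1_t0 (u * w) \<noteq> 0" using x y by (simp add: eval_simps)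
  have "to_fract (u * w) * (x + y) = to_fract w * (to_fract u * x) + to_fract u * (to_fract w * y)"
    by (simp add: algebra_simps)
  also have "\<dots> = to_fract (w * a + u * b)" by (simp add: x y)
  finally have e: "to_fract (u * w) * (x + y) = to_fract (w * a + u * b)" .
  show "x + y \<in> regular" by (rule regularI[OF uw e])
  show "value_q1_t0 (x + y) = value_q1_t0 x + value_q1_t0 y"
    unfolding value_q1_t0_eq[OF uw e] value_q1_t0_eq[OF x] value_q1_t0_eq[OF y]
    using x y by (simp add: eval_simps field_simps)
qed

lemma regular_mult:
  assumes "x \<in> regular" "y \<in> regular"
  shows "x * y \<in> regular" "value_q1_t0 (x * y) = value_q1_t0 x * value_q1_t0 y"
proof -
  obtain a u where x: "eval_q1_t0 u \<noteq> 0" "to_fract u * x = to_fract a" by (rule regularE[OF assms(1)])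
  obtain b w where y: "eval_q1_t0 w \<noteq> 0" "to_fract w * y = to_fract b" by (rule regularE[OF assms(2)])
  have uw: "eval_q1_t0 (u * w) \<noteq> 0" using x y by (simp add: eval_simps)
  have "to_fract (u * w) * (x * y) = (to_fract u * x) * (to_fract w * y)" by simp
  also have "\<dots> = to_fract (a * b)" by (simp add: x y)
  finally have e: "to_fract (u * w) * (x * y) = to_fract (a * b)" .
  show "x * y \<in> regular" by (rule regularI[OF uw e])
  show "value_q1_t0 (x * y) = value_q1_t0 x * value_q1_t0 y"
    unfolding value_q1_t0_eq[OF uw e] value_q1_t0_eq[OF x] value_q1_t0_eq[OF y]
    by (simp add: eval_simps)
qed

lemma value_to_fract: "value_q1_t0 (to_fract a) = eval_q1_t0 a"
  using value_q1_t0_eq[of 1 "to_fract a" a] by (simp add: eval_simps)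

lemma value_0 [simp]: "value_q1_t0 0 = 0"
  using value_to_fract[of 0] by (simp add: eval_simps)

lemma value_1 [simp]: "value_q1_t0 1 = 1"
  using value_to_fract[of 1] by (simp add: eval_simps)

lemma value_tvar: "value_q1_t0 tvar = 0"
  unfolding tvar_def value_to_fract by (rule eval_q1_t0_t)

lemma value_qvar: "value_q1_t0 qvar = 1"
  unfolding qvar_def value_to_fract by (rule eval_q1_t0_q)

lemma vanishing_regular: "x \<in> vanishing \<Longrightarrow> x \<in> regular"
  by (auto simp: vanishing_def regular_def)

lemma vanishing_iff: "x \<in> vanishing \<longleftrightarrow> x \<in> regular \<and> value_q1_t0 x = 0"
  using value_q1_t0_eq by (fastforce simp: vanishing_def regular_def)

text \<open>The multiples of \<open>q - 1\<close> in the local ring at \<open>(1, 0)\<close> with \<open>t\<close> inverted.\<close>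
definition t_laurent :: "qt set" where
  "t_laurent = {x. \<exists>a u b. eval_q1_t0 u \<noteq> 0 \<and> tvar ^ b * to_fract u * x = (qvar - 1) * to_fract a}"

text \<open>The equation defining \<open>t_laurent\<close>, multiplied by \<open>h\<close>, is
  reduced modulo t. If b is positive, its left side vanishes, and since \<open>h\<close> has a
  nonzero reduction, t divides \<open>a\<close>. Cancelling t lowers b down to 0, where x is q - 1
  times a regular element.\<close>

lemma t_laurent_vanishing:
  assumes x: "x \<in> t_laurent" and h: "poly h 0 \<noteq> 0" "to_fract h * x = to_fract c"
  shows "x \<in> vanishing"
proof -
  have "x \<in> vanishing"
    if u: "eval_q1_t0 u \<noteq> 0" and e: "tvar ^ b * to_fract u * x = (qvar - 1) * to_fract a" for a u b
    using e
  proof (induction b arbitrary: a)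
    case 0
    have "eval_q1_t0 (([:[:0, 1:]:] - 1) * a) = 0" by (simp add: eval_simps eval_q1_t0_q)
    moreover have "to_fract u * x = to_fract (([:[:0, 1:]:] - 1) * a)"
      using 0 by (simp add: qvar_def)
    ultimately show ?case using u unfolding vanishing_def by blast
  next
    case (Suc b)
    have t: "to_fract ([:0, 1:] ^ k) = tvar ^ k" for k
      by (simp only: tvar_def ring_hom_on_power[OF ring_hom_to_fract])
    have "to_fract ([:0, 1:] ^ Suc b * u * c) = to_fract h * (tvar ^ Suc b * to_fract u * x)"
      unfolding to_fract_mult t h(2)[symmetric] by (simp only: ac_simps)
    also have "\<dots> = to_fract (([:[:0, 1:]:] - 1) * a * h)"
      unfolding Suc.prems by (simp add: qvar_def ac_simps)
    finally have "[:0, 1:] ^ Suc b * u * c = ([:[:0, 1:]:] - 1) * a * h" by (simp only: to_fract_eq_iff)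
    from arg_cong[OF this, of "\<lambda>p. poly p 0"]
    have "([:0, 1:] - 1) * poly a 0 * poly h 0 = (0 :: rat poly)" by simp
    moreover have "[:0, 1:] - 1 \<noteq> (0 :: rat poly)" by (simp add: one_pCons)
    ultimately have "poly a 0 = 0" using h(1) by simp
    then obtain a' where a': "a = [:0, 1:] * a'" by (auto simp: poly_eq_0_iff_dvd elim: dvdE)
    have "tvar * (tvar ^ b * to_fract u * x) = tvar * ((qvar - 1) * to_fract a')"
      using Suc.prems unfolding a' to_fract_mult tvar_def[symmetric] by (simp only: power_Suc ac_simps)
    then have "tvar ^ b * to_fract u * x = (qvar - 1) * to_fract a'"
      by (simp add: tvar_def)
    then show ?case by (rule Suc.IH)
  qed
  then show ?thesis using x by (auto simp: t_laurent_def)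
qed

lemma submodule_t_laurent: "submodule_of polys t_laurent"
  unfolding submodule_of_def
proof (intro conjI ballI)
  show "0 \<in> t_laurent" unfolding t_laurent_def
    by (intro CollectI exI[of _ 0] exI[of _ 1]) (simp add: eval_simps)
next
  fix x y assume "x \<in> t_laurent" "y \<in> t_laurent"
  then obtain a u b a' u' b' where
    x: "eval_q1_t0 u \<noteq> 0" "tvar ^ b * to_fract u * x = (qvar - 1) * to_fract a" and
    y: "eval_q1_t0 u' \<noteq> 0" "tvar ^ b' * to_fract u' * y = (qvar - 1) * to_fract a'"
    unfolding t_laurent_def by blast
  have t: "to_fract ([:0, 1:] ^ k) = tvar ^ k" for k
    by (simp only: tvar_def ring_hom_on_power[OF ring_hom_to_fract])
  have "tvar ^ (b + b') * to_fract (u * u') * (x + y) =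
      (tvar ^ b' * to_fract u') * (tvar ^ b * to_fract u * x) + (tvar ^ b * to_fract u) * (tvar ^ b' * to_fract u' * y)"
    by (simp add: power_add algebra_simps)
  also have "\<dots> = (qvar - 1) * to_fract ([:0, 1:] ^ b' * u' * a + [:0, 1:] ^ b * u * a')"
    unfolding x y to_fract_add to_fract_mult t by (simp add: algebra_simps)
  finally show "x + y \<in> t_laurent"
    unfolding t_laurent_def using x(1) y(1)
    by (intro CollectI exI[of _ "[:0, 1:] ^ b' * u' * a + [:0, 1:] ^ b * u * a'"] exI[of _ "u * u'"] exI[of _ "b + b'"])
       (simp only: eval_simps mult_eq_0_iff not_False_eq_True de_Morgan_disj simp_thms)
next
  fix c x assume "c \<in> polys" "x \<in> t_laurent"
  then obtain d a u b where c: "c = to_fract d" and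
    x: "eval_q1_t0 u \<noteq> 0" "tvar ^ b * to_fract u * x = (qvar - 1) * to_fract a"
    unfolding t_laurent_def polys_def by blast
  have "tvar ^ b * to_fract u * (c * x) = c * (tvar ^ b * to_fract u * x)" by (simp only: ac_simps)
  also have "\<dots> = (qvar - 1) * to_fract (d * a)" unfolding x c to_fract_mult by (simp only: ac_simps)
  finally show "c * x \<in> t_laurent" unfolding t_laurent_def using x(1) by blast
qed

lemma t_laurent_divide:
  assumes u: "eval_q1_t0 u \<noteq> 0" and "tvar ^ k * to_fract u * x \<in> t_laurent"
  shows "x \<in> t_laurent"
proof -
  obtain a u' b where x: "eval_q1_t0 u' \<noteq> 0"
    "tvar ^ b * to_fract u' * (tvar ^ k * to_fract u * x) = (qvar - 1) * to_fract a"
    using assms(2) unfolding t_laurent_def by blast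
  have "tvar ^ (b + k) * to_fract (u' * u) * x = (qvar - 1) * to_fract a"
    unfolding x(2)[symmetric] power_add to_fract_mult by (simp only: ac_simps)
  moreover have "eval_q1_t0 (u' * u) \<noteq> 0" using u x(1) by (simp add: eval_simps)
  ultimately show ?thesis unfolding t_laurent_def by blast
qed

section \<open>Products of elementary symmetric functions modulo (q - 1)^2\<close>

lemma coeffs_in_polys_list_monom: "coeffs_in polys (list_monom mu)"
  by (simp add: coeffs_in_def list_monom_def lookup_single when_def)

lemma column_entry: "mu \<in> configs (column n r) \<Longrightarrow> i < length mu \<Longrightarrow> mu ! i = 0 \<or> mu ! i = 1"
proof -
  assume mu: "mu \<in> configs (column n r)" and i: "i < length mu"
  have "set mu = set (column n r)" using mu by (metis configs_iff set_mset_mset)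
  then have "mu ! i \<in> set (column n r)" using i nth_mem by blast
  then show ?thesis by (auto simp: column_def)
qed

lemma nth_column: "i < n \<Longrightarrow> column n r ! i = of_bool (i < r)"
  by (auto simp: column_def nth_append)

lemma coeffs_in_polys_esymp: "coeffs_in polys (esymp n r)"
  unfolding esymp_def by (intro coeffs_in_sum[OF submodule_polys] coeffs_in_polys_list_monom)

lemma in_vars_esymp: "r \<le> n \<Longrightarrow> in_vars n (esymp n r)"
  unfolding esymp_def by (intro in_vars_sum in_vars_list_monom) (metis length_column length_configs)

text \<open>The derivative x_i d/dx_i of the elementary symmetric function. Since all exponents are
  0 or 1, its q-shift in x_i is exactly linear in q - 1, with this coefficient.\<close>

definition esymp_deriv :: "nat \<Rightarrow> nat \<Rightarrow> nat \<Rightarrow> qtpoly" where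
  "esymp_deriv n r i = (\<Sum>mu\<in>configs (column n r). Const (of_nat (mu ! i)) * list_monom mu)"

lemma coeffs_in_polys_esymp_deriv: "coeffs_in polys (esymp_deriv n r i)"
  unfolding esymp_deriv_def
  by (intro coeffs_in_sum[OF submodule_polys] coeffs_in_times[OF submodule_polys]
      coeffs_in_polys_list_monom coeffs_in_Const polys_of_nat) simp

lemma shift_esymp:
  assumes "r \<le> n" "i < n"
  shows "shift qvar i (esymp n r) = esymp n r + Const (qvar - 1) * esymp_deriv n r i"
proof -
  have "shift qvar i (list_monom mu) = list_monom mu + Const (qvar - 1) * (Const (of_nat (mu ! i)) * list_monom mu)"
    if mu: "mu \<in> configs (column n r)" for mu
  proof (rule poly_mapping_eqI)
    fix e
    have len: "i < length mu" using length_configs[OF mu] length_column[OF assms(1)] assms(2) by simp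
    have "Poly_Mapping.lookup (Poly_Mapping.nth mu) i = mu ! i" using len by (simp add: nth_default_def)
    moreover have "qvar ^ (mu ! i) = 1 + (qvar - 1) * of_nat (mu ! i)" using column_entry[OF mu len] by auto
    ultimately show "Poly_Mapping.lookup (shift qvar i (list_monom mu)) e =
      Poly_Mapping.lookup (list_monom mu + Const (qvar - 1) * (Const (of_nat (mu ! i)) * list_monom mu)) e"
      by (auto simp: lookup_shift lookup_add list_monom_def lookup_single when_def simp del: lookup_nth)
  qed
  then show ?thesis
    by (simp add: esymp_def esymp_deriv_def shift_simps sum_distrib_left sum.distrib)
qed

text \<open>The coefficient of q - 1 in the eigenvalue of \<open>column n r\<close>.\<close>

definition row_weight :: "nat \<Rightarrow> nat \<Rightarrow> qt" where
  "row_weight n r = (\<Sum>i<n. of_bool (i < r) * tvar ^ (n - Suc i))"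

text \<open>After the contribution of the constant 1 is taken out of the eigenvalue equation of
  \<open>esymp n r\<close>, a multiple of q - 1 is left, which cancels. The result is an exact
  identity for a derivation, ready for the Leibniz rule.\<close>

lemma esymp_deriv_eigen:
  assumes r: "r \<le> n"
  shows "(\<Sum>i<n. shift tvar i (vdm n) * esymp_deriv n r i) = Const (row_weight n r) * (vdm n * esymp n r)"
proof -
  define E0 where "E0 = (\<Sum>i<n. tvar ^ (n - Suc i))"
  have "eigenvalue (column n r) = (\<Sum>i<n. tvar ^ (n - Suc i) + (qvar - 1) * (of_bool (i < r) * tvar ^ (n - Suc i)))"
    unfolding eigenvalue_def length_column[OF r]
    by (intro sum.cong refl) (auto simp: nth_column algebra_simps)
  then have E: "eigenvalue (column n r) = E0 + (qvar - 1) * row_weight n r"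
    by (simp only: sum.distrib E0_def row_weight_def sum_distrib_left)
  have "Const E0 * (vdm n * esymp n r) + Const (qvar - 1) * (\<Sum>i<n. shift tvar i (vdm n) * esymp_deriv n r i) =
     (\<Sum>i<n. shift tvar i (vdm n)) * esymp n r + Const (qvar - 1) * (\<Sum>i<n. shift tvar i (vdm n) * esymp_deriv n r i)"
    by (simp add: sum_shift_vdm E0_def mult.assoc)
  also have "\<dots> = (\<Sum>i<n. shift tvar i (vdm n) * shift qvar i (esymp n r))"
    by (simp add: shift_esymp[OF r] distrib_left sum.distrib sum_distrib_left sum_distrib_right mult.left_commute)
  also have "\<dots> = Const (eigenvalue (column n r)) * (vdm n * esymp n r)" by (rule esymp_eigen[OF r])
  finally have "Const (qvar - 1) * (\<Sum>i<n. shift tvar i (vdm n) * esymp_deriv n r i) =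
     Const (qvar - 1) * (Const (row_weight n r) * (vdm n * esymp n r))"
    unfolding E Const_add Const_mult by (simp add: algebra_simps)
  moreover have "Const (qvar - 1) \<noteq> 0"
  proof
    assume "Const (qvar - 1) = 0"
    then have "Poly_Mapping.lookup (Const (qvar - 1)) 0 = 0" by simp
    then show False using q_neq_1 by (simp add: Const_def)
  qed
  ultimately show ?thesis by simp
qed

definition eprod :: "nat \<Rightarrow> nat list \<Rightarrow> qtpoly" where
  "eprod n rs = prod_list (map (esymp n) rs)"

lemma eprod_simps [simp]: "eprod n [] = 1" "eprod n (r # rs) = esymp n r * eprod n rs"
  by (simp_all add: eprod_def)

lemma coeffs_in_polys_eprod: "coeffs_in polys (eprod n rs)"
  by (induction rs)
     (auto intro: coeffs_in_polys_1 coeffs_in_times[OF submodule_polys] coeffs_in_polys_esymp)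

lemma in_vars_eprod: "\<forall>r\<in>set rs. r \<le> n \<Longrightarrow> in_vars n (eprod n rs)"
proof (induction rs)
  case Nil
  then show ?case by (simp add: in_vars_def)
qed (auto intro: in_vars_times in_vars_esymp)

lemma swap_vars_eprod:
  assumes "\<forall>r\<in>set rs. r \<le> n" "Suc i < n"
  shows "swap_vars i (eprod n rs) = eprod n rs"
  using assms(1)
proof (induction rs)
  case (Cons r rs)
  then have r: "r \<le> n" by simp
  note len = length_column[OF r]
  have "in_vars n (swap_vars i (list_monom mu)) \<and> (length mu = n \<longrightarrow> swap_vars i (list_monom mu) = list_monom (swap_entries i mu))"
    if l: "length mu = n" for mu
  proof -
    have "to_fract (swap_vars i (list_monom mu)) = ev (swap_args i generic) (list_monom mu)"
      by (simp only: ev_generic[symmetric] ev_swap_vars)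
    also have "\<dots> = to_fract (list_monom (swap_entries i mu))"
    proof -
      define \<pi> where "\<pi> j = (if j = i then Suc i else if j = Suc i then i else j)" for j
      have "(\<Prod>j<n. swap_args i generic j ^ (mu ! j)) = (\<Prod>j<n. generic j ^ (swap_entries i mu ! j))"
        by (rule prod.reindex_bij_witness[of _ \<pi> \<pi>])
           (use l assms(2) in \<open>auto simp: \<pi>_def nth_swap_entries split: if_splits\<close>)
      then show ?thesis using l by (simp add: ev_generic[symmetric] ev_list_monom)
    qed
    finally have "swap_vars i (list_monom mu) = list_monom (swap_entries i mu)" by (simp only: to_fract_eq_iff)
    then show ?thesis using in_vars_list_monom[of "swap_entries i mu" n] l by simp
  qed
  then have sw: "swap_vars i (list_monom mu) = list_monom (swap_entries i mu)" if "length mu = n" for mu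
    using that by blast
  have lm: "length mu = n" if "mu \<in> configs (column n r)" for mu using length_configs[OF that] len by simp
  have "swap_vars i (esymp n r) = (\<Sum>mu\<in>configs (column n r). list_monom (swap_entries i mu))"
    unfolding esymp_def ring_hom_on_sum[OF ring_hom_on_insertion[OF ring_hom_on_Const]]
    by (intro sum.cong refl sw lm)
  also have "\<dots> = esymp n r"
    unfolding esymp_def
    by (rule sum.reindex_bij_witness[of _ "swap_entries i" "swap_entries i"])
       (use lm assms(2) in auto)
  finally have e: "swap_vars i (esymp n r) = esymp n r" .
  have IH: "swap_vars i (eprod n rs) = eprod n rs" by (rule Cons.IH) (use Cons.prems in simp)
  show ?case
    unfolding eprod_simps ring_hom_onD(4)[OF ring_hom_on_insertion[OF ring_hom_on_Const]] e IH ..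
qed (simp add: ring_hom_onD[OF ring_hom_on_insertion[OF ring_hom_on_Const]])

lemma symmetric_eprod: "\<forall>r\<in>set rs. r \<le> n \<Longrightarrow> symmetric_coeffs n (eprod n rs)"
  by (intro symmetric_coeffs_of_swap in_vars_eprod swap_vars_eprod)

abbreviation "q1_squares \<equiv> q1_multiples (q1_multiples polys)"

lemmas submodule_squares = submodule_q1_multiples[OF submodule_q1_multiples[OF submodule_polys]]

lemma coeffs_in_q1_multiples: "coeffs_in J p \<Longrightarrow> coeffs_in (q1_multiples J) (Const (qvar - 1) * p)"
  by (simp add: coeffs_in_def q1_multiplesI)

text \<open>To first order in \<open>q - 1\<close> the operator acts as a derivation.\<close>

lemma shift_eprod:
  assumes "\<forall>r\<in>set rs. r \<le> n"
  shows "\<exists>Y. (\<forall>i<n. coeffs_in polys (Y i) \<and>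
      coeffs_in q1_squares (shift qvar i (eprod n rs) - eprod n rs - Const (qvar - 1) * Y i)) \<and>
    (\<Sum>i<n. shift tvar i (vdm n) * Y i) = Const (\<Sum>r\<leftarrow>rs. row_weight n r) * (vdm n * eprod n rs)"
  using assms
proof (induction rs)
  case Nil
  have "coeffs_in q1_squares (0 :: qtpoly)"
    using submodule_ofD(1)[OF submodule_squares] by (simp add: coeffs_in_def)
  moreover have "coeffs_in polys (0 :: qtpoly)" by (simp add: coeffs_in_def)
  ultimately show ?case by (intro exI[of _ "\<lambda>_. 0"]) (simp add: shift_simps)
next
  case (Cons r rs)
  then have r: "r \<le> n" by simp
  define c where "c = Const (qvar - 1)"
  define e where "e = esymp n r"
  define P where "P = eprod n rs"
  define y where "y i = esymp_deriv n r i" for i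
  obtain Y where Y: "\<And>i. i < n \<Longrightarrow> coeffs_in polys (Y i)"
    "\<And>i. i < n \<Longrightarrow> coeffs_in q1_squares (shift qvar i P - P - c * Y i)"
    "(\<Sum>i<n. shift tvar i (vdm n) * Y i) = Const (\<Sum>r\<leftarrow>rs. row_weight n r) * (vdm n * P)"
    using Cons unfolding P_def c_def by auto
  define Z where "Z i = shift qvar i P - P - c * Y i" for i
  have pe: "coeffs_in polys e" and pP: "coeffs_in polys P" and py: "coeffs_in polys (y i)" for i
    unfolding e_def P_def y_def
    by (rule coeffs_in_polys_esymp coeffs_in_polys_eprod coeffs_in_polys_esymp_deriv)+
  have pc: "coeffs_in polys c" unfolding c_def by (intro coeffs_in_Const polys_diff) simp_all
  note pt = coeffs_in_times[OF submodule_polys] and pa = coeffs_in_add[OF submodule_polys]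
  have "coeffs_in polys (y i * P + e * Y i)" if "i < n" for i
    by (intro pa pt pe pP py Y(1) that)
  moreover have "coeffs_in q1_squares (shift qvar i (e * P) - e * P - c * (y i * P + e * Y i))" if i: "i < n" for i
  proof -
    have "shift qvar i (e * P) = (e + c * y i) * (P + c * Y i + Z i)"
      using shift_esymp[OF r i] by (simp add: shift_simps e_def y_def c_def Z_def)
    \<comment> \<open>Leibniz rule: what remains is a product of two first-order terms and a
      multiple of the remainder \<open>Z i\<close>, both of second order.\<close>
    then have "shift qvar i (e * P) - e * P - c * (y i * P + e * Y i) =
        c * (c * (y i * Y i)) + (e + c * y i) * Z i"
      by (simp add: algebra_simps)
    moreover have "coeffs_in q1_squares (c * (c * (y i * Y i)))"
      unfolding c_def by (intro coeffs_in_q1_multiples pt py Y(1) i)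
    moreover have "coeffs_in q1_squares ((e + c * y i) * Z i)"
      by (intro coeffs_in_times[OF submodule_squares] pa pt pe pc py) (use Y(2)[OF i] in \<open>simp add: Z_def\<close>)
    ultimately show ?thesis by (simp only: coeffs_in_add[OF submodule_squares])
  qed
  moreover have "(\<Sum>i<n. shift tvar i (vdm n) * (y i * P + e * Y i)) =
      Const (\<Sum>r\<leftarrow>r # rs. row_weight n r) * (vdm n * (e * P))"
  proof -
    have "(\<Sum>i<n. shift tvar i (vdm n) * (y i * P + e * Y i)) =
       (\<Sum>i<n. shift tvar i (vdm n) * y i) * P + e * (\<Sum>i<n. shift tvar i (vdm n) * Y i)"
      by (simp add: distrib_left sum.distrib sum_distrib_left sum_distrib_right ac_simps)
    also have "(\<Sum>i<n. shift tvar i (vdm n) * y i) = Const (row_weight n r) * (vdm n * e)"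
      unfolding y_def e_def by (rule esymp_deriv_eigen[OF r])
    finally show ?thesis unfolding Y(3) by (simp add: Const_add algebra_simps)
  qed
  ultimately show ?case
    unfolding eprod_simps e_def[symmetric] P_def[symmetric] c_def[symmetric]
    by (intro exI[of _ "\<lambda>i. y i * P + e * Y i"]) blast
qed

text \<open>The condition on \<open>lam\<close> says that \<open>rs\<close> lists its column
  lengths. Summing the row weights therefore gives lam_i times powers of t, which is the first-order
  term of the eigenvalue; the remaining discrepancies \<open>D\<close> and \<open>Z\<close> are of
  second order.\<close>

lemma residue_eprod:
  assumes rs: "\<forall>r\<in>set rs. r \<le> length lam"
    and lam: "\<And>i. i < length lam \<Longrightarrow> lam ! i = length (filter (\<lambda>r. i < r) rs)"
  shows "coeffs_in q1_squares (residue (length lam) (eigenvalue lam) (eprod (length lam) rs))"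
proof -
  define n where "n = length lam"
  define c where "c = Const (qvar - 1)"
  define P where "P = eprod n rs"
  obtain Y where Y: "\<And>i. i < n \<Longrightarrow> coeffs_in polys (Y i)"
    "\<And>i. i < n \<Longrightarrow> coeffs_in q1_squares (shift qvar i P - P - c * Y i)"
    "(\<Sum>i<n. shift tvar i (vdm n) * Y i) = Const (\<Sum>r\<leftarrow>rs. row_weight n r) * (vdm n * P)"
    using shift_eprod[OF rs] unfolding P_def c_def n_def by blast
  define Z where "Z i = shift qvar i P - P - c * Y i" for i
  define D where "D = (\<Sum>i<n. tvar ^ (n - Suc i)) + (qvar - 1) * (\<Sum>r\<leftarrow>rs. row_weight n r) - eigenvalue lam"
  have "residue n (eigenvalue lam) P = Const D * (vdm n * P) + (\<Sum>i<n. shift tvar i (vdm n) * Z i)"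
  proof -
    have "(\<Sum>i<n. shift tvar i (vdm n) * shift qvar i P) =
        (\<Sum>i<n. shift tvar i (vdm n)) * P + c * (\<Sum>i<n. shift tvar i (vdm n) * Y i)
        + (\<Sum>i<n. shift tvar i (vdm n) * Z i)"
      by (simp add: Z_def sum_distrib_left sum_distrib_right right_diff_distrib distrib_left
          sum.distrib sum_subtractf ac_simps)
    then show ?thesis
      unfolding residue_def Y(3) sum_shift_vdm D_def Const_diff Const_add Const_mult c_def
      by (simp add: algebra_simps)
  qed
  moreover have "D \<in> q1_squares"
  proof -
    have rows: "(\<Sum>r\<leftarrow>rs. row_weight n r) = (\<Sum>i<n. of_nat (lam ! i) * tvar ^ (n - Suc i))"
    proof -
      have "(\<Sum>r\<leftarrow>rs. row_weight n r) = (\<Sum>i<n. of_nat (length (filter (\<lambda>r. i < r) rs)) * tvar ^ (n - Suc i))"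
      proof (induction rs)
        case (Cons r rs)
        show ?case
          unfolding list.map sum_list.Cons Cons.IH
          unfolding row_weight_def sum.distrib[symmetric]
          by (intro sum.cong refl) (auto simp: algebra_simps)
      qed simp
      then show ?thesis using lam by (simp add: n_def)
    qed
    have "D = (\<Sum>i<n. - (tvar ^ (n - Suc i)) * (qvar ^ (lam ! i) - 1 - (qvar - 1) * of_nat (lam ! i)))"
      unfolding D_def rows unfolding eigenvalue_def n_def
      by (simp add: sum_distrib_left algebra_simps sum.distrib sum_subtractf sum_negf)
    also have "\<dots> \<in> q1_squares"
    proof (rule submodule_of_sum[OF submodule_squares], rule submodule_ofD(3)[OF submodule_squares])
      fix i
      have "- 1 * tvar ^ (n - Suc i) \<in> polys" by (intro polys_mult polys_power) simp_all
      then show "- (tvar ^ (n - Suc i)) \<in> polys" by simp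
      define a where "a = lam ! i"
      have "to_fract [:q_number a:] - of_nat a = (\<Sum>j<a. qvar ^ j - 1)"
      proof -
        have "(qvar - 1) * to_fract [:q_number a:] = (qvar - 1) * (\<Sum>j<a. qvar ^ j)"
          unfolding qvar_power_minus_1[symmetric] by (rule power_diff_1_eq)
        then show ?thesis using q_neq_1 by (simp add: sum_subtractf)
      qed
      also have "\<dots> \<in> q1_multiples polys"
        by (rule submodule_of_sum[OF submodule_q1_multiples[OF submodule_polys] qvar_power_minus_1_in])
      finally have "(qvar - 1) * (to_fract [:q_number a:] - of_nat a) \<in> q1_squares" by (rule q1_multiplesI)
      then show "qvar ^ (lam ! i) - 1 - (qvar - 1) * of_nat (lam ! i) \<in> q1_squares"
        unfolding a_def[symmetric] qvar_power_minus_1 by (simp add: right_diff_distrib)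
    qed
    finally show ?thesis .
  qed
  moreover have "coeffs_in q1_squares ((vdm n * P) * Const d)" if "d \<in> q1_squares" for d
    by (intro coeffs_in_times[OF submodule_squares] coeffs_in_times[OF submodule_polys] coeffs_in_polys_vdm
        coeffs_in_Const that submodule_ofD(1)[OF submodule_squares]) (simp add: P_def coeffs_in_polys_eprod)
  moreover have "coeffs_in q1_squares (\<Sum>i<n. shift tvar i (vdm n) * Z i)"
  proof (rule coeffs_in_sum[OF submodule_squares], rule coeffs_in_times[OF submodule_squares])
    fix i assume "i \<in> {..<n}"
    then show "coeffs_in q1_squares (Z i)" using Y(2) by (simp add: Z_def)
    show "coeffs_in polys (shift tvar i (vdm n))"
      using coeffs_in_polys_vdm[of n]
      by (auto simp: coeffs_in_def lookup_shift intro!: polys_mult polys_power[OF polys_simps(6)])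
  qed
  ultimately have "coeffs_in q1_squares (residue n (eigenvalue lam) P)"
    by (simp only: mult.commute[of "Const _"] coeffs_in_add[OF submodule_squares])
  then show ?thesis by (simp add: n_def P_def)
qed

lemma column_weight_less:
  assumes r: "r \<le> n" and mu: "mu \<in> configs (column n r)" "mu \<noteq> column n r"
  shows "(\<Sum>k<n. k * column n r ! k) < (\<Sum>k<n. k * mu ! k)"
proof -
  have "mu = column n r \<or> (\<Sum>k<n. k * column n r ! k) < (\<Sum>k<n. k * mu ! k)"
    using sorted_column[of n r] mu(1)
  proof (induction rule: configs_induct)
    case (swap mu i)
    have len: "length mu = n" using length_configs[OF swap(1)] length_column[OF r] by simp
    have "(\<Sum>k<n. k * mu ! k) < (\<Sum>k<n. k * swap_entries i mu ! k)"
      using sum_weighted_swap[of i "swap_entries i mu"] swap(2,3) len length_column[OF r] by simp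
    with swap(4) show ?case by auto
  qed simp
  with mu(2) show ?thesis by blast
qed

text \<open>Leading exponents add up under multiplication, and the sum of the columns is
  \<open>lam\<close>.\<close>

lemma lcoeff_eprod:
  assumes rs: "\<forall>r\<in>set rs. r \<le> length lam"
    and lam: "\<And>i. i < length lam \<Longrightarrow> lam ! i = length (filter (\<lambda>r. i < r) rs)"
  shows "lcoeff (eprod (length lam) rs) lam = 1"
proof -
  define n where "n = length lam"
  define w where "w i = - int i" for i
  have wt: "weight n w (Poly_Mapping.nth mu) = - int (\<Sum>k<n. k * mu ! k)" if "length mu = n" for mu
    using that by (simp add: weight_def w_def nth_default_def sum_negf)
  have top: "unique_top n w (esymp n r) (Poly_Mapping.nth (column n r))" if r: "r \<le> n" for r
    unfolding unique_top_def
  proof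
    have "lcoeff (\<Sum>nu\<in>configs (column n r). list_monom nu) (column n r) = 1"
      by (subst lcoeff_sum_list_monom) simp_all
    then show "lcoeff (esymp n r) (column n r) = 1" by (simp add: esymp_def)
    show "\<forall>d\<in>Poly_Mapping.keys (esymp n r). d \<noteq> Poly_Mapping.nth (column n r) \<longrightarrow>
        weight n w d < weight n w (Poly_Mapping.nth (column n r))"
    proof (intro ballI impI)
      fix d assume d: "d \<in> Poly_Mapping.keys (esymp n r)" "d \<noteq> Poly_Mapping.nth (column n r)"
      then obtain mu where mu: "mu \<in> configs (column n r)" "d = Poly_Mapping.nth mu"
        using keys_sum[of list_monom "configs (column n r)"]
        unfolding esymp_def list_monom_def by auto
      then have "(\<Sum>k<n. k * column n r ! k) < (\<Sum>k<n. k * mu ! k)"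
        using d(2) by (intro column_weight_less[OF r]) auto
      then show "weight n w d < weight n w (Poly_Mapping.nth (column n r))"
        unfolding mu(2) wt[OF length_column[OF r]] wt[OF trans[OF length_configs[OF mu(1)] length_column[OF r]]]
        by (simp only: neg_less_iff_less of_nat_less_iff)
    qed
  qed
  have "unique_top n w (eprod n rs) (\<Sum>r\<leftarrow>rs. Poly_Mapping.nth (column n r))" if "\<forall>r\<in>set rs. r \<le> n" for rs
    using that by (induction rs) (auto intro!: unique_top_times top unique_top_1)
  then have "Poly_Mapping.lookup (eprod n rs) (\<Sum>r\<leftarrow>rs. Poly_Mapping.nth (column n r)) = 1"
    using rs by (simp add: unique_top_def n_def)
  moreover have "(\<Sum>r\<leftarrow>rs. Poly_Mapping.nth (column n r)) = Poly_Mapping.nth lam"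
  proof (rule poly_mapping_eqI)
    fix i
    have "Poly_Mapping.lookup (\<Sum>r\<leftarrow>rs. Poly_Mapping.nth (column n r)) i =
        (if i < n then length (filter (\<lambda>r. i < r) rs) else 0)" if "\<forall>r\<in>set rs. r \<le> n" for rs
      using that
    proof (induction rs)
      case (Cons r rs)
      then have "length (column n r) = n" by (simp add: length_column)
      then show ?case using Cons by (simp add: lookup_add lookup_nth_eq nth_column del: lookup_nth)
    qed simp
    then show "Poly_Mapping.lookup (\<Sum>r\<leftarrow>rs. Poly_Mapping.nth (column n r)) i = Poly_Mapping.lookup (Poly_Mapping.nth lam) i"
      using rs lam by (simp add: lookup_nth_eq n_def del: lookup_nth)
  qed
  ultimately show ?thesis by (simp add: n_def)
qed

text \<open>The residue of the product is of second order in q - 1 and the triangular step divides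
  by q - 1 once, so the difference stays a multiple of q - 1, possibly with powers of t in the
  denominator. These are excluded by \<open>regular_at_t0\<close>.\<close>

theorem (in asep_family) total_minus_eprod:
  assumes rs: "\<forall>r\<in>set rs. r \<le> length lam"
    and lam: "\<And>i. i < length lam \<Longrightarrow> lam ! i = length (filter (\<lambda>r. i < r) rs)"
  shows "Poly_Mapping.lookup total_poly e - Poly_Mapping.lookup (eprod (length lam) rs) e \<in> vanishing"
proof (cases "Poly_Mapping.keys e \<subseteq> {..<length lam}")
  case False
  then have "e \<notin> Poly_Mapping.keys total_poly" "e \<notin> Poly_Mapping.keys (eprod (length lam) rs)"
    using in_vars_total in_vars_eprod[OF rs] by (auto simp: in_vars_def)
  then show ?thesis by (auto simp: in_keys_iff vanishing_iff intro: polys_regular)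
next
  case True
  define n where "n = length lam"
  define be where "be = expo n e"
  have be: "length be = length lam" "Poly_Mapping.nth be = e"
    using nth_of_expo[OF True] by (simp_all add: be_def n_def)
  have "lcoeff (total_poly - eprod n rs) be \<in> t_laurent"
  proof (rule triangular_induction[OF srt submodule_t_laurent _ _ _ _ _ be(1)])
    show "in_vars (length lam) (total_poly - eprod n rs)"
      using in_vars_diff in_vars_total in_vars_eprod rs unfolding n_def by blast
    show "symmetric_coeffs (length lam) (total_poly - eprod n rs)"
      using symmetric_coeffs_diff symmetric_total symmetric_eprod rs unfolding n_def by blast
    have "0 - x \<in> q1_multiples t_laurent" if x: "x \<in> q1_squares" for x
    proof -
      obtain y where y: "x = (qvar - 1) * ((qvar - 1) * y)" "y \<in> polys"
        using x by (auto simp: q1_multiples_def)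
      then obtain a where a: "y = to_fract a" by (auto simp: polys_def)
      have "tvar ^ 0 * to_fract 1 * ((qvar - 1) * (- y)) = (qvar - 1) * to_fract (- a)" by (simp add: a)
      moreover have "eval_q1_t0 1 \<noteq> 0" by (simp add: eval_simps)
      ultimately have "(qvar - 1) * (- y) \<in> t_laurent" unfolding t_laurent_def by blast
      from q1_multiplesI[OF this] show ?thesis unfolding y(1) by simp
    qed
    then show "coeffs_in (q1_multiples t_laurent) (residue (length lam) (eigenvalue lam) (total_poly - eprod n rs))"
      using residue_eprod[OF rs lam] unfolding residue_diff residue_total coeffs_in_def lookup_minus n_def by simp
    show "lcoeff (total_poly - eprod n rs) lam \<in> t_laurent"
      using submodule_ofD(1)[OF submodule_t_laurent] lcoeff_eprod[OF rs lam]
      by (simp add: lookup_minus lcoeff_total_lam n_def)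
  qed (rule t_laurent_divide)
  then have x: "lcoeff total_poly be - lcoeff (eprod n rs) be \<in> t_laurent" by (simp add: lookup_minus)
  obtain h where h: "poly h 0 \<noteq> 0"
    "\<And>mu be. mu \<in> configs lam \<Longrightarrow> length be = length lam \<Longrightarrow> \<exists>a. to_fract h * lcoeff (f mu) be = to_fract a"
    using regular_at_t0 by metis
  have "to_fract h * (lcoeff total_poly be - lcoeff (eprod n rs) be) \<in> polys"
  proof -
    have "to_fract h * lcoeff total_poly be = (\<Sum>mu\<in>configs lam. to_fract h * lcoeff (f mu) be)"
      by (simp add: total_poly_def lookup_sum sum_distrib_left)
    also have "\<dots> \<in> polys"
    proof (rule polys_sum)
      fix mu assume "mu \<in> configs lam"
      from h(2)[OF this be(1)] obtain a where "to_fract h * lcoeff (f mu) be = to_fract a" by blast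
      then show "to_fract h * lcoeff (f mu) be \<in> polys" by (simp only: polys_def rangeI)
    qed
    finally have "to_fract h * lcoeff total_poly be \<in> polys" .
    moreover have "to_fract h * lcoeff (eprod n rs) be \<in> polys"
      using coeffs_in_polys_eprod[of n rs] by (intro polys_mult) (auto simp: coeffs_in_def)
    ultimately show ?thesis by (simp add: right_diff_distrib polys_diff)
  qed
  then obtain c where "to_fract h * (lcoeff total_poly be - lcoeff (eprod n rs) be) = to_fract c"
    by (auto simp: polys_def)
  from t_laurent_vanishing[OF x h(1) this] show ?thesis by (simp add: be(2) n_def)
qed

section \<open>Additive functionals on modules of coefficients\<close>

lemma prod_Const_Var_power:
  assumes "finite I"
  shows "(\<Prod>i\<in>I. (Const (k i) * Var (\<pi> i)) ^ a i) =
    Poly_Mapping.single (\<Sum>i\<in>I. Poly_Mapping.single (\<pi> i) (a i)) (\<Prod>i\<in>I. k i ^ a i)"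
  using assms
proof (induction I)
  case (insert i I)
  have "Var j ^ b = Poly_Mapping.single (Poly_Mapping.single j b) 1" for j b
    by (induction b) (simp_all add: Var_def Poly_Mapping.mult_single single_add[symmetric])
  then have "(Const (k i) * Var (\<pi> i)) ^ a i =
      Poly_Mapping.single (Poly_Mapping.single (\<pi> i) (a i)) (k i ^ a i)"
    unfolding power_mult_distrib Const_power[symmetric] by (simp add: Const_def Poly_Mapping.mult_single)
  with insert show ?case by (simp add: Poly_Mapping.mult_single)
qed simp

lemma monom_value_sum: "monom_value v (sum g I) = (\<Prod>i\<in>I. monom_value v (g i))"
  by (induction I rule: infinite_finite_induct) (simp_all add: monom_value_add)

lemma insertion_monom_times:
  fixes h :: "qt \<Rightarrow> 'a::comm_semiring_1" and p :: qtpoly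
  assumes "h 0 = 0"
  shows "insertion h v (Poly_Mapping.single s 1 * p) = monom_value v s * insertion h v p"
    (is "insertion h v (?s * p) = _")
proof -
  have look: "Poly_Mapping.lookup (?s * p) (s + e) = Poly_Mapping.lookup p e" for e
    unfolding lookup_single_times by simp
  have "Poly_Mapping.keys (?s * p) \<subseteq> (+) s ` Poly_Mapping.keys p"
  proof
    fix d assume d: "d \<in> Poly_Mapping.keys (?s * p)"
    then obtain e where e: "d = s + e"
      using lookup_single_times_0[of d s] unfolding in_keys_iff by blast
    with d look show "d \<in> (+) s ` Poly_Mapping.keys p" by (auto simp: in_keys_iff)
  qed
  then have "insertion h v (?s * p) =
      (\<Sum>d\<in>(+) s ` Poly_Mapping.keys p. h (Poly_Mapping.lookup (?s * p) d) * monom_value v d)"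
    by (intro insertion_superset) (use assms in auto)
  also have "\<dots> = (\<Sum>e\<in>Poly_Mapping.keys p. monom_value v s * (h (Poly_Mapping.lookup p e) * monom_value v e))"
    unfolding sum.reindex[OF inj_on_add] o_def look monom_value_add
    by (intro sum.cong refl) (simp add: mult.left_commute)
  finally show ?thesis by (simp add: insertion_alt sum_distrib_left)
qed

lemma insertion_Var_times:
  fixes h :: "qt \<Rightarrow> 'a::comm_semiring_1"
  assumes "h 0 = 0"
  shows "insertion h v (Var i * p) = v i * insertion h v p"
  unfolding Var_def insertion_monom_times[of h, OF assms] by simp

text \<open>\<open>h\<close> is only additive and sees q as 1 and t as 0. Besides the value at (1,
  0) this admits functionals that factor through a quotient module, the form in which regularity is
  proved; \<open>N\<close> is the module containing the coefficients.\<close>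

locale q1_t0_functional =
  fixes N :: "qt set" and h :: "qt \<Rightarrow> real"
  assumes submodule: "submodule_of polys N"
    and h_add: "\<And>x y. x \<in> N \<Longrightarrow> y \<in> N \<Longrightarrow> h (x + y) = h x + h y"
    and h_q: "\<And>x. x \<in> N \<Longrightarrow> h (qvar * x) = h x"
    and h_t: "\<And>x. x \<in> N \<Longrightarrow> h (tvar * x) = 0"
begin

lemmas N_0 = submodule_ofD(1)[OF submodule]
lemmas N_mult = submodule_ofD(3)[OF submodule]

lemma h_0: "h 0 = 0"
  using h_add[OF N_0 N_0] by simp

lemma h_q_power: "x \<in> N \<Longrightarrow> h (qvar ^ k * x) = h x"
proof (induction k)
  case (Suc k)
  then have "h (qvar * (qvar ^ k * x)) = h x" by (simp add: h_q N_mult polys_power)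
  then show ?case by (simp add: ac_simps)
qed simp

lemma insertion_add:
  assumes "coeffs_in N p" "coeffs_in N r"
  shows "insertion h x (p + r) = insertion h x p + insertion h x r"
  by (rule insertion_additive) (use assms in \<open>auto simp: coeffs_in_def h_0 h_add\<close>)

lemma insertion_sum_on:
  assumes "\<And>a. a \<in> A \<Longrightarrow> coeffs_in N (g a)"
  shows "insertion h x (sum g A) = (\<Sum>a\<in>A. insertion h x (g a))"
  using assms
proof (induction A rule: infinite_finite_induct)
  case (insert a A)
  then show ?case
    using insertion_add[of "g a" "sum g A"] coeffs_in_sum[OF submodule, of A g] by simp
qed simp_all

lemma insertion_diff:
  assumes "coeffs_in N p" "coeffs_in N r"
  shows "insertion h x (p - r) = insertion h x p - insertion h x r"
proof -
  have "coeffs_in N (p - r)" by (rule coeffs_in_diff[OF submodule _ assms]) simp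
  from insertion_add[OF this assms(2), of x] show ?thesis by simp
qed

lemma insertion_Const_times:
  assumes "coeffs_in N p"
  shows "insertion h x (Const (qvar ^ k) * p) = insertion h x p" "insertion h x (Const tvar * p) = 0"
proof -
  have "Poly_Mapping.keys (Const c * p) \<subseteq> Poly_Mapping.keys p" for c
    by (auto simp: in_keys_iff)
  then have *: "insertion h x (Const c * p) =
     (\<Sum>e\<in>Poly_Mapping.keys p. h (c * Poly_Mapping.lookup p e) * monom_value x e)" for c
    by (subst insertion_superset[of "Poly_Mapping.keys p"]) (simp_all add: h_0)
  show "insertion h x (Const (qvar ^ k) * p) = insertion h x p" "insertion h x (Const tvar * p) = 0"
    unfolding * insertion_alt[of h x p] using assms by (simp_all add: coeffs_in_def h_q_power h_t)
qed

text \<open>The coefficients change only by powers of q, to which \<open>h\<close> is blind.\<close>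

lemma insertion_subst_vars:
  assumes p: "coeffs_in N p" and k: "\<And>i. \<exists>m. k i = qvar ^ m"
  shows "insertion h x (subst (\<lambda>i. Const (k i) * Var (\<pi> i)) p) = insertion h (\<lambda>i. x (\<pi> i)) p"
    and "coeffs_in N (subst (\<lambda>i. Const (k i) * Var (\<pi> i)) p)"
proof -
  define g where "g e = Poly_Mapping.single
      (\<Sum>i\<in>Poly_Mapping.keys e. Poly_Mapping.single (\<pi> i) (Poly_Mapping.lookup e i))
      (Poly_Mapping.lookup p e * (\<Prod>i\<in>Poly_Mapping.keys e. k i ^ Poly_Mapping.lookup e i))" for e
  have s: "subst (\<lambda>i. Const (k i) * Var (\<pi> i)) p = (\<Sum>e\<in>Poly_Mapping.keys p. g e)"
    unfolding insertion_alt monom_value_def prod_Const_Var_power[OF finite_keys] g_def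
    by (simp add: Const_def Poly_Mapping.mult_single)
  obtain m where m: "k i = qvar ^ m i" for i using k by metis
  have kp: "(\<Prod>i\<in>Poly_Mapping.keys e. k i ^ Poly_Mapping.lookup e i) =
      qvar ^ (\<Sum>i\<in>Poly_Mapping.keys e. m i * Poly_Mapping.lookup e i)" for e
    by (simp add: m power_sum power_mult)
  have hk: "h (Poly_Mapping.lookup p e * (\<Prod>i\<in>Poly_Mapping.keys e. k i ^ Poly_Mapping.lookup e i)) =
      h (Poly_Mapping.lookup p e)" for e
    unfolding kp using p by (simp add: mult.commute[of _ "qvar ^ _"] h_q_power coeffs_in_def)
  have N: "coeffs_in N (g e)" for e
    unfolding g_def kp coeffs_in_def
    using p by (auto simp: lookup_single when_def N_0 coeffs_in_def mult.commute[of _ "qvar ^ _"]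
        intro!: N_mult polys_power[OF polys_simps(5)])
  show "coeffs_in N (subst (\<lambda>i. Const (k i) * Var (\<pi> i)) p)"
    unfolding s by (rule coeffs_in_sum[OF submodule N])
  show "insertion h x (subst (\<lambda>i. Const (k i) * Var (\<pi> i)) p) = insertion h (\<lambda>i. x (\<pi> i)) p"
    unfolding s insertion_sum_on[OF N]
    unfolding g_def insertion_single[of h, OF h_0] hk monom_value_sum monom_value_single
    unfolding insertion_alt monom_value_def ..
qed

lemma insertion_swap_vars:
  assumes "coeffs_in N p"
  shows "insertion h x (swap_vars i p) = insertion h (x(i := x (Suc i), Suc i := x i)) p"
    and "coeffs_in N (swap_vars i p)"
proof -
  define \<pi> where "\<pi> = (\<lambda>j. j)(i := Suc i, Suc i := i)"
  have e: "Var(i := Var (Suc i), Suc i := Var i) = (\<lambda>j. Const 1 * Var (\<pi> j))"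
    by (auto simp: \<pi>_def fun_eq_iff)
  have k: "\<exists>m. (1 :: qt) = qvar ^ m" by (rule exI[of _ 0]) simp
  have x: "(\<lambda>j. x (\<pi> j)) = x(i := x (Suc i), Suc i := x i)" by (auto simp: \<pi>_def fun_eq_iff)
  show "insertion h x (swap_vars i p) = insertion h (x(i := x (Suc i), Suc i := x i)) p"
    "coeffs_in N (swap_vars i p)"
    unfolding e using insertion_subst_vars(1)[of p "\<lambda>_. 1" x \<pi>, OF assms k]
      insertion_subst_vars(2)[of p "\<lambda>_. 1" \<pi>, OF assms k] unfolding x by blast+
qed

lemma insertion_rotate_vars:
  assumes "coeffs_in N p"
  shows "insertion h x (rotate_vars n p) = insertion h (\<lambda>i. if i = 0 then x (n - 1) else x (i - 1)) p"
proof -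
  define k where "k i = (if i = 0 then qvar else 1)" for i :: nat
  define \<pi> where "\<pi> i = (if i = 0 then n - 1 else i - 1)" for i
  have e: "(\<lambda>i. if i = 0 then Const qvar * Var (n - 1) else Var (i - 1)) = (\<lambda>i. Const (k i) * Var (\<pi> i))"
    by (auto simp: \<pi>_def k_def fun_eq_iff)
  have k: "\<exists>m. k i = qvar ^ m" for i
    by (cases "i = 0") (auto simp: k_def intro: exI[of _ 0] exI[of _ 1])
  have x: "(\<lambda>j. x (\<pi> j)) = (\<lambda>i. if i = 0 then x (n - 1) else x (i - 1))" by (auto simp: \<pi>_def fun_eq_iff)
  show ?thesis
    unfolding e using insertion_subst_vars(1)[of p k x \<pi>, OF assms k] unfolding x .
qed

lemma coeffs_in_Var_times: "coeffs_in N p \<Longrightarrow> coeffs_in N (Var i * p)"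
  by (rule coeffs_in_times[OF submodule coeffs_in_polys_Var])

lemma coeffs_in_t_times: "coeffs_in N p \<Longrightarrow> coeffs_in N (Const tvar * p)"
  by (simp add: coeffs_in_def N_mult)

end

text \<open>With denominators cleared, the relations have coefficients polynomial in q and t, so
  \<open>h\<close> can be applied to each coefficient: terms with a factor t disappear, and powers
  of q become 1.\<close>

theorem (in asep_family) exchange_functions_insertion:
  assumes "q1_t0_functional N h" "0 \<in> set lam" and N: "\<And>mu. mu \<in> configs lam \<Longrightarrow> coeffs_in N (f mu)"
  shows "exchange_functions lam (\<lambda>mu x. insertion h x (f mu))"
proof -
  interpret q1_t0_functional N h by fact
  show ?thesis
  proof
    fix mu i and x :: "nat \<Rightarrow> real"
    assume mu: "mu \<in> configs lam" "Suc i < length lam" "mu ! i > mu ! Suc i"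
    have sw: "swap_entries i mu \<in> configs lam"
      using mu length_configs[OF mu(1)] by (simp add: configs_iff)
    note h0 = insertion_Var_times[of h, OF h_0]
    note cs = N[OF mu(1)] N[OF sw] insertion_swap_vars(2)[OF N[OF mu(1)]] coeffs_in_Var_times coeffs_in_t_times
    have e: "Var i * f (swap_entries i mu) - Var (Suc i) * f (swap_entries i mu) =
        Var (Suc i) * f mu - Const tvar * (Var (Suc i) * f mu) +
        Const tvar * (Var i * swap_vars i (f mu)) - Var (Suc i) * swap_vars i (f mu)"
      using f_exchange[OF mu] by (simp only: Const_diff Const_1 left_diff_distrib mult_1)
    have "x i * insertion h x (f (swap_entries i mu)) - x (Suc i) * insertion h x (f (swap_entries i mu)) =
        insertion h x (Var i * f (swap_entries i mu) - Var (Suc i) * f (swap_entries i mu))"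
      by (simp only: insertion_diff cs h0)
    also have "\<dots> = x (Suc i) * insertion h x (f mu) -
        x (Suc i) * insertion h (x(i := x (Suc i), Suc i := x i)) (f mu)"
      unfolding e
      by (simp only: insertion_diff insertion_add cs coeffs_in_diff[OF submodule polys_simps(3)]
          coeffs_in_add[OF submodule] h0 insertion_swap_vars(1) insertion_Const_times(2) diff_0_right add_0_right)
    finally show "(x i - x (Suc i)) * insertion h x (f (swap_entries i mu)) =
       x (Suc i) * (insertion h x (f mu) - insertion h (x(i := x (Suc i), Suc i := x i)) (f mu))"
      by (simp only: left_diff_distrib right_diff_distrib)
  next
    fix mu i and x :: "nat \<Rightarrow> real"
    assume mu: "mu \<in> configs lam" "Suc i < length lam" "mu ! i = mu ! Suc i"
    show "insertion h (x(i := x (Suc i), Suc i := x i)) (f mu) = insertion h x (f mu)"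
      using insertion_swap_vars(1)[OF N[OF mu(1)], of x i] f_symmetric[OF mu] by simp
  next
    fix a nu and x :: "nat \<Rightarrow> real"
    assume mu: "a # nu \<in> configs lam"
    then have nu: "nu @ [a] \<in> configs lam" by (simp add: configs_iff)
    show "insertion h x (f (nu @ [a])) =
        insertion h (\<lambda>i. if i = 0 then x (length lam - 1) else x (i - 1)) (f (a # nu))"
      using arg_cong[OF f_rotate[OF mu], of "insertion h x"]
      unfolding insertion_Const_times(1)[OF N[OF nu]] insertion_rotate_vars[OF N[OF mu]] .
  next
    fix mu and x y :: "nat \<Rightarrow> real"
    assume "mu \<in> configs lam" "\<forall>i<length lam. x i = y i"
    with in_vars_f show "insertion h x (f mu) = insertion h y (f mu)"
      by (intro insertion_cong_vars) (auto simp: in_vars_def)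
  next
    fix mu and x :: "nat \<Rightarrow> real"
    show "continuous_on UNIV (\<lambda>e. insertion h (\<lambda>i. x i + e * real i) (f mu))"
      unfolding insertion_def by (intro continuous_intros)
  qed (rule assms(2))
qed

section \<open>Regularity of the ASEP polynomials\<close>

lemma digits_unique:
  fixes a b :: "nat \<Rightarrow> nat"
  assumes "\<forall>i<n. a i < B" "\<forall>i<n. b i < B" "(\<Sum>i<n. a i * B ^ i) = (\<Sum>i<n. b i * B ^ i)"
  shows "\<forall>i<n. a i = b i"
  using assms
proof (induction n arbitrary: a b)
  case (Suc n)
  have s: "(\<Sum>i<Suc n. c i * B ^ i) = c 0 + B * (\<Sum>i<n. c (Suc i) * B ^ i)" for c
    unfolding sum.lessThan_Suc_shift by (simp add: sum_distrib_left ac_simps)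
  have e: "a 0 + B * (\<Sum>i<n. a (Suc i) * B ^ i) = b 0 + B * (\<Sum>i<n. b (Suc i) * B ^ i)"
    using Suc.prems(3) unfolding s .
  have lt: "a 0 < B" "b 0 < B" using Suc.prems by auto
  from arg_cong[OF e, of "\<lambda>k. k mod B"] have 0: "a 0 = b 0" using lt by simp
  have "(\<Sum>i<n. a (Suc i) * B ^ i) = (\<Sum>i<n. b (Suc i) * B ^ i)" using e lt unfolding 0 by simp
  then have "\<forall>i<n. a (Suc i) = b (Suc i)" by (intro Suc.IH) (use Suc.prems in auto)
  with 0 show ?case using less_Suc_eq_0_disj by auto
qed simp

text \<open>Kronecker substitution: \<open>x\<^sub>i = y ^ (B ^ i)\<close> with \<open>B\<close> larger than all exponents.\<close>
lemma coeff_eq_0_of_insertion: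
  fixes h :: "'a::zero \<Rightarrow> real"
  assumes p: "in_vars n p" and h: "h 0 = 0"
    and 0: "\<And>x. (\<And>i. 0 < x i) \<Longrightarrow> insertion h x p = 0"
  shows "h (Poly_Mapping.lookup p e) = 0"
proof (cases "e \<in> Poly_Mapping.keys p")
  case True
  define B where "B = Suc (\<Sum>e\<in>Poly_Mapping.keys p. \<Sum>i<n. Poly_Mapping.lookup e i)"
  have B: "Poly_Mapping.lookup e i < B" if "e \<in> Poly_Mapping.keys p" "i < n" for e i
  proof -
    have "Poly_Mapping.lookup e i \<le> (\<Sum>i<n. Poly_Mapping.lookup e i)"
      by (rule member_le_sum) (use that in auto)
    also have "\<dots> \<le> (\<Sum>e\<in>Poly_Mapping.keys p. \<Sum>i<n. Poly_Mapping.lookup e i)"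
      by (rule member_le_sum) (use that in auto)
    finally show ?thesis by (simp add: B_def)
  qed
  define code where "code e = (\<Sum>i<n. Poly_Mapping.lookup e i * B ^ i)" for e :: "nat \<Rightarrow>\<^sub>0 nat"
  have inj: "code d = code e \<longleftrightarrow> d = e" if d: "d \<in> Poly_Mapping.keys p" for d
  proof
    assume "code d = code e"
    then have *: "\<forall>i<n. Poly_Mapping.lookup d i = Poly_Mapping.lookup e i"
      unfolding code_def by (intro digits_unique) (use B d True in auto)
    show "d = e"
    proof (rule poly_mapping_eqI)
      fix i
      have "i \<notin> Poly_Mapping.keys d \<and> i \<notin> Poly_Mapping.keys e" if "\<not> i < n"
        using p d True that unfolding in_vars_def by blast
      with * show "Poly_Mapping.lookup d i = Poly_Mapping.lookup e i" by (cases "i < n") (auto simp: in_keys_iff)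
    qed
  qed simp
  define P where "P = (\<Sum>d\<in>Poly_Mapping.keys p. monom (h (Poly_Mapping.lookup p d)) (code d))"
  have "poly P y = 0" if "0 < y" for y
  proof -
    have "monom_value (\<lambda>i. y ^ B ^ i) d = y ^ code d" if "d \<in> Poly_Mapping.keys p" for d
    proof -
      have "monom_value (\<lambda>i. y ^ B ^ i) d = (\<Prod>i<n. (y ^ B ^ i) ^ Poly_Mapping.lookup d i)"
        by (rule monom_value_superset) (use p that in \<open>auto simp: in_vars_def\<close>)
      also have "\<dots> = (\<Prod>i<n. y ^ (Poly_Mapping.lookup d i * B ^ i))"
        unfolding power_mult[symmetric] by (simp only: mult.commute)
      also have "\<dots> = y ^ code d" unfolding code_def power_sum ..
      finally show ?thesis .
    qed
    then have "poly P y = insertion h (\<lambda>i. y ^ B ^ i) p"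
      by (simp add: P_def insertion_alt poly_sum poly_monom)
    also have "\<dots> = 0" by (rule 0) (simp add: \<open>0 < y\<close>)
    finally show ?thesis .
  qed
  then have "{0<..} \<subseteq> {y. poly P y = 0}" by auto
  then have "P = 0" using poly_roots_finite[of P] infinite_Ioi[of 0] finite_subset by blast
  then have "0 = coeff P (code e)" by simp
  also have "\<dots> = (\<Sum>d\<in>Poly_Mapping.keys p. if d = e then h (Poly_Mapping.lookup p d) else 0)"
    unfolding P_def coeff_sum coeff_monom by (intro sum.cong) (auto simp: inj)
  also have "\<dots> = h (Poly_Mapping.lookup p e)" using True by simp
  finally show ?thesis by simp
qed (simp add: in_keys_iff h)

section \<open>Nakayama's lemma over the local ring at (1, 0)\<close>

lemma submodule_regular: "submodule_of regular regular"
  using regular_add(1) regular_mult(1) polys_regular[of 0] by (simp add: submodule_of_def)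

lemma submodule_vanishing: "submodule_of regular vanishing"
  using regular_add regular_mult polys_regular[of 0] by (simp add: submodule_of_def vanishing_iff)

lemma one_minus_vanishing:
  assumes "x \<in> vanishing"
  obtains u where "u \<in> regular" "u * (1 - x) = 1"
proof -
  obtain a w where a: "eval_q1_t0 w \<noteq> 0" "eval_q1_t0 a = 0" "to_fract w * x = to_fract a"
    using assms by (auto simp: vanishing_def)
  have d: "eval_q1_t0 (w - a) \<noteq> 0" using a by (simp add: eval_simps)
  then have "w - a \<noteq> 0" by (metis eval_simps(1))
  then have n0: "to_fract (w - a) \<noteq> 0" by (metis to_fract_0 to_fract_eq_iff)
  have e: "to_fract (w - a) * (to_fract w / to_fract (w - a)) = to_fract w" using n0 by simp
  have "to_fract w * (1 - x) = to_fract (w - a)" using a(3) by (simp add: right_diff_distrib)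
  then have "to_fract w / to_fract (w - a) * (1 - x) = 1" using n0 by (simp add: field_simps)
  with regularI[OF d e] that show thesis by blast
qed

text \<open>Let R be the ring \<open>regular\<close> and N the R-module generated by 1 and
  \<open>X\<close>. For an ideal \<open>I\<close> of R this is the preimage in N of I times the
  quotient N / R, which is why \<open>r\<close> ranges over all of R. That \<open>X\<close> is
  regular means that the quotient is zero.\<close>

definition module_span :: "qt set \<Rightarrow> qt set \<Rightarrow> qt set" where
  "module_span I X = {r + (\<Sum>y\<in>X. m y * y) | r m. r \<in> regular \<and> (\<forall>y. m y \<in> I)}"

lemma module_spanI: "r \<in> regular \<Longrightarrow> (\<And>y. m y \<in> I) \<Longrightarrow> r + (\<Sum>y\<in>X. m y * y) \<in> module_span I X"
  by (auto simp: module_span_def)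

lemma submodule_module_span:
  assumes I: "submodule_of regular I"
  shows "submodule_of regular (module_span I X)"
  unfolding submodule_of_def
proof (intro conjI ballI)
  show "0 \<in> module_span I X"
    using module_spanI[of 0 "\<lambda>_. 0" I X] submodule_ofD(1)[OF I] polys_regular[of 0] by simp
next
  fix x y assume "x \<in> module_span I X" "y \<in> module_span I X"
  then obtain r m r' m' where *: "x = r + (\<Sum>y\<in>X. m y * y)" "r \<in> regular" "\<And>y. m y \<in> I"
    "y = r' + (\<Sum>y\<in>X. m' y * y)" "r' \<in> regular" "\<And>y. m' y \<in> I"
    by (auto simp: module_span_def)
  have "(r + r') + (\<Sum>y\<in>X. (m y + m' y) * y) \<in> module_span I X"
    by (intro module_spanI submodule_ofD(2)[OF I] regular_add *)
  then show "x + y \<in> module_span I X" unfolding *(1,4) by (simp add: sum.distrib algebra_simps)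
next
  fix a x assume a: "a \<in> regular" and "x \<in> module_span I X"
  then obtain r m where *: "x = r + (\<Sum>y\<in>X. m y * y)" "r \<in> regular" "\<And>y. m y \<in> I"
    by (auto simp: module_span_def)
  have "a * r + (\<Sum>y\<in>X. (a * m y) * y) \<in> module_span I X"
    by (intro module_spanI submodule_ofD(3)[OF I] regular_mult * a)
  then show "a * x \<in> module_span I X" unfolding *(1) by (simp add: distrib_left sum_distrib_left ac_simps)
qed

lemma module_span_regular: "0 \<in> I \<Longrightarrow> regular \<subseteq> module_span I X"
  using module_spanI[of _ "\<lambda>_. 0" I X] by auto

lemma module_span_superset:
  assumes "finite X"
  shows "X \<subseteq> module_span regular X"
proof
  fix x assume "x \<in> X"
  then have "(\<Sum>y\<in>X. of_bool (y = x) * y) = x"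
    using assms by (simp add: of_bool_def if_distrib[of "\<lambda>a. a * _"] cong: if_cong)
  moreover have "0 + (\<Sum>y\<in>X. of_bool (y = x) * y) \<in> module_span regular X"
    by (intro module_spanI) (auto intro: polys_regular)
  ultimately show "x \<in> module_span regular X" by simp
qed

lemma vanishing_times_module_span:
  assumes "v \<in> vanishing" "x \<in> module_span regular X"
  shows "v * x \<in> module_span vanishing X"
proof -
  obtain r m where *: "x = r + (\<Sum>y\<in>X. m y * y)" "r \<in> regular" "\<And>y. m y \<in> regular"
    using assms(2) by (auto simp: module_span_def)
  have "v * r + (\<Sum>y\<in>X. (m y * v) * y) \<in> module_span vanishing X"
    by (intro module_spanI submodule_ofD(3)[OF submodule_vanishing] regular_mult * assms(1) vanishing_regular)
  then show ?thesis unfolding *(1) by (simp add: distrib_left sum_distrib_left ac_simps)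
qed

text \<open>Generators of the quotient by \<open>regular\<close> are removed one at a time:
  \<open>x\<close> occurs in its own expansion with a coefficient from the maximal ideal, and 1
  minus this coefficient is invertible.\<close>

lemma nakayama:
  assumes "finite X" "X \<subseteq> module_span vanishing X"
  shows "X \<subseteq> regular"
  using assms
proof (induction X)
  case (insert x X)
  note van = submodule_ofD[OF submodule_vanishing]
  from insert.prems obtain r0 m0 where x: "x = r0 + (\<Sum>y\<in>insert x X. m0 y * y)" "r0 \<in> regular"
    "\<And>y. m0 y \<in> vanishing" by (auto simp: module_span_def)
  obtain u where u: "u \<in> regular" "u * (1 - m0 x) = 1" by (rule one_minus_vanishing[OF x(3)])
  have "(1 - m0 x) * x = r0 + (\<Sum>y\<in>X. m0 y * y)"
    using x(1) insert.hyps by (simp add: left_diff_distrib algebra_simps)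
  from arg_cong[OF this, of "(*) u"] u(2) have "x = u * (r0 + (\<Sum>y\<in>X. m0 y * y))"
    by (simp add: mult.assoc[symmetric])
  also have "\<dots> = u * r0 + (\<Sum>y\<in>X. (u * m0 y) * y)"
    by (simp add: distrib_left sum_distrib_left ac_simps)
  finally have xe: "x = u * r0 + (\<Sum>y\<in>X. (u * m0 y) * y)" .
  have xs: "x \<in> module_span vanishing X"
    by (subst xe, intro module_spanI regular_mult van u x)
  note sub = submodule_ofD[OF submodule_module_span[OF submodule_vanishing, of X]]
  have "X \<subseteq> module_span vanishing X"
  proof
    fix y assume "y \<in> X"
    with insert.prems obtain r m where y: "y = r + (\<Sum>y\<in>insert x X. m y * y)" "r \<in> regular"
      "\<And>y. m y \<in> vanishing" by (auto simp: module_span_def)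
    have "(r + (\<Sum>y\<in>X. m y * y)) + m x * x \<in> module_span vanishing X"
      by (intro sub(2) sub(3) module_spanI y xs vanishing_regular)
    then show "y \<in> module_span vanishing X" using y(1) insert.hyps by (simp add: ac_simps)
  qed
  then have X: "X \<subseteq> regular" by (rule insert.IH)
  have "u * r0 + (\<Sum>y\<in>X. (u * m0 y) * y) \<in> regular"
  proof (intro regular_add(1) submodule_of_sum[OF submodule_regular])
    show "u * r0 \<in> regular" using u x by (intro regular_mult)
    show "u * m0 y * y \<in> regular" if "y \<in> X" for y
      using u that X by (intro regular_mult vanishing_regular[OF x(3)]) auto
  qed
  with xe X show ?case by simp
qed simp

abbreviation rat_scale :: "rat \<Rightarrow> qt \<Rightarrow> qt" where
  "rat_scale r x \<equiv> to_fract [:[:r:]:] * x"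

interpretation rat_space: vector_space rat_scale
proof
  have "to_fract [:[:a + b:]:] = to_fract [:[:a:]:] + to_fract [:[:b:]:]" for a b :: rat
    by (simp flip: to_fract_add)
  then show "rat_scale (a + b) x = rat_scale a x + rat_scale b x" for a b x
    by (simp add: distrib_right)
  have "to_fract [:[:a * b:]:] = to_fract [:[:a:]:] * to_fract [:[:b:]:]" for a b :: rat
    by (simp flip: to_fract_mult)
  then show "rat_scale a (rat_scale b x) = rat_scale (a * b) x" for a b x by simp
  show "rat_scale 1 x = x" for x by (simp flip: one_pCons)
qed (simp add: distrib_left)

interpretation rat_functional: vector_space_pair rat_scale "(*) :: rat \<Rightarrow> rat \<Rightarrow> rat"
  by unfold_locales (simp_all add: algebra_simps)

text \<open>Linearity over the rationals: \<open>U\<close> is a rational subspace, and a basis of it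
  together with \<open>c\<close> is independent, so values may be prescribed there and
  extended.\<close>

lemma separating_functional:
  assumes U: "submodule_of regular U" and c: "c \<notin> U"
  obtains \<phi> :: "qt \<Rightarrow> rat" where "\<And>x y. \<phi> (x + y) = \<phi> x + \<phi> y" "\<And>x. x \<in> U \<Longrightarrow> \<phi> x = 0" "\<phi> c = 1"
proof -
  have sub: "rat_space.subspace U"
    unfolding rat_space.subspace_def using submodule_ofD[OF U] polys_regular polys_simps(4) by blast
  obtain B where B: "B \<subseteq> U" "rat_space.independent B" "U \<subseteq> rat_space.span B"
    using rat_space.basis_exists[of U] by metis
  have span: "rat_space.span B = U"
    using B rat_space.span_minimal[OF B(1) sub] by blast
  have "rat_space.independent (insert c B)"
    using rat_space.independent_insert[of c B] B c span by (auto dest: rat_space.span_base)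
  from rat_functional.linear_independent_extend[OF this, of "\<lambda>x. of_bool (x = c)"]
  obtain \<phi> where \<phi>: "Vector_Spaces.linear rat_scale (*) \<phi>" "\<forall>x\<in>insert c B. \<phi> x = of_bool (x = c)"
    by blast
  interpret l: Vector_Spaces.linear rat_scale "(*)" \<phi> by (rule \<phi>(1))
  show thesis
  proof
    show "\<phi> (x + y) = \<phi> x + \<phi> y" for x y by (rule l.add)
    show "\<phi> c = 1" using \<phi>(2) by simp
    have "\<phi> x = 0" if "x \<in> B" for x using \<phi>(2) that B(1) c by auto
    then show "\<phi> x = 0" if "x \<in> U" for x
      using rat_functional.linear_eq_0_on_span[OF \<phi>(1)] that span by blast
  qed
qed

text \<open>
  Reducing the coefficients modulo \<open>module_span vanishing X\<close> turns the \<open>f mu\<close> into solutions of the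
  relations at \<open>(1, 0)\<close> whose sum is zero, since the sum of the \<open>f mu\<close> is regular.
\<close>
theorem (in asep_family) regular_f:
  assumes zero: "0 \<in> set lam" and total: "coeffs_in regular total_poly"
    and mu: "mu \<in> configs lam"
  shows "coeffs_in regular (f mu)"
proof -
  define X where "X = (\<Union>mu\<in>configs lam. Poly_Mapping.lookup (f mu) ` Poly_Mapping.keys (f mu))"
  have fin: "finite X" by (auto simp: X_def configs_def)
  define N where "N = module_span regular X"
  define U where "U = module_span vanishing X"
  have reg: "regular \<subseteq> U" unfolding U_def
    by (rule module_span_regular) (rule submodule_ofD(1)[OF submodule_vanishing])
  have N: "submodule_of regular N" "submodule_of regular U" unfolding N_def U_def
    by (intro submodule_module_span submodule_regular submodule_vanishing)+
  have q: "qvar - 1 \<in> vanishing"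
  proof -
    have e: "qvar - 1 = to_fract ([:[:0, 1:]:] - 1)" by (simp add: qvar_def)
    show ?thesis
      unfolding vanishing_iff e value_to_fract
      by (intro conjI polys_regular polys_simps(4)) (simp add: eval_simps eval_q1_t0_q)
  qed
  have t: "tvar \<in> vanishing" unfolding vanishing_iff by (simp add: value_tvar polys_regular)
  have fN: "coeffs_in N (f mu)" if "mu \<in> configs lam" for mu
    unfolding coeffs_in_def
  proof
    fix e
    show "Poly_Mapping.lookup (f mu) e \<in> N"
    proof (cases "e \<in> Poly_Mapping.keys (f mu)")
      case True
      with that have "Poly_Mapping.lookup (f mu) e \<in> X" by (auto simp: X_def)
      then show ?thesis using module_span_superset[OF fin] by (auto simp: N_def)
    qed (simp add: in_keys_iff submodule_ofD(1)[OF N(1)])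
  qed
  have "X \<subseteq> U"
  proof (rule ccontr)
    assume "\<not> X \<subseteq> U"
    then obtain c where c: "c \<in> X" "c \<notin> U" by blast
    obtain \<phi> :: "qt \<Rightarrow> rat" where \<phi>: "\<And>x y. \<phi> (x + y) = \<phi> x + \<phi> y" "\<And>x. x \<in> U \<Longrightarrow> \<phi> x = 0" "\<phi> c = 1"
      using separating_functional[OF N(2) c(2)] by metis
    define h :: "qt \<Rightarrow> real" where "h x = of_rat (\<phi> x)" for x
    have func: "q1_t0_functional N h"
    proof
      show "submodule_of polys N"
        using N(1) polys_regular unfolding submodule_of_def by blast
      show "h (x + y) = h x + h y" for x y by (simp add: h_def \<phi>(1) of_rat_add)
      fix x assume x: "x \<in> N"
      \<comment> \<open>\<open>vanishing\<close> times \<open>N\<close> lies in \<open>U\<close>, on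
        which the functional is zero. As q - 1 and t belong to \<open>vanishing\<close>, it sees q
        as 1 and t as 0.\<close>
      have v: "v * x \<in> U" if "v \<in> vanishing" for v
        using vanishing_times_module_span[OF that] x by (simp add: N_def U_def)
      show "h (tvar * x) = 0" by (simp add: h_def \<phi>(2) v t)
      have "\<phi> (qvar * x) = \<phi> ((qvar - 1) * x) + \<phi> x"
        unfolding \<phi>(1)[symmetric] by (simp add: left_diff_distrib)
      then show "h (qvar * x) = h x" by (simp add: h_def \<phi>(2) v q)
    qed
    interpret fu: q1_t0_functional N h by (rule func)
    interpret ex: exchange_functions lam "\<lambda>mu x. insertion h x (f mu)"
      by (rule exchange_functions_insertion[OF func zero fN])
    have "insertion h x (f mu) = 0" if x: "\<And>i. 0 < x i" and mu: "mu \<in> configs lam" for x mu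
    proof (rule balanced_sum_0[OF zero x _ _ mu])
      show "balanced (configs lam) (jump_rate x) (\<lambda>mu. insertion h x (f mu))"
        by (rule ex.balanced_jump_rate) (use x in simp)
      have "(\<Sum>mu\<in>configs lam. insertion h x (f mu)) = insertion h x total_poly"
        unfolding total_poly_def by (rule fu.insertion_sum_on[symmetric, OF fN])
      also have "\<dots> = 0"
        unfolding insertion_alt
      proof (rule sum.neutral, rule ballI)
        fix e
        have "Poly_Mapping.lookup total_poly e \<in> U" using total reg by (auto simp: coeffs_in_def)
        then show "h (Poly_Mapping.lookup total_poly e) * monom_value x e = 0" by (simp add: h_def \<phi>(2))
      qed
      finally show "(\<Sum>mu\<in>configs lam. insertion h x (f mu)) = 0" .
    qed
    note vanish = this
    have "h (Poly_Mapping.lookup (f mu) e) = 0" if "mu \<in> configs lam" for mu e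
      by (rule coeff_eq_0_of_insertion[OF in_vars_f[OF that], where h = h, OF fu.h_0 vanish[OF _ that]])
    with c(1) \<phi>(3) show False by (auto simp: X_def h_def)
  qed
  then have X: "X \<subseteq> regular" using nakayama[OF fin] by (simp add: U_def)
  show ?thesis
    unfolding coeffs_in_def
  proof
    fix e
    show "Poly_Mapping.lookup (f mu) e \<in> regular"
    proof (cases "e \<in> Poly_Mapping.keys (f mu)")
      case True
      with mu X show ?thesis by (auto simp: X_def)
    qed (simp add: in_keys_iff polys_regular)
  qed
qed

section \<open>The stationary distribution\<close>

lemma mset_indicator_list:
  assumes "S \<subseteq> {..<n}" "card S = r"
  shows "mset (map (\<lambda>i. of_bool (i \<in> S)) [0..<n]) = mset (column n r)"
proof -
  have fin: "finite S" using assms(1) finite_subset by blast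
  have "mset_set {0..<n} = mset_set S + mset_set ({..<n} - S)"
    using assms(1) fin by (subst mset_set_Union[symmetric]) (auto intro: arg_cong[of _ _ mset_set])
  moreover have "image_mset (\<lambda>i. of_bool (i \<in> S)) (mset_set S) = image_mset (\<lambda>_. 1 :: nat) (mset_set S)"
    by (rule image_mset_cong) (simp add: fin)
  moreover have "image_mset (\<lambda>i. of_bool (i \<in> S)) (mset_set ({..<n} - S)) =
      image_mset (\<lambda>_. 0 :: nat) (mset_set ({..<n} - S))"
    by (rule image_mset_cong) simp
  ultimately show ?thesis
    using assms card_Diff_subset[OF fin assms(1)] by (simp add: column_def image_mset_const_eq)
qed

lemma sum_configs_column:
  assumes r: "r \<le> n"
  shows "(\<Sum>mu\<in>configs (column n r). monom_value x (Poly_Mapping.nth mu)) = esym n r x"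
  unfolding esym_def
proof (rule sum.reindex_bij_witness[of _ "\<lambda>S. map (\<lambda>i. of_bool (i \<in> S)) [0..<n]"
      "\<lambda>mu. {i. i < n \<and> mu ! i = 1}"])
  fix mu assume mu: "mu \<in> configs (column n r)"
  have len: "length mu = n" using length_configs[OF mu] length_column[OF r] by simp
  have ent: "mu ! i = 0 \<or> mu ! i = 1" if "i < n" for i using column_entry[OF mu] that len by simp
  show "map (\<lambda>i. of_bool (i \<in> {i. i < n \<and> mu ! i = 1})) [0..<n] = mu"
    by (rule nth_equalityI) (use len ent in auto)
  have "card {i. i < n \<and> mu ! i = 1} = count (mset mu) 1"
    by (simp add: count_mset count_list_eq_length_filter length_filter_conv_card len eq_commute[of "Suc 0"])
  also have "\<dots> = r" using mu by (simp add: configs_iff column_def)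
  finally show "{i. i < n \<and> mu ! i = 1} \<in> {S. S \<subseteq> {..<n} \<and> card S = r}" by auto
  have "monom_value x (Poly_Mapping.nth mu) = (\<Prod>i<n. x i ^ (mu ! i))"
    unfolding monom_value_superset[OF finite_lessThan keys_nth_subset] len
    by (intro prod.cong refl) (simp add: lookup_nth_eq len del: lookup_nth)
  also have "\<dots> = (\<Prod>i<n. if mu ! i = 1 then x i else 1)"
    by (intro prod.cong refl) (use ent in fastforce)
  also have "\<dots> = (\<Prod>i | i < n \<and> mu ! i = 1. x i)"
    by (simp add: prod.inter_filter[symmetric])
  finally show "(\<Prod>i\<in>{i. i < n \<and> mu ! i = 1}. x i) = monom_value x (Poly_Mapping.nth mu)" by simp
next
  fix S assume S: "S \<in> {S. S \<subseteq> {..<n} \<and> card S = r}"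
  then show "{i. i < n \<and> map (\<lambda>i. of_bool (i \<in> S)) [0..<n] ! i = (1 :: nat)} = S"
    by (auto simp: of_bool_def split: if_splits)
  show "map (\<lambda>i. of_bool (i \<in> S)) [0..<n] \<in> configs (column n r)"
    unfolding configs_iff by (rule mset_indicator_list) (use S in auto)
qed

lemma esym_pos:
  assumes "k \<le> n" "\<And>i. i < n \<Longrightarrow> 0 < x i"
  shows "0 < esym n k x"
  unfolding esym_def
proof (rule sum_pos)
  show "finite {S. S \<subseteq> {..<n} \<and> card S = k}" by (rule finite_subset[of _ "Pow {..<n}"]) auto
  have "{..<k} \<in> {S. S \<subseteq> {..<n} \<and> card S = k}" using assms(1) by auto
  then show "{S. S \<subseteq> {..<n} \<and> card S = k} \<noteq> {}" by blast
  show "0 < (\<Prod>i\<in>S. x i)" if "S \<in> {S. S \<subseteq> {..<n} \<and> card S = k}" for S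
    by (rule prod_pos) (use that assms(2) in auto)
qed

lemma q1_t0_functional_value: "q1_t0_functional regular (\<lambda>c. of_rat (value_q1_t0 c))"
proof
  show "submodule_of polys regular"
    using submodule_regular polys_regular unfolding submodule_of_def by blast
qed (simp_all add: regular_add regular_mult polys_regular of_rat_add value_qvar value_tvar)

interpretation at_q1_t0: q1_t0_functional regular "\<lambda>c. of_rat (value_q1_t0 c)"
  rewrites "insertion (\<lambda>c. of_rat (value_q1_t0 c)) = specialize_q1_t0"
  by (rule q1_t0_functional_value) (simp add: specialize_q1_t0_def fun_eq_iff)

lemma specialize_eprod:
  assumes "\<forall>r\<in>set rs. r \<le> n"
  shows "specialize_q1_t0 x (eprod n rs) = (\<Prod>r\<leftarrow>rs. esym n r x)"
  using assms
proof (induction rs)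
  case Nil
  have "specialize_q1_t0 x 1 = 1"
    unfolding specialize_q1_t0_def Const_1[symmetric] by (simp del: Const_1)
  then show ?case by simp
next
  case (Cons r rs)
  have reg: "coeffs_in regular (list_monom mu * eprod n rs)" for mu
    using coeffs_in_times[OF submodule_polys coeffs_in_polys_list_monom coeffs_in_polys_eprod, of mu n rs]
      polys_regular by (auto simp: coeffs_in_def)
  have "specialize_q1_t0 x (eprod n (r # rs)) =
      (\<Sum>mu\<in>configs (column n r). specialize_q1_t0 x (list_monom mu * eprod n rs))"
    unfolding eprod_simps esymp_def sum_distrib_right by (rule at_q1_t0.insertion_sum_on[OF reg])
  also have "\<dots> = (\<Sum>mu\<in>configs (column n r). monom_value x (Poly_Mapping.nth mu)) * specialize_q1_t0 x (eprod n rs)"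
    unfolding sum_distrib_right list_monom_def specialize_q1_t0_def
    by (intro sum.cong refl insertion_monom_times) simp
  also have "\<dots> = esym n r x * (\<Prod>r\<leftarrow>rs. esym n r x)"
    using Cons by (simp add: sum_configs_column)
  finally show ?case by simp
qed

section \<open>The content partition and its column lengths\<close>

lemma content_partition_Suc:
  "content_partition (Suc s) m = replicate (m (Suc s)) (Suc s) @ content_partition s m"
  by (simp add: content_partition_def)

lemma length_content_partition: "length (content_partition s m) = (\<Sum>r\<le>s. m r)"
  by (induction s) (simp_all add: content_partition_Suc, simp add: content_partition_def)

lemma set_content_partition: "set (content_partition s m) \<subseteq> {..s}"
  by (auto simp: content_partition_def)

lemma sorted_content_partition: "sorted_wrt (\<ge>) (content_partition s m)"
proof (induction s)
  case (Suc s)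
  have "sorted_wrt (\<ge>) (replicate (m (Suc s)) (Suc s))" by (simp add: sorted_wrt_iff_nth_less)
  with Suc show ?case
    using set_content_partition[of s m] by (fastforce simp: content_partition_Suc sorted_wrt_append)
qed (simp add: content_partition_def sorted_wrt_iff_nth_less)

text \<open>The sums M_i are the column lengths of the partition, so the part at index
  \<open>i\<close> counts those that exceed \<open>i\<close>. Raising \<open>s\<close> by one
  prepends a block of new largest parts: every earlier column grows by the length of the block, and
  one more column of exactly this length appears.\<close>

lemma nth_content_partition:
  assumes "i < length (content_partition s m)"
  shows "content_partition s m ! i = length (filter (\<lambda>r. i < r) (map (\<lambda>i. \<Sum>r=i..s. m r) [1..<Suc s]))"
  using assms
proof (induction s arbitrary: i)
  case 0
  then show ?case by (simp add: content_partition_def)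
next
  case (Suc s)
  let ?k = "m (Suc s)"
  have M: "map (\<lambda>i. \<Sum>r=i..Suc s. m r) [1..<Suc (Suc s)] =
      map (\<lambda>r. r + ?k) (map (\<lambda>i. \<Sum>r=i..s. m r) [1..<Suc s]) @ [?k]"
    by simp
  show ?case
  proof (cases "i < ?k")
    case True
    then have "filter (\<lambda>r. i < r) (map (\<lambda>i. \<Sum>r=i..Suc s. m r) [1..<Suc (Suc s)]) =
        map (\<lambda>i. \<Sum>r=i..Suc s. m r) [1..<Suc (Suc s)]"
      unfolding M by (intro filter_True) auto
    with True show ?thesis by (simp add: content_partition_Suc nth_append)
  next
    case False
    with Suc.prems have "i - ?k < length (content_partition s m)" by (simp add: content_partition_Suc)
    from Suc.IH[OF this] have "content_partition (Suc s) m ! i =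
        length (filter (\<lambda>r. i - ?k < r) (map (\<lambda>i. \<Sum>r=i..s. m r) [1..<Suc s]))"
      using False by (simp add: content_partition_Suc nth_append)
    also have "(\<lambda>r. i - ?k < r) = (\<lambda>r. i < r + ?k)" using False by auto
    finally show ?thesis unfolding M using False by (simp add: filter_map o_def del: upt_Suc)
  qed
qed

theorem theorem1:
  fixes s n :: nat and m M :: "nat \<Rightarrow> nat" and lam :: "nat list"
    and x :: "nat \<Rightarrow> real" and f :: "nat list \<Rightarrow> qtpoly" and P :: qtpoly and Z :: real
  defines "n \<equiv> \<Sum>r\<le>s. m r"
    and "M \<equiv> \<lambda>i. \<Sum>r=i..s. m r"
    and "lam \<equiv> content_partition s m"
    and "Z \<equiv> specialize_q1_t0 x P"
  assumes "1 \<le> s" and "1 \<le> m 0"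
    and "\<forall>j<n. 0 < x j"
    and "asep_polynomials lam f"
    and "macdonald_polynomial lam P"
  shows "Z = (\<Prod>i=1..s. esym n (M i) x) \<and>
         (\<forall>p. stationary_distribution (configs lam) (jump_rate x) p \<longleftrightarrow>
              (\<forall>eta\<in>configs lam. p eta = specialize_q1_t0 x (f eta) / Z))"
proof -
  interpret asep_family lam f
    by unfold_locales (use assms in \<open>simp_all add: sorted_content_partition\<close>)
  have len: "length lam = n" by (simp add: lam_def n_def length_content_partition)
  have zero: "0 \<in> set lam" using \<open>1 \<le> m 0\<close> by (auto simp: lam_def content_partition_def)
  have M: "M i \<le> n" for i unfolding M_def n_def by (rule sum_mono2) auto
  define rs where "rs = map M [1..<Suc s]"
  have rs: "\<forall>r\<in>set rs. r \<le> length lam" using M by (auto simp: rs_def len)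
  have van: "Poly_Mapping.lookup total_poly e - Poly_Mapping.lookup (eprod n rs) e \<in> vanishing" for e
    unfolding len[symmetric]
    by (rule total_minus_eprod[OF rs]) (simp only: lam_def rs_def M_def nth_content_partition)
  have reg_e: "coeffs_in regular (eprod n rs)"
    using coeffs_in_polys_eprod[of n rs] polys_regular by (auto simp: coeffs_in_def)
  have reg_d: "coeffs_in regular (total_poly - eprod n rs)"
    using van vanishing_regular by (simp add: coeffs_in_def lookup_minus)
  have reg: "coeffs_in regular total_poly"
    using coeffs_in_add[OF at_q1_t0.submodule reg_d reg_e] by simp
  have "specialize_q1_t0 x total_poly = specialize_q1_t0 x (total_poly - eprod n rs) + specialize_q1_t0 x (eprod n rs)"
    using at_q1_t0.insertion_add[OF reg_d reg_e] by simp
  also have "specialize_q1_t0 x (total_poly - eprod n rs) = 0"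
    using van unfolding specialize_q1_t0_def insertion_alt
    by (intro sum.neutral) (simp add: lookup_minus vanishing_iff)
  finally have "Z = (\<Prod>r\<leftarrow>rs. esym n r x)"
    using specialize_eprod[of rs n x] rs by (simp add: Z_def macdonald_eq_total[OF assms(9)] len)
  also have "\<dots> = (\<Prod>i=1..s. esym n (M i) x)"
    by (simp add: rs_def o_def prod.distinct_set_conv_list[symmetric] atLeastLessThanSuc_atLeastAtMost del: upt_Suc)
  finally have Z: "Z = (\<Prod>i=1..s. esym n (M i) x)" .
  \<comment> \<open>Positivity of \<open>Z\<close> fixes the common sign of the specialised
    polynomials in \<open>stationary_distribution_iff\<close>.\<close>
  have "0 < Z" unfolding Z by (intro prod_pos ballI esym_pos M) (use assms(7) in blast)
  have N: "coeffs_in regular (f mu)" if "mu \<in> configs lam" for mu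
    by (rule regular_f[OF zero reg that])
  interpret exchange_functions lam "\<lambda>mu x. specialize_q1_t0 x (f mu)"
    using exchange_functions_insertion[OF q1_t0_functional_value zero N] by (simp add: specialize_q1_t0_def)
  have "balanced (configs lam) (jump_rate x) (\<lambda>eta. specialize_q1_t0 x (f eta))"
    by (rule balanced_jump_rate) (use assms(7) len in simp)
  moreover have "(\<Sum>mu\<in>configs lam. specialize_q1_t0 x (f mu)) = Z"
    unfolding Z_def macdonald_eq_total[OF assms(9)] total_poly_def
    by (rule at_q1_t0.insertion_sum_on[symmetric, OF N])
  ultimately show ?thesis
    using Z \<open>0 < Z\<close> assms(7) len stationary_distribution_iff[OF zero, of x] by blast
qed

end
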